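(* For almost every IET $T=(\lambda,\pi)\in\Delta_{\mathcal A}\times\mathfrak G^0$ the following holds. Let $f$ be a GIET of class $C^3$ on $[0,1)$ with $\mathcal N(f)=0$ and $\gamma(f)=\gamma(T)$ verifying the EC Condition, let $\omega_f\in\mathrm{Ker}(\Omega_\pi)$ be an affine shadow vector of $f$ (see context), let $\omega\in E^{cs}(\lambda,\pi)$ with $\pi_{\mathrm{Ker}(\Omega_\pi)}(\omega)=\omega_f$, and let $S\in\mathrm{Aff}(T,\omega)$ be defined on $[0,1)$. Then $f$ and $S$ are $C^1$ conjugated (as GIETs).
   Context: **GIETs.** Let $\mathcal A$ be a finite alphabet with $d\ge 2$ elements. $\mathfrak G^0$ is the set of irreducible permutations: pairs $\pi=(\pi_0,\pi_1)$ of bijections $\mathcal A\to\{1,\dots,d\}$ such that $\pi_1\circ\pi_0^{-1}(\{1,\dots,k\})=\{1,\dots,k\}$ only for $k=d$. A GIET of class $C^r$ over $\pi\in\mathfrak G^0$ on $I=[0,a)$ is a right-continuous bijection $f:I\to I$ with a partition of $I$ into left-closed, right-open intervals $I_\alpha(f)$, $\alpha\in\mathcal A$, ordered from left to right by $\pi_0$, whose images $f(I_\alpha(f))$ are ordered from left to right by $\pi_1$, and such that each $f|_{I_\alpha(f)}$ extends to an orientation-preserving $C^r$ diffeomorphism between the closures. An IET is a GIET all of whose branches are translations, written $T=(\lambda,\pi)$ with $\lambda_\alpha=|I_\alpha(T)|$. An AIET is a GIET all of whose branches are affine; its log-slope vector is $\omega\in\mathbb R^{\mathcal A}$ with $DS=e^{\omega_\alpha}$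 on $I_\alpha(S)$. $\Delta_{\mathcal A}=\{\lambda\in\mathbb R_+^{\mathcal A}:\sum_\alpha\lambda_\alpha=1\}$. "Almost every" refers to the product of Lebesgue and counting measures on $\Delta_{\mathcal A}\times\mathfrak G^0$. $\mathcal N(f)=\int_I D\log Df(x)\,dx$. A GIET $f$ on $I$ is semi-conjugated to a GIET $g$ on $I$ if there is a non-decreasing continuous surjection $h:I\to I$ with $h\circ f=g\circ h$ and $h(I_\alpha(f))=I_\alpha(g)$ for all $\alpha$; they are $C^1$ conjugated if $h$ can be taken to be a $C^1$ diffeomorphism (of $[0,1]$ when $I=[0,1)$). **Rauzy–Veech induction.** Put $\alpha_\epsilon=\pi_\epsilon^{-1}(d)$. If $|I_{\alpha_0}(f)|\neq|f(I_{\alpha_1}(f))|$, the type is $\epsilon(f)=0$ if $|I_{\alpha_0}(f)|>|f(I_{\alpha_1}(f))|$ and $\epsilon(f)=1$ otherwise. $\mathcal{RV}(f)$ is the first return map of $f$ to $I\setminus f(I_{\alpha_1}(f))$ (type 0) or $I\setminus I_{\alpha_0}(f)$ (type 1), a GIET with the same alphabet: in type 0, $I_{\alpha_0}(\mathcal{RV}f)=I_{\alpha_0}(f)\setminus f(I_{\alpha_1}(f))$ and the other intervals are unchanged; in type 1, $I_{\alpha_0}(\mathcal{RV}f)=f^{-1}(I_{\alpha_0}(f))$, $I_{\alpha_1}(\mathcal{RV}f)=I_{\alpha_1}(f)\setminus f^{-1}(I_{\alpha_0}(f))$ and the others are unchanged. $f$ is infinitely renormalizable if all $\mathcal{RV}^n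 f$ are defined; its combinatorial rotation number $\gamma(f)$ is the sequence of permutations and types of $\mathcal{RV}^nf$, $n\ge 0$. $\mathrm{Aff}(T,\omega)$ is the set of AIETs $S$ with log-slope vector $\omega$ and $\gamma(S)=\gamma(T)$. **Boundary.** Let $p=\pi_1\circ\pi_0^{-1}$ and let $\sigma$ be the permutation of $\{0,\dots,d\}$ with $\sigma(0)=p^{-1}(1)-1$, $\sigma(j)=d$ if $p(j)=d$, and $\sigma(j)=p^{-1}(p(j)+1)-1$ otherwise. Let $s_1,\dots,s_\kappa$ be its orbits. For a GIET $f$ over $\pi$ with partition endpoints $u_0<\dots<u_d$, $\mathcal B(f)=(b_s)_s\in\mathbb R^\kappa$ with $b_s=\sum_{i\in s}\partial\log Df(u_i)$, where $\partial\varphi(u_i)$ is the right limit minus the left limit of $\varphi$ at $u_i$ (with $\varphi$ set to $0$ outside $I$). **Zorich induction and Oseledets splitting.** For an infinitely renormalizable GIET let $A(f)=\mathrm{Id}+E_{\alpha_{\epsilon(f)},\alpha_{1-\epsilon(f)}}$, $z(f)=\min\{n\ge1:\epsilon(\mathcal{RV}^nf)\ne\epsilon(f)\}$, $\mathcal Z(f)=\mathcal{RV}^{z(f)}(f)$ and $B(f)=A(f)A(\mathcal{RV}f)\cdots A(\mathcal{RV}^{z(f)-1}f)$; $z$ and $B$ depend only on $\gamma(f)$. Let $(\Omega_\pi)_{\alpha\beta}=+1$ if $\pi_1(\alpha)>\pi_1(\beta),\ \pi_0(\alpha)<\pi_0(\beta)$; $-1$ if $\pi_1(\alpha)<\pi_1(\beta),\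 \pi_0(\alpha)>\pi_0(\beta)$; $0$ otherwise. $\pi_{\mathrm{Ker}(\Omega_\pi)}$ is the orthogonal projection onto $\mathrm{Ker}(\Omega_\pi)$. Consider triples $(\tau,\lambda,\pi)$ with $(\lambda,\pi)$ an infinitely renormalizable IET and $\tau\in\mathbb R^{\mathcal A}$ with $\sum_{\pi_0(\alpha)\le k}\tau_\alpha>0$, $\sum_{\pi_1(\alpha)\le k}\tau_\alpha<0$ for $1\le k\le d-1$. Set $\mathcal Z_{\rm ext}(\tau,\lambda,\pi)=(B(\lambda,\pi)^{-1}\tau,\mathcal Z(\lambda,\pi))$. On the normalized triples ($|\lambda|=\sum_\alpha\lambda_\alpha=1$, $|\langle\Omega_\pi\tau,\lambda\rangle|=1$) let $\tilde{\mathcal Z}_{\rm ext}$ be the corresponding map in which lengths are divided by $|B^{-1}\lambda|$ and $\tau$-coordinates multiplied by it. It has an invariant probability measure $\mu_{\rm ext}$, is invertible $\mu_{\rm ext}$-a.e., and $\mu_{\rm ext}$ projects to the invariant probability measure, equivalent to Lebesgue, of the normalized Zorich map on normalized IETs. The height cocycle is the transpose ${}^TB$ over $\tilde{\mathcal Z}_{\rm ext}$; it is integrable. A triple is Oseledets generic if the conclusions of the two-sided Oseledets theorem for ${}^TB$ hold along its orbit; then $\mathbb R^{\mathcal A}=E^s\oplus E^c\oplus E^u$ at each point of the orbit, the sums of the Oseledets subspaces with negative, zero and positive exponents (the splitting at a non-normalized point is that of its normalization). $E^s$ and $E^{cs}=E^s\oplus E^c$ depend only on $(\lambda,\pi)$.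 **EC Condition.** For a homeomorphism $k:J\to J'$ of bounded closed intervals, $\Xi(k)$ is the homeomorphism of $[0,1]$ obtained by pre- and post-composing $k$ with increasing affine bijections. Let $L_\alpha(f)=\ln\big(\frac1{|I_\alpha(f)|}\int_{I_\alpha(f)}Df\big)$. A GIET $f$ semi-conjugated to a minimal IET $T=(\lambda,\pi)$ satisfies the EC Condition if there is $\tau$ such that $(\tau,\lambda,\pi)$ is Oseledets generic and, for some $0<c<1$, $\max_\alpha\|\Xi((\mathcal Z^nf)|_{I_\alpha(\mathcal Z^nf)})-\mathrm{Id}\|_{C^1[0,1]}=O(c^n)$ and $|L^u(\mathcal Z^nf)|,|L^s(\mathcal Z^nf)|=O(c^n)$, where $L(\mathcal Z^nf)=L^s+L^c+L^u$ is the decomposition along the splitting at $\mathcal Z_{\rm ext}^n(\tau,\lambda,\pi)$. **The acceleration $\mathcal R$.** Fix once and for all a full $\mu_{\rm ext}$-measure set $X$ of normalized triples and a measurable $N:X\to\mathbb N$, and put $\mathcal R(x)=\mathcal Z_{\rm ext}^{N(x)}(x)$, $Q(x)=B(x)B(\mathcal Z_{\rm ext}x)\cdots B(\mathcal Z_{\rm ext}^{N(x)-1}x)$, $(\tau^n,\lambda^n,\pi^n)=\mathcal R^n(\tau,\lambda,\pi)$, $Q_{m,n}=Q(\mathcal R^mx)\cdots Q(\mathcal R^{n-1}x)$, ${}^TQ_{m,n}$ its transpose (functions of $x$ being extended by scaling invariance), chosen so that every $x\in X$ is Oseledets generic and: (1) $m_n=\sum_{k<n}N(\mathcal R^kx)$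 satisfies $\sup_n m_n/n<\infty$; (2) for $n\ge1$, $\min_{\alpha,\beta}\lambda^n_\alpha/\lambda^n_\beta>c_0>0$ and $\lambda^n\in A^\gamma(\mathbb R_+^{\mathcal A})$ for a finite Rauzy–Veech path $\gamma$, independent of $n$ and $x$ (in the given Rauzy class), whose matrix $A^\gamma$ is positive; (3) $C^{-1}\le\|{}^TQ_{0,n}|_{E^c(\tau,\lambda,\pi)}\|<C$ with $C$ independent of $n\ge 1$; (4) $\sup_n\frac1n\log\|Q_{0,n}\|<\infty$; (5) for every $\epsilon>0$ there is $C>0$ with $\|Q_{n-1,n}\|\le C\|Q_{0,n}\|^{\epsilon}$ for all $n\ge1$. Such a choice exists. For a.e. $(\lambda,\pi)$ there is $\tau$ with $(\tau,\lambda,\pi)\in X$; fix one. For a GIET $f$ with $\gamma(f)=\gamma(T)$ set $\mathcal R^nf=\mathcal Z^{m_n}f$, and let $\tilde{\mathcal R}^nf$ be its affine rescaling to $[0,1)$. **Distance and affine shadow vector.** For GIETs with the same permutation, $d_{C^r}(f,g)=\max_\alpha\{\|\Xi(f|_{I_\alpha(f)})-\Xi(g|_{I_\alpha(g)})\|_{C^r}+||I_\alpha(f)|-|I_\alpha(g)||+||f(I_\alpha(f))|-|g(I_\alpha(g))||\}$. A vector $\omega_f\in\mathrm{Ker}(\Omega_\pi)$ is called an affine shadow vector of $f$ if for every $\omega\in E^{cs}(\lambda,\pi)$ with $\pi_{\mathrm{Ker}(\Omega_\pi)}(\omega)=\omega_f$ and every $S\in\mathrm{Aff}(T,\omega)$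 one has $\mathcal B(S)=\mathcal B(f)$ and $d_{C^1}(\tilde{\mathcal R}^nf,\tilde{\mathcal R}^nS)=O(c^n)$ for some $0<c<1$. For a.e. $T$ every $C^3$ GIET $f$ with $\mathcal N(f)=0$, $\gamma(f)=\gamma(T)$ and EC has such a vector. *)

theory Defs
  imports "HOL-Analysis.Analysis" "HOL-Library.Landau_Symbols" "HOL-Combinatorics.Orbits"
    "HOL-Probability.Probability_Measure"
begin

text \<open>
  The alphabet is a finite type \<open>'a\<close>, so that vectors indexed by the alphabet are elements of
  \<open>real^'a\<close> and \<open>d\<close> is \<open>CARD('a)\<close>.
\<close>

section \<open>Permutations and Rauzy moves\<close>

type_synonym 'a iet_perm = "('a \<Rightarrow> nat) \<times> ('a \<Rightarrow> nat)"

definition perm_quot :: "'a::finite iet_perm \<Rightarrow> nat \<Rightarrow> nat" where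
  "perm_quot \<pi> k = snd \<pi> (inv (fst \<pi>) k)"

definition irred_perms :: "'a::finite iet_perm set" where
  "irred_perms = {\<pi>. bij_betw (fst \<pi>) UNIV {1..CARD('a)} \<and> bij_betw (snd \<pi>) UNIV {1..CARD('a)} \<and>
     (\<forall>k\<in>{1..CARD('a)}. perm_quot \<pi> ` {1..k} = {1..k} \<longrightarrow> k = CARD('a))}"

definition perm_row :: "'a iet_perm \<Rightarrow> nat \<Rightarrow> 'a \<Rightarrow> nat" where
  "perm_row \<pi> e = (if e = 0 then fst \<pi> else snd \<pi>)"

definition last_letter :: "'a::finite iet_perm \<Rightarrow> nat \<Rightarrow> 'a" where
  "last_letter \<pi> e = inv (perm_row \<pi> e) CARD('a)"

text \<open>
  The letter \<open>b\<close> is removed from its (last) position in the row \<open>r\<close> and reinserted just after \<open>a\<close>.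
\<close>

definition move_after :: "'a \<Rightarrow> 'a \<Rightarrow> ('a \<Rightarrow> nat) \<Rightarrow> 'a \<Rightarrow> nat" where
  "move_after a b r c = (if c = b then r a + 1 else if r c > r a then r c + 1 else r c)"

text \<open>
  The permutation of the first return map in the Rauzy-Veech step of type \<open>e\<close>.  In type 0 the
  branch labelled by \<open>\<alpha>\<^sub>1\<close> becomes \<open>f \<circ> f\<close>, whose image is the right end of the image of the old
  interval \<open>\<alpha>\<^sub>0\<close>; in type 1 the new interval \<open>\<alpha>\<^sub>0\<close> is the right end of the old interval \<open>\<alpha>\<^sub>1\<close>.
\<close>

definition rauzy_move :: "'a::finite iet_perm \<Rightarrow> nat \<Rightarrow> 'a iet_perm" where
  "rauzy_move \<pi> e = (if e = 0
     then (fst \<pi>, move_after (last_letter \<pi> 0) (last_letter \<pi> 1) (snd \<pi>))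
     else (move_after (last_letter \<pi> 1) (last_letter \<pi> 0) (fst \<pi>), snd \<pi>))"

definition rauzy_class :: "'a::finite iet_perm \<Rightarrow> 'a iet_perm set" where
  "rauzy_class \<pi> = {\<rho>. (\<pi>, \<rho>) \<in> {(\<pi>', rauzy_move \<pi>' e) | \<pi>' e. e \<in> {0, 1}}\<^sup>*}"

definition rauzy_matrix :: "'a::finite iet_perm \<Rightarrow> nat \<Rightarrow> real^'a^'a" where
  "rauzy_matrix \<pi> e =
     mat 1 + (\<chi> i j. if i = last_letter \<pi> e \<and> j = last_letter \<pi> (1 - e) then 1 else 0)"

text \<open>A finite Rauzy-Veech path is given by its initial permutation and its list of types.\<close>

fun path_matrix :: "'a::finite iet_perm \<Rightarrow> nat list \<Rightarrow> real^'a^'a" where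
  "path_matrix \<pi> [] = mat 1"
| "path_matrix \<pi> (e # es) = rauzy_matrix \<pi> e ** path_matrix (rauzy_move \<pi> e) es"

definition Omega :: "'a::finite iet_perm \<Rightarrow> real^'a^'a" where
  "Omega \<pi> = (\<chi> a b.
     if snd \<pi> a > snd \<pi> b \<and> fst \<pi> a < fst \<pi> b then 1
     else if snd \<pi> a < snd \<pi> b \<and> fst \<pi> a > fst \<pi> b then - 1 else 0)"

definition Ker_Omega :: "'a::finite iet_perm \<Rightarrow> (real^'a) set" where
  "Ker_Omega \<pi> = {v. Omega \<pi> *v v = 0}"

definition proj_Ker :: "'a::finite iet_perm \<Rightarrow> real^'a \<Rightarrow> real^'a" where
  "proj_Ker \<pi> v = (THE w. w \<in> Ker_Omega \<pi> \<and> (\<forall>u\<in>Ker_Omega \<pi>. orthogonal (v - w) u))"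


section \<open>Generalized interval exchange transformations\<close>

definition Cr_on :: "nat \<Rightarrow> (real \<Rightarrow> real) \<Rightarrow> real set \<Rightarrow> bool" where
  "Cr_on r g S \<longleftrightarrow> (\<exists>D :: nat \<Rightarrow> real \<Rightarrow> real. D 0 = g \<and>
     (\<forall>i<r. \<forall>x\<in>S. (D i has_real_derivative D (Suc i) x) (at x within S)) \<and> continuous_on S (D r))"

definition Cr_diffeo :: "nat \<Rightarrow> (real \<Rightarrow> real) \<Rightarrow> real set \<Rightarrow> real set \<Rightarrow> bool" where
  "Cr_diffeo r g S S' \<longleftrightarrow> bij_betw g S S' \<and> Cr_on r g S \<and> Cr_on r (inv_into S g) S'"

text \<open>
  Only the values of \<open>gmap\<close> on the union of the intervals \<open>gint\<close> are meaningful.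
\<close>

record 'a giet =
  gperm :: "'a iet_perm"
  gint :: "'a \<Rightarrow> real set"
  gmap :: "real \<Rightarrow> real"

definition gdom :: "'a giet \<Rightarrow> real set" where
  "gdom f = (\<Union>a. gint f a)"

abbreviation ilen :: "real set \<Rightarrow> real" where
  "ilen J \<equiv> measure lborel J"

definition glen :: "'a::finite giet \<Rightarrow> real^'a" where
  "glen f = (\<chi> a. ilen (gint f a))"

definition is_giet :: "nat \<Rightarrow> 'a::finite giet \<Rightarrow> bool" where
  "is_giet r f \<longleftrightarrow>
     gperm f \<in> irred_perms \<and>
     (\<exists>A>0. gdom f = {0..<A}) \<and>
     bij_betw (gmap f) (gdom f) (gdom f) \<and>
     (\<forall>x\<in>gdom f. (gmap f \<longlongrightarrow> gmap f x) (at_right x)) \<and>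
     (\<forall>a. \<exists>u v. u < v \<and> gint f a = {u..<v}) \<and>
     disjoint_family (gint f) \<and>
     (\<forall>a b. fst (gperm f) a < fst (gperm f) b \<longrightarrow>
        (\<forall>x\<in>gint f a. \<forall>y\<in>gint f b. x < y)) \<and>
     (\<forall>a b. snd (gperm f) a < snd (gperm f) b \<longrightarrow>
        (\<forall>x\<in>gint f a. \<forall>y\<in>gint f b. gmap f x < gmap f y)) \<and>
     (\<forall>a. \<exists>g. (\<forall>x\<in>gint f a. g x = gmap f x) \<and>
        Cr_diffeo r g (closure (gint f a)) (closure (gmap f ` gint f a)) \<and>
        strict_mono_on (closure (gint f a)) g)"

definition iet_left :: "real^'a \<Rightarrow> ('a::finite \<Rightarrow> nat) \<Rightarrow> 'a \<Rightarrow> real" where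
  "iet_left l r a = (\<Sum>b\<in>{b. r b < r a}. l $ b)"

definition iet_int :: "real^'a \<Rightarrow> 'a::finite iet_perm \<Rightarrow> 'a \<Rightarrow> real set" where
  "iet_int l \<pi> a = {iet_left l (fst \<pi>) a ..< iet_left l (fst \<pi>) a + l $ a}"

definition iet :: "real^'a \<Rightarrow> 'a::finite iet_perm \<Rightarrow> 'a giet" where
  "iet l \<pi> = \<lparr> gperm = \<pi>, gint = iet_int l \<pi>,
     gmap = (\<lambda>x. let a = (THE a. x \<in> iet_int l \<pi> a)
                 in x - iet_left l (fst \<pi>) a + iet_left l (snd \<pi>) a) \<rparr>"

definition orbit_Z :: "'a giet \<Rightarrow> real \<Rightarrow> real set" where
  "orbit_Z f x = {y\<in>gdom f. \<exists>n. (gmap f ^^ n) x = y \<or> (gmap f ^^ n) y = x}"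

definition minimal_giet :: "'a giet \<Rightarrow> bool" where
  "minimal_giet f \<longleftrightarrow> (\<forall>x\<in>gdom f. gdom f \<subseteq> closure (orbit_Z f x))"

definition mean_nonlinearity :: "'a giet \<Rightarrow> real" where
  "mean_nonlinearity f = integral (gdom f) (deriv (\<lambda>x. ln (deriv (gmap f) x)))"

definition giet_semiconj_by :: "(real \<Rightarrow> real) \<Rightarrow> 'a giet \<Rightarrow> 'a giet \<Rightarrow> bool" where
  "giet_semiconj_by h f g \<longleftrightarrow> gdom f = gdom g \<and>
     mono_on (gdom f) h \<and> continuous_on (gdom f) h \<and> h ` gdom f = gdom g \<and>
     (\<forall>x\<in>gdom f. h (gmap f x) = gmap g (h x)) \<and> (\<forall>a. h ` gint f a = gint g a)"

definition giet_semiconj :: "'a giet \<Rightarrow> 'a giet \<Rightarrow> bool" where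
  "giet_semiconj f g \<longleftrightarrow> (\<exists>h. giet_semiconj_by h f g)"

definition giet_C1_conj :: "'a giet \<Rightarrow> 'a giet \<Rightarrow> bool" where
  "giet_C1_conj f g \<longleftrightarrow>
     (\<exists>h. giet_semiconj_by h f g \<and> Cr_diffeo 1 h (closure (gdom f)) (closure (gdom g)))"


section \<open>Rauzy-Veech and Zorich induction\<close>

abbreviation gtop :: "'a::finite giet \<Rightarrow> 'a" where
  "gtop f \<equiv> last_letter (gperm f) 0"

abbreviation gbot :: "'a::finite giet \<Rightarrow> 'a" where
  "gbot f \<equiv> last_letter (gperm f) 1"

definition rv_defined :: "'a::finite giet \<Rightarrow> bool" where
  "rv_defined f \<longleftrightarrow> ilen (gint f (gtop f)) \<noteq> ilen (gmap f ` gint f (gbot f))"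

definition rv_type :: "'a::finite giet \<Rightarrow> nat" where
  "rv_type f = (if ilen (gint f (gtop f)) > ilen (gmap f ` gint f (gbot f)) then 0 else 1)"

definition first_return :: "(real \<Rightarrow> real) \<Rightarrow> real set \<Rightarrow> real \<Rightarrow> real" where
  "first_return g J x = (g ^^ (LEAST n. 0 < n \<and> (g ^^ n) x \<in> J)) x"

definition rv :: "'a::finite giet \<Rightarrow> 'a giet" where
  "rv f =
     (let im = gmap f ` gint f (gbot f);
          pre = {x\<in>gdom f. gmap f x \<in> gint f (gtop f)}
      in if rv_type f = 0
         then \<lparr> gperm = rauzy_move (gperm f) 0,
                gint = (gint f)(gtop f := gint f (gtop f) - im),
                gmap = first_return (gmap f) (gdom f - im) \<rparr>
         else \<lparr> gperm = rauzy_move (gperm f) 1,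
                gint = (gint f)(gtop f := pre, gbot f := gint f (gbot f) - pre),
                gmap = first_return (gmap f) (gdom f - gint f (gtop f)) \<rparr>)"

definition inf_renorm :: "'a::finite giet \<Rightarrow> bool" where
  "inf_renorm f \<longleftrightarrow> (\<forall>n. rv_defined ((rv ^^ n) f))"

definition rot_number :: "'a::finite giet \<Rightarrow> nat \<Rightarrow> 'a iet_perm \<times> nat" where
  "rot_number f n = (gperm ((rv ^^ n) f), rv_type ((rv ^^ n) f))"

definition same_rot_number :: "'a::finite giet \<Rightarrow> 'a giet \<Rightarrow> bool" where
  "same_rot_number f g \<longleftrightarrow> inf_renorm f \<and> inf_renorm g \<and> rot_number f = rot_number g"

definition Aff :: "'a::finite giet \<Rightarrow> real^'a \<Rightarrow> 'a giet set" where
  "Aff T \<omega> = {S. is_giet 1 S \<and>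
     (\<forall>a. \<exists>b. \<forall>x\<in>gint S a. gmap S x = exp (\<omega> $ a) * x + b) \<and> same_rot_number S T}"

fun mat_prod :: "(nat \<Rightarrow> real^'a^'a) \<Rightarrow> nat \<Rightarrow> real^'a::finite^'a" where
  "mat_prod M 0 = mat 1"
| "mat_prod M (Suc n) = mat_prod M n ** M n"

definition zor_time :: "'a::finite giet \<Rightarrow> nat" where
  "zor_time f = (LEAST n. 1 \<le> n \<and> rv_type ((rv ^^ n) f) \<noteq> rv_type f)"

definition zor :: "'a::finite giet \<Rightarrow> 'a giet" where
  "zor f = (rv ^^ zor_time f) f"

definition zor_matrix :: "'a::finite giet \<Rightarrow> real^'a^'a" where
  "zor_matrix f =
     mat_prod (\<lambda>i. rauzy_matrix (gperm ((rv ^^ i) f)) (rv_type ((rv ^^ i) f))) (zor_time f)"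


section \<open>Boundary\<close>

definition bd_perm :: "'a::finite iet_perm \<Rightarrow> nat \<Rightarrow> nat" where
  "bd_perm \<pi> j =
     (let p = perm_quot \<pi>; q = inv_into {1..CARD('a)} p
      in if j = 0 then q 1 - 1
         else if p j = CARD('a) then CARD('a)
         else q (p j + 1) - 1)"

definition gendpoint :: "'a::finite giet \<Rightarrow> nat \<Rightarrow> real" where
  "gendpoint f i =
     (if i < CARD('a) then Inf (gint f (inv (fst (gperm f)) (i + 1))) else Sup (gdom f))"

definition jump :: "(real \<Rightarrow> real) \<Rightarrow> real \<Rightarrow> real" where
  "jump \<phi> u = Lim (at_right u) \<phi> - Lim (at_left u) \<phi>"

definition log_deriv :: "'a giet \<Rightarrow> real \<Rightarrow> real" where
  "log_deriv f x = (if x \<in> gdom f then ln (deriv (gmap f) x) else 0)"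

definition boundary :: "'a::finite giet \<Rightarrow> nat set \<Rightarrow> real" where
  "boundary f =
     (\<lambda>s \<in> orbit (bd_perm (gperm f)) ` {0..CARD('a)}. \<Sum>i\<in>s. jump (log_deriv f) (gendpoint f i))"


section \<open>Natural extension of the Zorich map\<close>

type_synonym 'a triple = "(real^'a) \<times> (real^'a) \<times> 'a iet_perm"

definition vsum :: "real^'a::finite \<Rightarrow> real" where
  "vsum l = (\<Sum>a\<in>UNIV. l $ a)"

definition ext_triples :: "'a::finite triple set" where
  "ext_triples = {(\<tau>, l, \<pi>). \<pi> \<in> irred_perms \<and> (\<forall>a. 0 < l $ a) \<and> inf_renorm (iet l \<pi>) \<and>
     (\<forall>k\<in>{1..CARD('a) - 1}. (\<Sum>a\<in>{a. fst \<pi> a \<le> k}. \<tau> $ a) > 0 \<and>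
                             (\<Sum>a\<in>{a. snd \<pi> a \<le> k}. \<tau> $ a) < 0)}"

definition ext_area :: "'a::finite triple \<Rightarrow> real" where
  "ext_area = (\<lambda>(\<tau>, l, \<pi>). \<bar>(Omega \<pi> *v \<tau>) \<bullet> l\<bar>)"

definition norm_triples :: "'a::finite triple set" where
  "norm_triples = {x\<in>ext_triples. vsum (fst (snd x)) = 1 \<and> ext_area x = 1}"

text \<open>Rescaling of lengths and of \<open>\<tau>\<close> to total length 1 and area 1.\<close>

definition normalize_triple :: "'a::finite triple \<Rightarrow> 'a triple" where
  "normalize_triple = (\<lambda>(\<tau>, l, \<pi>).
     ((vsum l / ext_area (\<tau>, l, \<pi>)) *\<^sub>R \<tau>, (1 / vsum l) *\<^sub>R l, \<pi>))"

definition ext_matrix :: "'a::finite triple \<Rightarrow> real^'a^'a" where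
  "ext_matrix = (\<lambda>(\<tau>, l, \<pi>). zor_matrix (iet l \<pi>))"

definition Zext :: "'a::finite triple \<Rightarrow> 'a triple" where
  "Zext = (\<lambda>(\<tau>, l, \<pi>).
     (matrix_inv (zor_matrix (iet l \<pi>)) *v \<tau>, glen (zor (iet l \<pi>)), gperm (zor (iet l \<pi>))))"

definition Zext_norm :: "'a::finite triple \<Rightarrow> 'a triple" where
  "Zext_norm x = (case (x, Zext x) of ((\<tau>, l, \<pi>), (\<tau>', l', \<pi>')) \<Rightarrow>
     (let c = vsum (matrix_inv (ext_matrix x) *v l) in (c *\<^sub>R \<tau>', (1 / c) *\<^sub>R l', \<pi>')))"

definition iet_simplex :: "(real^'a::finite) set" where
  "iet_simplex = {l. (\<forall>a. 0 < l $ a) \<and> vsum l = 1}"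

text \<open>
  The open simplex is parametrized by all coordinates but one (\<open>a\<^sub>0\<close>); up to a constant factor the
  result is the Lebesgue measure of the simplex, whichever coordinate is left out.
\<close>

definition simplex_chart :: "'a \<Rightarrow> ('a \<Rightarrow> real) \<Rightarrow> real^'a::finite" where
  "simplex_chart a\<^sub>0 x = (\<chi> a. if a = a\<^sub>0 then 1 - (\<Sum>b\<in>UNIV - {a\<^sub>0}. x b) else x a)"

definition simplex_lebesgue :: "(real^'a::finite) measure" where
  "simplex_lebesgue =
     (let a\<^sub>0 = (SOME a. True); M = Pi\<^sub>M (UNIV - {a\<^sub>0}) (\<lambda>_. lborel)
      in distr (restrict_space M (simplex_chart a\<^sub>0 -` iet_simplex)) borel (simplex_chart a\<^sub>0))"

definition iet_lebesgue :: "((real^'a) \<times> 'a::finite iet_perm) measure" where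
  "iet_lebesgue = simplex_lebesgue \<Otimes>\<^sub>M count_space irred_perms"

text \<open>
  The properties of the invariant measure of the normalized natural extension: it is an invariant
  probability measure, the map is invertible almost everywhere, its projection to normalized IETs
  is equivalent to Lebesgue measure (the projection is automatically invariant), and the height
  cocycle is (log-)integrable.
\<close>

definition is_mu_ext :: "'a::finite triple measure \<Rightarrow> bool" where
  "is_mu_ext \<mu> \<longleftrightarrow> prob_space \<mu> \<and>
     sets \<mu> = sets (borel \<Otimes>\<^sub>M (borel \<Otimes>\<^sub>M count_space irred_perms)) \<and>
     (AE x in \<mu>. x \<in> norm_triples) \<and>
     (\<forall>E\<in>sets \<mu>. Zext_norm -` E \<inter> norm_triples \<in> sets \<mu> \<and>
        emeasure \<mu> (Zext_norm -` E \<inter> norm_triples) = emeasure \<mu> E) \<and>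
     (\<exists>Y\<in>sets \<mu>. Y \<subseteq> norm_triples \<and> (AE x in \<mu>. x \<in> Y) \<and> bij_betw Zext_norm Y Y) \<and>
     null_sets (distr \<mu> (borel \<Otimes>\<^sub>M count_space irred_perms) snd) = null_sets iet_lebesgue \<and>
     set_integrable \<mu> norm_triples (\<lambda>x. max 0 (ln (onorm ((*v) (transpose (ext_matrix x)))))) \<and>
     set_integrable \<mu> norm_triples
       (\<lambda>x. max 0 (ln (onorm ((*v) (matrix_inv (transpose (ext_matrix x)))))))"


section \<open>Oseledets splitting of the height cocycle\<close>

text \<open>
  A two-sided orbit through a given normalized triple is unique if it exists: a triple with a
  preimage lies in the set on which the natural extension is injective.
\<close>

definition two_sided_orbit :: "'a::finite triple \<Rightarrow> (int \<Rightarrow> 'a triple) \<Rightarrow> bool" where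
  "two_sided_orbit x xs \<longleftrightarrow>
     xs 0 = x \<and> (\<forall>k. xs k \<in> norm_triples \<and> xs (k + 1) = Zext_norm (xs k))"

text \<open>The cocycle over \<open>m\<close> steps, from position \<open>k\<close> to position \<open>k + m\<close> of the orbit.\<close>

definition height_cocycle :: "(int \<Rightarrow> 'a::finite triple) \<Rightarrow> int \<Rightarrow> nat \<Rightarrow> real^'a^'a" where
  "height_cocycle xs k m = transpose (mat_prod (\<lambda>i. ext_matrix (xs (k + int i))) m)"

text \<open>
  The Oseledets subspace of exponent \<open>\<theta>\<close> at position \<open>k\<close>: the growth rate is \<open>\<theta>\<close> both in the
  future and in the past.  It is \<open>{0}\<close> when \<open>\<theta>\<close> is not an exponent.
\<close>

definition oseledets_space :: "(int \<Rightarrow> 'a::finite triple) \<Rightarrow> int \<Rightarrow> real \<Rightarrow> (real^'a) set" where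
  "oseledets_space xs k \<theta> = {v. v = 0 \<or>
     ((\<lambda>m. ln (norm (height_cocycle xs k m *v v)) / real m) \<longlonglongrightarrow> \<theta> \<and>
      (\<lambda>m. ln (norm (matrix_inv (height_cocycle xs (k - int m) m) *v v)) / (- real m)) \<longlonglongrightarrow> \<theta>)}"

definition oseledets_sum :: "(int \<Rightarrow> 'a::finite triple) \<Rightarrow> int \<Rightarrow> real set \<Rightarrow> (real^'a) set" where
  "oseledets_sum xs k I = span (\<Union>\<theta>\<in>I. oseledets_space xs k \<theta>)"

definition exponents :: "(int \<Rightarrow> 'a::finite triple) \<Rightarrow> int \<Rightarrow> real set" where
  "exponents xs k = {\<theta>. oseledets_space xs k \<theta> \<noteq> {0}}"

text \<open>The sine of the smallest angle between two non-zero subspaces.\<close>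

definition sin_angle :: "(real^'a) set \<Rightarrow> (real^'a::finite) set \<Rightarrow> real" where
  "sin_angle U V = (INF u\<in>{u\<in>U. norm u = 1}. infdist u V)"

definition oseledets_orbit :: "(int \<Rightarrow> 'a::finite triple) \<Rightarrow> bool" where
  "oseledets_orbit xs \<longleftrightarrow>
     (\<forall>k. finite (exponents xs k) \<and>
          (\<forall>\<theta>. subspace (oseledets_space xs k \<theta>)) \<and>
          (\<forall>v. \<exists>!w. (\<forall>\<theta>. w \<theta> \<in> oseledets_space xs k \<theta>) \<and> v = (\<Sum>\<theta>\<in>exponents xs k. w \<theta>)) \<and>
          (\<forall>\<theta>. (*v) (height_cocycle xs k 1) ` oseledets_space xs k \<theta> = oseledets_space xs (k + 1) \<theta>)) \<and>
     (\<forall>I. I \<noteq> {} \<and> I \<subset> exponents xs 0 \<longrightarrow>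
        (let angle = (\<lambda>k. sin_angle (oseledets_sum xs k I) (oseledets_sum xs k (exponents xs 0 - I)))
         in (\<lambda>m. ln (angle (int m)) / real m) \<longlonglongrightarrow> 0 \<and>
            (\<lambda>m. ln (angle (- int m)) / real m) \<longlonglongrightarrow> 0))"

text \<open>Everything is extended to non-normalized triples through their normalization.\<close>

definition oseledets_generic :: "'a::finite triple \<Rightarrow> bool" where
  "oseledets_generic x \<longleftrightarrow> x \<in> ext_triples \<and>
     (\<exists>xs. two_sided_orbit (normalize_triple x) xs \<and> oseledets_orbit xs)"

definition ext_orbit :: "'a::finite triple \<Rightarrow> int \<Rightarrow> 'a triple" where
  "ext_orbit x = (SOME xs. two_sided_orbit (normalize_triple x) xs)"

text \<open>The splitting at the \<open>n\<close>-th point of the forward orbit of \<open>x\<close> under the Zorich map.\<close>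

definition E_s :: "'a::finite triple \<Rightarrow> nat \<Rightarrow> (real^'a) set" where
  "E_s x n = oseledets_sum (ext_orbit x) (int n) {..<0}"

definition E_c :: "'a::finite triple \<Rightarrow> nat \<Rightarrow> (real^'a) set" where
  "E_c x n = oseledets_sum (ext_orbit x) (int n) {0}"

definition E_u :: "'a::finite triple \<Rightarrow> nat \<Rightarrow> (real^'a) set" where
  "E_u x n = oseledets_sum (ext_orbit x) (int n) {0<..}"

definition E_cs :: "'a::finite triple \<Rightarrow> (real^'a) set" where
  "E_cs x = {v + w | v w. v \<in> E_s x 0 \<and> w \<in> E_c x 0}"


section \<open>Shapes of branches, distances and the EC Condition\<close>

definition Xi :: "real set \<Rightarrow> (real \<Rightarrow> real) \<Rightarrow> real \<Rightarrow> real" where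
  "Xi J k t = (k (Inf J + t * (Sup J - Inf J)) - Inf (k ` J)) / (Sup (k ` J) - Inf (k ` J))"

text \<open>The continuous extension of a branch to the closed interval.\<close>

definition branch :: "'a giet \<Rightarrow> 'a \<Rightarrow> real \<Rightarrow> real" where
  "branch f a x = (if x \<in> gint f a then gmap f x else Lim (at x within gint f a) (gmap f))"

definition shape :: "'a giet \<Rightarrow> 'a \<Rightarrow> real \<Rightarrow> real" where
  "shape f a = Xi (closure (gint f a)) (branch f a)"

text \<open>The \<open>C\<^sup>r\<close> norm on \<open>[0,1]\<close>, with one-sided derivatives at the endpoints.\<close>

definition Cr_norm :: "nat \<Rightarrow> (real \<Rightarrow> real) \<Rightarrow> real" where
  "Cr_norm r g = Max ((\<lambda>i. SUP t\<in>{0..1}.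
     \<bar>((\<lambda>h s. vector_derivative h (at s within {0..1})) ^^ i) g t\<bar>) ` {..r})"

definition giet_dist :: "nat \<Rightarrow> 'a::finite giet \<Rightarrow> 'a giet \<Rightarrow> real" where
  "giet_dist r f g = (MAX a\<in>UNIV.
     Cr_norm r (\<lambda>t. shape f a t - shape g a t)
     + \<bar>ilen (gint f a) - ilen (gint g a)\<bar>
     + \<bar>ilen (gmap f ` gint f a) - ilen (gmap g ` gint g a)\<bar>)"

definition log_mean_slope :: "'a::finite giet \<Rightarrow> real^'a" where
  "log_mean_slope f = (\<chi> a. ln (1 / ilen (gint f a) * integral (gint f a) (deriv (gmap f))))"

definition EC_condition :: "'a::finite giet \<Rightarrow> real^'a \<Rightarrow> 'a iet_perm \<Rightarrow> bool" where
  "EC_condition f l \<pi> \<longleftrightarrow> minimal_giet (iet l \<pi>) \<and> giet_semiconj f (iet l \<pi>) \<and>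
     (\<exists>\<tau> c. oseledets_generic (\<tau>, l, \<pi>) \<and> 0 < c \<and> c < 1 \<and>
        (\<lambda>n. MAX a\<in>UNIV. Cr_norm 1 (\<lambda>t. shape ((zor ^^ n) f) a t - t)) \<in> O(\<lambda>n. c ^ n) \<and>
        (\<exists>Ls Lc Lu.
           (\<forall>n. Ls n \<in> E_s (\<tau>, l, \<pi>) n \<and> Lc n \<in> E_c (\<tau>, l, \<pi>) n \<and> Lu n \<in> E_u (\<tau>, l, \<pi>) n \<and>
                log_mean_slope ((zor ^^ n) f) = Ls n + Lc n + Lu n) \<and>
           (\<lambda>n. norm (Lu n)) \<in> O(\<lambda>n. c ^ n) \<and> (\<lambda>n. norm (Ls n)) \<in> O(\<lambda>n. c ^ n)))"


section \<open>The acceleration and affine shadow vectors\<close>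

definition acc :: "('a::finite triple \<Rightarrow> nat) \<Rightarrow> 'a triple \<Rightarrow> 'a triple" where
  "acc N x = (Zext ^^ N (normalize_triple x)) x"

definition acc_Q :: "('a::finite triple \<Rightarrow> nat) \<Rightarrow> 'a triple \<Rightarrow> real^'a^'a" where
  "acc_Q N x = mat_prod (\<lambda>i. ext_matrix ((Zext ^^ i) x)) (N (normalize_triple x))"

definition acc_prod :: "('a::finite triple \<Rightarrow> nat) \<Rightarrow> 'a triple \<Rightarrow> nat \<Rightarrow> nat \<Rightarrow> real^'a^'a" where
  "acc_prod N x m n = mat_prod (\<lambda>i. acc_Q N ((acc N ^^ (m + i)) x)) (n - m)"

definition acc_lambda :: "('a::finite triple \<Rightarrow> nat) \<Rightarrow> 'a triple \<Rightarrow> nat \<Rightarrow> real^'a" where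
  "acc_lambda N x n = fst (snd ((acc N ^^ n) x))"

definition acc_time :: "('a::finite triple \<Rightarrow> nat) \<Rightarrow> 'a triple \<Rightarrow> nat \<Rightarrow> nat" where
  "acc_time N x n = (\<Sum>k<n. N (normalize_triple ((acc N ^^ k) x)))"

definition opnorm :: "real^'a^'a \<Rightarrow> real" where
  "opnorm M = onorm ((*v) M)"

definition opnorm_on :: "(real^'a) set \<Rightarrow> real^'a^'a \<Rightarrow> real" where
  "opnorm_on E M = (SUP v\<in>{v\<in>E. norm v = 1}. norm (M *v v))"

definition acc_linear_time :: "('a::finite triple \<Rightarrow> nat) \<Rightarrow> 'a triple \<Rightarrow> bool" where
  "acc_linear_time N x \<longleftrightarrow> bdd_above ((\<lambda>n. real (acc_time N x n) / real n) ` {1..})"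

definition acc_balanced :: "('a::finite triple \<Rightarrow> nat) \<Rightarrow> 'a triple set \<Rightarrow> bool" where
  "acc_balanced N X \<longleftrightarrow>
     (\<exists>c\<^sub>0>0. \<forall>x\<in>X. \<forall>n\<ge>1. \<forall>a b. acc_lambda N x n $ a / acc_lambda N x n $ b > c\<^sub>0) \<and>
     (\<forall>\<pi>\<in>irred_perms. \<exists>\<rho>\<in>rauzy_class \<pi>. \<exists>es. set es \<subseteq> {0, 1} \<and>
        (\<forall>a b. path_matrix \<rho> es $ a $ b > 0) \<and>
        (\<forall>x\<in>X. snd (snd x) \<in> rauzy_class \<pi> \<longrightarrow>
           (\<forall>n\<ge>1. acc_lambda N x n \<in> (*v) (path_matrix \<rho> es) ` {v. \<forall>a. 0 < v $ a})))"

text \<open>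
  The operator norm of the restriction to a trivial central space is 0, so the two-sided bound is
  only required when the central space is non-trivial.
\<close>

definition acc_central :: "('a::finite triple \<Rightarrow> nat) \<Rightarrow> 'a triple \<Rightarrow> bool" where
  "acc_central N x \<longleftrightarrow> E_c x 0 \<noteq> {0} \<longrightarrow>
     (\<exists>C>0. \<forall>n\<ge>1. inverse C \<le> opnorm_on (E_c x 0) (transpose (acc_prod N x 0 n)) \<and>
                   opnorm_on (E_c x 0) (transpose (acc_prod N x 0 n)) < C)"

definition acc_exp_growth :: "('a::finite triple \<Rightarrow> nat) \<Rightarrow> 'a triple \<Rightarrow> bool" where
  "acc_exp_growth N x \<longleftrightarrow> bdd_above ((\<lambda>n. 1 / real n * ln (opnorm (acc_prod N x 0 n))) ` {1..})"

definition acc_roth :: "('a::finite triple \<Rightarrow> nat) \<Rightarrow> 'a triple \<Rightarrow> bool" where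
  "acc_roth N x \<longleftrightarrow> (\<forall>\<epsilon>>0. \<exists>C>0. \<forall>n\<ge>1.
     opnorm (acc_prod N x (n - 1) n) \<le> C * opnorm (acc_prod N x 0 n) powr \<epsilon>)"

definition is_acceleration ::
    "'a::finite triple measure \<Rightarrow> 'a triple set \<Rightarrow> ('a triple \<Rightarrow> nat) \<Rightarrow> bool" where
  "is_acceleration \<mu> X N \<longleftrightarrow>
     X \<in> sets \<mu> \<and> X \<subseteq> norm_triples \<and> (AE x in \<mu>. x \<in> X) \<and>
     N \<in> measurable (restrict_space \<mu> X) (count_space UNIV) \<and>
     (\<forall>x\<in>X. 1 \<le> N x \<and> normalize_triple (acc N x) \<in> X) \<and>
     (\<forall>x\<in>X. oseledets_generic x \<and> acc_linear_time N x \<and> acc_central N x \<and>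
             acc_exp_growth N x \<and> acc_roth N x) \<and>
     acc_balanced N X"

definition rescale_giet :: "'a giet \<Rightarrow> 'a giet" where
  "rescale_giet f = (let A = Sup (gdom f) in
     \<lparr> gperm = gperm f, gint = (\<lambda>a. (\<lambda>x. x / A) ` gint f a), gmap = (\<lambda>x. gmap f (A * x) / A) \<rparr>)"

definition acc_giet ::
    "('a::finite triple \<Rightarrow> nat) \<Rightarrow> 'a triple \<Rightarrow> nat \<Rightarrow> 'a giet \<Rightarrow> 'a giet" where
  "acc_giet N x n f = rescale_giet ((zor ^^ acc_time N x n) f)"

definition affine_shadow ::
    "('a::finite triple \<Rightarrow> nat) \<Rightarrow> 'a triple \<Rightarrow> 'a giet \<Rightarrow> real^'a \<Rightarrow> bool" where
  "affine_shadow N = (\<lambda>(\<tau>, l, \<pi>) f \<omega>\<^sub>f. \<omega>\<^sub>f \<in> Ker_Omega \<pi> \<and>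
     (\<forall>\<omega>\<in>E_cs (\<tau>, l, \<pi>). proj_Ker \<pi> \<omega> = \<omega>\<^sub>f \<longrightarrow>
        (\<forall>S\<in>Aff (iet l \<pi>) \<omega>. boundary S = boundary f \<and>
           (\<exists>c. 0 < c \<and> c < 1 \<and>
              (\<lambda>n. giet_dist 1 (acc_giet N (\<tau>, l, \<pi>) n f) (acc_giet N (\<tau>, l, \<pi>) n S))
                \<in> O(\<lambda>n. c ^ n)))))"

end

theory Submission
  imports Defs
begin

text \<open>
  Let \<open>f\<^sub>n\<close> and \<open>S\<^sub>n\<close> be the Rauzy-Veech renormalizations and \<open>\<omega>\<^sub>n\<close> the log-slope vector of \<open>S\<^sub>n\<close>.
  If the sup norms of \<open>log Df\<^sub>n - \<omega>\<^sub>n\<close> are summable, then the sums of \<open>log Df - \<omega>\<close> over the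
  renormalization towers converge to a continuous solution \<open>u\<close> of \<open>log Df - \<omega> = u \<circ> f - u\<close>, and
  the normalized primitive \<open>H\<close> of \<open>exp (- u)\<close> gives \<open>f\<close> the constant slopes \<open>exp \<omega>\<close>. The lengths of
  the intervals of \<open>f\<^sub>n\<close> measured by \<open>H\<close> and those of \<open>S\<^sub>n\<close> satisfy the same linear recursion along
  the common rotation number; a Perron-Frobenius contraction at infinitely many good times makes
  them equal, hence \<open>H\<close> conjugates \<open>f\<close> to \<open>S\<close>.

  At Zorich times the EC Condition makes \<open>log Df\<^sub>n\<close> close to the mean slopes \<open>L\<^sub>n\<close>, and up to an
  exponentially small error \<open>L\<^sub>n - \<omega>\<^sub>n\<close> is the image under the height cocycle of a vector of
  subexponential growth with exponentially small increments. In an Oseledets basis its unstable part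
  vanishes, its stable part contracts, and its central part converges, necessarily to zero, because
  the affine shadow makes \<open>L\<^sub>n - \<omega>\<^sub>n\<close> exponentially small at the good times. The Roth type bound on
  the acceleration carries the decay to the intermediate Rauzy-Veech times.

  A time is good if a positive product of boundedly many Rauzy-Veech matrices starts there and \<open>\<omega>\<^sub>n\<close>
  is bounded, so that \<open>S\<^sub>n\<close> is balanced. Since \<open>\<mu>\<^sub>e\<^sub>x\<^sub>t\<close> is invariant, the Zorich times with a short
  positive product have frequency close to 1 for almost every \<open>(\<lambda>, \<pi>)\<close>; as \<open>m\<^sub>n\<close> grows linearly,
  some of them are times of the acceleration, at which \<open>\<omega> \<in> E\<^sup>c\<^sup>s\<close> stays bounded.
\<close>

section \<open>Right derivatives and branches\<close>

text \<open>Nothing says in advance that the affine map \<open>S\<close> is determined by its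
  rotation number and slopes. The conjugacy is therefore built from \<open>f\<close> alone and
  compared with \<open>S\<close> afterwards, through interval lengths. In the cohomological equation
  the obstacle is continuity: the tower sums could jump at the cut points of every level. It is
  recovered by moving a point with one of the induced maps, forwards or backwards, into ever shorter
  base intervals, on which the sums are uniformly small. Two splittings occur. The EC Condition
  brings its own \<tau>, while \<omega> and the acceleration belong to another one, and only
  (\<lambda>, \<pi>) is common. The decay argument compares growth rates of vectors, never the
  subspaces themselves. Balance of the lengths of \<open>T\<close> says nothing about those of
  \<open>S\<close>. These are balanced where a positive product starts and the log-slopes are
  bounded at the same moment. The two properties come from different sources, recurrence and the
  acceleration, and a count of times makes them meet.\<close>

definition right_deriv :: "(real \<Rightarrow> real) \<Rightarrow> real \<Rightarrow> real" where
  "right_deriv F x = vector_derivative F (at_right x)"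

text \<open>The branch \<open>F\<close> on the half-open interval travels together with its
  extension \<open>G\<close> to the closed interval and the derivative \<open>D\<close> of
  \<open>G\<close>. Positivity of \<open>D\<close> up to both ends keeps its logarithm bounded. For
  the maps themselves right derivatives are used, because these exist at the left ends of the
  intervals too.\<close>

definition C1_ext :: "(real \<Rightarrow> real) \<Rightarrow> real \<Rightarrow> real \<Rightarrow> real \<Rightarrow> real \<Rightarrow> (real \<Rightarrow> real) \<Rightarrow> (real \<Rightarrow> real) \<Rightarrow> bool" where
  "C1_ext F u v p q G D \<longleftrightarrow> u < v \<and> (\<forall>x\<in>{u..<v}. F x = G x) \<and> G u = p \<and> G v = q \<and>
     (\<forall>x\<in>{u..v}. (G has_real_derivative D x) (at x within {u..v}) \<and> 0 < D x) \<and> continuous_on {u..v} D"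

definition C1_branch :: "(real \<Rightarrow> real) \<Rightarrow> real \<Rightarrow> real \<Rightarrow> real \<Rightarrow> real \<Rightarrow> bool" where
  "C1_branch F u v p q \<longleftrightarrow> (\<exists>G D. C1_ext F u v p q G D)"

lemma C1_ext_strict:
  assumes "C1_ext F u v p q G D" "u \<le> x" "x < y" "y \<le> v"
  shows "G x < G y"
proof -
  have "continuous_on {x..y} G"
  proof (rule continuous_on_subset)
    show "continuous_on {u..v} G"
      using assms(1) unfolding C1_ext_def
      by (auto simp: continuous_on_eq_continuous_within intro: DERIV_continuous)
  qed (use assms in auto)
  moreover have "(G has_real_derivative D z) (at z)" "0 < D z" if "x < z" "z < y" for z
  proof -
    have "z \<in> {u..v}" "z \<in> interior {u..v}" using that assms by auto
    then show "(G has_real_derivative D z) (at z)" "0 < D z"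
      using assms(1) at_within_interior[of z "{u..v}"] unfolding C1_ext_def by metis+
  qed
  ultimately show ?thesis using DERIV_pos_imp_increasing_open[OF assms(3)] by metis
qed

lemma C1_ext_cont:
  assumes "C1_ext F u v p q G D" shows "continuous_on {u..v} G"
  using assms unfolding C1_ext_def
  by (auto simp: continuous_on_eq_continuous_within intro: DERIV_continuous)

lemma C1_ext_bij:
  assumes "C1_ext F u v p q G D"
  shows "F ` {u..<v} = {p..<q}" "p < q" "G ` {u..v} = {p..q}"
proof -
  have uv: "u < v" and G: "G u = p" "G v = q" and FG: "\<And>x. x \<in> {u..<v} \<Longrightarrow> F x = G x"
    using assms unfolding C1_ext_def by auto
  show pq: "p < q" using C1_ext_strict[OF assms, of u v] uv G by auto
  have ivt: "\<exists>x. u \<le> x \<and> x \<le> v \<and> G x = y" if "p \<le> y" "y \<le> q" for y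
    using IVT'[of G u y v] that uv G C1_ext_cont[OF assms] by auto
  have mono: "u \<le> x \<Longrightarrow> x \<le> y \<Longrightarrow> y \<le> v \<Longrightarrow> G x \<le> G y" for x y
    using C1_ext_strict[OF assms, of x y] by (cases "x = y") auto
  show "G ` {u..v} = {p..q}"
    using ivt mono[of u] mono[of _ v] G uv by (force simp: image_iff)
  have "G ` {u..<v} = {p..<q}"
  proof (intro equalityI subsetI)
    fix y assume "y \<in> G ` {u..<v}"
    then obtain x where "x \<in> {u..<v}" "y = G x" by auto
    then show "y \<in> {p..<q}" using mono[of u x] C1_ext_strict[OF assms, of x v] G by auto
  next
    fix y assume y: "y \<in> {p..<q}"
    then obtain x where "u \<le> x" "x \<le> v" "G x = y" using ivt[of y] by auto
    moreover have "x \<noteq> v" using y G \<open>G x = y\<close> by auto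
    ultimately show "y \<in> G ` {u..<v}" by force
  qed
  then show "F ` {u..<v} = {p..<q}" using FG by (metis (no_types, lifting) image_cong)
qed

lemma C1_branch_image:
  assumes "C1_branch F u v p q" shows "F ` {u..<v} = {p..<q}" "p < q" "u < v"
proof -
  obtain G D where G: "C1_ext F u v p q G D" using assms unfolding C1_branch_def by auto
  show "F ` {u..<v} = {p..<q}" "p < q" using C1_ext_bij[OF G] by auto
  show "u < v" using G unfolding C1_ext_def by auto
qed

lemma C1_branch_strict:
  assumes "C1_branch F u v p q" "u \<le> x" "x < y" "y < v" shows "F x < F y"
proof -
  obtain G D where G: "C1_ext F u v p q G D" using assms(1) unfolding C1_branch_def by auto
  then have "F x = G x" "F y = G y" using assms unfolding C1_ext_def by auto
  then show ?thesis using C1_ext_strict[OF G, of x y] assms by auto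
qed

lemma C1_branch_left:
  assumes "C1_branch F u v p q" shows "F u = p"
  using assms unfolding C1_branch_def C1_ext_def by auto

lemma C1_branch_bounds:
  assumes "C1_branch F u v p q" "u \<le> x" "x < v" shows "p \<le> F x" "F x < q"
proof -
  have "F x \<in> {p..<q}" using C1_branch_image(1)[OF assms(1)] assms by force
  then show "p \<le> F x" "F x < q" by auto
qed

lemma C1_branch_bounds_strict:
  assumes "C1_branch F u v p q" "u < x" "x < v" shows "p < F x"
  using C1_branch_strict[OF assms(1), of u x] C1_branch_left[OF assms(1)] assms by auto

lemma C1_branch_cong:
  assumes "C1_branch F u v p q" "\<And>x. u \<le> x \<Longrightarrow> x < v \<Longrightarrow> F' x = F x"
  shows "C1_branch F' u v p q"
proof -
  obtain G D where "C1_ext F u v p q G D" using assms(1) unfolding C1_branch_def by auto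
  then have "C1_ext F' u v p q G D" using assms(2) unfolding C1_ext_def by auto
  then show ?thesis unfolding C1_branch_def by auto
qed

lemma C1_branch_split:
  assumes "C1_branch F u v p q" "u < c" "c < v"
  shows "C1_branch F u c p (F c)" "C1_branch F c v (F c) q"
proof -
  obtain G D where G: "C1_ext F u v p q G D" using assms(1) unfolding C1_branch_def by auto
  have Fc: "F c = G c" using G assms unfolding C1_ext_def by auto
  have d: "(G has_real_derivative D x) (at x within S)" if "S \<subseteq> {u..v}" "x \<in> S" for x S
    using G that DERIV_subset unfolding C1_ext_def by blast
  have "C1_ext F u c p (F c) G D"
    unfolding C1_ext_def using G assms Fc
    by (auto simp: C1_ext_def intro: d continuous_on_subset)
  moreover have "C1_ext F c v (F c) q G D"
    unfolding C1_ext_def using G assms Fc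
    by (auto simp: C1_ext_def intro: d continuous_on_subset)
  ultimately show "C1_branch F u c p (F c)" "C1_branch F c v (F c) q"
    unfolding C1_branch_def by auto
qed

lemma C1_branch_compose:
  assumes "C1_branch F u v p q" "C1_branch F' p q r s"
    and H: "\<And>x. u \<le> x \<Longrightarrow> x < v \<Longrightarrow> H x = F' (F x)"
  shows "C1_branch H u v r s"
proof -
  obtain G D where G: "C1_ext F u v p q G D" using assms(1) unfolding C1_branch_def by auto
  obtain G' D' where G': "C1_ext F' p q r s G' D'" using assms(2) unfolding C1_branch_def by auto
  have im: "G ` {u..v} = {p..q}" "F ` {u..<v} = {p..<q}" using C1_ext_bij[OF G] by auto
  have "C1_ext H u v r s (G' \<circ> G) (\<lambda>x. D' (G x) * D x)"
    unfolding C1_ext_def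
  proof (intro conjI ballI)
    show "u < v" using G by (auto simp: C1_ext_def)
    show "H x = (G' \<circ> G) x" if "x \<in> {u..<v}" for x
    proof -
      have "F x = G x" using G that by (auto simp: C1_ext_def)
      moreover have "F x \<in> {p..<q}" using im that by auto
      ultimately show ?thesis using H[of x] that G' by (auto simp: C1_ext_def)
    qed
    show "(G' \<circ> G) u = r" "(G' \<circ> G) v = s" using G G' by (auto simp: C1_ext_def)
    fix x assume x: "x \<in> {u..v}"
    then have "G x \<in> {p..q}" using im by auto
    then have "(G' has_real_derivative D' (G x)) (at (G x) within G ` {u..v})" "0 < D' (G x)"
      using G' im by (auto simp: C1_ext_def)
    moreover have "(G has_real_derivative D x) (at x within {u..v})" "0 < D x"
      using G x by (auto simp: C1_ext_def)
    ultimately show "(G' \<circ> G has_real_derivative D' (G x) * D x) (at x within {u..v})" "0 < D' (G x) * D x"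
      using DERIV_image_chain by (blast, simp)
  next
    have "continuous_on {u..v} (D' \<circ> G)"
      using C1_ext_cont[OF G] G' im by (intro continuous_on_compose) (auto simp: C1_ext_def)
    then show "continuous_on {u..v} (\<lambda>x. D' (G x) * D x)"
      using G by (intro continuous_on_mult) (auto simp: C1_ext_def o_def)
  qed
  then show ?thesis unfolding C1_branch_def by auto
qed

lemma rd_eqI:
  assumes "(F has_real_derivative D) (at_right x)" shows "right_deriv F x = D"
  unfolding right_deriv_def using assms
  by (intro vector_derivative_within) (auto simp: has_real_derivative_iff_has_vector_derivative)

lemma at_within_greaterThanLessThan_at_right:
  fixes x v :: real
  assumes "x < v" shows "at x within {x<..<v} = at_right x"
  by (rule at_within_nhd[of _ "{..<v}"]) (use assms in auto)

lemma C1_ext_has_right: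
  assumes "C1_ext F u v p q G D" "u \<le> x" "x < v"
  shows "(F has_real_derivative D x) (at_right x)"
proof -
  have "(G has_real_derivative D x) (at x within {u..v})" using assms by (auto simp: C1_ext_def)
  then have "(G has_real_derivative D x) (at x within {x<..<v})"
    by (rule DERIV_subset) (use assms in auto)
  then have "(G has_real_derivative D x) (at_right x)"
    using at_within_greaterThanLessThan_at_right assms(3) by metis
  moreover have "eventually (\<lambda>y. F y = G y) (at_right x)"
    using assms unfolding C1_ext_def eventually_at_right[OF assms(3)]
    by (intro exI[of _ v]) auto
  moreover have "F x = G x" using assms by (auto simp: C1_ext_def)
  ultimately show ?thesis
    using has_field_derivative_cong_eventually[of F G x "{x<..}"] by blast
qed

lemma C1_ext_rd:
  assumes "C1_ext F u v p q G D" "u \<le> x" "x < v"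
  shows "right_deriv F x = D x"
  using rd_eqI C1_ext_has_right[OF assms] by blast

lemma C1_branch_rd_pos:
  assumes "C1_branch F u v p q" "u \<le> x" "x < v"
  shows "0 < right_deriv F x"
proof -
  obtain G D where G: "C1_ext F u v p q G D" using assms(1) unfolding C1_branch_def by auto
  then show ?thesis using C1_ext_rd[OF G assms(2,3)] assms by (simp add: C1_ext_def)
qed

text \<open>\<open>F\<close> is increasing, so it sends a right neighbourhood of \<open>x\<close>
  into a right neighbourhood of \<open>F x\<close>, and one-sided derivatives obey the chain
  rule.\<close>

lemma C1_branch_rd_compose:
  assumes "C1_branch F u v p q" "C1_branch F' p q r s"
    and H: "\<And>x. u \<le> x \<Longrightarrow> x < v \<Longrightarrow> H x = F' (F x)" and "u \<le> x" "x < v"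
  shows "right_deriv H x = right_deriv F' (F x) * right_deriv F x"
proof -
  obtain G D where G: "C1_ext F u v p q G D" using assms(1) unfolding C1_branch_def by auto
  obtain G' D' where G': "C1_ext F' p q r s G' D'" using assms(2) unfolding C1_branch_def by auto
  have Fx: "p \<le> F x" "F x < q" using C1_branch_bounds[OF assms(1) assms(4,5)] by auto
  have dF: "(F has_real_derivative D x) (at x within {x<..<v})"
    using C1_ext_has_right[OF G assms(4,5)] at_within_greaterThanLessThan_at_right[OF assms(5)] by simp
  have "(F' has_real_derivative D' (F x)) (at_right (F x))"
    using C1_ext_has_right[OF G' Fx] .
  then have "(F' has_real_derivative D' (F x)) (at (F x) within F ` {x<..<v})"
    by (rule DERIV_subset) (use C1_branch_strict[OF assms(1,4)] in auto)
  then have "(F' \<circ> F has_real_derivative D' (F x) * D x) (at x within {x<..<v})"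
    using DERIV_image_chain dF by blast
  then have "(F' \<circ> F has_real_derivative D' (F x) * D x) (at_right x)"
    using at_within_greaterThanLessThan_at_right[OF assms(5)] by simp
  moreover have "eventually (\<lambda>y. H y = (F' \<circ> F) y) (at_right x)"
    unfolding eventually_at_right[OF assms(5)] using H assms by (intro exI[of _ v]) auto
  ultimately have "(H has_real_derivative D' (F x) * D x) (at_right x)"
    using has_field_derivative_cong_eventually[of H "F' \<circ> F" x "{x<..}"] H assms by simp
  then have "right_deriv H x = D' (F x) * D x" using rd_eqI by blast
  then show ?thesis using C1_ext_rd[OF G assms(4,5)] C1_ext_rd[OF G' Fx] by simp
qed

lemma rd_cong:
  assumes "\<And>y. x \<le> y \<Longrightarrow> y < v \<Longrightarrow> H y = F y" "x < v" "(F has_real_derivative D) (at_right x)"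
  shows "right_deriv H x = D"
proof -
  have "eventually (\<lambda>y. H y = F y) (at_right x)"
    unfolding eventually_at_right[OF assms(2)] using assms by (intro exI[of _ v]) auto
  then have "(H has_real_derivative D) (at_right x)"
    using has_field_derivative_cong_eventually[of H F x "{x<..}"] assms by simp
  then show ?thesis using rd_eqI by blast
qed

lemma C1_branch_rd_cong:
  assumes "C1_branch F u v p q" "u \<le> x" "x < v'" "v' \<le> v" "\<And>y. x \<le> y \<Longrightarrow> y < v' \<Longrightarrow> H y = F y"
  shows "right_deriv H x = right_deriv F x"
proof -
  obtain G D where G: "C1_ext F u v p q G D" using assms(1) unfolding C1_branch_def by auto
  show ?thesis
    using rd_cong[of x v' H F "D x"] C1_ext_has_right[OF G, of x] C1_ext_rd[OF G, of x] assms by auto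
qed

lemma C1_branch_rd_cont:
  assumes "C1_branch F u v p q" "u < x" "x < v"
  shows "isCont (right_deriv F) x" "isCont F x"
proof -
  obtain G D where G: "C1_ext F u v p q G D" using assms(1) unfolding C1_branch_def by auto
  have x: "x \<in> interior {u..v}" using assms by auto
  have op: "open {u<..<v}" "x \<in> {u<..<v}" using assms by auto
  have ev: "eventually (\<lambda>y. y \<in> {u<..<v}) (nhds x)" using op eventually_nhds by blast
  have "isCont D x" using G x continuous_on_interior[of "{u..v}" D] by (auto simp: C1_ext_def)
  moreover have "eventually (\<lambda>y. right_deriv F y = D y) (nhds x)"
    using ev by eventually_elim (use C1_ext_rd[OF G] in auto)
  ultimately show "isCont (right_deriv F) x" using isCont_cong by blast
  have "isCont G x" using C1_ext_cont[OF G] x continuous_on_interior by blast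
  moreover have "eventually (\<lambda>y. F y = G y) (nhds x)"
    using ev by eventually_elim (use G in \<open>auto simp: C1_ext_def\<close>)
  ultimately show "isCont F x" using isCont_cong by blast
qed

section \<open>One step of Rauzy-Veech induction\<close>

text \<open>All endpoints are explicit: \<open>u\<close>, \<open>v\<close> for the intervals and
  \<open>p\<close>, \<open>q\<close> for their images. The permutation enters as a pair of
  bijections, a property that the Rauzy moves visibly preserve; that the two last letters differ is
  supplied separately along the orbit.\<close>

definition giet_data :: "'a::finite giet \<Rightarrow> real \<Rightarrow> ('a \<Rightarrow> real) \<Rightarrow> ('a \<Rightarrow> real) \<Rightarrow> ('a \<Rightarrow> real) \<Rightarrow> ('a \<Rightarrow> real) \<Rightarrow> bool" where
  "giet_data g A u v p q \<longleftrightarrow>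
     bij_betw (fst (gperm g)) UNIV {1..CARD('a)} \<and> bij_betw (snd (gperm g)) UNIV {1..CARD('a)} \<and>
     (\<forall>a. gint g a = {u a..<v a} \<and> C1_branch (gmap g) (u a) (v a) (p a) (q a)) \<and>
     gdom g = {0..<A} \<and> (\<Union>a. {p a..<q a}) = {0..<A} \<and>
     (\<forall>a b. fst (gperm g) a < fst (gperm g) b \<longrightarrow> v a \<le> u b) \<and>
     (\<forall>a b. snd (gperm g) a < snd (gperm g) b \<longrightarrow> q a \<le> p b)"

lemma giet_dataI:
  fixes g :: "'a::finite giet"
  assumes "bij_betw (fst (gperm g)) UNIV {1..CARD('a)}" "bij_betw (snd (gperm g)) UNIV {1..CARD('a)}"
    and "\<And>a. gint g a = {u a..<v a}" "\<And>a. C1_branch (gmap g) (u a) (v a) (p a) (q a)"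
    and "gdom g = {0..<A}" "(\<Union>a. {p a..<q a}) = {0..<A}"
    and "\<And>a b. fst (gperm g) a < fst (gperm g) b \<Longrightarrow> v a \<le> u b"
    and "\<And>a b. snd (gperm g) a < snd (gperm g) b \<Longrightarrow> q a \<le> p b"
  shows "giet_data g A u v p q"
  using assms unfolding giet_data_def by simp

lemma bij_last:
  fixes r :: "'a::finite \<Rightarrow> nat"
  assumes "bij_betw r UNIV {1..CARD('a)}"
  shows "r (inv r CARD('a)) = CARD('a)" "a \<noteq> inv r CARD('a) \<Longrightarrow> r a < CARD('a)"
    "r a = CARD('a) \<Longrightarrow> a = inv r CARD('a)"
proof -
  have "CARD('a) \<in> range r" using assms by (simp add: bij_betw_def)
  then show 1: "r (inv r CARD('a)) = CARD('a)" by (rule f_inv_into_f)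
  have inj: "inj r" using assms by (simp add: bij_betw_def)
  have le: "r a \<le> CARD('a)" for a using assms by (auto simp: bij_betw_def)
  show "a \<noteq> inv r CARD('a) \<Longrightarrow> r a < CARD('a)"
    using le[of a] 1 inj by (metis injD le_neq_implies_less)
  show "r a = CARD('a) \<Longrightarrow> a = inv r CARD('a)" using 1 inj by (metis injD)
qed

lemma bij_last_letter:
  assumes "bij_betw (perm_row \<pi> e) UNIV {1..CARD('a)}"
  shows "perm_row \<pi> e (last_letter \<pi> e) = CARD('a)"
    "a \<noteq> last_letter \<pi> e \<Longrightarrow> perm_row \<pi> e a < perm_row \<pi> e (last_letter (\<pi>::'a::finite iet_perm) e)"
  unfolding last_letter_def using bij_last(1)[OF assms] bij_last(2)[OF assms, of a] by metis+

lemma move_after_bij: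
  fixes r :: "'a::finite \<Rightarrow> nat"
  assumes r: "bij_betw r UNIV {1..CARD('a)}" and "r b = CARD('a)" "a \<noteq> b"
  shows "bij_betw (move_after a b r) UNIV {1..CARD('a)}"
proof -
  have inj: "inj r" using r by (simp add: bij_betw_def)
  have rng: "1 \<le> r c" "r c \<le> CARD('a)" for c using r by (auto simp: bij_betw_def)
  have lt: "r c < CARD('a)" if "c \<noteq> b" for c
    using rng(2)[of c] assms(2) inj that by (metis injD le_neq_implies_less)
  have ne: "r c \<noteq> r c'" if "c \<noteq> c'" for c c' using inj that by (auto dest: injD)
  have "inj (move_after a b r)"
  proof (rule injI, rule ccontr)
    fix c c' assume "move_after a b r c = move_after a b r c'" "c \<noteq> c'"
    then show False using ne[of c c'] ne[of c a] ne[of c' a] by (auto simp: move_after_def split: if_splits)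
  qed
  moreover have "move_after a b r ` UNIV \<subseteq> {1..CARD('a)}"
    using rng lt assms by (auto simp: move_after_def Suc_leI)
  ultimately show ?thesis
    by (simp add: bij_betw_def card_image card_subset_eq)
qed

lemma disjoint_union_diff: "U = X \<union> Y \<Longrightarrow> X \<inter> Y = {} \<Longrightarrow> X = U - Y"
  by blast

locale giet_step =
  fixes g :: "'a::finite giet" and A u v p q
  assumes data: "giet_data g A u v p q"
    and dist: "gtop g \<noteq> gbot g" and rvd: "rv_defined g"
begin

lemma perm0: "bij_betw (fst (gperm g)) UNIV {1..CARD('a)}"
  and perm1: "bij_betw (snd (gperm g)) UNIV {1..CARD('a)}"
  and gint_eq: "gint g a = {u a..<v a}" and br: "C1_branch (gmap g) (u a) (v a) (p a) (q a)"
  and dom: "gdom g = {0..<A}" and imdom: "(\<Union>a. {p a..<q a}) = {0..<A}"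
  and ord0: "fst (gperm g) a < fst (gperm g) b \<Longrightarrow> v a \<le> u b"
  and ord1: "snd (gperm g) a < snd (gperm g) b \<Longrightarrow> q a \<le> p b"
  using data unfolding giet_data_def by blast+

lemma uv: "u a < v a" and pq: "p a < q a" and im: "gmap g ` gint g a = {p a..<q a}"
  using C1_branch_image[OF br[of a]] gint_eq[of a] by simp_all

lemma indom: "0 \<le> u a" "v a \<le> A" "0 \<le> p a" "q a \<le> A"
proof -
  have "{u a..<v a} \<subseteq> {0..<A}" "{p a..<q a} \<subseteq> {0..<A}"
    using dom gint_eq imdom unfolding gdom_def by blast+
  then show "0 \<le> u a" "v a \<le> A" "0 \<le> p a" "q a \<le> A"
    using uv[of a] pq[of a] by (auto simp: ivl_subset)
qed

lemma domU: "(\<Union>a. {u a..<v a}) = {0..<A}"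
  using dom gint_eq unfolding gdom_def by simp

lemma top_last: "a \<noteq> gtop g \<Longrightarrow> fst (gperm g) a < fst (gperm g) (gtop g)"
  and top_card: "fst (gperm g) (gtop g) = CARD('a)"
  using bij_last_letter[of "gperm g" 0] perm0 by (auto simp: perm_row_def)

lemma bot_last: "a \<noteq> gbot g \<Longrightarrow> snd (gperm g) a < snd (gperm g) (gbot g)"
  and bot_card: "snd (gperm g) (gbot g) = CARD('a)"
  using bij_last_letter[of "gperm g" 1] perm1 by (auto simp: perm_row_def)

lemma v_top: "v (gtop g) = A"
proof (rule antisym)
  show "v (gtop g) \<le> A" by (rule indom)
  show "A \<le> v (gtop g)"
  proof (rule ccontr)
    assume "\<not> ?thesis"
    then have "v (gtop g) \<in> {0..<A}" using indom(1)[of "gtop g"] uv[of "gtop g"] by auto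
    then have "v (gtop g) \<in> (\<Union>a. {u a..<v a})" using domU by simp
    then obtain a where a: "u a \<le> v (gtop g)" "v (gtop g) < v a" by auto
    then have "a \<noteq> gtop g" by auto
    then show False using ord0[OF top_last[of a]] uv[of "gtop g"] a by linarith
  qed
qed

lemma q_bot: "q (gbot g) = A"
proof (rule antisym)
  show "q (gbot g) \<le> A" by (rule indom)
  show "A \<le> q (gbot g)"
  proof (rule ccontr)
    assume "\<not> ?thesis"
    then have "q (gbot g) \<in> {0..<A}" using indom(3)[of "gbot g"] pq[of "gbot g"] by auto
    then have "q (gbot g) \<in> (\<Union>a. {p a..<q a})" using imdom by simp
    then obtain a where a: "p a \<le> q (gbot g)" "q (gbot g) < q a" by auto
    then have "a \<noteq> gbot g" by auto
    then show False using ord1[OF bot_last[of a]] pq[of "gbot g"] a by linarith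
  qed
qed

text \<open>The last interval of the domain and the last one of the image both end at
  \<open>A\<close>. Comparing their lengths is comparing their left ends, and
  \<open>rv_defined\<close> excludes equality.\<close>

lemma type_iff: "rv_type g = 0 \<longleftrightarrow> u (gtop g) < p (gbot g)" "rv_type g = 0 \<or> rv_type g = 1"
  "rv_type g = 1 \<longleftrightarrow> p (gbot g) < u (gtop g)"
proof -
  have "A - u (gtop g) \<noteq> A - p (gbot g)"
    using rvd uv[of "gtop g"] pq[of "gbot g"] v_top q_bot
    unfolding rv_defined_def im by (simp add: gint_eq split: if_splits)
  then show "rv_type g = 0 \<longleftrightarrow> u (gtop g) < p (gbot g)" "rv_type g = 0 \<or> rv_type g = 1"
    "rv_type g = 1 \<longleftrightarrow> p (gbot g) < u (gtop g)"
    using uv[of "gtop g"] pq[of "gbot g"] v_top q_bot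
    unfolding rv_type_def im by (auto simp: gint_eq split: if_splits)
qed

lemma first_return1: "gmap g x \<in> J \<Longrightarrow> first_return (gmap g) J x = gmap g x"
proof -
  assume *: "gmap g x \<in> J"
  have "(LEAST n. 0 < n \<and> (gmap g ^^ n) x \<in> J) = 1"
    by (rule Least_equality) (use * in auto)
  then show ?thesis unfolding first_return_def by simp
qed

lemma first_return2: "gmap g x \<notin> J \<Longrightarrow> gmap g (gmap g x) \<in> J \<Longrightarrow>
  first_return (gmap g) J x = gmap g (gmap g x)"
proof -
  assume *: "gmap g x \<notin> J" "gmap g (gmap g x) \<in> J"
  have "(LEAST n. 0 < n \<and> (gmap g ^^ n) x \<in> J) = 2"
  proof (rule Least_equality)
    show "0 < (2::nat) \<and> (gmap g ^^ 2) x \<in> J" using * by (simp add: numeral_2_eq_2)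
    fix n :: nat assume n: "0 < n \<and> (gmap g ^^ n) x \<in> J"
    then have "n \<noteq> 1" using * by auto
    then show "2 \<le> n" using n by linarith
  qed
  then show ?thesis unfolding first_return_def by (simp add: numeral_2_eq_2)
qed

lemma disj0: "a \<noteq> b \<Longrightarrow> v a \<le> u b \<or> v b \<le> u a"
proof -
  assume "a \<noteq> b"
  then have "fst (gperm g) a \<noteq> fst (gperm g) b" using perm0 by (metis bij_betw_def injD)
  then show ?thesis using ord0 by (metis nat_neq_iff)
qed

lemma disj1: "a \<noteq> b \<Longrightarrow> q a \<le> p b \<or> q b \<le> p a"
proof -
  assume "a \<noteq> b"
  then have "snd (gperm g) a \<noteq> snd (gperm g) b" using perm1 by (metis bij_betw_def injD)
  then show ?thesis using ord1 by (metis nat_neq_iff)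
qed

text \<open>In type 0 the cut is at the left end of the image of the bottom-last interval.\<close>

lemma data0:
  assumes ty: "rv_type g = 0"
  defines "a0 \<equiv> gtop g" and "a1 \<equiv> gbot g"
  defines "b \<equiv> p a1"
  shows "giet_data (rv g) b u (v(a0 := b)) (p(a1 := gmap g b)) (q(a0 := gmap g b, a1 := q a0))"
    and "gperm (rv g) = rauzy_move (gperm g) 0"
    and "gmap (rv g) = first_return (gmap g) {0..<b}"
    and "u a0 < b" "b < A"
proof -
  have ne: "a0 \<noteq> a1" using dist unfolding a0_def a1_def .
  show b: "u a0 < b" using ty type_iff(1) unfolding a0_def a1_def b_def by auto
  have v0: "v a0 = A" and q1: "q a1 = A" using v_top q_bot unfolding a0_def a1_def by auto
  show bA: "b < A" using pq[of a1] q1 unfolding b_def by auto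
  have sub: "gdom g - gmap g ` gint g (gbot g) = {0..<b}"
    unfolding dom im using q1 indom(3)[of a1] bA unfolding b_def a1_def by auto
  have rv: "rv g = \<lparr> gperm = rauzy_move (gperm g) 0,
                gint = (gint g)(gtop g := gint g (gtop g) - gmap g ` gint g (gbot g)),
                gmap = first_return (gmap g) {0..<b} \<rparr>"
    unfolding rv_def Let_def using ty sub by simp
  show perm: "gperm (rv g) = rauzy_move (gperm g) 0"
    and mp: "gmap (rv g) = first_return (gmap g) {0..<b}" unfolding rv by auto
  have gi: "gint (rv g) a = {u a..<(v(a0 := b)) a}" for a
    unfolding rv im using b bA v0 q1 by (auto simp: gint_eq a0_def a1_def b_def)
  have va: "v a \<le> u a0" if "a \<noteq> a0" for a using ord0[OF top_last[of a]] that unfolding a0_def by simp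
  have qa: "q a \<le> b" if "a \<noteq> a1" for a using ord1[OF bot_last[of a]] that unfolding a1_def b_def by simp
  have one: "gmap (rv g) x = gmap g x" if "x \<in> gint g a" "a \<noteq> a1" for a x
  proof -
    have "gmap g x \<in> {p a..<q a}" using that im by blast
    then have "gmap g x \<in> {0..<b}" using qa[OF that(2)] indom(3)[of a] by auto
    then show ?thesis unfolding mp by (rule first_return1)
  qed
  have two: "gmap (rv g) x = gmap g (gmap g x)" if "x \<in> gint g a1" for x
  proof -
    have "gmap g x \<in> {p a1..<q a1}" using that im by blast
    then have *: "b \<le> gmap g x" "gmap g x < A" using q1 b_def by auto
    then have "gmap g x \<in> gint g a0" using gint_eq b v0 by auto
    then have "gmap g (gmap g x) \<in> {p a0..<q a0}" using im by blast
    then have "gmap g (gmap g x) \<in> {0..<b}" using qa[OF ne] indom(3)[of a0] by auto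
    then show ?thesis unfolding mp using * by (intro first_return2) auto
  qed
  \<comment> \<open>The point \<open>b\<close> cuts the top interval. The left part is the new
    branch of \<open>a0\<close>; the right part is the second leg of the new branch of
    \<open>a1\<close>.\<close>
  have bsplit: "C1_branch (gmap g) (u a0) b (p a0) (gmap g b)" "C1_branch (gmap g) b A (gmap g b) (q a0)"
    using C1_branch_split[OF br[of a0], of b] b bA v0 by auto
  have bq: "p a0 < gmap g b" "gmap g b < q a0"
    using C1_branch_image(2) bsplit by blast+
  have B: "C1_branch (gmap (rv g)) (u a) ((v(a0 := b)) a) ((p(a1 := gmap g b)) a) ((q(a0 := gmap g b, a1 := q a0)) a)" for a
  proof -
    consider "a = a0" | "a = a1" | "a \<noteq> a0" "a \<noteq> a1" by blast
    then show ?thesis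
    proof cases
      case 1
      have "C1_branch (gmap (rv g)) (u a0) b (p a0) (gmap g b)"
        by (rule C1_branch_cong[OF bsplit(1)]) (use one[of _ a0] ne gint_eq[of a0] bA v0 in auto)
      then show ?thesis using 1 ne by simp
    next
      case 2
      have "C1_branch (gmap g) (u a1) (v a1) b A" using br[of a1] q1 b_def by simp
      from C1_branch_compose[OF this bsplit(2)] have "C1_branch (gmap (rv g)) (u a1) (v a1) (gmap g b) (q a0)"
        using two gint_eq[of a1] by simp
      then show ?thesis using 2 ne by simp
    next
      case 3
      have "C1_branch (gmap (rv g)) (u a) (v a) (p a) (q a)"
        by (rule C1_branch_cong[OF br[of a]]) (use one[of _ a] gint_eq[of a] 3 in auto)
      then show ?thesis using 3 by simp
    qed
  qed
  have r1: "bij_betw (snd (gperm (rv g))) UNIV {1..CARD('a)}"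
    unfolding perm rauzy_move_def using move_after_bij[OF perm1, of a1 a0] bot_card ne
    by (simp add: a0_def a1_def)
  have r0: "bij_betw (fst (gperm (rv g))) UNIV {1..CARD('a)}"
    unfolding perm rauzy_move_def using perm0 by simp
  have dm: "gdom (rv g) = {0..<b}"
  proof -
    have "gdom (rv g) = (\<Union>a. gint g a) - {b..<A}"
    proof -
      have "gint (rv g) a = gint g a - {b..<A}" for a
        unfolding gi gint_eq using v0 b bA va[of a] by auto
      then show ?thesis unfolding gdom_def by auto
    qed
    then show ?thesis using dom bA indom(3)[of a1] unfolding gdom_def b_def by auto
  qed
  \<comment> \<open>The two halves of the old image of \<open>a0\<close> become the images of
    \<open>a0\<close> and \<open>a1\<close>, so the union loses exactly the old image of
    \<open>a1\<close>, which is \<open>{b..<A}\<close>.\<close>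
  have imd: "(\<Union>a. {(p(a1 := gmap g b)) a..<(q(a0 := gmap g b, a1 := q a0)) a}) = {0..<b}" (is "(\<Union>a. ?J a) = _")
  proof -
    have "(\<Union>a. ?J a) = (\<Union>a\<in>-{a1}. {p a..<q a})"
    proof -
      have "(\<Union>a. ?J a) = (\<Union>a\<in>-{a0,a1}. ?J a) \<union> (?J a0 \<union> ?J a1)" by blast
      also have "?J a0 \<union> ?J a1 = {p a0..<q a0}" using ne bq by auto
      also have "(\<Union>a\<in>-{a0,a1}. ?J a) = (\<Union>a\<in>-{a0,a1}. {p a..<q a})" by auto
      also have "\<dots> \<union> {p a0..<q a0} = (\<Union>a\<in>-{a1}. {p a..<q a})" using ne by blast
      finally show ?thesis .
    qed
    also have "\<dots> = {0..<A} - {b..<A}"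
    proof -
      have "(\<Union>a. {p a..<q a}) = (\<Union>a\<in>-{a1}. {p a..<q a}) \<union> {b..<A}" using q1 b_def by auto
      moreover have "(\<Union>a\<in>-{a1}. {p a..<q a}) \<inter> {b..<A} = {}" using qa by fastforce
      ultimately show ?thesis unfolding imdom[symmetric] by (rule disjoint_union_diff)
    qed
    finally show ?thesis using bA indom(3)[of a1] b_def by auto
  qed
  have o0: "(v(a0 := b)) a \<le> u c" if "fst (gperm (rv g)) a < fst (gperm (rv g)) c" for a c
    using that ord0[of a c] bA v0 unfolding perm rauzy_move_def by auto
  have o1: "(q(a0 := gmap g b, a1 := q a0)) a \<le> (p(a1 := gmap g b)) c"
    if *: "snd (gperm (rv g)) a < snd (gperm (rv g)) c" for a c
  proof -
    let ?s = "snd (gperm g)"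
    have m: "snd (gperm (rv g)) x = (if x = a1 then ?s a0 + 1 else if ?s x > ?s a0 then ?s x + 1 else ?s x)" for x
      unfolding perm rauzy_move_def by (simp add: move_after_def a0_def a1_def)
    have inj: "?s x = ?s y \<Longrightarrow> x = y" for x y using perm1 by (metis bij_betw_def injD)
    show ?thesis
    proof (cases "a = a1")
      case True
      then have "c \<noteq> a1" using * by auto
      then have "?s a0 < ?s c" using * True m[of a] m[of c] inj[of c a0] by (auto split: if_splits)
      then show ?thesis using True ord1[of a0 c] \<open>c \<noteq> a1\<close> by auto
    next
      case False
      show ?thesis
      proof (cases "c = a1")
        case True
        then have "?s a \<le> ?s a0" using * False m[of a] m[of c] by (auto split: if_splits)
        then consider "a = a0" | "?s a < ?s a0" using inj by fastforce
        then show ?thesis using True False ord1[of a a0] bq ne by cases auto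
      next
        case F2: False
        then have "?s a < ?s c" using * False m[of a] m[of c] by (auto split: if_splits)
        then show ?thesis using F2 False ord1[of a c] bq by (auto split: if_splits)
      qed
    qed
  qed
  show "giet_data (rv g) b u (v(a0 := b)) (p(a1 := gmap g b)) (q(a0 := gmap g b, a1 := q a0))"
    by (rule giet_dataI[OF r0 r1 gi B dm imd o0 o1])
qed

text \<open>In type 1 the new right end of the domain falls strictly inside the image of the
  bottom-last interval. Its preimage \<open>c\<close> is the point at which that interval will be
  cut.\<close>

lemma cut_exists:
  assumes ty: "rv_type g = 1"
  obtains c where "u (gbot g) < c" "c < v (gbot g)" "gmap g c = u (gtop g)"
proof -
  have "p (gbot g) < u (gtop g)" using ty type_iff(3) by auto
  moreover have "u (gtop g) < q (gbot g)" using q_bot v_top uv[of "gtop g"] by auto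
  ultimately have "u (gtop g) \<in> gmap g ` {u (gbot g)..<v (gbot g)}"
    using C1_branch_image(1)[OF br[of "gbot g"]] by auto
  then obtain c where c: "u (gbot g) \<le> c" "c < v (gbot g)" "gmap g c = u (gtop g)" by auto
  moreover have "c \<noteq> u (gbot g)" using C1_branch_left[OF br[of "gbot g"]] c \<open>p (gbot g) < u (gtop g)\<close> by auto
  ultimately show ?thesis using that[of c] by auto
qed

text \<open>The dual of type 0: here the bottom-last interval is cut, at the preimage
  \<open>c\<close> of the new right end of the domain, and its right part becomes the interval of
  \<open>a0\<close>. Images keep their left ends, and that of \<open>a1\<close> is
  shortened.\<close>

lemma data1:
  assumes ty: "rv_type g = 1"
  defines "a0 \<equiv> gtop g" and "a1 \<equiv> gbot g"
  assumes c: "u a1 < c" "c < v a1" "gmap g c = u a0"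
  shows "giet_data (rv g) (u a0) (u(a0 := c)) (v(a0 := v a1, a1 := c)) p (q(a1 := u a0))"
    and "gperm (rv g) = rauzy_move (gperm g) 1"
    and "gmap (rv g) = first_return (gmap g) {0..<u a0}"
    and "p a1 < u a0" "u a0 < A"
proof -
  have ne: "a0 \<noteq> a1" using dist unfolding a0_def a1_def .
  have v0: "v a0 = A" and q1: "q a1 = A" using v_top q_bot unfolding a0_def a1_def by auto
  show b: "p a1 < u a0" using ty type_iff(3) unfolding a0_def a1_def by auto
  show bA: "u a0 < A" using uv[of a0] v0 by auto
  have va: "v a \<le> u a0" if "a \<noteq> a0" for a using ord0[OF top_last[of a]] that unfolding a0_def by simp
  have qa: "q a \<le> p a1" if "a \<noteq> a1" for a using ord1[OF bot_last[of a]] that unfolding a1_def by simp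
  \<comment> \<open>The bottom-last branch is the only one with values beyond \<open>p a1\<close>,
    so every preimage of the top interval lies in \<open>gint g a1\<close>, and by monotonicity to
    the right of \<open>c\<close>.\<close>
  have pre: "{x\<in>gdom g. gmap g x \<in> gint g (gtop g)} = {c..<v a1}"
  proof (intro equalityI subsetI)
    fix x assume x: "x \<in> {x\<in>gdom g. gmap g x \<in> gint g (gtop g)}"
    then obtain a where a: "x \<in> gint g a" unfolding gdom_def by auto
    then have "gmap g x \<in> {p a..<q a}" using im by blast
    then have "a = a1" using x qa[of a] b unfolding gint_eq a0_def[symmetric] by force
    then have xa: "u a1 \<le> x" "x < v a1" using a gint_eq by auto
    have "c \<le> x"
    proof (rule ccontr)
      assume "\<not> c \<le> x"
      then have "gmap g x < gmap g c" using C1_branch_strict[OF br[of a1], of x c] xa c by auto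
      then show False using x c unfolding gint_eq a0_def by auto
    qed
    then show "x \<in> {c..<v a1}" using xa by auto
  next
    fix x assume x: "x \<in> {c..<v a1}"
    then have xa: "x \<in> gint g a1" using c gint_eq by auto
    then have "gmap g x \<in> {p a1..<q a1}" using im by blast
    moreover have "gmap g c \<le> gmap g x"
      using C1_branch_strict[OF br[of a1], of c x] x c by (cases "c = x") auto
    ultimately show "x \<in> {x\<in>gdom g. gmap g x \<in> gint g (gtop g)}"
      using xa c q1 v0 unfolding gint_eq gdom_def a0_def by auto
  qed
  have sub: "gdom g - gint g (gtop g) = {0..<u a0}"
    unfolding dom gint_eq using v0 indom(1)[of a0] bA unfolding a0_def by auto
  have rv: "rv g = \<lparr> gperm = rauzy_move (gperm g) 1,
                gint = (gint g)(gtop g := {c..<v a1}, gbot g := gint g (gbot g) - {c..<v a1}),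
                gmap = first_return (gmap g) {0..<u a0} \<rparr>"
    unfolding rv_def Let_def using ty sub pre by simp
  show perm: "gperm (rv g) = rauzy_move (gperm g) 1"
    and mp: "gmap (rv g) = first_return (gmap g) {0..<u a0}" unfolding rv by auto
  have gi: "gint (rv g) a = {(u(a0 := c)) a..<(v(a0 := v a1, a1 := c)) a}" for a
    unfolding rv using c ne by (auto simp: gint_eq a0_def a1_def)
  have gc: "u a0 \<le> gmap g x" "gmap g x < A" if "c \<le> x" "x < v a1" for x
  proof -
    have "x \<in> {x\<in>gdom g. gmap g x \<in> gint g (gtop g)}" unfolding pre using that by simp
    then have "gmap g x \<in> gint g a0" unfolding a0_def by simp
    then show "u a0 \<le> gmap g x" "gmap g x < A" using gint_eq[of a0] v0 by auto
  qed
  have one: "gmap (rv g) x = gmap g x" if "x \<in> gint g a" "x \<notin> {c..<v a1}" for a x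
  proof -
    have "x \<in> gdom g" using that unfolding gdom_def by blast
    then have "gmap g x \<notin> gint g a0" using that(2) unfolding pre[symmetric] a0_def by simp
    moreover have "gmap g x \<in> {p a..<q a}" using that im by blast
    then have "gmap g x \<in> {0..<A}" using indom[of a] by auto
    ultimately have "gmap g x \<in> {0..<u a0}" using gint_eq[of a0] v0 by auto
    then show ?thesis unfolding mp by (rule first_return1)
  qed
  have two: "gmap (rv g) x = gmap g (gmap g x)" if "c \<le> x" "x < v a1" for x
  proof -
    have "gmap g x \<in> gint g a0" using gc[OF that] gint_eq[of a0] v0 by simp
    then have "gmap g (gmap g x) \<in> {p a0..<q a0}" using im by blast
    then have "gmap g (gmap g x) \<in> {0..<u a0}" using qa[OF ne] indom(3)[of a0] b by auto
    then show ?thesis unfolding mp using gc[OF that] by (intro first_return2) auto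
  qed
  have bsplit: "C1_branch (gmap g) (u a1) c (p a1) (u a0)" "C1_branch (gmap g) c (v a1) (u a0) A"
    using C1_branch_split[OF br[of a1], of c] c q1 by auto
  have B: "C1_branch (gmap (rv g)) ((u(a0 := c)) a) ((v(a0 := v a1, a1 := c)) a) (p a) ((q(a1 := u a0)) a)" for a
  proof -
    consider "a = a0" | "a = a1" | "a \<noteq> a0" "a \<noteq> a1" by blast
    then show ?thesis
    proof cases
      case 1
      have "C1_branch (gmap g) (u a0) A (p a0) (q a0)" using br[of a0] v0 by simp
      from C1_branch_compose[OF bsplit(2) this] have "C1_branch (gmap (rv g)) c (v a1) (p a0) (q a0)"
        using two by simp
      then show ?thesis using 1 ne by simp
    next
      case 2
      have "C1_branch (gmap (rv g)) (u a1) c (p a1) (u a0)"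
        by (rule C1_branch_cong[OF bsplit(1)]) (use one[of _ a1] c gint_eq[of a1] in auto)
      then show ?thesis using 2 ne by simp
    next
      case 3
      have "x \<notin> {c..<v a1}" if "x \<in> gint g a" for x
        using disj0[OF 3(2)] that c gint_eq[of a] by auto
      then have "C1_branch (gmap (rv g)) (u a) (v a) (p a) (q a)"
        by (intro C1_branch_cong[OF br[of a]]) (use one[of _ a] gint_eq[of a] in auto)
      then show ?thesis using 3 by simp
    qed
  qed
  have r0: "bij_betw (fst (gperm (rv g))) UNIV {1..CARD('a)}"
    unfolding perm rauzy_move_def using move_after_bij[OF perm0, of a0 a1] top_card ne
    by (simp add: a0_def a1_def)
  have r1: "bij_betw (snd (gperm (rv g))) UNIV {1..CARD('a)}"
    unfolding perm rauzy_move_def using perm1 by simp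
  have dm: "gdom (rv g) = {0..<u a0}"
  proof -
    have "(\<Union>a. gint (rv g) a) = (\<Union>a\<in>-{a0}. {u a..<v a})"
    proof -
      have "(\<Union>a. gint (rv g) a) = (\<Union>a\<in>-{a0,a1}. gint (rv g) a) \<union> (gint (rv g) a0 \<union> gint (rv g) a1)" by blast
      also have "gint (rv g) a0 \<union> gint (rv g) a1 = {u a1..<v a1}" unfolding gi using ne c by auto
      also have "(\<Union>a\<in>-{a0,a1}. gint (rv g) a) = (\<Union>a\<in>-{a0,a1}. {u a..<v a})" unfolding gi by auto
      also have "\<dots> \<union> {u a1..<v a1} = (\<Union>a\<in>-{a0}. {u a..<v a})" using ne by blast
      finally show ?thesis .
    qed
    also have "\<dots> = {0..<A} - {u a0..<A}"
    proof -
      have "(\<Union>a. {u a..<v a}) = (\<Union>a\<in>-{a0}. {u a..<v a}) \<union> {u a0..<A}" using v0 by auto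
      moreover have "(\<Union>a\<in>-{a0}. {u a..<v a}) \<inter> {u a0..<A} = {}" using va by fastforce
      ultimately show ?thesis unfolding domU[symmetric] by (rule disjoint_union_diff)
    qed
    finally show ?thesis using bA indom(1)[of a0] unfolding gdom_def by auto
  qed
  have imd: "(\<Union>a. {p a..<(q(a1 := u a0)) a}) = {0..<u a0}"
  proof -
    have "{p a..<(q(a1 := u a0)) a} = {p a..<q a} - {u a0..<A}" for a
      using b bA q1 qa[of a] by auto
    then have "(\<Union>a. {p a..<(q(a1 := u a0)) a}) = (\<Union>a. {p a..<q a}) - {u a0..<A}" by auto
    then show ?thesis using imdom bA indom(1)[of a0] by auto
  qed
  have o1: "(q(a1 := u a0)) a \<le> p c'" if "snd (gperm (rv g)) a < snd (gperm (rv g)) c'" for a c'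
    using that ord1[of a c'] bA q1 unfolding perm rauzy_move_def by auto
  have o0: "(v(a0 := v a1, a1 := c)) a \<le> (u(a0 := c)) x"
    if *: "fst (gperm (rv g)) a < fst (gperm (rv g)) x" for a x
  proof -
    let ?s = "fst (gperm g)"
    have m: "fst (gperm (rv g)) x = (if x = a0 then ?s a1 + 1 else if ?s x > ?s a1 then ?s x + 1 else ?s x)" for x
      unfolding perm rauzy_move_def by (simp add: move_after_def a0_def a1_def)
    have inj: "?s x = ?s y \<Longrightarrow> x = y" for x y using perm0 by (metis bij_betw_def injD)
    show ?thesis
    proof (cases "a = a0")
      case True
      then have "x \<noteq> a0" using * by auto
      then have "?s a1 < ?s x" using * True m[of a] m[of x] inj[of x a1] by (auto split: if_splits)
      then show ?thesis using True ord0[of a1 x] \<open>x \<noteq> a0\<close> ne by auto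
    next
      case False
      show ?thesis
      proof (cases "x = a0")
        case True
        then have "?s a \<le> ?s a1" using * False m[of a] m[of x] by (auto split: if_splits)
        then consider "a = a1" | "?s a < ?s a1" using inj by fastforce
        then show ?thesis using True False ord0[of a a1] c ne by cases auto
      next
        case F2: False
        then have "?s a < ?s x" using * False m[of a] m[of x] by (auto split: if_splits)
        then show ?thesis using F2 False ord0[of a x] c by (auto split: if_splits)
      qed
    qed
  qed
  show "giet_data (rv g) (u a0) (u(a0 := c)) (v(a0 := v a1, a1 := c)) p (q(a1 := u a0))"
    by (rule giet_dataI[OF r0 r1 gi B dm imd o0 o1])
qed

end

section \<open>Interval lengths measured by a scaling function\<close>

definition lft :: "'a giet \<Rightarrow> 'a \<Rightarrow> real" where "lft g a = Inf (gint g a)"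
definition rgt :: "'a giet \<Rightarrow> 'a \<Rightarrow> real" where "rgt g a = Sup (gint g a)"
definition gend :: "'a giet \<Rightarrow> real" where "gend g = Sup (gdom g)"

definition C1_giet :: "'a::finite giet \<Rightarrow> bool" where
  "C1_giet g \<longleftrightarrow> (\<exists>A u v p q. giet_data g A u v p q)"

definition winner :: "'a::finite iet_perm \<times> nat \<Rightarrow> 'a" where
  "winner s = last_letter (fst s) (snd s)"
definition loser :: "'a::finite iet_perm \<times> nat \<Rightarrow> 'a" where
  "loser s = last_letter (fst s) (1 - snd s)"

definition state :: "'a::finite giet \<Rightarrow> 'a iet_perm \<times> nat" where
  "state g = (gperm g, rv_type g)"

text \<open>Seen through \<open>H\<close>, every branch is affine with slope
  \<open>exp (\<omega> $ a)\<close>. The identity has this property for \<open>S\<close>, the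
  primitive constructed later has it for \<open>f\<close>, so one set of lemmas serves both
  maps.\<close>

definition scales :: "(real \<Rightarrow> real) \<Rightarrow> real^'a \<Rightarrow> 'a::finite giet \<Rightarrow> bool" where
  "scales H \<omega> g \<longleftrightarrow> (\<forall>a. \<forall>x\<in>gint g a. \<forall>y\<in>gint g a.
     H (gmap g y) - H (gmap g x) = exp (\<omega> $ a) * (H y - H x))"

lemma scalesD:
  assumes "scales H \<omega> g" "x \<in> gint g a" "y \<in> gint g a"
  shows "H (gmap g y) - H (gmap g x) = exp (\<omega> $ a) * (H y - H x)"
  using assms unfolding scales_def by blast

definition Hlen :: "(real \<Rightarrow> real) \<Rightarrow> 'a giet \<Rightarrow> 'a::finite \<Rightarrow> real" where
  "Hlen H g a = H (rgt g a) - H (lft g a)"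

lemma rauzy_matrix_mult:
  "(rauzy_matrix \<pi> e *v s) $ a = s $ a + (if a = winner (\<pi>, e) then s $ loser (\<pi>, e) else 0)"
proof -
  have "(rauzy_matrix \<pi> e *v s) $ a = (\<Sum>j\<in>UNIV. (if a = j then s $ j else 0)) +
     (\<Sum>j\<in>UNIV. if a = winner (\<pi>, e) \<and> j = loser (\<pi>, e) then s $ j else 0)"
    unfolding matrix_vector_mult_def rauzy_matrix_def winner_def loser_def
    by (simp add: mat_def distrib_right if_distrib[of "\<lambda>x. x * _"] sum.distrib cong: if_cong)
  then show ?thesis by (auto simp: sum.delta)
qed

lemma rauzy_matrix_transpose_mult:
  "(transpose (rauzy_matrix \<pi> e) *v s) $ a = s $ a + (if a = loser (\<pi>, e) then s $ winner (\<pi>, e) else 0)"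
proof -
  have "(transpose (rauzy_matrix \<pi> e) *v s) $ a = (\<Sum>j\<in>UNIV. (if j = a then s $ j else 0)) +
     (\<Sum>j\<in>UNIV. if j = winner (\<pi>, e) \<and> a = loser (\<pi>, e) then s $ j else 0)"
    unfolding matrix_vector_mult_def rauzy_matrix_def winner_def loser_def transpose_def
    by (simp add: mat_def distrib_right if_distrib[of "\<lambda>x. x * _"] sum.distrib cong: if_cong)
  then show ?thesis by (auto simp: sum.delta)
qed

lemma giet_dataD:
  assumes "giet_data g A u v p q"
  shows "gint g a = {u a..<v a}" "C1_branch (gmap g) (u a) (v a) (p a) (q a)" "gdom g = {0..<A}"
  using assms unfolding giet_data_def by blast+

lemma giet_data_lft:
  assumes "giet_data g A u v p q"
  shows "lft g a = u a" "rgt g a = v a" "gend g = A" "0 < A"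
proof -
  have "gint g b = {u b..<v b} \<and> C1_branch (gmap g) (u b) (v b) (p b) (q b)" for b
    using assms unfolding giet_data_def by blast
  then have i: "gint g b = {u b..<v b}" "u b < v b" for b
    using C1_branch_image(3) by (blast, metis)
  then show "lft g a = u a" "rgt g a = v a" unfolding lft_def rgt_def by simp_all
  have d: "gdom g = {0..<A}" using assms unfolding giet_data_def by blast
  have "u a \<in> gdom g" using i[of a] unfolding gdom_def by force
  then show "0 < A" using d by auto
  then show "gend g = A" unfolding gend_def d by simp
qed

text \<open>The right ends \<open>v\<close> and \<open>q\<close> lie outside the half-open
  intervals. The relation reaches them because both sides extend continuously to the closed
  branch.\<close>

lemma scales_limit:
  fixes H :: "real \<Rightarrow> real"
  assumes B: "C1_branch F u v p q" and H: "continuous_on {0..A} H"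
    and sub: "0 \<le> u" "v \<le> A" "0 \<le> p" "q \<le> A"
    and rescale: "\<And>x y. x \<in> {u..<v} \<Longrightarrow> y \<in> {u..<v} \<Longrightarrow> H (F y) - H (F x) = c * (H y - H x)"
  shows "H q - H p = c * (H v - H u)"
proof -
  obtain G D where G: "C1_ext F u v p q G D" using B unfolding C1_branch_def by auto
  have uv: "u < v" and Gu: "G u = p" "G v = q" using G unfolding C1_ext_def by auto
  have img: "G ` {u..v} = {p..q}" using C1_ext_bij[OF G] by auto
  let ?f = "\<lambda>y. H (G y) - H p - c * (H y - H u)"
  have c1: "continuous_on {u..v} (H \<circ> G)"
    by (rule continuous_on_compose[OF C1_ext_cont[OF G]]) (rule continuous_on_subset[OF H], use sub img in auto)
  have c2: "continuous_on {u..v} H" by (rule continuous_on_subset[OF H]) (use sub in auto)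
  have cf: "continuous_on {u..v} ?f"
    by (rule continuous_on_diff[OF continuous_on_diff[OF c1[unfolded o_def] continuous_on_const]
      continuous_on_mult[OF continuous_on_const continuous_on_diff[OF c2 continuous_on_const]]])
  have cl: "closure {u..<v} = {u..v}" using uv by simp
  have "?f v = 0"
  proof (rule continuous_constant_on_closure[of "{u..<v}" ?f 0])
    show "continuous_on (closure {u..<v}) ?f" using cf cl by simp
    show "v \<in> closure {u..<v}" using cl uv by simp
    fix x assume x: "x \<in> {u..<v}"
    then have "F x = G x" "F u = p" using G uv unfolding C1_ext_def by auto
    then show "?f x = 0" using rescale[of u x] x uv by simp
  qed
  then show ?thesis using Gu by simp
qed

context giet_step
begin

abbreviation "w \<equiv> winner (state g)"
abbreviation "l \<equiv> loser (state g)"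

lemma A_pos: "0 < A" using giet_data_lft(4)[OF data] .

lemma wl0: "rv_type g = 0 \<Longrightarrow> w = gtop g" "rv_type g = 0 \<Longrightarrow> l = gbot g"
  and wl1: "rv_type g = 1 \<Longrightarrow> w = gbot g" "rv_type g = 1 \<Longrightarrow> l = gtop g"
  by (auto simp: winner_def loser_def state_def)

lemma wl_ne: "w \<noteq> l"
  using type_iff(2) wl0 wl1 dist by fastforce

lemma map_le: "x \<in> {0..<A} \<Longrightarrow> gmap g x \<in> {0..<A}"
proof -
  assume "x \<in> {0..<A}"
  then obtain a where "x \<in> gint g a" using domU gint_eq by blast
  then have "gmap g x \<in> {p a..<q a}" using im by blast
  then show ?thesis using indom[of a] by auto
qed

lemma rv_giet:
  shows "C1_giet (rv g)" "gperm (rv g) = rauzy_move (gperm g) (rv_type g)"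
    "0 < gend (rv g)" "gend (rv g) < A" "gdom (rv g) = {0..<gend (rv g)}"
proof -
  have "C1_giet (rv g) \<and> gperm (rv g) = rauzy_move (gperm g) (rv_type g) \<and> gend (rv g) < A"
    using type_iff(2)
  proof
    assume ty: "rv_type g = 0"
    note d = data0[OF ty]
    have "C1_giet (rv g)" unfolding C1_giet_def using d(1) by blast
    then show ?thesis unfolding giet_data_lft(3)[OF d(1)] using d(2,5) ty by simp
  next
    assume ty: "rv_type g = 1"
    obtain c where c: "u (gbot g) < c" "c < v (gbot g)" "gmap g c = u (gtop g)" using cut_exists[OF ty] .
    note d = data1[OF ty c]
    have "C1_giet (rv g)" unfolding C1_giet_def using d(1) by blast
    then show ?thesis unfolding giet_data_lft(3)[OF d(1)] using d(2,5) ty by simp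
  qed
  then show "C1_giet (rv g)" "gperm (rv g) = rauzy_move (gperm g) (rv_type g)" "gend (rv g) < A" by auto
  then obtain A' u' v' p' q' where d: "giet_data (rv g) A' u' v' p' q'" unfolding C1_giet_def by auto
  show "0 < gend (rv g)" "gdom (rv g) = {0..<gend (rv g)}"
    using giet_data_lft(3,4)[OF d] giet_dataD(3)[OF d] by simp_all
qed

text \<open>Every letter but the loser keeps return time one.\<close>

lemma rv_other:
  assumes "a \<noteq> l"
  shows "gint (rv g) a \<subseteq> gint g a" "x \<in> gint (rv g) a \<Longrightarrow> gmap (rv g) x = gmap g x"
    "x \<in> gint (rv g) a \<Longrightarrow> right_deriv (gmap (rv g)) x = right_deriv (gmap g) x"
proof -
  have "\<exists>u' v'. gint (rv g) a = {u'..<v'} \<and> u a \<le> u' \<and> v' \<le> v a \<and> (\<forall>x\<in>{u'..<v'}. gmap (rv g) x = gmap g x)"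
    using type_iff(2)
  proof
    assume ty: "rv_type g = 0"
    then have a: "a \<noteq> gbot g" using assms wl0 by simp
    note d = data0[OF ty]
    have gi: "gint (rv g) a = {u a..<(v(gtop g := p (gbot g))) a}"
      using giet_dataD(1)[OF d(1)] .
    have le: "(v(gtop g := p (gbot g))) a \<le> v a" using d(5) v_top by auto
    have "gmap (rv g) x = gmap g x" if "x \<in> gint g a" for x
    proof -
      have "gmap g x \<in> {p a..<q a}" using that im by blast
      then have "gmap g x \<in> {0..<p (gbot g)}" using ord1[OF bot_last[OF a]] indom(3)[of a] by auto
      then show ?thesis unfolding d(3) by (rule first_return1)
    qed
    then show ?thesis using gi le gint_eq[of a] by (intro exI conjI ballI) auto
  next
    assume ty: "rv_type g = 1"
    then have a: "a \<noteq> gtop g" using assms wl1 by simp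
    obtain c where c: "u (gbot g) < c" "c < v (gbot g)" "gmap g c = u (gtop g)" using cut_exists[OF ty] .
    note d = data1[OF ty c]
    have gi: "gint (rv g) a = {u a..<(v(gtop g := v (gbot g), gbot g := c)) a}"
      and B: "C1_branch (gmap (rv g)) (u a) ((v(gtop g := v (gbot g), gbot g := c)) a) (p a) ((q(gbot g := u (gtop g))) a)"
      using giet_dataD(1,2)[OF d(1), of a] a by simp_all
    have le: "(v(gtop g := v (gbot g), gbot g := c)) a \<le> v a" using c a by auto
    have "gmap (rv g) x = gmap g x" if x: "x \<in> {u a..<(v(gtop g := v (gbot g), gbot g := c)) a}" for x
    proof -
      have xa: "x \<in> {u a..<v a}" using x le by auto
      have "gmap g x \<in> {p a..<q a}" using xa im[of a] gint_eq[of a] by blast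
      moreover have "gmap g x < u (gtop g)"
      proof (cases "a = gbot g")
        case True
        then show ?thesis using C1_branch_strict[OF br[of a], of x c] c x a by auto
      next
        case False
        then show ?thesis using ord1[OF bot_last[OF False]] calculation d(4) by auto
      qed
      ultimately have "gmap g x \<in> {0..<u (gtop g)}" using indom(3)[of a] by auto
      then show ?thesis unfolding d(3) by (rule first_return1)
    qed
    then show ?thesis using gi le by (intro exI conjI ballI) auto
  qed
  then obtain u' v' where *: "gint (rv g) a = {u'..<v'}" "u a \<le> u'" "v' \<le> v a"
    "\<And>x. x \<in> {u'..<v'} \<Longrightarrow> gmap (rv g) x = gmap g x" by blast
  show "gint (rv g) a \<subseteq> gint g a" using * gint_eq[of a] by auto
  show "x \<in> gint (rv g) a \<Longrightarrow> gmap (rv g) x = gmap g x" using * by blast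
  assume x: "x \<in> gint (rv g) a"
  show "right_deriv (gmap (rv g)) x = right_deriv (gmap g) x"
    by (rule C1_branch_rd_cong[OF br[of a], of _ v']) (use * x in auto)
qed

text \<open>Points of the loser return after two steps and pass through the removed part of the
  domain. The letters \<open>b\<close> and \<open>b'\<close> met on the way are loser and winner, in
  an order that depends on the type; hence the symmetric formulation.\<close>

lemma rv_loser:
  shows "gmap g ` gint (rv g) l = {gend (rv g)..<A}"
    and "\<exists>b b'. b \<in> {l, w} \<and> b' \<in> {l, w} \<and> b \<noteq> b' \<and> gint (rv g) l \<subseteq> gint g b \<and> gmap g ` gint (rv g) l \<subseteq> gint g b' \<and>
      (\<forall>x\<in>gint (rv g) l. gmap (rv g) x = gmap g (gmap g x) \<and>
         right_deriv (gmap (rv g)) x = right_deriv (gmap g) (gmap g x) * right_deriv (gmap g) x) \<and> u b \<le> lft (rv g) l \<and> rgt (rv g) l \<le> v b"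
proof -
  have "gmap g ` gint (rv g) l = {gend (rv g)..<A} \<and> (\<exists>b b'. b \<in> {l, w} \<and> b' \<in> {l, w} \<and> b \<noteq> b' \<and> gint (rv g) l \<subseteq> gint g b \<and> gmap g ` gint (rv g) l \<subseteq> gint g b' \<and>
      (\<forall>x\<in>gint (rv g) l. gmap (rv g) x = gmap g (gmap g x) \<and>
         right_deriv (gmap (rv g)) x = right_deriv (gmap g) (gmap g x) * right_deriv (gmap g) x) \<and> u b \<le> lft (rv g) l \<and> rgt (rv g) l \<le> v b)"
    using type_iff(2)
  proof
    assume ty: "rv_type g = 0"
    note wl = wl0[OF ty]
    note d = data0[OF ty]
    have ne: "gbot g \<noteq> gtop g" using dist by simp
    have gi: "gint (rv g) l = {u (gbot g)..<v (gbot g)}"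
      using giet_dataD(1)[OF d(1), of "gbot g"] ne unfolding wl by simp
    have en: "gend (rv g) = p (gbot g)" using giet_data_lft(3)[OF d(1)] .
    have img: "gmap g ` gint (rv g) l = {gend (rv g)..<A}"
      unfolding gi en using im[of "gbot g"] q_bot gint_eq[of "gbot g"] by simp
    have sub: "{gend (rv g)..<A} \<subseteq> gint g (gtop g)" unfolding en gint_eq using d(4) v_top by auto
    have br2: "C1_branch (gmap g) (p (gbot g)) A (gmap g (p (gbot g))) (q (gtop g))"
      using C1_branch_split(2)[OF br[of "gtop g"], of "p (gbot g)"] d(4,5) v_top by simp
    have br1: "C1_branch (gmap g) (u (gbot g)) (v (gbot g)) (p (gbot g)) A" using br[of "gbot g"] q_bot by simp
    have two: "gmap (rv g) x = gmap g (gmap g x)" if x: "u (gbot g) \<le> x" "x < v (gbot g)" for x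
    proof -
      have *: "gmap g x \<in> {gend (rv g)..<A}" using x img gi by auto
      then have "gmap g x \<in> gint g (gtop g)" using sub by auto
      then have "gmap g (gmap g x) \<in> {p (gtop g)..<q (gtop g)}" using im by blast
      then have "gmap g (gmap g x) \<in> {0..<p (gbot g)}"
        using ord1[OF bot_last[OF dist]] indom(3)[of "gtop g"] by auto
      then show ?thesis unfolding d(3) using * en by (intro first_return2) auto
    qed
    have "right_deriv (gmap (rv g)) x = right_deriv (gmap g) (gmap g x) * right_deriv (gmap g) x" if x: "u (gbot g) \<le> x" "x < v (gbot g)" for x
      by (rule C1_branch_rd_compose[OF br1 br2 two x])
    then show ?thesis
      using img sub two ne gi gint_eq[of "gbot g"] giet_data_lft(1,2)[OF d(1), of "gbot g"] unfolding wl
      by (intro conjI exI[of _ "gbot g"] exI[of _ "gtop g"]) simp_all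
  next
    assume ty: "rv_type g = 1"
    note wl = wl1[OF ty]
    obtain c where c: "u (gbot g) < c" "c < v (gbot g)" "gmap g c = u (gtop g)" using cut_exists[OF ty] .
    note d = data1[OF ty c]
    have ne: "gbot g \<noteq> gtop g" using dist by simp
    have gi: "gint (rv g) l = {c..<v (gbot g)}"
      using giet_dataD(1)[OF d(1), of "gtop g"] ne unfolding wl by simp
    have en: "gend (rv g) = u (gtop g)" using giet_data_lft(3)[OF d(1)] .
    have br1: "C1_branch (gmap g) c (v (gbot g)) (u (gtop g)) A"
      using C1_branch_split(2)[OF br[of "gbot g"] c(1,2)] q_bot c by simp
    have br2: "C1_branch (gmap g) (u (gtop g)) A (p (gtop g)) (q (gtop g))" using br[of "gtop g"] v_top by simp
    have img: "gmap g ` gint (rv g) l = {gend (rv g)..<A}"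
      unfolding gi en by (rule C1_branch_image(1)[OF br1])
    have sub: "{gend (rv g)..<A} \<subseteq> gint g (gtop g)" unfolding en gint_eq using v_top by auto
    have two: "gmap (rv g) x = gmap g (gmap g x)" if x: "c \<le> x" "x < v (gbot g)" for x
    proof -
      have *: "gmap g x \<in> {gend (rv g)..<A}" using x img gi by auto
      then have "gmap g x \<in> gint g (gtop g)" using sub by auto
      then have "gmap g (gmap g x) \<in> {p (gtop g)..<q (gtop g)}" using im by blast
      then have "gmap g (gmap g x) \<in> {0..<u (gtop g)}"
        using ord1[OF bot_last[OF dist]] indom(3)[of "gtop g"] d(4) by auto
      then show ?thesis unfolding d(3) using * en by (intro first_return2) auto
    qed
    have "right_deriv (gmap (rv g)) x = right_deriv (gmap g) (gmap g x) * right_deriv (gmap g) x" if x: "c \<le> x" "x < v (gbot g)" for x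
      by (rule C1_branch_rd_compose[OF br1 br2 two x])
    then show ?thesis
      using img sub two ne gi c gint_eq[of "gbot g"] giet_data_lft(1,2)[OF d(1), of "gtop g"] unfolding wl
      by (intro conjI exI[of _ "gbot g"] exI[of _ "gtop g"]) auto
  qed
  then show "gmap g ` gint (rv g) l = {gend (rv g)..<A}"
    and "\<exists>b b'. b \<in> {l, w} \<and> b' \<in> {l, w} \<and> b \<noteq> b' \<and> gint (rv g) l \<subseteq> gint g b \<and> gmap g ` gint (rv g) l \<subseteq> gint g b' \<and>
      (\<forall>x\<in>gint (rv g) l. gmap (rv g) x = gmap g (gmap g x) \<and>
         right_deriv (gmap (rv g)) x = right_deriv (gmap g) (gmap g x) * right_deriv (gmap g) x) \<and> u b \<le> lft (rv g) l \<and> rgt (rv g) l \<le> v b"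
    by blast+
qed

text \<open>Continuity at a removed point will be reduced to continuity at a point of the smaller
  domain, and for this one needs the interior of a branch. A point beyond \<open>gend (rv g)\<close>
  is the image of an interior point of the loser's interval. The point \<open>gend (rv g)\<close>
  itself is treated by type: in type 0 it is interior to the top interval and is mapped forwards, in
  type 1 it is the image of the cut point \<open>c\<close>, which is interior to the old bottom-last
  interval.\<close>

lemma rv_interior:
  assumes z: "gend (rv g) \<le> z" "z < A"
  shows "\<exists>y a. u a < y \<and> y < v a \<and> ((gmap g y = z \<and> 0 < y \<and> y < gend (rv g)) \<or> (y = z \<and> 0 < gmap g y \<and> gmap g y < gend (rv g)))"
proof -
  obtain A' u' v' p' q' where d': "giet_data (rv g) A' u' v' p' q'" using rv_giet(1) unfolding C1_giet_def by auto
  have e': "gend (rv g) = A'" and lr': "lft (rv g) l = u' l" "rgt (rv g) l = v' l" using giet_data_lft[OF d'] by auto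
  have gi': "gint (rv g) l = {u' l..<v' l}" and gd': "gdom (rv g) = {0..<A'}"
    using giet_dataD[OF d'] by blast+
  have uv': "u' l < v' l" using C1_branch_image(3)[OF giet_dataD(2)[OF d']] .
  have "u' l \<in> gdom (rv g)" unfolding gdom_def using gi' uv' by force
  then have u'0: "0 \<le> u' l" using gd' by auto
  show ?thesis
  proof (cases "z = gend (rv g)")
    case False
    then have "z \<in> gmap g ` gint (rv g) l" using z unfolding rv_loser(1) by auto
    then obtain y where y: "y \<in> gint (rv g) l" "gmap g y = z" by auto
    have m: "gmap g (u' l) \<in> {gend (rv g)..<A}" using uv' gi' rv_loser(1) by fastforce
    obtain b where b: "u b \<le> u' l" "v' l \<le> v b" using rv_loser(2) lr' by auto
    have yne: "y \<noteq> u' l"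
    proof
      assume "y = u' l"
      have "gend (rv g) \<in> gmap g ` gint (rv g) l" unfolding rv_loser(1) using z by auto
      then obtain x where x: "x \<in> gint (rv g) l" "gmap g x = gend (rv g)" by auto
      have "gmap g (u' l) \<le> gmap g x" using C1_branch_strict[OF br[of b], of "u' l" x] x gi' b
        by (cases "u' l = x") auto
      then show False using x False z y \<open>y = u' l\<close> by auto
    qed
    have "y \<in> gdom (rv g)" using y unfolding gdom_def by blast
    then show ?thesis using y yne gi' b u'0 gd' e' by (intro exI[of _ y] exI[of _ b]) auto
  next
    case z': True
    show ?thesis using type_iff(2)
    proof
      assume ty: "rv_type g = 0"
      note d = data0[OF ty]
      have en: "gend (rv g) = p (gbot g)" using giet_data_lft(3)[OF d(1)] .
      have i: "u (gtop g) < z" "z < v (gtop g)" using z' en d(4,5) v_top by auto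
      then have "p (gtop g) < gmap g z" "gmap g z < q (gtop g)"
        using C1_branch_bounds_strict[OF br[of "gtop g"] i] C1_branch_bounds(2)[OF br[of "gtop g"]] by auto
      then show ?thesis using i z' en ord1[OF bot_last[OF dist]] indom(3)[of "gtop g"]
        by (intro exI[of _ z] exI[of _ "gtop g"]) auto
    next
      assume ty: "rv_type g = 1"
      obtain c where c: "u (gbot g) < c" "c < v (gbot g)" "gmap g c = u (gtop g)" using cut_exists[OF ty] .
      note d = data1[OF ty c]
      have en: "gend (rv g) = u (gtop g)" using giet_data_lft(3)[OF d(1)] .
      have "v (gbot g) \<le> u (gtop g)" using ord0[OF top_last[of "gbot g"]] dist by auto
      then show ?thesis using c z' en indom(1)[of "gbot g"]
        by (intro exI[of _ c] exI[of _ "gbot g"]) auto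
    qed
  qed
qed

lemma rv_scales:
  assumes "scales H \<omega> g"
  shows "scales H (transpose (rauzy_matrix (gperm g) (rv_type g)) *v \<omega>) (rv g)"
  unfolding scales_def
proof (intro allI ballI)
  fix a x y assume xy: "x \<in> gint (rv g) a" "y \<in> gint (rv g) a"
  let ?\<omega> = "transpose (rauzy_matrix (gperm g) (rv_type g)) *v \<omega>"
  have \<omega>: "?\<omega> $ a = \<omega> $ a + (if a = l then \<omega> $ w else 0)"
    unfolding rauzy_matrix_transpose_mult state_def by simp
  show "H (gmap (rv g) y) - H (gmap (rv g) x) = exp (?\<omega> $ a) * (H y - H x)"
  proof (cases "a = l")
    case False
    have "x \<in> gint g a" "y \<in> gint g a" using xy rv_other(1)[OF False] by auto
    from scalesD[OF assms this] show ?thesis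
      using \<omega> False rv_other(2)[OF False xy(1)] rv_other(2)[OF False xy(2)] by simp
  next
    case True
    obtain b b' where b: "b \<in> {l, w}" "b' \<in> {l, w}" "b \<noteq> b'" "gint (rv g) l \<subseteq> gint g b"
      "gmap g ` gint (rv g) l \<subseteq> gint g b'" "\<And>x. x\<in>gint (rv g) l \<Longrightarrow> gmap (rv g) x = gmap g (gmap g x)"
      using rv_loser(2) by blast
    have xb: "x \<in> gint g b" "y \<in> gint g b" "gmap g x \<in> gint g b'" "gmap g y \<in> gint g b'" using xy b True by blast+
    have "H (gmap (rv g) y) - H (gmap (rv g) x) = exp (\<omega> $ b') * (H (gmap g y) - H (gmap g x))"
      using scalesD[OF assms xb(3,4)] b(6) xy True by simp
    also have "\<dots> = exp (\<omega> $ b') * (exp (\<omega> $ b) * (H y - H x))" using scalesD[OF assms xb(1,2)] by simp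
    also have "\<dots> = exp (\<omega> $ b' + \<omega> $ b) * (H y - H x)" by (simp add: exp_add)
    also have "\<omega> $ b' + \<omega> $ b = ?\<omega> $ a" using \<omega> True b(1,2,3) by auto
    finally show ?thesis .
  qed
qed

text \<open>In type 0 the piece cut off from the winner is the image of the loser's interval and
  carries the slope of the loser. In type 1 the old interval of the loser is the image of the piece
  cut off from the winner and carries the slope of the winner.\<close>

lemma rv_Hlen:
  assumes rescale: "scales H \<omega> g" and H: "continuous_on {0..A} H"
  shows "a \<noteq> w \<Longrightarrow> a \<noteq> l \<Longrightarrow> Hlen H g a = Hlen H (rv g) a"
    "rv_type g = 0 \<Longrightarrow> Hlen H g l = Hlen H (rv g) l"
    "rv_type g = 0 \<Longrightarrow> Hlen H g w = Hlen H (rv g) w + exp (\<omega> $ l) * Hlen H (rv g) l"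
    "rv_type g = 1 \<Longrightarrow> Hlen H g l = exp (\<omega> $ w) * Hlen H (rv g) l"
    "rv_type g = 1 \<Longrightarrow> Hlen H g w = Hlen H (rv g) w + Hlen H (rv g) l"
proof -
  have lr: "lft g a = u a" "rgt g a = v a" for a using giet_data_lft[OF data] by auto
  have lim: "H (q a) - H (p a) = exp (\<omega> $ a) * (H (v a) - H (u a))" for a
    by (rule scales_limit[OF br H indom]) (use scalesD[OF rescale, of _ a] gint_eq[of a] in simp)
  have t0: "(a \<noteq> w \<longrightarrow> Hlen H g a = Hlen H (rv g) a) \<and> Hlen H g w = Hlen H (rv g) w + exp (\<omega> $ l) * Hlen H (rv g) l"
    if ty: "rv_type g = 0" for a
  proof -
    note d = data0[OF ty]
    have lr': "lft (rv g) a = u a" "rgt (rv g) a = (v(gtop g := p (gbot g))) a" for a using giet_data_lft[OF d(1)] by auto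
    show ?thesis using lim[of "gbot g"] v_top q_bot dist unfolding Hlen_def lr lr' wl0[OF ty] by auto
  qed
  have t1: "(a \<noteq> w \<and> a \<noteq> l \<longrightarrow> Hlen H g a = Hlen H (rv g) a) \<and> Hlen H g l = exp (\<omega> $ w) * Hlen H (rv g) l \<and> Hlen H g w = Hlen H (rv g) w + Hlen H (rv g) l"
    if ty: "rv_type g = 1" for a
  proof -
    obtain c where c: "u (gbot g) < c" "c < v (gbot g)" "gmap g c = u (gtop g)" using cut_exists[OF ty] .
    note d = data1[OF ty c]
    have lr': "lft (rv g) a = (u(gtop g := c)) a" "rgt (rv g) a = (v(gtop g := v (gbot g), gbot g := c)) a" for a
      using giet_data_lft[OF d(1)] by auto
    have B: "C1_branch (gmap g) c (v (gbot g)) (u (gtop g)) A"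
      using C1_branch_split(2)[OF br[of "gbot g"] c(1,2)] q_bot c by simp
    have "H A - H (u (gtop g)) = exp (\<omega> $ gbot g) * (H (v (gbot g)) - H c)"
    proof (rule scales_limit[OF B H])
      show "0 \<le> c" "v (gbot g) \<le> A" "0 \<le> u (gtop g)" "A \<le> A" using indom[of "gbot g"] indom[of "gtop g"] c by auto
      show "H (gmap g y) - H (gmap g x) = exp (\<omega> $ gbot g) * (H y - H x)" if "x \<in> {c..<v (gbot g)}" "y \<in> {c..<v (gbot g)}" for x y
        using scalesD[OF rescale, of _ "gbot g"] that c gint_eq[of "gbot g"] by auto
    qed
    then show ?thesis using v_top dist c unfolding Hlen_def lr lr' wl1[OF ty] by auto
  qed
  show "a \<noteq> w \<Longrightarrow> a \<noteq> l \<Longrightarrow> Hlen H g a = Hlen H (rv g) a" using t0[of a] t1[of a] type_iff(2) by metis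
  show "rv_type g = 0 \<Longrightarrow> Hlen H g l = Hlen H (rv g) l"
    "rv_type g = 0 \<Longrightarrow> Hlen H g w = Hlen H (rv g) w + exp (\<omega> $ l) * Hlen H (rv g) l" using t0[of l] wl_ne by auto
  show "rv_type g = 1 \<Longrightarrow> Hlen H g l = exp (\<omega> $ w) * Hlen H (rv g) l"
    "rv_type g = 1 \<Longrightarrow> Hlen H g w = Hlen H (rv g) w + Hlen H (rv g) l" using t1[of w] by auto
qed

end

section \<open>Transfer functions over towers of induced maps\<close>

text \<open>What the transfer function needs from renormalization: nested intervals with common left
  end 0, each map being induced by the previous one with return time 2 on \<open>R n\<close> and 1
  elsewhere, the induced cocycles \<open>\<phi> n\<close>, and summable bounds for them. The
  assumption \<open>smooth\<close> serves the continuity proof; it links each removed point to the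
  smaller interval through a point at which map and cocycle are continuous.\<close>

locale induced_tower =
  fixes A :: "nat \<Rightarrow> real" and F :: "nat \<Rightarrow> real \<Rightarrow> real" and \<phi> :: "nat \<Rightarrow> real \<Rightarrow> real"
    and R :: "nat \<Rightarrow> real set" and e :: "nat \<Rightarrow> real"
  assumes A_pos: "0 < A n" and A_dec: "A (Suc n) < A n"
    and F_maps: "x \<in> {0..<A n} \<Longrightarrow> F n x \<in> {0..<A n}"
    and F_inj: "inj_on (F n) {0..<A n}"
    and R_sub: "R n \<subseteq> {0..<A (Suc n)}"
    and one: "x \<in> {0..<A (Suc n)} - R n \<Longrightarrow> F (Suc n) x = F n x \<and> \<phi> (Suc n) x = \<phi> n x"
    and two: "x \<in> R n \<Longrightarrow> F (Suc n) x = F n (F n x) \<and> \<phi> (Suc n) x = \<phi> n x + \<phi> n (F n x)"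
    and R_image: "F n ` R n = {A (Suc n)..<A n}"
    and e_bound: "x \<in> {0..<A n} \<Longrightarrow> \<bar>\<phi> n x\<bar> \<le> e n" and e_summable: "summable e"
    and smooth: "z \<in> {A (Suc n)..<A n} \<Longrightarrow> \<exists>y. isCont (F n) y \<and> isCont (\<phi> n) y \<and>
       (\<forall>\<delta>>0. \<exists>\<eta>>0. ball (F n y) \<eta> \<subseteq> F n ` ball y \<delta>) \<and>
       (F n y = z \<and> 0 < y \<and> y < A (Suc n) \<or> y = z \<and> 0 < F n y \<and> F n y < A (Suc n))"
begin

definition G where "G n = inv_into (R n) (F n)"

lemma G: assumes "x \<in> {A (Suc n)..<A n}" shows "G n x \<in> R n" "F n (G n x) = x"
  using assms R_image[of n] unfolding G_def by (metis inv_into_into, metis f_inv_into_f)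

lemma G_F: assumes "x \<in> R n" shows "G n (F n x) = x"
proof -
  have "inj_on (F n) (R n)" using F_inj[of n] R_sub[of n] A_dec[of n] by (auto elim!: inj_on_subset)
  then show ?thesis unfolding G_def using assms by simp
qed

lemma e_nonneg: "0 \<le> e n"
  using e_bound[of 0 n] A_pos[of n] by auto

text \<open>Descends to the base point under \<open>x\<close> in the towers over the shrinking
  intervals: a point removed at some level is replaced by its preimage in the return piece. The sum
  \<open>U\<close> of the contributions \<open>c\<close> is thus the sum of the cocycle along the
  orbit from the base up to \<open>x\<close>.\<close>

primrec pos where
  "pos k x 0 = x"
| "pos k x (Suc i) = (if pos k x i < A (Suc (k + i)) then pos k x i else G (k + i) (pos k x i))"

definition c where
  "c k x i = (if pos k x i < A (Suc (k + i)) then 0 else \<phi> (k + i) (G (k + i) (pos k x i)))"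

definition U where "U k x = (\<Sum>i. c k x i)"

definition tail where "tail k = (\<Sum>i. e (k + i))"

lemma pos_dom: "x \<in> {0..<A k} \<Longrightarrow> pos k x i \<in> {0..<A (k + i)}"
proof (induction i)
  case (Suc i)
  then show ?case using G(1)[of "pos k x i" "k + i"] R_sub[of "k + i"] by (auto simp: subset_iff)
qed simp

lemma c_bound: assumes "x \<in> {0..<A k}" shows "\<bar>c k x i\<bar> \<le> e (k + i)"
proof (cases "pos k x i < A (Suc (k + i))")
  case True
  then show ?thesis by (simp add: c_def e_nonneg)
next
  case False
  then have "pos k x i \<in> {A (Suc (k + i))..<A (k + i)}" using pos_dom[OF assms, of i] by auto
  then have "G (k + i) (pos k x i) \<in> {0..<A (k + i)}"
    using G(1) R_sub[of "k + i"] A_dec[of "k + i"] by fastforce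
  then show ?thesis using False e_bound by (simp add: c_def)
qed

lemma e_shift: "summable (\<lambda>i. e (k + i))"
  using summable_ignore_initial_segment[OF e_summable, of k] by (simp add: add.commute)

lemma c_summable: assumes "x \<in> {0..<A k}" shows "summable (c k x)" "summable (\<lambda>i. \<bar>c k x i\<bar>)"
proof -
  show "summable (\<lambda>i. \<bar>c k x i\<bar>)"
    by (rule summable_comparison_test'[OF e_shift[of k], of 0]) (use c_bound[OF assms] in simp)
  then show "summable (c k x)" by (rule summable_rabs_cancel)
qed

lemma U_bound: assumes "x \<in> {0..<A k}" shows "\<bar>U k x\<bar> \<le> tail k"
proof -
  have "\<bar>U k x\<bar> \<le> (\<Sum>i. \<bar>c k x i\<bar>)" unfolding U_def by (rule summable_rabs[OF c_summable(2)[OF assms]])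
  also have "\<dots> \<le> tail k" unfolding tail_def
    by (rule suminf_le[OF c_bound[OF assms] c_summable(2)[OF assms] e_shift])
  finally show ?thesis .
qed

lemma tail_0: "tail \<longlonglongrightarrow> 0"
proof -
  have "(\<lambda>k. \<Sum>i. e (i + k)) \<longlonglongrightarrow> 0" by (rule suminf_exist_split2[OF e_summable])
  then show ?thesis unfolding tail_def by (simp add: add.commute)
qed

lemma pos_shift: "pos k x (Suc i) = pos (Suc k) (pos k x 1) i"
  by (induction i) simp_all

lemma U_rec:
  assumes "x \<in> {0..<A k}"
  shows "U k x = (if x < A (Suc k) then U (Suc k) x else U (Suc k) (G k x) + \<phi> k (G k x))"
proof -
  have "c k x (Suc i) = c (Suc k) (pos k x 1) i" for i
    unfolding c_def pos_shift by (simp del: pos.simps)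
  then have "(\<Sum>i. c k x (Suc i)) = U (Suc k) (pos k x 1)"
    unfolding U_def by presburger
  moreover have "(\<Sum>i. c k x (Suc i)) = U k x - c k x 0"
    using suminf_split_head[OF c_summable(1)[OF assms]] unfolding U_def .
  ultimately have "U k x = U (Suc k) (pos k x 1) + c k x 0" by simp
  then show ?thesis unfolding c_def by simp
qed

lemma U_eq: "x \<in> {0..<A k} \<Longrightarrow> U k x = U 0 x"
proof (induction k)
  case (Suc k)
  then show ?case using U_rec[of x k] A_dec[of k] by auto
qed simp

text \<open>The cocycle of the induced map is the sum of the cocycle over the return, so an equation
  that holds up to \<open>D\<close> deep down holds up to the same \<open>D\<close> one level
  higher.\<close>

lemma U_defect_step:
  assumes D: "\<And>x. x \<in> {0..<A (Suc k)} \<Longrightarrow> \<bar>U (Suc k) (F (Suc k) x) - U (Suc k) x - \<phi> (Suc k) x\<bar> \<le> D"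
    and x: "x \<in> {0..<A k}"
  shows "\<bar>U k (F k x) - U k x - \<phi> k x\<bar> \<le> D"
proof -
  have Fx: "F k x \<in> {0..<A k}" using F_maps x by blast
  have "0 \<in> {0..<A (Suc k)}" using A_pos by auto
  from D[OF this] have D0: "0 \<le> D" by linarith
  consider "x \<in> R k" | "x \<in> {0..<A (Suc k)} - R k" | "x \<in> {A (Suc k)..<A k}" using x by force
  then show ?thesis
  proof cases
    case 1
    then have "F k x \<in> {A (Suc k)..<A k}" using R_image by blast
    moreover have "x < A (Suc k)" using 1 R_sub[of k] by auto
    ultimately show ?thesis using U_rec[OF Fx] U_rec[OF x] G_F[OF 1] D0 by auto
  next
    case 2
    then have "F (Suc k) x < A (Suc k)" using F_maps[of x "Suc k"] by auto
    then show ?thesis using U_rec[OF Fx] U_rec[OF x] one[OF 2] D[of x] 2 by auto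
  next
    case 3
    note y = G[OF 3]
    have yd: "G k x \<in> {0..<A (Suc k)}" using y R_sub by blast
    have e1: "F (Suc k) (G k x) = F k x" "\<phi> (Suc k) (G k x) = \<phi> k (G k x) + \<phi> k x" using two[OF y(1)] y(2) by auto
    then have "F k x < A (Suc k)" using F_maps[OF yd] by auto
    then have "U k (F k x) = U (Suc k) (F (Suc k) (G k x))" using U_rec[OF Fx] e1 by auto
    moreover have "U k x = U (Suc k) (G k x) + \<phi> k (G k x)" using U_rec[OF x] 3 by auto
    ultimately show ?thesis using D[OF yd] e1 by (simp add: algebra_simps)
  qed
qed

text \<open>At level \<open>n\<close> the defect is trivially at most
  \<open>2 * tail n + e n\<close>. It does not increase on the way up to level \<open>k\<close>, and
  \<open>n\<close> is arbitrary.\<close>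

lemma U_cohom:
  assumes "x \<in> {0..<A k}" shows "U k (F k x) - U k x = \<phi> k x"
proof -
  let ?D = "\<lambda>n. 2 * tail n + e n"
  have base: "\<bar>U n (F n x) - U n x - \<phi> n x\<bar> \<le> ?D n" if "x \<in> {0..<A n}" for n x
    using U_bound[OF that] U_bound[OF F_maps[OF that]] e_bound[OF that] by linarith
  have "\<bar>U k (F k x) - U k x - \<phi> k x\<bar> \<le> ?D (k + n)" for n
  proof -
    have "\<forall>x\<in>{0..<A (k + n - j)}. \<bar>U (k + n - j) (F (k + n - j) x) - U (k + n - j) x - \<phi> (k + n - j) x\<bar> \<le> ?D (k + n)"
      if "j \<le> n" for j using that
    proof (induction j)
      case 0
      then show ?case using base by simp
    next
      case (Suc j)
      then have "k + n - j = Suc (k + n - Suc j)" by simp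
      then show ?case using Suc U_defect_step[of "k + n - Suc j" "?D (k + n)"] by simp
    qed
    from this[of n] show ?thesis using assms by simp
  qed
  moreover have "(\<lambda>n. ?D (k + n)) \<longlonglongrightarrow> 0"
  proof -
    have "?D \<longlonglongrightarrow> 2 * 0 + 0"
      by (intro tendsto_intros tail_0 summable_LIMSEQ_zero e_summable)
    from LIMSEQ_ignore_initial_segment[OF this, of k] show ?thesis by (simp add: add.commute)
  qed
  ultimately have "\<bar>U k (F k x) - U k x - \<phi> k x\<bar> \<le> 0"
    by (intro LIMSEQ_le_const[of _ 0]) auto
  then show ?thesis by linarith
qed

section \<open>Continuity of the transfer function\<close>

definition osc :: "real \<Rightarrow> real \<Rightarrow> bool" where
  "osc \<epsilon> x \<longleftrightarrow> (\<forall>\<epsilon>'>\<epsilon>. \<exists>\<delta>>0. \<forall>y z. \<bar>y - x\<bar> < \<delta> \<longrightarrow> \<bar>z - x\<bar> < \<delta> \<longrightarrow> \<bar>U 0 y - U 0 z\<bar> < \<epsilon>')"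

text \<open>Adding a continuous function does not raise the oscillation. The hypothesis
  \<open>nb\<close> is phrased so that it covers both ways of relating \<open>y\<close> to
  \<open>x\<close>, as an image and as a preimage.\<close>

lemma osc_transfer:
  assumes x: "osc \<epsilon> x" and c: "isCont \<psi> b"
    and nb: "\<And>\<delta>. \<delta> > 0 \<Longrightarrow> \<exists>\<eta>>0. \<forall>p. \<bar>p - y\<bar> < \<eta> \<longrightarrow> (\<exists>p' p''. \<bar>p' - x\<bar> < \<delta> \<and> \<bar>p'' - b\<bar> < \<delta> \<and> U 0 p = U 0 p' + \<psi> p'')"
  shows "osc \<epsilon> y"
  unfolding osc_def
proof (intro allI impI)
  fix \<epsilon>' assume e: "\<epsilon> < \<epsilon>'"
  then have "\<epsilon> < (\<epsilon> + \<epsilon>') / 2" by simp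
  with x obtain \<delta>1 where d1: "\<delta>1 > 0" "\<And>y z. \<bar>y - x\<bar> < \<delta>1 \<Longrightarrow> \<bar>z - x\<bar> < \<delta>1 \<Longrightarrow> \<bar>U 0 y - U 0 z\<bar> < (\<epsilon> + \<epsilon>') / 2"
    unfolding osc_def by meson
  have "0 < (\<epsilon>' - \<epsilon>) / 4" using e by simp
  from c[unfolded continuous_at_eps_delta dist_real_def, rule_format, OF this]
  obtain \<delta>2 where d2: "\<delta>2 > 0" "\<And>z. \<bar>z - b\<bar> < \<delta>2 \<Longrightarrow> \<bar>\<psi> z - \<psi> b\<bar> < (\<epsilon>' - \<epsilon>) / 4"
    by blast
  obtain \<eta> where n: "\<eta> > 0" "\<And>p. \<bar>p - y\<bar> < \<eta> \<Longrightarrow> (\<exists>p' p''. \<bar>p' - x\<bar> < min \<delta>1 \<delta>2 \<and> \<bar>p'' - b\<bar> < min \<delta>1 \<delta>2 \<and> U 0 p = U 0 p' + \<psi> p'')"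
    using nb[of "min \<delta>1 \<delta>2"] d1(1) d2(1) by auto
  show "\<exists>\<delta>>0. \<forall>p q. \<bar>p - y\<bar> < \<delta> \<longrightarrow> \<bar>q - y\<bar> < \<delta> \<longrightarrow> \<bar>U 0 p - U 0 q\<bar> < \<epsilon>'"
  proof (intro exI[of _ \<eta>] conjI allI impI n(1))
    fix p q assume "\<bar>p - y\<bar> < \<eta>" "\<bar>q - y\<bar> < \<eta>"
    then obtain p' p'' q' q'' where p: "\<bar>p' - x\<bar> < min \<delta>1 \<delta>2" "\<bar>p'' - b\<bar> < min \<delta>1 \<delta>2" "U 0 p = U 0 p' + \<psi> p''"
      and q: "\<bar>q' - x\<bar> < min \<delta>1 \<delta>2" "\<bar>q'' - b\<bar> < min \<delta>1 \<delta>2" "U 0 q = U 0 q' + \<psi> q''"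
      using n(2) by metis
    then have "\<bar>U 0 p' - U 0 q'\<bar> < (\<epsilon> + \<epsilon>') / 2" "\<bar>\<psi> p'' - \<psi> b\<bar> < (\<epsilon>' - \<epsilon>) / 4" "\<bar>\<psi> q'' - \<psi> b\<bar> < (\<epsilon>' - \<epsilon>) / 4"
      using d1(2) d2(2) by auto
    then show "\<bar>U 0 p - U 0 q\<bar> < \<epsilon>'" using p(3) q(3) by argo
  qed
qed

lemma U0_cohom: "x \<in> {0..<A k} \<Longrightarrow> U 0 (F k x) = U 0 x + \<phi> k x"
  using U_cohom[of x k] U_eq[of x k] U_eq[OF F_maps, of x k] by simp

text \<open>A removed point is one application of \<open>F k\<close> away, forwards or backwards,
  from a point inside the smaller interval. Along this move \<open>U 0\<close> changes by
  \<open>\<phi> k\<close>, which is continuous there.\<close>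

lemma osc_step:
  assumes "\<And>x. 0 < x \<Longrightarrow> x < A (Suc k) \<Longrightarrow> osc \<epsilon> x" and x: "0 < x" "x < A k"
  shows "osc \<epsilon> x"
proof (cases "x < A (Suc k)")
  case True
  then show ?thesis using assms by blast
next
  case False
  then obtain y where y: "isCont (F k) y" "isCont (\<phi> k) y" "\<And>\<delta>. \<delta>>0 \<Longrightarrow> \<exists>\<eta>>0. ball (F k y) \<eta> \<subseteq> F k ` ball y \<delta>"
    and c: "F k y = x \<and> 0 < y \<and> y < A (Suc k) \<or> y = x \<and> 0 < F k y \<and> F k y < A (Suc k)"
    using smooth[of x k] x by auto
  from c show ?thesis
  proof
    assume c: "F k y = x \<and> 0 < y \<and> y < A (Suc k)"
    show ?thesis
    proof (rule osc_transfer[where \<epsilon>=\<epsilon> and x=y and \<psi>="\<phi> k" and b=y])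
      show "osc \<epsilon> y" using assms(1) c by blast
      fix \<delta> :: real assume "\<delta> > 0"
      then have "0 < min \<delta> (min y (A (Suc k) - y))" using c by auto
      then obtain \<eta> where n: "\<eta> > 0" "ball (F k y) \<eta> \<subseteq> F k ` ball y (min \<delta> (min y (A (Suc k) - y)))" using y(3) by blast
      show "\<exists>\<eta>>0. \<forall>p. \<bar>p - x\<bar> < \<eta> \<longrightarrow> (\<exists>p' p''. \<bar>p' - y\<bar> < \<delta> \<and> \<bar>p'' - y\<bar> < \<delta> \<and> U 0 p = U 0 p' + \<phi> k p'')"
      proof (rule exI[of _ \<eta>], intro conjI allI impI n(1))
        fix p assume "\<bar>p - x\<bar> < \<eta>"
        then have "p \<in> ball (F k y) \<eta>" using c by (simp add: dist_real_def abs_minus_commute)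
        then obtain p' where p': "p = F k p'" "p' \<in> ball y (min \<delta> (min y (A (Suc k) - y)))" using n(2) by blast
        then have "\<bar>p' - y\<bar> < \<delta>" "p' \<in> {0..<A k}" using A_dec[of k] by (auto simp: dist_real_def abs_if split: if_splits)
        then show "\<exists>p' p''. \<bar>p' - y\<bar> < \<delta> \<and> \<bar>p'' - y\<bar> < \<delta> \<and> U 0 p = U 0 p' + \<phi> k p''"
          using U0_cohom p'(1) by blast
      qed
    qed (rule y(2))
  next
    assume c: "y = x \<and> 0 < F k y \<and> F k y < A (Suc k)"
    have cm: "isCont (\<lambda>z. - \<phi> k z) y" using y(2) by simp
    show ?thesis
    proof (rule osc_transfer[where \<epsilon>=\<epsilon> and x="F k y" and \<psi>="\<lambda>z. - \<phi> k z" and b=y])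
      show "osc \<epsilon> (F k y)" using assms(1) c by blast
      fix \<delta> :: real assume d: "\<delta> > 0"
      then obtain \<eta> where n: "\<eta> > 0" "\<And>p. \<bar>p - y\<bar> < \<eta> \<Longrightarrow> \<bar>F k p - F k y\<bar> < \<delta>"
        using y(1)[unfolded continuous_at_eps_delta dist_real_def, rule_format, OF d] by blast
      show "\<exists>\<eta>>0. \<forall>p. \<bar>p - x\<bar> < \<eta> \<longrightarrow> (\<exists>p' p''. \<bar>p' - F k y\<bar> < \<delta> \<and> \<bar>p'' - y\<bar> < \<delta> \<and> U 0 p = U 0 p' + - \<phi> k p'')"
      proof (rule exI[of _ "min \<eta> (min \<delta> (min x (A k - x)))"], intro conjI allI impI)
        show "0 < min \<eta> (min \<delta> (min x (A k - x)))" using n d x by simp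
        fix p assume p: "\<bar>p - x\<bar> < min \<eta> (min \<delta> (min x (A k - x)))"
        then have "p \<in> {0..<A k}" by auto
        then have "U 0 p = U 0 (F k p) + - \<phi> k p" using U0_cohom by simp
        then show "\<exists>p' p''. \<bar>p' - F k y\<bar> < \<delta> \<and> \<bar>p'' - y\<bar> < \<delta> \<and> U 0 p = U 0 p' + - \<phi> k p''"
          using p n(2)[of p] c by (intro exI[of _ "F k p"] exI[of _ p]) auto
      qed
    qed (rule cm)
  qed
qed

lemma osc_tail: assumes x: "0 < x" "x < A n" shows "osc (2 * tail n) x"
  unfolding osc_def
proof (intro allI impI exI[of _ "min x (A n - x)"] conjI)
  show "0 < min x (A n - x)" using x by simp
  fix \<epsilon>' y z assume *: "2 * tail n < \<epsilon>'" "\<bar>y - x\<bar> < min x (A n - x)" "\<bar>z - x\<bar> < min x (A n - x)"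
  then have "y \<in> {0..<A n}" "z \<in> {0..<A n}" by auto
  then have "\<bar>U 0 y\<bar> \<le> tail n" "\<bar>U 0 z\<bar> \<le> tail n" using U_bound U_eq by metis+
  then show "\<bar>U 0 y - U 0 z\<bar> < \<epsilon>'" using * by linarith
qed

text \<open>On the interval of level \<open>n\<close> the function is bounded by
  \<open>tail n\<close>, so it oscillates by at most twice that much. This bound is carried to the
  whole domain without loss, for every \<open>n\<close>.\<close>

lemma U_isCont: assumes x: "0 < x" "x < A 0" shows "isCont (U 0) x"
proof -
  have o: "osc (2 * tail n) x" for n
  proof -
    have "\<forall>x. 0 < x \<and> x < A (n - j) \<longrightarrow> osc (2 * tail n) x" if "j \<le> n" for j using that
    proof (induction j)
      case 0
      then show ?case using osc_tail by simp
    next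
      case (Suc j)
      then have "n - j = Suc (n - Suc j)" by simp
      then show ?case using Suc osc_step[of "n - Suc j" "2 * tail n"] by simp
    qed
    from this[of n] show ?thesis using x by simp
  qed
  show ?thesis unfolding continuous_at_eps_delta
  proof (intro allI impI)
    fix \<epsilon> :: real assume e: "\<epsilon> > 0"
    then have "eventually (\<lambda>n. tail n < \<epsilon> / 2) sequentially" by (intro order_tendstoD(2)[OF tail_0]) simp
    then obtain n where "tail n < \<epsilon> / 2" unfolding eventually_sequentially by blast
    then have "2 * tail n < \<epsilon>" by simp
    with o[of n] obtain \<delta> where "\<delta> > 0" "\<And>y z. \<bar>y - x\<bar> < \<delta> \<Longrightarrow> \<bar>z - x\<bar> < \<delta> \<Longrightarrow> \<bar>U 0 y - U 0 z\<bar> < \<epsilon>"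
      unfolding osc_def by meson
    then show "\<exists>d>0. \<forall>x'. dist x' x < d \<longrightarrow> dist (U 0 x') (U 0 x) < \<epsilon>"
      by (intro exI[of _ \<delta>]) (auto simp: dist_real_def)
  qed
qed

lemma U_0: "U 0 0 = 0"
proof -
  have "\<bar>U 0 0\<bar> \<le> tail n" for n using U_bound[of 0 n] U_eq[of 0 n] A_pos[of n] by auto
  then have "\<bar>U 0 0\<bar> \<le> 0" by (intro LIMSEQ_le_const[OF tail_0]) auto
  then show ?thesis by simp
qed

text \<open>The point 0 lies in every interval of the tower, so the bounds by \<open>tail n\<close>
  apply near it directly.\<close>

lemma U_right: "(U 0 \<longlongrightarrow> 0) (at_right 0)"
proof (rule tendstoI)
  fix \<epsilon> :: real assume "\<epsilon> > 0"
  then obtain n where n: "tail n < \<epsilon>" using order_tendstoD(2)[OF tail_0, of \<epsilon>] by (auto simp: eventually_sequentially)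
  show "eventually (\<lambda>x. dist (U 0 x) 0 < \<epsilon>) (at_right 0)"
    unfolding eventually_at_right[OF A_pos[of n]]
  proof (intro exI[of _ "A n"] conjI allI impI)
    fix x assume x: "0 < x" "x < A n"
    then have "\<bar>U 0 x\<bar> \<le> tail n" using U_bound[of x n] U_eq[of x n] by auto
    then show "dist (U 0 x) 0 < \<epsilon>" using n by (simp add: dist_real_def)
  qed (rule A_pos)
qed

end

section \<open>Renormalization orbits\<close>

definition path_step :: "(nat \<Rightarrow> 'a::finite iet_perm \<times> nat) \<Rightarrow> nat \<Rightarrow> real^'a^'a" where
  "path_step p n = rauzy_matrix (fst (p n)) (snd (p n))"

primrec log_slope :: "(nat \<Rightarrow> 'a::finite iet_perm \<times> nat) \<Rightarrow> real^'a \<Rightarrow> nat \<Rightarrow> real^'a" where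
  "log_slope p \<omega> 0 = \<omega>"
| "log_slope p \<omega> (Suc n) = transpose (path_step p n) *v log_slope p \<omega> n"

definition letter_of :: "'a giet \<Rightarrow> real \<Rightarrow> 'a" where
  "letter_of g x = (THE a. x \<in> gint g a)"

definition slope_defect :: "real^'a \<Rightarrow> 'a::finite giet \<Rightarrow> real \<Rightarrow> real" where
  "slope_defect \<omega> g x = ln (right_deriv (gmap g) x) - \<omega> $ letter_of g x"

lemma gint_unique:
  assumes "C1_giet g" "x \<in> gint g a" "x \<in> gint g b" shows "a = b"
proof (rule ccontr)
  assume ne: "a \<noteq> b"
  obtain A u v p q where d: "giet_data g A u v p q" using assms(1) unfolding C1_giet_def by blast
  have inj: "inj (fst (gperm g))" and o: "\<And>a b. fst (gperm g) a < fst (gperm g) b \<Longrightarrow> v a \<le> u b"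
    using d unfolding giet_data_def bij_betw_def by blast+
  have "fst (gperm g) a \<noteq> fst (gperm g) b" using inj ne by (metis injD)
  then have "v a \<le> u b \<or> v b \<le> u a" using o by (metis nat_neq_iff)
  then show False using assms(2,3) giet_dataD(1)[OF d] by auto
qed

lemma letter_of_eq: "C1_giet g \<Longrightarrow> x \<in> gint g a \<Longrightarrow> letter_of g x = a"
  unfolding letter_of_def using gint_unique by (metis the_equality)

lemma letter_of_in:
  assumes "C1_giet g" "x \<in> gdom g" shows "x \<in> gint g (letter_of g x)"
proof -
  obtain a where "x \<in> gint g a" using assms unfolding gdom_def by blast
  then show ?thesis using letter_of_eq[OF assms(1)] by metis
qed

lemma C1_branch_open:
  assumes B: "C1_branch F u v p q" and y: "u < y" "y < v" and d: "\<delta> > 0"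
  shows "\<exists>\<eta>>0. ball (F y) \<eta> \<subseteq> F ` ball y \<delta>"
proof -
  define r where "r = min (\<delta> / 2) (min ((y - u) / 2) ((v - y) / 2))"
  have r: "0 < r" "r < \<delta>" "u < y - r" "y + r < v" using y d unfolding r_def by (auto simp: min_def field_simps)
  have "F (y - r) < F y" "F y < F (y + r)" using C1_branch_strict[OF B] r by auto
  then have eta: "0 < min (F y - F (y - r)) (F (y + r) - F y)" by simp
  have "ball (F y) (min (F y - F (y - r)) (F (y + r) - F y)) \<subseteq> F ` ball y \<delta>"
  proof
    fix z assume "z \<in> ball (F y) (min (F y - F (y - r)) (F (y + r) - F y))"
    then have z: "F (y - r) \<le> z" "z \<le> F (y + r)" by (auto simp: dist_real_def abs_less_iff)
    have "\<exists>x\<ge>y - r. x \<le> y + r \<and> F x = z"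
    proof (rule IVT[of F "y - r" z "y + r", OF z])
      show "\<forall>x. y - r \<le> x \<and> x \<le> y + r \<longrightarrow> isCont F x" using C1_branch_rd_cont(2)[OF B] r by auto
    qed (use r in simp)
    then obtain x where "y - r \<le> x" "x \<le> y + r" "F x = z" by blast
    then show "z \<in> F ` ball y \<delta>" using r by (intro image_eqI[of _ _ x]) (auto simp: dist_real_def)
  qed
  then show ?thesis using eta by blast
qed

locale rv_orbit =
  fixes f :: "'a::finite giet"
  assumes f: "C1_giet f" and def: "\<And>n. rv_defined ((rv ^^ n) f)"
    and ne: "\<And>n. gtop ((rv ^^ n) f) \<noteq> gbot ((rv ^^ n) f)"
begin

abbreviation "g n \<equiv> (rv ^^ n) f"

lemma g: "C1_giet (g n)"
proof (induction n)
  case (Suc n)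
  obtain A u v p q where d: "giet_data (g n) A u v p q" using Suc unfolding C1_giet_def by blast
  interpret giet_step "g n" A u v p q using d ne def by unfold_locales
  show ?case using rv_giet(1) by simp
qed (simp add: f)

definition "ul n = lft (g n)"
definition "vl n = rgt (g n)"

lemma data_ex: "\<exists>p q. giet_data (g n) (gend (g n)) (ul n) (vl n) p q"
proof -
  obtain A u v p q where d: "giet_data (g n) A u v p q" using g unfolding C1_giet_def by blast
  have "A = gend (g n)" "u = ul n" "v = vl n" using giet_data_lft[OF d] unfolding ul_def vl_def by auto
  then show ?thesis using d by blast
qed

text \<open>Image endpoints chosen once for all levels, so that a single interpretation indexed by
  \<open>n\<close> makes the one-step lemmas available everywhere on the orbit.\<close>

definition "pl n = (SOME p. \<exists>q. giet_data (g n) (gend (g n)) (ul n) (vl n) p q)"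
definition "ql n = (SOME q. giet_data (g n) (gend (g n)) (ul n) (vl n) (pl n) q)"

lemma data: "giet_data (g n) (gend (g n)) (ul n) (vl n) (pl n) (ql n)"
  unfolding ql_def pl_def using someI_ex[OF someI_ex[OF data_ex[of n]]] .

sublocale step: giet_step "g n" "gend (g n)" "ul n" "vl n" "pl n" "ql n" for n
  using data ne def by unfold_locales

abbreviation "W n \<equiv> winner (state (g n))"
abbreviation "L n \<equiv> loser (state (g n))"

lemma gdom_g: "gdom (g n) = {0..<gend (g n)}" by (rule step.dom)

lemma rot: "rot_number f n = state (g n)" unfolding rot_number_def state_def ..

lemma rm_rot: "path_step (rot_number f) n = rauzy_matrix (gperm (g n)) (rv_type (g n))"
  unfolding path_step_def rot_number_def by simp

lemma log_slope_Suc: "log_slope (rot_number f) \<omega> (Suc n) $ a = log_slope (rot_number f) \<omega> n $ a +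
   (if a = L n then log_slope (rot_number f) \<omega> n $ W n else 0)"
  unfolding log_slope.simps rm_rot rauzy_matrix_transpose_mult state_def ..

lemma slope_defect_one:
  assumes "x \<in> gdom (g (Suc n))" "x \<notin> gint (g (Suc n)) (L n)"
  shows "gmap (g (Suc n)) x = gmap (g n) x"
    "slope_defect (log_slope (rot_number f) \<omega> (Suc n)) (g (Suc n)) x = slope_defect (log_slope (rot_number f) \<omega> n) (g n) x"
    "letter_of (g (Suc n)) x = letter_of (g n) x"
proof -
  let ?a = "letter_of (g (Suc n)) x"
  have a: "x \<in> gint (g (Suc n)) ?a" using letter_of_in[OF g] assms(1) by blast
  then have al: "?a \<noteq> L n" using assms(2) by metis
  have rvn: "g (Suc n) = rv (g n)" by simp
  note o = step.rv_other[OF al, folded rvn]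
  show "gmap (g (Suc n)) x = gmap (g n) x" using o(2)[OF a] .
  have "x \<in> gint (g n) ?a" using o(1) a by blast
  then show l: "?a = letter_of (g n) x" using letter_of_eq[OF g] by metis
  show "slope_defect (log_slope (rot_number f) \<omega> (Suc n)) (g (Suc n)) x = slope_defect (log_slope (rot_number f) \<omega> n) (g n) x"
    unfolding slope_defect_def log_slope_Suc o(3)[OF a] using al l by simp
qed

text \<open>The chain rule on one side and the transposed Rauzy matrix on the other add the same two
  terms, those of the loser and of the winner.\<close>

lemma slope_defect_two:
  assumes x: "x \<in> gint (g (Suc n)) (L n)"
  shows "gmap (g (Suc n)) x = gmap (g n) (gmap (g n) x)"
    "slope_defect (log_slope (rot_number f) \<omega> (Suc n)) (g (Suc n)) x = slope_defect (log_slope (rot_number f) \<omega> n) (g n) x + slope_defect (log_slope (rot_number f) \<omega> n) (g n) (gmap (g n) x)"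
    "{letter_of (g n) x, letter_of (g n) (gmap (g n) x)} = {L n, W n}" "x \<in> gdom (g n)" "gmap (g n) x \<in> gdom (g n)"
proof -
  have rvn: "g (Suc n) = rv (g n)" by simp
  obtain b b' where b: "b \<in> {L n, W n}" "b' \<in> {L n, W n}" "b \<noteq> b'" "gint (g (Suc n)) (L n) \<subseteq> gint (g n) b"
      "gmap (g n) ` gint (g (Suc n)) (L n) \<subseteq> gint (g n) b'"
      and e: "gmap (g (Suc n)) x = gmap (g n) (gmap (g n) x)" "right_deriv (gmap (g (Suc n))) x = right_deriv (gmap (g n)) (gmap (g n) x) * right_deriv (gmap (g n)) x"
    using step.rv_loser(2)[of n, folded rvn] x by blast
  show "gmap (g (Suc n)) x = gmap (g n) (gmap (g n) x)" by (rule e)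
  have xb: "x \<in> gint (g n) b" "gmap (g n) x \<in> gint (g n) b'" using x b by blast+
  then have l: "letter_of (g n) x = b" "letter_of (g n) (gmap (g n) x) = b'" using letter_of_eq[OF g] by blast+
  then show "{letter_of (g n) x, letter_of (g n) (gmap (g n) x)} = {L n, W n}" using b(1,2,3) by auto
  show "x \<in> gdom (g n)" "gmap (g n) x \<in> gdom (g n)" using xb unfolding gdom_def by blast+
  have "0 < right_deriv (gmap (g n)) x" "0 < right_deriv (gmap (g n)) (gmap (g n) x)"
    using C1_branch_rd_pos[OF step.br[of n b]] C1_branch_rd_pos[OF step.br[of n b']] xb step.gint_eq[of n b] step.gint_eq[of n b'] by auto
  then have "ln (right_deriv (gmap (g (Suc n))) x) = ln (right_deriv (gmap (g n)) x) + ln (right_deriv (gmap (g n)) (gmap (g n) x))"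
    unfolding e(2) by (simp add: ln_mult)
  moreover have "letter_of (g (Suc n)) x = L n" using letter_of_eq[OF g x] .
  moreover have "log_slope (rot_number f) \<omega> n $ b + log_slope (rot_number f) \<omega> n $ b' = log_slope (rot_number f) \<omega> (Suc n) $ L n"
    unfolding log_slope_Suc using b(1,2,3) by auto
  ultimately show "slope_defect (log_slope (rot_number f) \<omega> (Suc n)) (g (Suc n)) x = slope_defect (log_slope (rot_number f) \<omega> n) (g n) x + slope_defect (log_slope (rot_number f) \<omega> n) (g n) (gmap (g n) x)"
    unfolding slope_defect_def l by simp
qed

lemma isCont_ldiff:
  assumes "ul n a < y" "y < vl n a"
  shows "isCont (gmap (g n)) y" "isCont (slope_defect \<omega> (g n)) y"
proof -
  note c = C1_branch_rd_cont[OF step.br[of n a] assms]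
  show "isCont (gmap (g n)) y" by (rule c)
  have pos: "0 < right_deriv (gmap (g n)) y" using C1_branch_rd_pos[OF step.br[of n a]] assms by simp
  have "isCont (\<lambda>x. ln (right_deriv (gmap (g n)) x) - \<omega> $ a) y"
    using c pos by (intro continuous_intros) auto
  moreover have "eventually (\<lambda>x. slope_defect \<omega> (g n) x = ln (right_deriv (gmap (g n)) x) - \<omega> $ a) (nhds y)"
  proof -
    have "eventually (\<lambda>x. x \<in> {ul n a<..<vl n a}) (nhds y)"
      using assms by (intro eventually_nhds_in_open) auto
    then show ?thesis
    proof eventually_elim
      case (elim x)
      then have "x \<in> gint (g n) a" using step.gint_eq[of n a] by auto
      then show ?case unfolding slope_defect_def using letter_of_eq[OF g] by metis
    qed
  qed
  ultimately show "isCont (slope_defect \<omega> (g n)) y" using isCont_cong by metis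
qed

lemma inj_gmap: "inj_on (gmap (g n)) {0..<gend (g n)}"
proof (rule inj_onI)
  fix x y assume xy: "x \<in> {0..<gend (g n)}" "y \<in> {0..<gend (g n)}" "gmap (g n) x = gmap (g n) y"
  have i: "x \<in> gint (g n) (letter_of (g n) x)" "y \<in> gint (g n) (letter_of (g n) y)" using letter_of_in[OF g] xy gdom_g by blast+
  have m: "gmap (g n) z \<in> {pl n a..<ql n a}" if "z \<in> gint (g n) a" for z a using step.im that by blast
  have "letter_of (g n) x = letter_of (g n) y"
  proof (rule ccontr)
    assume "letter_of (g n) x \<noteq> letter_of (g n) y"
    from step.disj1[OF this, of n] show False using m[OF i(1)] m[OF i(2)] xy(3) by auto
  qed
  then have "x \<in> {ul n (letter_of (g n) x)..<vl n (letter_of (g n) x)}" "y \<in> {ul n (letter_of (g n) x)..<vl n (letter_of (g n) x)}"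
    using i step.gint_eq[of n "letter_of (g n) x"] by (simp_all del: step.gint_eq)
  then show "x = y" using C1_branch_strict[OF step.br[of n "letter_of (g n) x"], of x y]
      C1_branch_strict[OF step.br[of n "letter_of (g n) x"], of y x] xy(3) by fastforce
qed

lemma tower:
  assumes "\<And>n x. x \<in> gdom (g n) \<Longrightarrow> \<bar>slope_defect (log_slope (rot_number f) \<omega> n) (g n) x\<bar> \<le> e n" "summable e"
  shows "induced_tower (\<lambda>n. gend (g n)) (\<lambda>n. gmap (g n)) (\<lambda>n. slope_defect (log_slope (rot_number f) \<omega> n) (g n)) (\<lambda>n. gint (g (Suc n)) (L n)) e"
proof
  fix n x
  have rvn: "g (Suc n) = rv (g n)" for n by simp
  show "0 < gend (g n)" by (rule step.A_pos)
  show "gend (g (Suc n)) < gend (g n)" using step.rv_giet(4)[of n] by simp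
  show "x \<in> {0..<gend (g n)} \<Longrightarrow> gmap (g n) x \<in> {0..<gend (g n)}" by (rule step.map_le)
  show "inj_on (gmap (g n)) {0..<gend (g n)}" by (rule inj_gmap)
  show "gint (g (Suc n)) (L n) \<subseteq> {0..<gend (g (Suc n))}" using gdom_g[of "Suc n"] unfolding gdom_def by blast
  show "gmap (g n) ` gint (g (Suc n)) (L n) = {gend (g (Suc n))..<gend (g n)}" using step.rv_loser(1)[of n] by simp
  show "x \<in> {0..<gend (g n)} \<Longrightarrow> \<bar>slope_defect (log_slope (rot_number f) \<omega> n) (g n) x\<bar> \<le> e n" using assms(1) gdom_g by blast
  show "summable e" by (rule assms(2))
  show "x \<in> {0..<gend (g (Suc n))} - gint (g (Suc n)) (L n) \<Longrightarrow>
     gmap (g (Suc n)) x = gmap (g n) x \<and> slope_defect (log_slope (rot_number f) \<omega> (Suc n)) (g (Suc n)) x = slope_defect (log_slope (rot_number f) \<omega> n) (g n) x"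
    using slope_defect_one[of x n] gdom_g[of "Suc n"] by blast
  show "x \<in> gint (g (Suc n)) (L n) \<Longrightarrow> gmap (g (Suc n)) x = gmap (g n) (gmap (g n) x) \<and>
     slope_defect (log_slope (rot_number f) \<omega> (Suc n)) (g (Suc n)) x = slope_defect (log_slope (rot_number f) \<omega> n) (g n) x + slope_defect (log_slope (rot_number f) \<omega> n) (g n) (gmap (g n) x)"
    using slope_defect_two[of x n] by blast
  fix z assume z: "z \<in> {gend (g (Suc n))..<gend (g n)}"
  obtain y a where y: "ul n a < y" "y < vl n a" and yz: "gmap (g n) y = z \<and> 0 < y \<and> y < gend (g (Suc n)) \<or> y = z \<and> 0 < gmap (g n) y \<and> gmap (g n) y < gend (g (Suc n))"
    using step.rv_interior[of n z, folded rvn] z by auto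
  show "\<exists>y. isCont (gmap (g n)) y \<and> isCont (slope_defect (log_slope (rot_number f) \<omega> n) (g n)) y \<and>
       (\<forall>\<delta>>0. \<exists>\<eta>>0. ball (gmap (g n) y) \<eta> \<subseteq> gmap (g n) ` ball y \<delta>) \<and>
       (gmap (g n) y = z \<and> 0 < y \<and> y < gend (g (Suc n)) \<or> y = z \<and> 0 < gmap (g n) y \<and> gmap (g n) y < gend (g (Suc n)))"
    using isCont_ldiff[OF y] C1_branch_open[OF step.br[of n a] y] yz by blast
qed

text \<open>At the right end of the domain, continuity is pulled back along the bottom-last branch.\<close>

lemma transfer_function:
  assumes "\<And>n x. x \<in> gdom (g n) \<Longrightarrow> \<bar>slope_defect (log_slope (rot_number f) \<omega> n) (g n) x\<bar> \<le> e n" "summable e"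
  obtains u where "continuous_on {0..gend f} u"
    "\<And>x. x \<in> gdom f \<Longrightarrow> u (gmap f x) = u x + ln (right_deriv (gmap f) x) - \<omega> $ letter_of f x"
proof -
  let ?\<phi> = "\<lambda>n. slope_defect (log_slope (rot_number f) \<omega> n) (g n)"
  interpret T: induced_tower "\<lambda>n. gend (g n)" "\<lambda>n. gmap (g n)" ?\<phi> "\<lambda>n. gint (g (Suc n)) (L n)" e
    by (rule tower[OF assms])
  define U where "U = T.U 0"
  let ?A = "gend f"
  have A: "0 < ?A" using step.A_pos[of 0] by simp
  have coh: "U (gmap f x) = U x + ?\<phi> 0 x" if "x \<in> gdom f" for x
    using T.U0_cohom[of x 0] that gdom_g[of 0] unfolding U_def by simp
  have cont: "isCont U x" if "0 < x" "x < ?A" for x using T.U_isCont[of x] that unfolding U_def by simp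
  let ?c = "gbot f"
  have uvc: "ul 0 ?c < vl 0 ?c" "0 \<le> ul 0 ?c" using step.uv[of 0 ?c] step.indom[of 0 ?c] by auto
  have "vl 0 ?c \<le> ul 0 (gtop f)" using step.ord0[of 0 ?c "gtop f"] step.top_last[of ?c 0] ne[of 0] by simp
  then have vc: "0 < vl 0 ?c" "vl 0 ?c < ?A" using uvc step.uv[of 0 "gtop f"] step.v_top[of 0] by auto
  obtain G D where GD: "C1_ext (gmap f) (ul 0 ?c) (vl 0 ?c) (pl 0 ?c) (ql 0 ?c) G D"
    using step.br[of 0 ?c] unfolding C1_branch_def by auto
  have q: "ql 0 ?c = ?A" using step.q_bot[of 0] by simp
  \<comment> \<open>The value of \<open>U\<close> at the image point, written with the extended
    derivative \<open>D\<close> so that it makes sense at the right end of the bottom-last interval.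
    That end lies below \<open>?A\<close>, where \<open>U\<close> is already known to be
    continuous.\<close>
  define \<psi> where "\<psi> x = U x + ln (D x) - \<omega> $ ?c" for x
  have v_in: "vl 0 ?c \<in> {ul 0 ?c..vl 0 ?c}" using uvc by auto
  have lim: "(\<psi> \<longlongrightarrow> \<psi> (vl 0 ?c)) (at_left (vl 0 ?c))"
  proof -
    have Dl: "(D \<longlongrightarrow> D (vl 0 ?c)) (at_left (vl 0 ?c))"
    proof -
      have "(D \<longlongrightarrow> D (vl 0 ?c)) (at (vl 0 ?c) within {ul 0 ?c..vl 0 ?c})"
        using GD v_in unfolding C1_ext_def continuous_on_def by blast
      then show ?thesis using at_within_Icc_at_left[OF uvc(1)] by simp
    qed
    have Dp: "D (vl 0 ?c) > 0" using GD v_in unfolding C1_ext_def by blast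
    have "(U \<longlongrightarrow> U (vl 0 ?c)) (at_left (vl 0 ?c))"
      using cont[OF vc] unfolding isCont_def by (rule filterlim_mono) (auto simp: at_le)
    then show ?thesis unfolding \<psi>_def by (intro tendsto_intros Dl) (use Dp in auto)
  qed
  have Ulim: "(U \<longlongrightarrow> \<psi> (vl 0 ?c)) (at_left ?A)"
  proof (rule tendstoI)
    fix \<epsilon> :: real assume "\<epsilon> > 0"
    then have "eventually (\<lambda>x. dist (\<psi> x) (\<psi> (vl 0 ?c)) < \<epsilon>) (at_left (vl 0 ?c))" using lim tendstoD by blast
    then obtain b where b: "b < vl 0 ?c" "\<And>x. b < x \<Longrightarrow> x < vl 0 ?c \<Longrightarrow> dist (\<psi> x) (\<psi> (vl 0 ?c)) < \<epsilon>"
      unfolding eventually_at_left[OF uvc(1)] by blast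
    define b' where "b' = (max b (ul 0 ?c) + vl 0 ?c) / 2"
    have b': "b < b'" "ul 0 ?c < b'" "b' < vl 0 ?c" using b(1) uvc unfolding b'_def by (auto simp: max_def field_simps)
    have br2: "C1_branch (gmap f) b' (vl 0 ?c) (gmap f b') ?A"
      using C1_branch_split(2)[OF step.br[of 0 ?c] b'(2,3)] q by simp
    show "eventually (\<lambda>z. dist (U z) (\<psi> (vl 0 ?c)) < \<epsilon>) (at_left ?A)"
      unfolding eventually_at_left[OF A]
    proof (intro exI[of _ "gmap f b'"] conjI allI impI)
      show "gmap f b' < ?A" using C1_branch_image(2)[OF br2] .
      fix z assume z: "gmap f b' < z" "z < ?A"
      then have "z \<in> gmap f ` {b'..<vl 0 ?c}" using C1_branch_image(1)[OF br2] by auto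
      then obtain x where x: "b' \<le> x" "x < vl 0 ?c" "z = gmap f x" by auto
      have xi: "x \<in> gint f ?c" using step.gint_eq[of 0 ?c] x b' by simp
      then have "x \<in> gdom f" unfolding gdom_def by blast
      have "right_deriv (gmap f) x = D x" using C1_ext_rd[OF GD] x b' by simp
      then have "U z = \<psi> x" using coh[OF \<open>x \<in> gdom f\<close>] x letter_of_eq[OF f xi] unfolding slope_defect_def \<psi>_def by simp
      then show "dist (U z) (\<psi> (vl 0 ?c)) < \<epsilon>" using b(2)[of x] x b' by simp
    qed
  qed
  \<comment> \<open>The cohomological equation does not involve the point \<open>?A\<close>; there
    \<open>U\<close> is replaced by its limit from the left.\<close>
  define V where "V x = (if x = ?A then \<psi> (vl 0 ?c) else U x)" for x
  have "continuous_on {0..?A} V"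
  proof (rule continuous_on_IccI[OF _ _ _ A])
    have evA: "eventually (\<lambda>x. V x = U x) (at_left ?A)"
      unfolding eventually_at_left[OF A] V_def by (intro exI[of _ 0]) (use A in auto)
    show "(V \<longlongrightarrow> V ?A) (at_left ?A)" using Ulim evA tendsto_cong unfolding V_def by fastforce
    have ev0: "eventually (\<lambda>x. V x = U x) (at_right 0)"
      unfolding eventually_at_right[OF A] V_def by (intro exI[of _ ?A]) (use A in auto)
    have "V 0 = 0" using T.U_0 A unfolding V_def U_def by simp
    then show "(V \<longlongrightarrow> V 0) (at_right 0)" using T.U_right ev0 tendsto_cong[OF ev0] unfolding U_def by simp
    fix x assume x: "0 < x" "x < ?A"
    have "eventually (\<lambda>y. y \<in> {0<..<?A}) (nhds x)" using x by (intro eventually_nhds_in_open) auto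
    then have "eventually (\<lambda>y. V y = U y) (nhds x)" by eventually_elim (auto simp: V_def)
    then have "isCont V x" using cont[OF x] isCont_cong by metis
    then show "V \<midarrow>x\<rightarrow> V x" unfolding isCont_def .
  qed
  moreover have "V (gmap f x) = V x + ln (right_deriv (gmap f) x) - \<omega> $ letter_of f x" if x: "x \<in> gdom f" for x
  proof -
    have "x < ?A" "gmap f x < ?A" using step.map_le[of x 0] x gdom_g[of 0] by auto
    then show ?thesis using coh[OF x] unfolding V_def slope_defect_def by simp
  qed
  ultimately show ?thesis using that by blast
qed

end

lemma C1_extI_self:
  assumes "u < v" "\<And>x. x \<in> {u..v} \<Longrightarrow> (G has_real_derivative D x) (at x within {u..v})"
    "\<And>x. x \<in> {u..v} \<Longrightarrow> 0 < D x" "continuous_on {u..v} D"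
  shows "C1_ext G u v (G u) (G v) G D"
  using assms unfolding C1_ext_def by auto

lemma C1_ext_DERIV:
  assumes "C1_ext F u v p q G D" "u < z" "z < v"
  shows "(G has_real_derivative D z) (at z)" "0 < D z"
proof -
  have "z \<in> {u..v}" "z \<in> interior {u..v}" using assms by auto
  then show "(G has_real_derivative D z) (at z)" "0 < D z"
    using assms(1) at_within_interior[of z "{u..v}"] unfolding C1_ext_def by metis+
qed

context rv_orbit
begin

lemma scale_function:
  assumes "\<And>n x. x \<in> gdom (g n) \<Longrightarrow> \<bar>slope_defect (log_slope (rot_number f) \<omega> n) (g n) x\<bar> \<le> e n" "summable e"
  obtains H D where "C1_ext H 0 (gend f) 0 1 H D" "scales H \<omega> f"
proof -
  obtain u where u: "continuous_on {0..gend f} u"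
    "\<And>x. x \<in> gdom f \<Longrightarrow> u (gmap f x) = u x + ln (right_deriv (gmap f) x) - \<omega> $ letter_of f x"
    using transfer_function[OF assms] by blast
  let ?A = "gend f"
  have A: "0 < ?A" using step.A_pos[of 0] by simp
  define D0 where "D0 x = exp (- u x)" for x
  define K where "K x = integral {0..x} D0" for x
  have cD: "continuous_on {0..?A} D0" unfolding D0_def by (intro continuous_intros u)
  have dK: "(K has_real_derivative D0 x) (at x within {0..?A})" if "x \<in> {0..?A}" for x
    unfolding K_def using integral_has_real_derivative[OF cD that] .
  have K: "C1_ext K 0 ?A (K 0) (K ?A) K D0"
    by (rule C1_extI_self[OF A dK _ cD]) (auto simp: D0_def)
  have K0: "K 0 = 0" unfolding K_def by simp
  define I where "I = K ?A"
  have I: "0 < I" using C1_ext_strict[OF K, of 0 ?A] A K0 unfolding I_def by simp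
  define H where "H x = K x / I" for x
  define D where "D x = D0 x / I" for x
  have dH: "(H has_real_derivative D x) (at x within {0..?A})" if "x \<in> {0..?A}" for x
    unfolding H_def D_def using DERIV_cdivide[OF dK[OF that]] .
  have "C1_ext H 0 ?A (H 0) (H ?A) H D"
    by (rule C1_extI_self[OF A dH]) (use I in \<open>auto simp: D_def D0_def[abs_def] intro!: continuous_intros u\<close>)
  moreover have "H 0 = 0" "H ?A = 1" using K0 I unfolding H_def I_def by auto
  ultimately have CH: "C1_ext H 0 ?A 0 1 H D" by simp
  have const: "H (gmap f y) - exp (\<omega> $ a) * H y = H (gmap f x) - exp (\<omega> $ a) * H x"
    if xy: "x < y" "x \<in> gint f a" "y \<in> gint f a" for x y a
  proof (rule DERIV_isconst_end[OF xy(1)])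
    have i: "ul 0 a \<le> x" "y < vl 0 a" using xy step.gint_eq[of 0 a] by auto
    have sub: "{x..y} \<subseteq> gint f a"
    proof
      fix z assume "z \<in> {x..y}"
      then show "z \<in> gint f a" using i step.gint_eq[of 0 a] by simp
    qed
    have "gint f a \<subseteq> gdom f" unfolding gdom_def by blast
    then have subd: "{x..y} \<subseteq> {0..<?A}" using gdom_g[of 0] sub by simp
    have img: "gmap f ` {x..y} \<subseteq> {0..?A}" using subd step.map_le[of _ 0] by fastforce
    obtain G DG where GD: "C1_ext (gmap f) (ul 0 a) (vl 0 a) (pl 0 a) (ql 0 a) G DG"
      using step.br[of 0 a] unfolding C1_branch_def by auto
    have "continuous_on {x..y} G" by (rule continuous_on_subset[OF C1_ext_cont[OF GD]]) (use i in auto)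
    moreover have "\<And>z. z \<in> {x..y} \<Longrightarrow> gmap f z = G z" using GD i unfolding C1_ext_def by auto
    ultimately have cf: "continuous_on {x..y} (gmap f)" using continuous_on_cong by metis
    have "continuous_on {x..y} (\<lambda>z. H (gmap f z))"
      using continuous_on_compose[OF cf continuous_on_subset[OF C1_ext_cont[OF CH] img]] by (simp add: o_def)
    moreover have "continuous_on {x..y} H"
      by (rule continuous_on_subset[OF C1_ext_cont[OF CH]]) (use subd in force)
    ultimately show "continuous_on {x..y} (\<lambda>z. H (gmap f z) - exp (\<omega> $ a) * H z)"
      by (intro continuous_on_diff continuous_on_mult continuous_on_const)
    fix z assume z: "x < z" "z < y"
    have zi: "z \<in> gint f a" using z sub by auto
    have zd: "z \<in> gdom f" using zi unfolding gdom_def by blast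
    have "x \<in> {x..y}" "z \<in> {x..y}" using z by auto
    then have "x \<in> {0..<?A}" "z \<in> {0..<?A}" using subd by blast+
    then have z0: "0 < z" "z < ?A" using z by auto
    have fz: "0 < gmap f z" "gmap f z < ?A"
      using C1_branch_bounds_strict[OF step.br[of 0 a], of z] i z step.indom[of 0 a] step.map_le[of z 0] zd gdom_g[of 0] by auto
    note dHat = C1_ext_DERIV(1)[OF CH]
    have dz: "(G has_real_derivative DG z) (at z)" and pos: "0 < DG z"
      using C1_ext_DERIV[OF GD, of z] i z by simp_all
    have "eventually (\<lambda>t. t \<in> {x<..<y}) (nhds z)" using z by (intro eventually_nhds_in_open) auto
    then have ev: "eventually (\<lambda>t. gmap f t = G t) (nhds z)"
      by eventually_elim (use GD i in \<open>auto simp: C1_ext_def\<close>)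
    then have df: "(gmap f has_real_derivative DG z) (at z)"
      using dz DERIV_cong_ev[of z z "gmap f" G "DG z" "DG z"] by simp
    have rdz: "right_deriv (gmap f) z = DG z" using C1_ext_rd[OF GD] i z by simp
    have "u (gmap f z) = u z + ln (DG z) - \<omega> $ a" using u(2)[OF zd] letter_of_eq[OF f zi] rdz by simp
    then have "- u (gmap f z) = \<omega> $ a + (- u z + - ln (DG z))" by simp
    then have "exp (- u (gmap f z)) = exp (\<omega> $ a) * (exp (- u z) * exp (- ln (DG z)))" by (simp only: exp_add)
    moreover have "exp (- ln (DG z)) * DG z = 1" using pos by (simp add: exp_minus)
    ultimately have "exp (- u (gmap f z)) * DG z = exp (\<omega> $ a) * exp (- u z)" by (metis mult.assoc mult.right_neutral)
    then have "D (gmap f z) * DG z = exp (\<omega> $ a) * D z" unfolding D_def D0_def by (simp add: field_simps)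
    moreover have "((\<lambda>t. H (gmap f t) - exp (\<omega> $ a) * H t) has_real_derivative D (gmap f z) * DG z - exp (\<omega> $ a) * D z) (at z)"
      by (intro DERIV_diff DERIV_cmult DERIV_chain2[OF dHat[OF fz] df] dHat[OF z0])
    ultimately show "((\<lambda>t. H (gmap f t) - exp (\<omega> $ a) * H t) has_real_derivative 0) (at z)" by simp
  qed
  have "scales H \<omega> f"
    unfolding scales_def
  proof (intro allI ballI)
    fix a x y assume "x \<in> gint f a" "y \<in> gint f a"
    then have "H (gmap f y) - exp (\<omega> $ a) * H y = H (gmap f x) - exp (\<omega> $ a) * H x"
      using const[of x y a] const[of y x a] by (cases x y rule: linorder_cases) auto
    then show "H (gmap f y) - H (gmap f x) = exp (\<omega> $ a) * (H y - H x)" by (simp add: algebra_simps)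
  qed
  then show ?thesis using CH that by blast
qed

end

text \<open>The recursion satisfied by the interval lengths of an affine map with log-slope vector
  \<open>\<omega>\<close>, whose combinatorics follow the Rauzy-Veech path \<open>p\<close>.\<close>

definition length_rec :: "(nat \<Rightarrow> 'a::finite iet_perm \<times> nat) \<Rightarrow> real^'a \<Rightarrow> (nat \<Rightarrow> real^'a) \<Rightarrow> bool" where
  "length_rec p \<omega> s \<longleftrightarrow> (\<forall>n.
     (\<forall>a. a \<noteq> winner (p n) \<longrightarrow> a \<noteq> loser (p n) \<longrightarrow> s n $ a = s (Suc n) $ a) \<and>
     s n $ loser (p n) = (if snd (p n) = 0 then 1 else exp (log_slope p \<omega> n $ winner (p n))) * s (Suc n) $ loser (p n) \<and>
     s n $ winner (p n) = s (Suc n) $ winner (p n) +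
        (if snd (p n) = 0 then exp (log_slope p \<omega> n $ loser (p n)) else 1) * s (Suc n) $ loser (p n))"

context rv_orbit
begin

lemma scales_all:
  assumes "scales H \<omega> f" shows "scales H (log_slope (rot_number f) \<omega> n) (g n)"
proof (induction n)
  case (Suc n)
  then show ?case using step.rv_scales[OF Suc] by (simp add: rm_rot)
qed (simp add: assms)

lemma gend_le: "gend (g n) \<le> gend f"
proof (induction n)
  case (Suc n)
  then show ?case using step.rv_giet(4)[of n] by simp
qed simp

lemma scales_wrec:
  assumes rescale: "scales H \<omega> f" and H: "continuous_on {0..gend f} H"
  shows "length_rec (rot_number f) \<omega> (\<lambda>n. \<chi> a. Hlen H (g n) a)"
proof -
  have "continuous_on {0..gend (g n)} H" for n
    by (rule continuous_on_subset[OF H]) (use gend_le[of n] in auto)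
  note h = step.rv_Hlen[OF scales_all[OF rescale] this, folded rot]
  have s: "snd (rot_number f n) = rv_type (g n)" for n unfolding rot_number_def by simp
  have rvn: "rv (g n) = g (Suc n)" for n by simp
  show ?thesis unfolding length_rec_def vec_lambda_beta s
  proof (intro allI conjI impI)
    fix n a
    show "a \<noteq> winner (rot_number f n) \<Longrightarrow> a \<noteq> loser (rot_number f n) \<Longrightarrow> Hlen H (g n) a = Hlen H (g (Suc n)) a"
      using h(1)[of a n] unfolding rvn by blast
    show "Hlen H (g n) (loser (rot_number f n)) = (if rv_type (g n) = 0 then 1 else exp (log_slope (rot_number f) \<omega> n $ winner (rot_number f n))) *
      Hlen H (g (Suc n)) (loser (rot_number f n))"
      using h(2,4)[of n] step.type_iff(2)[of n] unfolding rvn by auto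
    show "Hlen H (g n) (winner (rot_number f n)) = Hlen H (g (Suc n)) (winner (rot_number f n)) +
      (if rv_type (g n) = 0 then exp (log_slope (rot_number f) \<omega> n $ loser (rot_number f n)) else 1) * Hlen H (g (Suc n)) (loser (rot_number f n))"
      using h(3,5)[of n] step.type_iff(2)[of n] unfolding rvn by auto
  qed
qed

lemma Hlen_pos:
  assumes "C1_ext H 0 (gend f) q r H D" shows "0 < Hlen H (g n) a"
proof -
  have "lft (g n) a = ul n a" "rgt (g n) a = vl n a" unfolding ul_def vl_def by auto
  moreover have "H (ul n a) < H (vl n a)"
    using C1_ext_strict[OF assms, of "ul n a" "vl n a"] step.uv[of n a] step.indom[of n a] gend_le[of n] by simp
  ultimately show ?thesis unfolding Hlen_def by simp
qed

end

section \<open>Perron-Frobenius contraction for the length recursion\<close>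

abbreviation path_prod :: "(nat \<Rightarrow> 'a::finite iet_perm \<times> nat) \<Rightarrow> nat \<Rightarrow> nat \<Rightarrow> real^'a^'a" where
  "path_prod p n k \<equiv> mat_prod (\<lambda>i. path_step p (n + i)) k"

text \<open>Products of Rauzy matrices have non-negative integer entries, so an entry is positive
  exactly when it is at least 1, and this form is quantitative.\<close>

definition posblock :: "(nat \<Rightarrow> 'a::finite iet_perm \<times> nat) \<Rightarrow> nat \<Rightarrow> nat \<Rightarrow> bool" where
  "posblock p n k \<longleftrightarrow> (\<forall>a b. 1 \<le> path_prod p n k $ a $ b)"

lemma rm_mult: "(path_step p n *v s) $ a = s $ a + (if a = winner (p n) then s $ loser (p n) else 0)"
  unfolding path_step_def by (simp add: rauzy_matrix_mult)

lemma rauzy_matrix_entry: "rauzy_matrix \<pi> e $ i $ j = (if i = j then 1 else 0) +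
  (if i = winner (\<pi>, e) \<and> j = loser (\<pi>, e) then 1 else 0)"
  unfolding rauzy_matrix_def winner_def loser_def by (simp add: mat_def)

lemma matrix_mult_rm: "(M ** path_step p n) $ a $ b = M $ a $ b + (if b = loser (p n) then M $ a $ winner (p n) else 0)"
proof -
  have "(M ** path_step p n) $ a $ b = (\<Sum>k\<in>UNIV. (if k = b then M $ a $ k else 0)) +
     (\<Sum>k\<in>UNIV. if k = winner (p n) \<and> b = loser (p n) then M $ a $ k else 0)"
    unfolding matrix_matrix_mult_def path_step_def
    by (simp add: rauzy_matrix_entry distrib_left if_distrib[of "\<lambda>x. _ * x"] sum.distrib cong: if_cong)
  then show ?thesis by auto
qed

lemma path_prod_bounds: "0 \<le> path_prod p n k $ a $ b" "path_prod p n k $ a $ b \<le> 2 ^ k"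
proof -
  have "0 \<le> path_prod p n k $ a $ b \<and> path_prod p n k $ a $ b \<le> 2 ^ k" for a b
  proof (induction k arbitrary: b)
    case 0
    then show ?case by (simp add: mat_def)
  next
    case (Suc k)
    have "0 \<le> path_prod p n k $ a $ b \<and> path_prod p n k $ a $ b \<le> 2 ^ k"
      "0 \<le> path_prod p n k $ a $ winner (p (n + k)) \<and> path_prod p n k $ a $ winner (p (n + k)) \<le> 2 ^ k"
      using Suc by blast+
    then show ?case unfolding mat_prod.simps matrix_mult_rm by auto
  qed
  then show "0 \<le> path_prod p n k $ a $ b" "path_prod p n k $ a $ b \<le> 2 ^ k" by blast+
qed

text \<open>The recursion is the Rauzy matrix with one entry multiplied by a slope. When the
  logarithms of the slopes are bounded by \<open>m\<close>, it differs from the matrix by factors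
  between \<open>exp (- m)\<close> and \<open>exp m\<close>.\<close>

lemma length_rec_step_bounds:
  assumes w: "length_rec p \<omega> s" and ne: "winner (p n) \<noteq> loser (p n)" and pos: "\<And>a. 0 \<le> s (Suc n) $ a"
    and m: "\<And>a. \<bar>log_slope p \<omega> n $ a\<bar> \<le> m"
  shows "exp (- m) * (path_step p n *v s (Suc n)) $ a \<le> s n $ a" "s n $ a \<le> exp m * (path_step p n *v s (Suc n)) $ a"
    "0 \<le> s n $ a"
proof -
  have m0: "0 \<le> m" using m[of a] by linarith
  have e: "exp (- m) \<le> exp (log_slope p \<omega> n $ a)" "exp (log_slope p \<omega> n $ a) \<le> exp m" "exp (-m) \<le> 1" "1 \<le> exp m" for a
    using m[of a] m0 by auto
  have le: "exp (-m) * x \<le> x" "x \<le> exp m * x" if "0 \<le> x" for x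
    using e(3,4) that mult_right_mono[of "exp (-m)" 1 x] mult_right_mono[of 1 "exp m" x] by auto
  have le2: "exp (-m) * x \<le> exp (log_slope p \<omega> n $ a) * x" "exp (log_slope p \<omega> n $ a) * x \<le> exp m * x" if "0 \<le> x" for x a
    using e(1,2)[of a] that by (auto intro: mult_right_mono)
  have rec: "a \<noteq> winner (p n) \<Longrightarrow> a \<noteq> loser (p n) \<Longrightarrow> s n $ a = s (Suc n) $ a"
     "s n $ loser (p n) = (if snd (p n) = 0 then 1 else exp (log_slope p \<omega> n $ winner (p n))) * s (Suc n) $ loser (p n)"
     "s n $ winner (p n) = s (Suc n) $ winner (p n) +
        (if snd (p n) = 0 then exp (log_slope p \<omega> n $ loser (p n)) else 1) * s (Suc n) $ loser (p n)"
    using w unfolding length_rec_def by blast+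
  consider "a = winner (p n)" | "a = loser (p n)" | "a \<noteq> winner (p n)" "a \<noteq> loser (p n)" by blast
  then have "exp (- m) * (path_step p n *v s (Suc n)) $ a \<le> s n $ a \<and> s n $ a \<le> exp m * (path_step p n *v s (Suc n)) $ a"
  proof cases
    case 1
    have r: "(path_step p n *v s (Suc n)) $ a = s (Suc n) $ winner (p n) + s (Suc n) $ loser (p n)" using 1 rm_mult[of p n "s (Suc n)" a] by simp
    show ?thesis unfolding r distrib_left using rec(3) 1 pos[of "winner (p n)"] pos[of "loser (p n)"]
      le[of "s (Suc n) $ winner (p n)"] le[of "s (Suc n) $ loser (p n)"] le2[of "s (Suc n) $ loser (p n)" "loser (p n)"] by auto
  next
    case 2
    have r: "(path_step p n *v s (Suc n)) $ a = s (Suc n) $ loser (p n)" using 2 rm_mult[of p n "s (Suc n)" a] ne by auto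
    show ?thesis unfolding r using rec(2) 2 pos[of "loser (p n)"]
      le[of "s (Suc n) $ loser (p n)"] le2[of "s (Suc n) $ loser (p n)" "winner (p n)"] by auto
  next
    case 3
    have r: "(path_step p n *v s (Suc n)) $ a = s (Suc n) $ a" using 3 rm_mult[of p n "s (Suc n)" a] by auto
    show ?thesis unfolding r using rec(1)[OF 3] pos[of a] le[of "s (Suc n) $ a"] by auto
  qed
  then show "exp (- m) * (path_step p n *v s (Suc n)) $ a \<le> s n $ a" "s n $ a \<le> exp m * (path_step p n *v s (Suc n)) $ a" by auto
  moreover have "0 \<le> (path_step p n *v s (Suc n)) $ a" using rm_mult[of p n "s (Suc n)" a] pos[of a] pos[of "loser (p n)"] by auto
  ultimately show "0 \<le> s n $ a" by (meson exp_ge_zero mult_nonneg_nonneg order_trans)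
qed

text \<open>A step adds one coordinate to another, so the largest modulus at most doubles.\<close>

lemma log_slope_bound:
  assumes "\<And>a. \<bar>log_slope p \<omega> n $ a\<bar> \<le> m" shows "\<bar>log_slope p \<omega> (n + k) $ a\<bar> \<le> 2 ^ k * m"
proof (induction k arbitrary: a)
  case (Suc k)
  have "log_slope p \<omega> (n + Suc k) $ a = log_slope p \<omega> (n + k) $ a + (if a = loser (p (n + k)) then log_slope p \<omega> (n + k) $ winner (p (n + k)) else 0)"
    by (simp only: add_Suc_right log_slope.simps path_step_def rauzy_matrix_transpose_mult prod.collapse)
  then show ?case using Suc[of a] Suc[of "winner (p (n + k))"] by auto
qed (simp add: assms)

text \<open>The coefficients of the recursion are positive, so signs are inherited backwards in
  time. Applied to differences of solutions, this is the monotonicity behind the comparison of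
  ratios.\<close>

lemma length_rec_nonneg:
  assumes w: "length_rec p \<omega> s" and ne: "\<And>n. winner (p n) \<noteq> loser (p n)" and pos: "\<And>a. 0 \<le> s (n + k) $ a"
  shows "0 \<le> s n $ a"
proof -
  have "\<forall>a. 0 \<le> s (n + k - j) $ a" if "j \<le> k" for j using that
  proof (induction j)
    case 0
    then show ?case using pos by simp
  next
    case (Suc j)
    let ?n = "n + k - Suc j"
    have m: "\<bar>log_slope p \<omega> ?n $ a\<bar> \<le> Max (range (\<lambda>a. \<bar>log_slope p \<omega> ?n $ a\<bar>))" for a by simp
    have "Suc ?n = n + k - j" using Suc by simp
    then have "0 \<le> s (Suc ?n) $ a" for a using Suc by simp
    from length_rec_step_bounds(3)[OF w ne this m] show ?case by blast
  qed
  from this[of k] show ?thesis by simp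
qed

lemma matrix_vec_mono:
  fixes M :: "real^'a::finite^'a"
  assumes "\<And>a b. 0 \<le> M $ a $ b" "\<And>b. x $ b \<le> y $ b"
  shows "(M *v x) $ a \<le> (M *v y) $ a"
  unfolding matrix_vector_mult_def using assms by (auto intro!: sum_mono mult_left_mono)

text \<open>The bound on the log-slopes doubles at every step, and so does the accumulated exponent:
  after \<open>k\<close> steps both are \<open>2 ^ k * m\<close>.\<close>

lemma length_rec_block_bounds:
  assumes w: "length_rec p \<omega> s" and ne: "\<And>n. winner (p n) \<noteq> loser (p n)"
    and m: "\<And>a. \<bar>log_slope p \<omega> n $ a\<bar> \<le> m"
  shows "(\<And>a. 0 \<le> s (n + k) $ a) \<Longrightarrow> exp (- (2 ^ k * m)) * (path_prod p n k *v s (n + k)) $ a \<le> s n $ a \<and> s n $ a \<le> exp (2 ^ k * m) * (path_prod p n k *v s (n + k)) $ a"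
proof (induction k)
  case 0
  have "0 \<le> m" using m[of a] by linarith
  then show ?case using 0 mult_right_mono[of "exp (-m)" 1 "s n $ a"] mult_right_mono[of 1 "exp m" "s n $ a"] by simp
next
  case (Suc k)
  have m0: "0 \<le> 2 ^ k * m" using m[of a] by simp
  let ?y = "path_step p (n + k) *v s (n + Suc k)" and ?e = "exp (2 ^ k * m)" and ?e' = "exp (- (2 ^ k * m))"
  have b: "?e' * ?y $ a \<le> s (n + k) $ a" "s (n + k) $ a \<le> ?e * ?y $ a" "0 \<le> s (n + k) $ a" for a
    using length_rec_step_bounds[OF w ne, of "n + k" "2 ^ k * m"] log_slope_bound[OF m, of k] Suc.prems by auto
  have nn: "0 \<le> path_prod p n k $ a $ b" for a b by (rule path_prod_bounds)
  have ih: "?e' * (path_prod p n k *v s (n + k)) $ a \<le> s n $ a" "s n $ a \<le> ?e * (path_prod p n k *v s (n + k)) $ a"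
    using Suc.IH b(3) by auto
  have mv: "path_prod p n (Suc k) *v s (n + Suc k) = path_prod p n k *v ?y" by (simp add: matrix_vector_mul_assoc)
  have "(path_prod p n k *v (?e' *\<^sub>R ?y)) $ a \<le> (path_prod p n k *v s (n + k)) $ a"
    by (rule matrix_vec_mono[OF nn]) (use b in simp)
  then have l: "?e' * (path_prod p n k *v ?y) $ a \<le> (path_prod p n k *v s (n + k)) $ a" by (simp add: matrix_vector_mult_scaleR)
  have "(path_prod p n k *v s (n + k)) $ a \<le> (path_prod p n k *v (?e *\<^sub>R ?y)) $ a"
    by (rule matrix_vec_mono[OF nn]) (use b in simp)
  then have u: "(path_prod p n k *v s (n + k)) $ a \<le> ?e * (path_prod p n k *v ?y) $ a" by (simp add: matrix_vector_mult_scaleR)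
  have e2: "exp (- (2 ^ Suc k * m)) = ?e' * ?e'" "exp (2 ^ Suc k * m) = ?e * ?e" by (simp_all add: exp_add[symmetric])
  have "?e' * (?e' * (path_prod p n k *v ?y) $ a) \<le> ?e' * (path_prod p n k *v s (n + k)) $ a"
    by (rule mult_left_mono[OF l]) simp
  moreover have "?e * (path_prod p n k *v s (n + k)) $ a \<le> ?e * (?e * (path_prod p n k *v ?y) $ a)"
    by (rule mult_left_mono[OF u]) simp
  ultimately show ?case unfolding mv e2 mult.assoc using ih by linarith
qed

text \<open>A positive block mixes: each coordinate before it is comparable to the total length
  after it, with constants that depend on \<open>K\<close> and \<open>m\<close> alone. The upper
  bound rests on the fact that a product of \<open>k\<close> steps has entries at most
  \<open>2 ^ k\<close>.\<close>

lemma posblock_bounds: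
  fixes s :: "nat \<Rightarrow> real^'a::finite"
  assumes w: "length_rec p \<omega> s" and ne: "\<And>n. winner (p n) \<noteq> loser (p n)"
    and m: "\<And>a. \<bar>log_slope p \<omega> n $ a\<bar> \<le> m" and P: "posblock p n k" "k \<le> K" and pos: "\<And>a. 0 \<le> s (n + k) $ a"
  shows "exp (- (2 ^ K * m)) * vsum (s (n + k)) \<le> s n $ a" "s n $ a \<le> exp (2 ^ K * m) * 2 ^ K * vsum (s (n + k))"
proof -
  have m0: "0 \<le> m" using m[of a] by linarith
  have v0: "0 \<le> vsum (s (n + k))" unfolding vsum_def using pos by (intro sum_nonneg) auto
  have km: "2 ^ k * m \<le> 2 ^ K * m" using P(2) m0 by (intro mult_right_mono) auto
  have "vsum (s (n + k)) \<le> (path_prod p n k *v s (n + k)) $ a"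
    unfolding vsum_def matrix_vector_mult_def vec_lambda_beta
    using P(1) pos unfolding posblock_def by (intro sum_mono) (metis mult_1 mult_right_mono)
  then have "exp (- (2 ^ K * m)) * vsum (s (n + k)) \<le> exp (- (2 ^ k * m)) * (path_prod p n k *v s (n + k)) $ a"
    using km v0 by (intro mult_mono) auto
  then show "exp (- (2 ^ K * m)) * vsum (s (n + k)) \<le> s n $ a"
    using length_rec_block_bounds[where a=a, OF w ne m pos] by linarith
  have "(path_prod p n k *v s (n + k)) $ a \<le> (\<Sum>b\<in>UNIV. 2 ^ K * s (n + k) $ b)"
    unfolding matrix_vector_mult_def vec_lambda_beta
  proof (intro sum_mono mult_right_mono pos)
    fix b show "path_prod p n k $ a $ b \<le> 2 ^ K"
      by (rule order_trans[OF path_prod_bounds(2) power_increasing[OF P(2)]]) simp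
  qed
  then have "(path_prod p n k *v s (n + k)) $ a \<le> 2 ^ K * vsum (s (n + k))" by (simp add: vsum_def sum_distrib_left)
  then have "exp (2 ^ k * m) * (path_prod p n k *v s (n + k)) $ a \<le> exp (2 ^ K * m) * (2 ^ K * vsum (s (n + k)))"
    using km v0 by (intro mult_mono') (auto simp: matrix_vector_mult_def intro!: sum_nonneg mult_nonneg_nonneg path_prod_bounds pos)
  then show "s n $ a \<le> exp (2 ^ K * m) * 2 ^ K * vsum (s (n + k))"
    using length_rec_block_bounds[where a=a, OF w ne m pos] by (simp add: mult.assoc)
qed

lemma length_rec_lin:
  assumes "length_rec p \<omega> s" "length_rec p \<omega> s'" shows "length_rec p \<omega> (\<lambda>n. x *\<^sub>R s n + y *\<^sub>R s' n)"
  using assms unfolding length_rec_def by (simp add: algebra_simps)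

lemma vsum_pos: "(\<And>a. 0 < s $ a) \<Longrightarrow> 0 < vsum s"
  unfolding vsum_def by (intro sum_pos) auto

lemma vsum_add: "vsum (x + y) = vsum x + vsum y" and vsum_scaleR: "vsum (c *\<^sub>R x) = c * vsum x"
  unfolding vsum_def by (simp_all add: sum.distrib sum_distrib_left)

locale length_rec_pair =
  fixes p :: "nat \<Rightarrow> 'a::finite iet_perm \<times> nat" and \<omega> :: "real^'a" and s s' :: "nat \<Rightarrow> real^'a" and m :: real and K :: nat
  assumes w: "length_rec p \<omega> s" and w': "length_rec p \<omega> s'" and ne: "\<And>n. winner (p n) \<noteq> loser (p n)"
    and pos: "\<And>n a. 0 < s n $ a" and pos': "\<And>n a. 0 < s' n $ a"
begin

text \<open>Here \<open>\<kappa>\<close> and \<open>\<Lambda>\<close> are the lower and upper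
  constants of \<open>posblock_bounds\<close>: at a good time every length lies between these
  multiples of the total length after the block.\<close>

definition "\<kappa> = exp (- (2 ^ K * m))"
definition "\<Lambda> = exp (2 ^ K * m) * 2 ^ K"
definition good where "good n \<longleftrightarrow> (\<exists>k\<le>K. posblock p n k) \<and> (\<forall>a. \<bar>log_slope p \<omega> n $ a\<bar> \<le> m)"
definition rng where "rng a b n \<longleftrightarrow> (\<forall>i. a * s n $ i \<le> s' n $ i \<and> s' n $ i \<le> b * s n $ i)"

lemma kl: "0 < \<kappa>" "0 < \<Lambda>" unfolding \<kappa>_def \<Lambda>_def by auto

lemma rng_alt: "rng a b n \<longleftrightarrow> (\<forall>i. 0 \<le> ((-a) *\<^sub>R s n + 1 *\<^sub>R s' n) $ i \<and> 0 \<le> (b *\<^sub>R s n + (-1) *\<^sub>R s' n) $ i)"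
  unfolding rng_def by simp

lemma rng_down: "rng a b (n + k) \<Longrightarrow> rng a b n"
  unfolding rng_alt
  using length_rec_nonneg[OF length_rec_lin[OF w w', of "-a" 1] ne] length_rec_nonneg[OF length_rec_lin[OF w w', of b "-1"] ne] by blast

text \<open>The combinations \<open>s' - a s\<close> and \<open>b s - s'\<close> are non-negative
  solutions at the end of the block, and their totals add up to \<open>(b - a) * S\<close>. The
  block gives every coordinate at least the share \<open>\<kappa>\<close> of these totals, while
  \<open>s\<close> is at most \<open>\<Lambda> * S\<close>; both ends of the interval of ratios can
  therefore be moved inwards.\<close>

lemma rng_contract:
  assumes g: "posblock p n k" "k \<le> K" "\<And>a. \<bar>log_slope p \<omega> n $ a\<bar> \<le> m" and r: "rng a b (n + k)"
  shows "\<exists>a' b'. a \<le> a' \<and> b' \<le> b \<and> b' - a' \<le> (1 - \<kappa> / \<Lambda>) * (b - a) \<and> rng a' b' n"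
proof -
  define x where "x n = (-a) *\<^sub>R s n + 1 *\<^sub>R s' n" for n
  define y where "y n = b *\<^sub>R s n + (-1) *\<^sub>R s' n" for n
  have wx: "length_rec p \<omega> x" and wy: "length_rec p \<omega> y" unfolding x_def y_def by (rule length_rec_lin[OF w w'])+
  have x0: "0 \<le> x (n + k) $ i" and y0: "0 \<le> y (n + k) $ i" for i using r unfolding rng_alt x_def y_def by blast+
  define X Y S where "X = vsum (x (n + k))" and "Y = vsum (y (n + k))" and "S = vsum (s (n + k))"
  have S: "0 < S" unfolding S_def by (rule vsum_pos) (rule pos)
  have XY: "0 \<le> X" "0 \<le> Y" unfolding X_def Y_def vsum_def using x0 y0 by (auto intro!: sum_nonneg)
  have "X + Y = (b - a) * S" unfolding X_def Y_def S_def x_def y_def vsum_add vsum_scaleR by (simp add: algebra_simps)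
  have xl: "\<kappa> * X \<le> x n $ i" and yl: "\<kappa> * Y \<le> y n $ i" for i
    using posblock_bounds(1)[OF wx ne g(3,1,2) x0] posblock_bounds(1)[OF wy ne g(3,1,2) y0] unfolding \<kappa>_def X_def Y_def by auto
  have su: "s n $ i \<le> \<Lambda> * S" for i
    using posblock_bounds(2)[OF w ne g(3,1,2)] pos unfolding \<Lambda>_def S_def by (simp add: less_imp_le)
  have c: "\<kappa> * Z / (\<Lambda> * S) * s n $ i \<le> \<kappa> * Z" if "0 \<le> Z" for Z i
  proof -
    have "\<kappa> * Z * s n $ i \<le> \<kappa> * Z * (\<Lambda> * S)" using su[of i] that kl by (intro mult_left_mono) auto
    then show ?thesis using kl S by (simp add: field_simps)
  qed
  define a' b' where "a' = a + \<kappa> * X / (\<Lambda> * S)" and "b' = b - \<kappa> * Y / (\<Lambda> * S)"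
  have "a \<le> a'" "b' \<le> b" unfolding a'_def b'_def using XY kl S by auto
  moreover have "b' - a' \<le> (1 - \<kappa> / \<Lambda>) * (b - a)"
  proof -
    have "b' - a' = (b - a) - \<kappa> * (X + Y) / (\<Lambda> * S)" unfolding a'_def b'_def by (simp add: add_divide_distrib algebra_simps)
    also have "\<dots> = (1 - \<kappa> / \<Lambda>) * (b - a)" unfolding \<open>X + Y = (b - a) * S\<close> using S kl by (simp add: field_simps)
    finally show ?thesis by simp
  qed
  moreover have "rng a' b' n"
    unfolding rng_def
  proof (intro allI conjI)
    fix i
    have "\<kappa> * X / (\<Lambda> * S) * s n $ i \<le> x n $ i" using c[OF XY(1), of i] xl[of i] by linarith
    then show "a' * s n $ i \<le> s' n $ i" unfolding a'_def x_def by (simp add: algebra_simps)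
    have "\<kappa> * Y / (\<Lambda> * S) * s n $ i \<le> y n $ i" using c[OF XY(2), of i] yl[of i] by linarith
    then show "s' n $ i \<le> b' * s n $ i" unfolding b'_def y_def by (simp add: algebra_simps)
  qed
  ultimately show ?thesis by blast
qed

text \<open>Nothing relates the two solutions a priori, but at a good time each of them is balanced,
  so the ratios of their coordinates agree up to a bounded factor.\<close>

lemma rng_initial:
  assumes g: "posblock p n k" "k \<le> K" "\<And>a. \<bar>log_slope p \<omega> n $ a\<bar> \<le> m"
  shows "\<exists>a>0. rng a ((\<Lambda> / \<kappa>)\<^sup>2 * a) n"
proof -
  define S S' where "S = vsum (s (n + k))" and "S' = vsum (s' (n + k))"
  have S: "0 < S" "0 < S'" unfolding S_def S'_def by (rule vsum_pos, rule pos pos')+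
  have b: "\<kappa> * S \<le> s n $ i" "s n $ i \<le> \<Lambda> * S" "\<kappa> * S' \<le> s' n $ i" "s' n $ i \<le> \<Lambda> * S'" for i
    using posblock_bounds[OF w ne g(3,1,2)] posblock_bounds[OF w' ne g(3,1,2)] pos pos'
    unfolding \<kappa>_def \<Lambda>_def S_def S'_def by (simp_all add: less_imp_le)
  define a where "a = \<kappa> * S' / (\<Lambda> * S)"
  have "0 < a" unfolding a_def using kl S by simp
  moreover have "rng a ((\<Lambda> / \<kappa>)\<^sup>2 * a) n"
    unfolding rng_def
  proof (intro allI conjI)
    fix i
    have "a * s n $ i \<le> a * (\<Lambda> * S)" using b(2)[of i] \<open>0 < a\<close> by (intro mult_left_mono) auto
    also have "\<dots> = \<kappa> * S'" unfolding a_def using kl S by simp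
    finally show "a * s n $ i \<le> s' n $ i" using b(3)[of i] by linarith
    have "\<Lambda> * S' = (\<Lambda> / \<kappa>)\<^sup>2 * a * (\<kappa> * S)" unfolding a_def using kl S by (simp add: power2_eq_square field_simps)
    also have "\<dots> \<le> (\<Lambda> / \<kappa>)\<^sup>2 * a * s n $ i" using b(1)[of i] \<open>0 < a\<close> by (intro mult_left_mono) auto
    finally show "s' n $ i \<le> (\<Lambda> / \<kappa>)\<^sup>2 * a * s n $ i" using b(4)[of i] by linarith
  qed
  ultimately show ?thesis by blast
qed

lemma kl_le: "\<kappa> / \<Lambda> \<le> 1" if "good n"
proof -
  have "0 \<le> m" using that unfolding good_def by (meson abs_ge_zero order_trans)
  then have "\<kappa> \<le> 1" "1 \<le> exp (2 ^ K * m)" "(1::real) \<le> 2 ^ K" unfolding \<kappa>_def by auto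
  then have "1 \<le> \<Lambda>" unfolding \<Lambda>_def using mult_mono[of 1 "exp (2 ^ K * m)" 1 "2^K"] by simp
  then show ?thesis using \<open>\<kappa> \<le> 1\<close> kl by simp
qed

text \<open>The interval containing the ratios at time 0 is contracted once per good block.
  Infinitely many blocks leave a single value.\<close>

lemma proportional:
  assumes good: "\<And>n0. \<exists>n\<ge>n0. good n"
  shows "\<exists>c>0. \<forall>a. s' 0 $ a = c * s 0 $ a"
proof -
  let ?q = "1 - \<kappa> / \<Lambda>"
  have q: "0 \<le> ?q" "?q < 1" using good[of 0] kl_le kl by auto
  \<comment> \<open>Blocks are found outwards from time 0, each beyond the end of the preceding one,
    and are used inwards from \<open>N\<close>, since the contraction acts from the end of a block
    to its start.\<close>
  have chain: "\<exists>N\<ge>n1. good N \<and> (\<forall>a b. rng a b N \<longrightarrow> (\<exists>a' b'. a \<le> a' \<and> b' \<le> b \<and> b' - a' \<le> ?q ^ j * (b - a) \<and> rng a' b' 0))" for j n1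
  proof (induction j arbitrary: n1)
    case 0
    obtain N where "N \<ge> n1" "good N" using good by blast
    then show ?case using rng_down[of _ _ 0 N] by (intro exI[of _ N]) auto
  next
    case (Suc j)
    obtain N where N: "good N" "\<And>a b. rng a b N \<Longrightarrow> (\<exists>a' b'. a \<le> a' \<and> b' \<le> b \<and> b' - a' \<le> ?q ^ j * (b - a) \<and> rng a' b' 0)"
      using Suc[of 0] by blast
    obtain k where k: "k \<le> K" "posblock p N k" "\<And>a. \<bar>log_slope p \<omega> N $ a\<bar> \<le> m" using N(1) unfolding good_def by blast
    obtain N' where N': "N' \<ge> max n1 (N + k)" "good N'" using good by blast
    have "\<exists>a' b'. a \<le> a' \<and> b' \<le> b \<and> b' - a' \<le> ?q ^ Suc j * (b - a) \<and> rng a' b' 0" if "rng a b N'" for a b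
    proof -
      have "rng a b (N + k)" using rng_down[of a b "N + k" "N' - (N + k)"] that N'(1) by simp
      from rng_contract[OF k(2,1,3) this] obtain a1 b1 where 1: "a \<le> a1" "b1 \<le> b" "b1 - a1 \<le> ?q * (b - a)" "rng a1 b1 N" by blast
      obtain a' b' where 2: "a1 \<le> a'" "b' \<le> b1" "b' - a' \<le> ?q ^ j * (b1 - a1)" "rng a' b' 0" using N(2)[OF 1(4)] by blast
      have "?q ^ j * (b1 - a1) \<le> ?q ^ j * (?q * (b - a))" using 1(3) q by (intro mult_left_mono) auto
      then have "b' - a' \<le> ?q ^ Suc j * (b - a)" using 2(3) by (simp add: mult_ac)
      then show ?thesis using 1 2 by (intro exI[of _ a'] exI[of _ b']) auto
    qed
    then show ?case using N' by (intro exI[of _ N']) auto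
  qed
  define r where "r = s' 0 $ undefined / s 0 $ undefined"
  have r: "0 < r" unfolding r_def using pos pos' by simp
  let ?M = "(\<Lambda> / \<kappa>)\<^sup>2"
  have "s' 0 $ a / s 0 $ a = r" for a
  proof -
    have "\<bar>s' 0 $ a / s 0 $ a - r\<bar> \<le> ?q ^ j * (?M * r)" for j
    proof -
      obtain N where N: "good N" "\<And>a b. rng a b N \<Longrightarrow> (\<exists>a' b'. a \<le> a' \<and> b' \<le> b \<and> b' - a' \<le> ?q ^ j * (b - a) \<and> rng a' b' 0)"
        using chain by blast
      obtain k where k: "k \<le> K" "posblock p N k" "\<And>a. \<bar>log_slope p \<omega> N $ a\<bar> \<le> m" using N(1) unfolding good_def by blast
      obtain c where c: "c > 0" "rng c (?M * c) N" using rng_initial[OF k(2,1,3)] by blast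
      obtain a' b' where ab: "c \<le> a'" "b' - a' \<le> ?q ^ j * (?M * c - c)" "rng a' b' 0" using N(2)[OF c(2)] by blast
      have i: "a' \<le> s' 0 $ i / s 0 $ i" "s' 0 $ i / s 0 $ i \<le> b'" for i
        using ab(3) pos[of 0 i] unfolding rng_def by (auto simp: field_simps)
      \<comment> \<open>The initial interval is found at a time that depends on \<open>j\<close>.
        Its left end lies below the ratio at time 0, which bounds its width by \<open>?M * r\<close>
        independently of \<open>j\<close>.\<close>
      have "c \<le> r" using ab(1) i(1)[of undefined] unfolding r_def by linarith
      have "?q ^ j * (?M * c - c) \<le> ?q ^ j * (?M * r)"
      proof (intro mult_left_mono)
        have "?M * c \<le> ?M * r" using \<open>c \<le> r\<close> by (intro mult_left_mono) auto
        then show "?M * c - c \<le> ?M * r" using c(1) by linarith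
      qed (use q in auto)
      then show ?thesis using ab(2) i[of a] i[of undefined] unfolding r_def[symmetric] by linarith
    qed
    moreover have "(\<lambda>j. ?q ^ j * (?M * r)) \<longlonglongrightarrow> 0 * (?M * r)"
      using q by (intro tendsto_mult_right LIMSEQ_realpow_zero) auto
    ultimately have "\<bar>s' 0 $ a / s 0 $ a - r\<bar> \<le> 0 * (?M * r)" by (intro LIMSEQ_le_const) auto
    then show ?thesis by simp
  qed
  then show ?thesis using r pos by (intro exI[of _ r]) (metis less_irrefl nonzero_divide_eq_eq)
qed

end

section \<open>Positive products along a Rauzy-Veech path\<close>

locale rv_path =
  fixes p :: "nat \<Rightarrow> 'a::finite iet_perm \<times> nat"
  assumes move: "fst (p (Suc n)) = rauzy_move (fst (p n)) (snd (p n))"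
    and ty: "snd (p n) \<in> {0, 1}" and ne: "winner (p n) \<noteq> loser (p n)"
begin

text \<open>A move leaves the row of the winner unchanged, so the winner is still last in that row
  and takes part in the next step.\<close>

lemma winner_next: "winner (p n) \<in> {winner (p (Suc n)), loser (p (Suc n))}"
  "snd (p (Suc n)) = snd (p n) \<Longrightarrow> winner (p (Suc n)) = winner (p n)"
proof -
  have "last_letter (fst (p (Suc n))) (snd (p n)) = winner (p n)"
    using ty[of n] unfolding move winner_def last_letter_def perm_row_def rauzy_move_def by auto
  then show "winner (p n) \<in> {winner (p (Suc n)), loser (p (Suc n))}"
     "snd (p (Suc n)) = snd (p n) \<Longrightarrow> winner (p (Suc n)) = winner (p n)"
    using ty[of n] ty[of "Suc n"] unfolding winner_def loser_def by auto
qed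

lemma path_prod_mono: "k \<le> k' \<Longrightarrow> path_prod p n k $ a $ b \<le> path_prod p n k' $ a $ b"
proof (induction rule: dec_induct)
  case (step i)
  then show ?case unfolding mat_prod.simps matrix_mult_rm using path_prod_bounds(1)[of p n i a "winner (p (n + i))"] by auto
qed simp

text \<open>Once the columns reached from a fixed row no longer increase, they are never won by letters
  outside; since the winner stays last in its row, the first outside winner would be followed by
  outside winners only.\<close>

lemma posblock_exists:
  assumes win: "\<And>n a. \<exists>n'\<ge>n. winner (p n') = a"
  shows "\<exists>k. posblock p n k"
proof -
  have "\<exists>k. \<forall>b. 1 \<le> path_prod p n k $ a $ b" for a
  proof -
    define C where "C k = {b. 1 \<le> path_prod p n k $ a $ b}" for k
    have mono: "k \<le> k' \<Longrightarrow> C k \<subseteq> C k'" for k k' unfolding C_def using path_prod_mono order_trans by blast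
    have C0: "a \<in> C k" for k using mono[of 0 k] unfolding C_def by (auto simp: mat_def)
    obtain k0 where k0: "\<And>k. card (C k) \<le> card (C k0)"
    proof -
      have "finite (range (\<lambda>k. card (C k)))" by (rule finite_subset[of _ "{..CARD('a)}"]) (auto intro: card_mono)
      then have "Max (range (\<lambda>k. card (C k))) \<in> range (\<lambda>k. card (C k))" by (intro Max_in) auto
      then obtain k0 where "card (C k0) = Max (range (\<lambda>k. card (C k)))" by auto
      then show ?thesis using that[of k0] Max_ge[OF \<open>finite (range (\<lambda>k. card (C k)))\<close>] by auto
    qed
    have st: "C k = C k0" if "k0 \<le> k" for k
      using card_seteq[OF finite mono[OF that]] k0[of k] by simp
    have los: "loser (p (n + k)) \<in> C k0" if "k0 \<le> k" "winner (p (n + k)) \<in> C k0" for k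
    proof -
      have "1 \<le> path_prod p n k $ a $ winner (p (n + k))" using that st[of k] unfolding C_def by blast
      then have "1 \<le> path_prod p n (Suc k) $ a $ loser (p (n + k))"
        unfolding mat_prod.simps matrix_mult_rm using path_prod_bounds(1)[of p n k a "loser (p (n + k))"] by simp
      then show ?thesis using st[of "Suc k"] that unfolding C_def by auto
    qed
    have "C k0 = UNIV"
    proof (rule ccontr)
      assume "C k0 \<noteq> UNIV"
      then obtain \<delta> where d: "\<delta> \<notin> C k0" by blast
      obtain i where i: "i \<ge> n + k0" "winner (p i) = \<delta>" using win by blast
      have "winner (p (i + j)) \<notin> C k0" for j
      proof (induction j)
        case 0
        then show ?case using i d by simp
      next
        case (Suc j)
        have "winner (p (i + Suc j)) \<in> C k0 \<Longrightarrow> loser (p (i + Suc j)) \<in> C k0"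
          using los[of "i + Suc j - n"] i(1) by simp
        then show ?case using winner_next(1)[of "i + j"] Suc by auto
      qed
      moreover obtain i' where "i' \<ge> i" "winner (p i') = a" using win by blast
      ultimately show False using C0[of k0] by (metis le_Suc_ex)
    qed
    then show ?thesis unfolding C_def by blast
  qed
  then obtain k where k: "\<And>a b. 1 \<le> path_prod p n (k a) $ a $ b" by metis
  have "1 \<le> path_prod p n (Max (range k)) $ a $ b" for a b
    using order_trans[OF k[of a b] path_prod_mono[of "k a" "Max (range k)"]] by simp
  then show ?thesis unfolding posblock_def by blast
qed

end

section \<open>Translation maps and Zorich induction\<close>

lemma ivl_order:
  fixes a b c d :: real
  assumes "\<And>x y. x \<in> {a..<b} \<Longrightarrow> y \<in> {c..<d} \<Longrightarrow> x < y" "a < b" "c < d"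
  shows "b \<le> c"
proof (rule ccontr)
  assume "\<not> b \<le> c"
  then have "max a c \<in> {a..<b}" "c \<in> {c..<d}" using assms(2,3) by auto
  from assms(1)[OF this] show False by simp
qed

lemma within_Icc_nontrivial: "u < v \<Longrightarrow> (x::real) \<in> {u..v} \<Longrightarrow> at x within {u..v} \<noteq> bot"
  using trivial_limit_within islimpt_Icc by metis

text \<open>Monotonicity gives a non-negative derivative. It cannot vanish, since its product with
  the derivative of the differentiable inverse is 1; at the ends this uses uniqueness of the
  derivative within the closed interval.\<close>

lemma C1_diffeo_branch:
  assumes r: "1 \<le> r" and uv: "u < v" and GF: "\<And>x. x \<in> {u..<v} \<Longrightarrow> G x = F x"
    and dif: "Cr_diffeo r G {u..v} S'" and mono: "strict_mono_on {u..v} G"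
  shows "C1_branch F u v (G u) (G v)"
proof -
  let ?S = "{u..v}"
  obtain D where D: "D 0 = G" "\<And>i x. i < r \<Longrightarrow> x \<in> ?S \<Longrightarrow> (D i has_real_derivative D (Suc i) x) (at x within ?S)"
    "continuous_on ?S (D r)" using dif unfolding Cr_diffeo_def Cr_on_def by blast
  obtain E where E: "E 0 = inv_into ?S G" "\<And>i x. i < r \<Longrightarrow> x \<in> S' \<Longrightarrow> (E i has_real_derivative E (Suc i) x) (at x within S')"
    using dif unfolding Cr_diffeo_def Cr_on_def by blast
  have bij: "G ` ?S = S'" "inj_on G ?S" using dif unfolding Cr_diffeo_def bij_betw_def by auto
  have dG: "(G has_real_derivative D 1 x) (at x within ?S)" if "x \<in> ?S" for x
    using D(2)[of 0 x] r that D(1) by simp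
  have nb: "at x within ?S \<noteq> bot" if "x \<in> ?S" for x using within_Icc_nontrivial[OF uv that] .
  have pos: "0 < D 1 x" if x: "x \<in> ?S" for x
  proof -
    have "(inv_into ?S G has_real_derivative E 1 (G x)) (at (G x) within G ` ?S)"
      using E(2)[of 0 "G x"] r x bij E(1) by auto
    from DERIV_image_chain[OF this dG[OF x]]
    have "(inv_into ?S G \<circ> G has_real_derivative E 1 (G x) * D 1 x) (at x within ?S)" .
    then have "((\<lambda>y. y) has_real_derivative E 1 (G x) * D 1 x) (at x within ?S)"
      by (rule has_field_derivative_transform_within[OF _ zero_less_one x]) (use bij(2) in simp)
    moreover have "((\<lambda>y. y) has_real_derivative 1) (at x within ?S)" by (rule DERIV_ident)
    ultimately have "E 1 (G x) * D 1 x = 1"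
      using nb[OF x] unfolding has_real_derivative_iff_has_vector_derivative
      by (metis vector_derivative_unique_within)
    then have "D 1 x \<noteq> 0" by auto
    moreover have "0 \<le> D 1 x"
    proof (rule tendsto_lowerbound[OF _ _ nb[OF x]])
      show "((\<lambda>y. (G y - G x) / (y - x)) \<longlongrightarrow> D 1 x) (at x within ?S)"
        using dG[OF x] unfolding has_field_derivative_iff .
      have "0 \<le> (G y - G x) / (y - x)" if "y \<in> ?S" "y \<noteq> x" for y
        using mono x that unfolding strict_mono_on_def
        by (cases "x < y") (auto intro!: divide_nonneg_nonneg divide_nonpos_nonpos simp: less_imp_le)
      then show "eventually (\<lambda>y. 0 \<le> (G y - G x) / (y - x)) (at x within ?S)"
        unfolding eventually_at_filter by (auto intro!: always_eventually)
    qed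
    ultimately show ?thesis by simp
  qed
  have "continuous_on ?S (D 1)"
  proof (cases "r = 1")
    case False
    then have "\<And>x. x \<in> ?S \<Longrightarrow> (D 1 has_real_derivative D (Suc 1) x) (at x within ?S)" using D(2)[of 1] r by simp
    then show ?thesis by (meson DERIV_continuous continuous_on_eq_continuous_within)
  qed (use D(3) in simp)
  then have "C1_ext F u v (G u) (G v) G (D 1)"
    unfolding C1_ext_def using uv GF dG pos by auto
  then show ?thesis unfolding C1_branch_def by blast
qed

lemma is_giet_data:
  fixes f :: "'a::finite giet"
  assumes "is_giet r f" "1 \<le> r"
  shows "C1_giet f"
proof -
  have perm: "bij_betw (fst (gperm f)) UNIV {1..CARD('a)}" "bij_betw (snd (gperm f)) UNIV {1..CARD('a)}"
    using assms(1) unfolding is_giet_def irred_perms_def by auto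
  obtain A where A: "gdom f = {0..<A}" using assms(1) unfolding is_giet_def by auto
  have bij: "gmap f ` gdom f = gdom f" using assms(1) unfolding is_giet_def bij_betw_def by auto
  have "\<exists>u v. u < v \<and> gint f a = {u..<v}" for a using assms(1) unfolding is_giet_def by blast
  then obtain u v where uv: "\<And>a. u a < v a" "\<And>a. gint f a = {u a..<v a}" by metis
  have "\<exists>p q. C1_branch (gmap f) (u a) (v a) p q" for a
  proof -
    obtain G where G: "\<forall>x\<in>gint f a. G x = gmap f x" "Cr_diffeo r G (closure (gint f a)) (closure (gmap f ` gint f a))"
      "strict_mono_on (closure (gint f a)) G" using assms(1) unfolding is_giet_def by blast
    have cl: "closure (gint f a) = {u a..v a}" using uv[of a] by simp
    show ?thesis
      using C1_diffeo_branch[OF assms(2) uv(1), of a G "gmap f"] G uv(2)[of a] unfolding cl by blast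
  qed
  then obtain p q where pq: "\<And>a. C1_branch (gmap f) (u a) (v a) (p a) (q a)" by metis
  have im: "gmap f ` gint f a = {p a..<q a}" "p a < q a" for a using C1_branch_image[OF pq[of a]] uv(2) by auto
  have "giet_data f A u v p q"
  proof (rule giet_dataI[OF perm uv(2) pq A])
    have "(\<Union>a. {p a..<q a}) = gmap f ` gdom f" unfolding gdom_def image_UN im ..
    then show "(\<Union>a. {p a..<q a}) = {0..<A}" using bij A by simp
    fix a b
    show "v a \<le> u b" if "fst (gperm f) a < fst (gperm f) b"
    proof (rule ivl_order[OF _ uv(1) uv(1)])
      show "\<And>x y. x \<in> {u a..<v a} \<Longrightarrow> y \<in> {u b..<v b} \<Longrightarrow> x < y"
        using assms(1) that unfolding is_giet_def uv(2)[symmetric] by blast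
    qed
    show "q a \<le> p b" if o: "snd (gperm f) a < snd (gperm f) b"
    proof (rule ivl_order[OF _ im(2) im(2)])
      fix x y assume "x \<in> {p a..<q a}" "y \<in> {p b..<q b}"
      then obtain x' y' where "x' \<in> gint f a" "y' \<in> gint f b" "x = gmap f x'" "y = gmap f y'" unfolding im(1)[symmetric] by blast
      then show "x < y" using assms(1) o unfolding is_giet_def by blast
    qed
  qed
  then show ?thesis unfolding C1_giet_def by blast
qed

definition valid_perm :: "'a::finite iet_perm \<Rightarrow> bool" where
  "valid_perm \<pi> \<longleftrightarrow> bij_betw (fst \<pi>) UNIV {1..CARD('a)} \<and> bij_betw (snd \<pi>) UNIV {1..CARD('a)}"

lemma iet_left_tiles:
  fixes l :: "real^'a::finite"
  assumes r: "bij_betw r UNIV {1..CARD('a)}" and l: "\<And>a. 0 < l $ a"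
  shows "r a < r b \<Longrightarrow> iet_left l r a + l $ a \<le> iet_left l r b"
    "(\<Union>a. {iet_left l r a..<iet_left l r a + l $ a}) = {0..<vsum l}"
proof -
  define P where "P k = (\<Sum>b\<in>{b. r b \<le> k}. l $ b)" for k
  have inj: "inj r" using r by (simp add: bij_betw_def)
  have rr: "1 \<le> r b" "r b \<le> CARD('a)" for b using bij_betw_apply[OF r, of b] by auto
  have mono: "P j \<le> P k" if "j \<le> k" for j k
    unfolding P_def using l that by (intro sum_mono2) (auto intro: less_imp_le)
  have le: "iet_left l r a + l $ a = P (r a)" for a
  proof -
    have "{b. r b \<le> r a} = insert a {b. r b < r a}" using inj by (auto simp: le_less dest: injD)
    then show ?thesis unfolding P_def iet_left_def by simp
  qed
  have left: "iet_left l r b = P (r b - 1)" for b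
  proof -
    have "{c. r c < r b} = {c. r c \<le> r b - 1}" using rr(1)[of b] by auto
    then show ?thesis unfolding P_def iet_left_def by simp
  qed
  show "r a < r b \<Longrightarrow> iet_left l r a + l $ a \<le> iet_left l r b" using mono[of "r a" "r b - 1"] le[of a] left[of b] by simp
  have P0: "P 0 = 0"
  proof -
    have "{b. r b \<le> 0} = {}" using rr(1) by (auto simp: Suc_le_eq)
    then show ?thesis unfolding P_def by (simp only: sum.empty)
  qed
  have Pd: "P CARD('a) = vsum l"
  proof -
    have "{b. r b \<le> CARD('a)} = UNIV" using rr(2) by auto
    then show ?thesis unfolding P_def vsum_def by simp
  qed
  show "(\<Union>a. {iet_left l r a..<iet_left l r a + l $ a}) = {0..<vsum l}"
  proof (intro equalityI subsetI)
    fix x assume "x \<in> (\<Union>a. {iet_left l r a..<iet_left l r a + l $ a})"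
    then obtain a where a: "iet_left l r a \<le> x" "x < P (r a)" unfolding le by auto
    have "x < vsum l" using a(2) mono[OF rr(2)[of a]] Pd by simp
    moreover have "0 \<le> iet_left l r a" unfolding iet_left_def using l by (intro sum_nonneg) (auto intro: less_imp_le)
    ultimately show "x \<in> {0..<vsum l}" using a by simp
  next
    fix x assume x: "x \<in> {0..<vsum l}"
    \<comment> \<open>The tile that contains \<open>x\<close> belongs to the first partial sum
      exceeding \<open>x\<close>.\<close>
    define k where "k = (LEAST k. x < P k)"
    have ex: "x < P CARD('a)" using x Pd by simp
    have k: "x < P k" unfolding k_def by (rule LeastI[of "\<lambda>k. x < P k", OF ex])
    have kle: "k \<le> CARD('a)" unfolding k_def by (rule Least_le[of "\<lambda>k. x < P k", OF ex])
    have k1: "1 \<le> k" using k P0 x by (cases k) auto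
    then have "\<not> x < P (k - 1)" unfolding k_def by (intro not_less_Least) (use k1 k_def in linarith)
    have "k \<in> range r" using r k1 kle by (simp add: bij_betw_def)
    then obtain a where "r a = k" by auto
    have "x < iet_left l r a + l $ a" using k le[of a] \<open>r a = k\<close> by simp
    moreover have "iet_left l r a \<le> x" using left[of a] \<open>r a = k\<close> \<open>\<not> x < P (k - 1)\<close> by simp
    ultimately have "x \<in> {iet_left l r a..<iet_left l r a + l $ a}" by simp
    then show "x \<in> (\<Union>a. {iet_left l r a..<iet_left l r a + l $ a})" by blast
  qed
qed

lemma iet_C1:
  fixes l :: "real^'a::finite"
  assumes pi: "valid_perm \<pi>" and l: "\<And>a. 0 < l $ a"
  shows "C1_giet (iet l \<pi>)" "scales (\<lambda>x. x) 0 (iet l \<pi>)" "glen (iet l \<pi>) = l" "gperm (iet l \<pi>) = \<pi>"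
    "gend (iet l \<pi>) = vsum l"
proof -
  define u where "u = iet_left l (fst \<pi>)"
  define p where "p = iet_left l (snd \<pi>)"
  note t0 = iet_left_tiles[of "fst \<pi>" l, OF _ l] and t1 = iet_left_tiles[of "snd \<pi>" l, OF _ l]
  have b: "bij_betw (fst \<pi>) UNIV {1..CARD('a)}" "bij_betw (snd \<pi>) UNIV {1..CARD('a)}"
    using pi unfolding valid_perm_def by auto
  have gi: "gint (iet l \<pi>) a = {u a..<u a + l $ a}" for a unfolding iet_def iet_int_def u_def by simp
  have uniq: "a = c" if "x \<in> iet_int l \<pi> a" "x \<in> iet_int l \<pi> c" for x a c
  proof (rule ccontr)
    assume "a \<noteq> c"
    then have "fst \<pi> a \<noteq> fst \<pi> c" using b(1) by (metis bij_betw_def injD)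
    then have "u a + l $ a \<le> u c \<or> u c + l $ c \<le> u a" using t0(1)[OF b(1)] unfolding u_def by (metis nat_neq_iff)
    then show False using that unfolding iet_int_def u_def by auto
  qed
  have gm: "gmap (iet l \<pi>) x = x - u a + p a" if "x \<in> gint (iet l \<pi>) a" for x a
  proof -
    have x: "x \<in> iet_int l \<pi> a" using that unfolding iet_def by simp
    then have "(THE a. x \<in> iet_int l \<pi> a) = a" using uniq by blast
    then show ?thesis unfolding iet_def u_def p_def by (simp add: Let_def)
  qed
  have "C1_ext (gmap (iet l \<pi>)) (u a) (u a + l $ a) (p a) (p a + l $ a) (\<lambda>x. x - u a + p a) (\<lambda>_. 1)" for a
    unfolding C1_ext_def using l[of a] gm[of _ a] gi[of a] by (auto intro!: derivative_eq_intros)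
  then have br: "C1_branch (gmap (iet l \<pi>)) (u a) (u a + l $ a) (p a) (p a + l $ a)" for a
    unfolding C1_branch_def by blast
  have d: "giet_data (iet l \<pi>) (vsum l) u (\<lambda>a. u a + l $ a) p (\<lambda>a. p a + l $ a)"
  proof (rule giet_dataI[OF _ _ gi br])
    show "bij_betw (fst (gperm (iet l \<pi>))) UNIV {1..CARD('a)}" "bij_betw (snd (gperm (iet l \<pi>))) UNIV {1..CARD('a)}"
      using b unfolding iet_def by auto
    show "gdom (iet l \<pi>) = {0..<vsum l}" unfolding gdom_def gi u_def by (rule t0(2)[OF b(1)])
    show "(\<Union>a. {p a..<p a + l $ a}) = {0..<vsum l}" unfolding p_def by (rule t1(2)[OF b(2)])
    show "fst (gperm (iet l \<pi>)) a < fst (gperm (iet l \<pi>)) c \<Longrightarrow> u a + l $ a \<le> u c" for a c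
      unfolding iet_def u_def using t0(1)[OF b(1)] by simp
    show "snd (gperm (iet l \<pi>)) a < snd (gperm (iet l \<pi>)) c \<Longrightarrow> p a + l $ a \<le> p c" for a c
      unfolding iet_def p_def using t1(1)[OF b(2)] by simp
  qed
  then show "C1_giet (iet l \<pi>)" unfolding C1_giet_def by blast
  show "scales (\<lambda>x. x) 0 (iet l \<pi>)" unfolding scales_def using gm by simp
  show "glen (iet l \<pi>) = l" unfolding glen_def gi using l by (simp add: vec_eq_iff less_imp_le)
  show "gperm (iet l \<pi>) = \<pi>" unfolding iet_def by simp
  show "gend (iet l \<pi>) = vsum l" using giet_data_lft(3)[OF d] .
qed

section \<open>Rauzy-Veech induction on length vectors\<close>

definition itype :: "(real^'a) \<times> 'a::finite iet_perm \<Rightarrow> nat" where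
  "itype q = (if fst q $ last_letter (snd q) 0 > fst q $ last_letter (snd q) 1 then 0 else 1)"

definition istate :: "(real^'a) \<times> 'a::finite iet_perm \<Rightarrow> 'a iet_perm \<times> nat" where
  "istate q = (snd q, itype q)"

text \<open>Induction of an IET as an operation on lengths and permutation alone. In this form its
  measurability and its behaviour under rescaling are visible.\<close>

definition istep :: "(real^'a) \<times> 'a::finite iet_perm \<Rightarrow> (real^'a) \<times> 'a iet_perm" where
  "istep q = ((\<chi> a. if a = winner (istate q) then fst q $ a - fst q $ loser (istate q) else fst q $ a),
     rauzy_move (snd q) (itype q))"

definition ipath :: "(real^'a) \<times> 'a::finite iet_perm \<Rightarrow> nat \<Rightarrow> 'a iet_perm \<times> nat" where
  "ipath q n = istate ((istep ^^ n) q)"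

definition trans_giet :: "'a::finite giet \<Rightarrow> bool" where
  "trans_giet g \<longleftrightarrow> C1_giet g \<and> scales (\<lambda>x. x) 0 g"

definition lengths_perm :: "'a::finite giet \<Rightarrow> (real^'a) \<times> 'a iet_perm" where
  "lengths_perm g = (glen g, gperm g)"

lemma glen_Hlen: assumes "C1_giet g" shows "glen g $ a = Hlen (\<lambda>x. x) g a" "0 < glen g $ a"
proof -
  obtain A u v p q where d: "giet_data g A u v p q" using assms unfolding C1_giet_def by blast
  have "gint g a = {u a..<v a}" "u a < v a" using giet_dataD(1,2)[OF d, of a] C1_branch_image(3) by blast+
  then show "glen g $ a = Hlen (\<lambda>x. x) g a" "0 < glen g $ a"
    unfolding glen_def Hlen_def using giet_data_lft[OF d] by auto
qed

text \<open>Translations preserve lengths, so the image of the bottom-last interval is as long as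
  the interval itself and the type is decided by the length vector.\<close>

lemma trans_step:
  assumes "trans_giet g"
  shows "rv_defined g \<longleftrightarrow> glen g $ gtop g \<noteq> glen g $ gbot g" "rv_type g = itype (lengths_perm g)"
    "rv_defined g \<Longrightarrow> gtop g \<noteq> gbot g" "rv_defined g \<Longrightarrow> trans_giet (rv g) \<and> lengths_perm (rv g) = istep (lengths_perm g)"
proof -
  have C: "C1_giet g" and rescale: "scales (\<lambda>x. x) 0 g" using assms unfolding trans_giet_def by auto
  obtain A u v p q where d: "giet_data g A u v p q" using C unfolding C1_giet_def by blast
  have gi: "gint g a = {u a..<v a}" and br: "C1_branch (gmap g) (u a) (v a) (p a) (q a)" for a using giet_dataD[OF d] by blast+
  have "q a - p a = 1 * (v a - u a)" for a
  proof (rule scales_limit[where H="\<lambda>x. x" and A="max (v a) (q a)", OF br])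
    have "{u a..<v a} \<subseteq> gdom g" using gi unfolding gdom_def by blast
    moreover have "{p a..<q a} \<subseteq> gdom g" using d unfolding giet_data_def by blast
    ultimately show "0 \<le> u a" "0 \<le> p a" using C1_branch_image[OF br[of a]] giet_dataD(3)[OF d] by (auto simp: ivl_subset)
  qed (use scalesD[OF rescale, of _ a] gi[of a] in auto)
  then have im: "ilen (gmap g ` gint g a) = glen g $ a" for a
    using C1_branch_image[OF br[of a]] unfolding glen_def gi by simp
  have len: "ilen (gint g a) = glen g $ a" for a unfolding glen_def by simp
  show df: "rv_defined g \<longleftrightarrow> glen g $ gtop g \<noteq> glen g $ gbot g" unfolding rv_defined_def im len ..
  show ty: "rv_type g = itype (lengths_perm g)" unfolding rv_type_def im len itype_def lengths_perm_def by simp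
  show ne: "gtop g \<noteq> gbot g" if "rv_defined g" using that df by auto
  assume right_deriv: "rv_defined g"
  interpret giet_step g A u v p q using d ne[OF right_deriv] right_deriv by unfold_locales
  have "scales (\<lambda>x. x) 0 (rv g)" using rv_scales[OF rescale] by simp
  then have T: "trans_giet (rv g)" using rv_giet(1) unfolding trans_giet_def by simp
  have h: "Hlen (\<lambda>x. x) g a = Hlen (\<lambda>x. x) (rv g) a + (if a = winner (state g) then Hlen (\<lambda>x. x) (rv g) (loser (state g)) else 0)"
    and hl: "Hlen (\<lambda>x. x) g (loser (state g)) = Hlen (\<lambda>x. x) (rv g) (loser (state g))" for a
    using rv_Hlen[OF rescale continuous_on_id] type_iff(2) wl_ne by (auto split: if_splits)
  have st: "state g = istate (lengths_perm g)" unfolding state_def istate_def ty by (simp add: lengths_perm_def)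
  have "glen (rv g) $ a = fst (istep (lengths_perm g)) $ a" for a
  proof -
    have "fst (istep (lengths_perm g)) $ a = (if a = winner (state g) then glen g $ a - glen g $ loser (state g) else glen g $ a)"
      unfolding istep_def st by (simp add: lengths_perm_def)
    then show ?thesis using h[of a] hl glen_Hlen(1)[OF C] glen_Hlen(1)[OF rv_giet(1)] by (cases "a = w") simp_all
  qed
  then have "lengths_perm (rv g) = istep (lengths_perm g)"
    using rv_giet(2) ty unfolding lengths_perm_def istep_def by (simp add: vec_eq_iff)
  then show "trans_giet (rv g) \<and> lengths_perm (rv g) = istep (lengths_perm g)" using T by simp
qed

text \<open>The two competing lengths never coincide: this is infinite renormalizability as it
  appears on length vectors.\<close>

definition valid :: "(real^'a) \<times> 'a::finite iet_perm \<Rightarrow> bool" where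
  "valid q \<longleftrightarrow> valid_perm (snd q) \<and> (\<forall>a. 0 < fst q $ a) \<and>
     (\<forall>n. fst ((istep ^^ n) q) $ last_letter (snd ((istep ^^ n) q)) 0 \<noteq> fst ((istep ^^ n) q) $ last_letter (snd ((istep ^^ n) q)) 1)"

lemma trans_giet_iter:
  assumes "trans_giet g" "\<And>m. m < n \<Longrightarrow> rv_defined ((rv ^^ m) g)"
  shows "trans_giet ((rv ^^ n) g) \<and> lengths_perm ((rv ^^ n) g) = (istep ^^ n) (lengths_perm g)"
  using assms(2)
proof (induction n)
  case (Suc n)
  then have "trans_giet ((rv ^^ n) g)" "lengths_perm ((rv ^^ n) g) = (istep ^^ n) (lengths_perm g)" by auto
  then show ?case using trans_step(4)[of "(rv ^^ n) g"] Suc.prems[of n] by simp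
qed (simp add: assms(1))

lemma valid_rv_defined:
  assumes "trans_giet g" "valid (lengths_perm g)" shows "rv_defined ((rv ^^ n) g)"
proof (induction n rule: less_induct)
  case (less n)
  then have "trans_giet ((rv ^^ n) g)" "lengths_perm ((rv ^^ n) g) = (istep ^^ n) (lengths_perm g)" using trans_giet_iter[OF assms(1)] by auto
  then show ?case using trans_step(1) assms(2) unfolding valid_def by (metis fst_conv lengths_perm_def snd_conv)
qed

lemma trans_orbit:
  assumes "trans_giet g" "\<And>n. rv_defined ((rv ^^ n) g)"
  shows "rv_orbit g" "rot_number g = ipath (lengths_perm g)" "lengths_perm ((rv ^^ n) g) = (istep ^^ n) (lengths_perm g)" "trans_giet ((rv ^^ n) g)"
proof -
  have t: "trans_giet ((rv ^^ n) g)" and l: "lengths_perm ((rv ^^ n) g) = (istep ^^ n) (lengths_perm g)" for n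
    using trans_giet_iter[OF assms(1)] assms(2) by auto
  show "lengths_perm ((rv ^^ n) g) = (istep ^^ n) (lengths_perm g)" "trans_giet ((rv ^^ n) g)" by (rule l, rule t)
  show "rv_orbit g"
  proof
    show "C1_giet g" using assms(1) unfolding trans_giet_def by simp
    show "rv_defined ((rv ^^ n) g)" for n by (rule assms(2))
    show "gtop ((rv ^^ n) g) \<noteq> gbot ((rv ^^ n) g)" for n using trans_step(3)[OF t assms(2)] .
  qed
  show "rot_number g = ipath (lengths_perm g)"
  proof
    fix n
    show "rot_number g n = ipath (lengths_perm g) n"
      unfolding rot_number_def ipath_def istate_def l[symmetric] using trans_step(2)[OF t] by (simp add: lengths_perm_def)
  qed
qed

lemma valid_iet:
  assumes "valid q"
  shows "trans_giet (iet (fst q) (snd q))" "lengths_perm (iet (fst q) (snd q)) = q" "\<And>n. rv_defined ((rv ^^ n) (iet (fst q) (snd q)))"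
    "rv_orbit (iet (fst q) (snd q))" "rot_number (iet (fst q) (snd q)) = ipath q"
proof -
  have v: "valid_perm (snd q)" "\<And>a. 0 < fst q $ a" using assms unfolding valid_def by auto
  show t: "trans_giet (iet (fst q) (snd q))" unfolding trans_giet_def using iet_C1[OF v] by simp
  show l: "lengths_perm (iet (fst q) (snd q)) = q" unfolding lengths_perm_def using iet_C1[OF v] by simp
  show d: "rv_defined ((rv ^^ n) (iet (fst q) (snd q)))" for n by (rule valid_rv_defined[OF t]) (simp add: l assms)
  show "rv_orbit (iet (fst q) (snd q))" "rot_number (iet (fst q) (snd q)) = ipath q" using trans_orbit[OF t d] l by auto
qed

lemma inf_renorm_valid:
  assumes "valid_perm \<pi>" "\<And>a. 0 < l $ a" "inf_renorm (iet l \<pi>)" shows "valid (l, \<pi>)"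
proof -
  have t: "trans_giet (iet l \<pi>)" unfolding trans_giet_def using iet_C1[OF assms(1,2)] by simp
  have l: "lengths_perm (iet l \<pi>) = (l, \<pi>)" unfolding lengths_perm_def using iet_C1[OF assms(1,2)] by simp
  have d: "rv_defined ((rv ^^ n) (iet l \<pi>))" for n using assms(3) unfolding inf_renorm_def by blast
  have "fst ((istep ^^ n) (l, \<pi>)) $ last_letter (snd ((istep ^^ n) (l, \<pi>))) 0 \<noteq> fst ((istep ^^ n) (l, \<pi>)) $ last_letter (snd ((istep ^^ n) (l, \<pi>))) 1" for n
    using trans_step(1)[OF trans_orbit(4)[OF t d], of n] d[of n] trans_orbit(3)[OF t d, of n] l by (metis fst_conv lengths_perm_def snd_conv)
  then show ?thesis unfolding valid_def using assms by simp
qed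

section \<open>Zorich steps as blocks of a Rauzy-Veech path\<close>

definition ztime :: "(nat \<Rightarrow> 'a::finite iet_perm \<times> nat) \<Rightarrow> nat" where
  "ztime p = (LEAST n. 1 \<le> n \<and> snd (p n) \<noteq> snd (p 0))"

text \<open>The Rauzy-Veech time reached after \<open>j\<close> Zorich steps. It is a function of
  the path, so \<open>f\<close>, \<open>S\<close> and \<open>T\<close> share it.\<close>

primrec zorich_time :: "(nat \<Rightarrow> 'a::finite iet_perm \<times> nat) \<Rightarrow> nat \<Rightarrow> nat" where
  "zorich_time p 0 = 0"
| "zorich_time p (Suc j) = zorich_time p j + ztime (\<lambda>i. p (zorich_time p j + i))"

abbreviation zorich_step_mat :: "(nat \<Rightarrow> 'a::finite iet_perm \<times> nat) \<Rightarrow> nat \<Rightarrow> real^'a^'a" where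
  "zorich_step_mat p j \<equiv> path_prod p (zorich_time p j) (ztime (\<lambda>i. p (zorich_time p j + i)))"

definition zstep :: "(real^'a) \<times> 'a::finite iet_perm \<Rightarrow> (real^'a) \<times> 'a iet_perm" where
  "zstep q = (istep ^^ ztime (ipath q)) q"

definition rescale :: "real \<Rightarrow> (real^'a) \<times> 'a::finite iet_perm \<Rightarrow> (real^'a) \<times> 'a iet_perm" where
  "rescale c q = (c *\<^sub>R fst q, snd q)"

lemma rot_number_rv: "rot_number ((rv ^^ m) g) = (\<lambda>i. rot_number g (m + i))"
proof
  fix i
  have "(rv ^^ i) ((rv ^^ m) g) = (rv ^^ (m + i)) g" by (metis add.commute comp_apply funpow_add)
  then show "rot_number ((rv ^^ m) g) i = rot_number g (m + i)" unfolding rot_number_def by simp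
qed

lemma zor_time_ztime: "zor_time g = ztime (rot_number g)"
  unfolding zor_time_def ztime_def rot_number_def by simp

lemma zor_iter: "(zor ^^ j) g = (rv ^^ zorich_time (rot_number g) j) g"
proof (induction j)
  case (Suc j)
  have "(zor ^^ Suc j) g = (rv ^^ ztime (rot_number ((rv ^^ zorich_time (rot_number g) j) g))) ((rv ^^ zorich_time (rot_number g) j) g)"
    unfolding funpow.simps comp_apply Suc zor_def[of "(rv ^^ zorich_time (rot_number g) j) g"] zor_time_ztime ..
  also have "\<dots> = (rv ^^ (ztime (\<lambda>i. rot_number g (zorich_time (rot_number g) j + i)) + zorich_time (rot_number g) j)) g"
    unfolding rot_number_rv by (simp add: funpow_add)
  finally show ?case by (simp add: add.commute)
qed simp

lemma zor_matrix_pm: "zor_matrix g = path_prod (rot_number g) 0 (ztime (rot_number g))"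
  unfolding zor_matrix_def zor_time_ztime path_step_def rot_number_def by simp

lemma path_prod_add: "path_prod p n (k + k') = path_prod p n k ** path_prod p (n + k) k'"
  by (induction k') (simp_all add: matrix_mul_assoc add.assoc)

lemma rm_shift: "path_step (\<lambda>i. p (m + i)) = (\<lambda>i. path_step p (m + i))"
  unfolding path_step_def by simp

lemma mat_prod_Bm: "mat_prod (\<lambda>i. zorich_step_mat p (m + i)) k = path_prod p (zorich_time p m) (zorich_time p (m + k) - zorich_time p m) \<and> zorich_time p m \<le> zorich_time p (m + k)"
proof (induction k)
  case (Suc k)
  have z: "zorich_time p (m + Suc k) = zorich_time p (m + k) + ztime (\<lambda>i. p (zorich_time p (m + k) + i))" by simp
  have "zorich_time p (m + Suc k) - zorich_time p m = (zorich_time p (m + k) - zorich_time p m) + ztime (\<lambda>i. p (zorich_time p (m + k) + i))"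
    using Suc unfolding z by simp
  then show ?case using Suc path_prod_add[of p "zorich_time p m" "zorich_time p (m + k) - zorich_time p m"] by simp
qed simp

text \<open>Log-slope vectors move by the height cocycle, which is why the Oseledets splitting
  controls them.\<close>

lemma transpose_pm_om: "transpose (path_prod p 0 n) *v \<omega> = log_slope p \<omega> n"
proof (induction n)
  case (Suc n)
  have "transpose (path_prod p 0 (Suc n)) *v \<omega> = transpose (path_step p n) *v (transpose (path_prod p 0 n) *v \<omega>)"
    by (simp only: mat_prod.simps matrix_transpose_mul matrix_vector_mul_assoc add_0)
  then show ?case using Suc by simp
qed (simp add: transpose_mat)

lemma rescale_iet_istep: assumes "c > 0" shows "istep (rescale c q) = rescale c (istep q)" "itype (rescale c q) = itype q"
proof -
  show i: "itype (rescale c q) = itype q" unfolding itype_def rescale_def using assms by simp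
  have "istate (rescale c q) = istate q" unfolding istate_def i by (simp add: rescale_def)
  then show "istep (rescale c q) = rescale c (istep q)"
    unfolding istep_def i by (simp add: rescale_def vec_eq_iff right_diff_distrib)
qed

lemma rescale_iet_istep_iter: assumes "c > 0" shows "(istep ^^ n) (rescale c q) = rescale c ((istep ^^ n) q)"
  by (induction n) (simp_all add: rescale_iet_istep[OF assms])

lemma rescale_iet_ipath: assumes "c > 0" shows "ipath (rescale c q) = ipath q"
proof
  fix n
  show "ipath (rescale c q) n = ipath q n"
    unfolding ipath_def istate_def rescale_iet_istep_iter[OF assms] rescale_iet_istep(2)[OF assms] by (simp add: rescale_def)
qed

lemma rescale_iet_valid: assumes "c > 0" "valid q" shows "valid (rescale c q)"
  using assms unfolding valid_def rescale_iet_istep_iter[OF assms(1)] by (simp add: rescale_def)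

lemma rescale_iet_zstep: assumes "c > 0" shows "zstep (rescale c q) = rescale c (zstep q)"
  unfolding zstep_def rescale_iet_ipath[OF assms] by (rule rescale_iet_istep_iter[OF assms])

lemma ipath_istep: "ipath ((istep ^^ m) q) = (\<lambda>i. ipath q (m + i))"
proof
  fix i
  have "(istep ^^ i) ((istep ^^ m) q) = (istep ^^ (m + i)) q" by (metis add.commute comp_apply funpow_add)
  then show "ipath ((istep ^^ m) q) i = ipath q (m + i)" unfolding ipath_def by simp
qed

lemma valid_istep: assumes "valid q" shows "valid ((istep ^^ m) q)"
proof -
  let ?T = "iet (fst q) (snd q)"
  note v = valid_iet[OF assms]
  have lpm: "lengths_perm ((rv ^^ m) ?T) = (istep ^^ m) q" and "trans_giet ((rv ^^ m) ?T)"
    using trans_orbit[OF v(1,3)] v(2) by auto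
  then have C: "C1_giet ((rv ^^ m) ?T)" unfolding trans_giet_def by simp
  have "valid_perm (gperm ((rv ^^ m) ?T))" using C unfolding C1_giet_def giet_data_def valid_perm_def by blast
  moreover have "\<And>a. 0 < glen ((rv ^^ m) ?T) $ a" using glen_Hlen(2)[OF C] .
  moreover have "(istep ^^ n) ((istep ^^ m) q) = (istep ^^ (m + n)) q" for n by (metis add.commute comp_apply funpow_add)
  ultimately show ?thesis using assms unfolding valid_def lpm[symmetric] by (simp add: lengths_perm_def)
qed

lemma zstep_iter: "(zstep ^^ j) q = (istep ^^ zorich_time (ipath q) j) q"
proof (induction j)
  case (Suc j)
  have "(zstep ^^ Suc j) q = zstep ((istep ^^ zorich_time (ipath q) j) q)" using Suc by simp
  also have "\<dots> = (istep ^^ (ztime (\<lambda>i. ipath q (zorich_time (ipath q) j + i)) + zorich_time (ipath q) j)) q"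
    unfolding zstep_def ipath_istep by (simp add: funpow_add)
  finally show ?case by (simp add: add.commute)
qed simp

lemma valid_zstep: "valid q \<Longrightarrow> valid ((zstep ^^ j) q)"
  unfolding zstep_iter by (rule valid_istep)

lemma ext_valid:
  assumes "valid (snd y)"
  shows "ext_matrix y = path_prod (ipath (snd y)) 0 (ztime (ipath (snd y)))"
    "Zext y = (matrix_inv (ext_matrix y) *v fst y, zstep (snd y))"
proof -
  obtain \<tau> l \<pi> where y: "y = (\<tau>, l, \<pi>)" by (cases y) auto
  let ?T = "iet l \<pi>"
  note v = valid_iet[OF assms, unfolded y snd_conv fst_conv]
  show m: "ext_matrix y = path_prod (ipath (snd y)) 0 (ztime (ipath (snd y)))"
    unfolding y ext_matrix_def by (simp add: zor_matrix_pm v(5))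
  have "lengths_perm (zor ?T) = zstep (l, \<pi>)"
    unfolding zor_def zor_time_ztime zstep_def using trans_orbit(3)[OF v(1,3)] v(2,5) by simp
  then show "Zext y = (matrix_inv (ext_matrix y) *v fst y, zstep (snd y))"
    unfolding y Zext_def lengths_perm_def ext_matrix_def by simp
qed

lemma Zext_iter:
  assumes "valid (snd y)"
  shows "snd ((Zext ^^ i) y) = (zstep ^^ i) (snd y)"
proof (induction i)
  case (Suc i)
  then show ?case using ext_valid(2)[of "(Zext ^^ i) y"] valid_zstep[OF assms, of i] by simp
qed simp

lemma ext_matrix_iter:
  assumes v: "valid (snd y)" shows "ext_matrix ((Zext ^^ i) y) = zorich_step_mat (ipath (snd y)) i"
proof -
  have "valid (snd ((Zext ^^ i) y))" unfolding Zext_iter[OF v] by (rule valid_zstep[OF v])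
  from ext_valid(1)[OF this] show ?thesis unfolding Zext_iter[OF v] zstep_iter ipath_istep rm_shift by simp
qed

lemma irred_valid_perm: "\<pi> \<in> irred_perms \<Longrightarrow> valid_perm \<pi>"
  unfolding irred_perms_def valid_perm_def by simp

lemma norm_triples_valid:
  assumes "x \<in> norm_triples" shows "valid (snd x)" "vsum (fst (snd x)) = 1" "ext_area x = 1"
proof -
  show "vsum (fst (snd x)) = 1" "ext_area x = 1" using assms unfolding norm_triples_def by auto
  show "valid (snd x)"
    using assms unfolding norm_triples_def ext_triples_def by (auto intro!: inf_renorm_valid irred_valid_perm)
qed

text \<open>\<tau> and the lengths are rescaled independently, and \<open>Zext\<close> commutes with
  both rescalings. Normalizing before or after an iteration makes no difference.\<close>

definition scale3 :: "real \<Rightarrow> real \<Rightarrow> 'a::finite triple \<Rightarrow> 'a triple" where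
  "scale3 a b y = (a *\<^sub>R fst y, rescale b (snd y))"

lemma vsum_scale: "vsum (c *\<^sub>R l) = c * vsum l"
  unfolding vsum_def by (simp add: sum_distrib_left)

lemma normalize_scale3:
  assumes "a > 0" "b > 0" shows "normalize_triple (scale3 a b y) = normalize_triple y"
proof -
  obtain \<tau> l \<pi> where y: "y = (\<tau>, l, \<pi>)" by (cases y) auto
  have "ext_area (a *\<^sub>R \<tau>, b *\<^sub>R l, \<pi>) = a * b * ext_area (\<tau>, l, \<pi>)"
    unfolding ext_area_def using assms by (simp add: matrix_vector_mult_scaleR abs_mult)
  then show ?thesis unfolding y scale3_def rescale_def normalize_triple_def using assms by (simp add: vsum_scale)
qed

lemma normalize_eq_scale3:
  assumes "0 < vsum (fst (snd y))" "0 < ext_area y"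
  shows "normalize_triple y = scale3 (vsum (fst (snd y)) / ext_area y) (1 / vsum (fst (snd y))) y"
  by (cases y) (simp add: normalize_triple_def scale3_def rescale_def)

lemma normalize_norm: assumes "x \<in> norm_triples" shows "normalize_triple x = x"
  using norm_triples_valid[OF assms] by (cases x) (simp add: normalize_triple_def)

lemma Zext_scale3:
  assumes "a > 0" "b > 0" "valid (snd y)" shows "(Zext ^^ i) (scale3 a b y) = scale3 a b ((Zext ^^ i) y)"
proof (induction i)
  case (Suc i)
  let ?z = "(Zext ^^ i) y"
  have v: "valid (snd ?z)" unfolding Zext_iter[OF assms(3)] by (rule valid_zstep[OF assms(3)])
  have v': "valid (snd (scale3 a b ?z))" using rescale_iet_valid[OF assms(2) v] by (simp add: scale3_def)
  have "ext_matrix (scale3 a b ?z) = ext_matrix ?z"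
    unfolding ext_valid(1)[OF v] ext_valid(1)[OF v'] by (simp add: scale3_def rescale_iet_ipath[OF assms(2)])
  then have "Zext (scale3 a b ?z) = scale3 a b (Zext ?z)"
    unfolding ext_valid(2)[OF v] ext_valid(2)[OF v'] by (simp add: scale3_def rescale_iet_zstep[OF assms(2)] matrix_vector_mult_scaleR)
  then show ?case using Suc by simp
qed simp

lemma vsum_valid_pos: "valid q \<Longrightarrow> 0 < vsum (fst q)"
  unfolding valid_def by (intro vsum_pos) auto

section \<open>Times of the acceleration\<close>

locale accel =
  fixes X :: "'a::finite triple set" and N :: "'a triple \<Rightarrow> nat" and x :: "'a triple"
  assumes Xn: "X \<subseteq> norm_triples" and N1: "\<And>x. x \<in> X \<Longrightarrow> 1 \<le> N x \<and> normalize_triple (acc N x) \<in> X"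
    and x: "x \<in> X"
begin

definition "pth = ipath (snd x)"
abbreviation "T n \<equiv> acc_time N x n"
text \<open>Three clocks run side by side: \<open>n\<close> counts steps of the acceleration,
  \<open>T n\<close> Zorich steps, \<open>R n\<close> Rauzy-Veech steps.\<close>

definition "R n = zorich_time pth (T n)"

lemma xn: "x \<in> norm_triples" using x Xn by blast
lemma vx: "valid (snd x)" using norm_triples_valid(1)[OF xn] .

lemma acc_iter: "(acc N ^^ n) x = (Zext ^^ T n) x"
proof (induction n)
  case (Suc n)
  have "(acc N ^^ Suc n) x = (Zext ^^ N (normalize_triple ((acc N ^^ n) x))) ((Zext ^^ T n) x)"
    unfolding funpow.simps comp_apply Suc acc_def[of N "(Zext ^^ T n) x"] ..
  also have "\<dots> = (Zext ^^ (N (normalize_triple ((acc N ^^ n) x)) + T n)) x" by (simp add: funpow_add)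
  finally show ?case by (simp add: acc_time_def add.commute)
qed (simp add: acc_time_def)

text \<open>The hypothesis \<open>N1\<close> speaks of points of \<open>X\<close>, which are
  normalized, while the iterates of \<open>acc\<close> are not. Equivariance of \<open>Zext\<close>
  under rescaling reconciles the two.\<close>

lemma acc_in_X: "normalize_triple ((acc N ^^ n) x) \<in> X"
proof (induction n)
  case 0
  then show ?case using normalize_norm[OF xn] x by simp
next
  case (Suc n)
  let ?y = "(acc N ^^ n) x"
  have vy: "valid (snd ?y)" unfolding acc_iter Zext_iter[OF vx] by (rule valid_zstep[OF vx])
  have v0: "0 < vsum (fst (snd ?y))" using vsum_valid_pos[OF vy] .
  have "ext_area (normalize_triple ?y) = 1" using Suc Xn norm_triples_valid(3) by blast
  \<comment> \<open>A vanishing area would turn the normalized \<tau> into 0, as division by zero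
    gives 0, and the normalized triple could not have area 1.\<close>
  then have "ext_area ?y \<noteq> 0"
    by (cases ?y) (auto simp: normalize_triple_def ext_area_def)
  then have a0: "0 < ext_area ?y" by (cases ?y) (auto simp: ext_area_def)
  let ?a = "vsum (fst (snd ?y)) / ext_area ?y" and ?b = "1 / vsum (fst (snd ?y))"
  have ab: "?a > 0" "?b > 0" using v0 a0 by auto
  note e = normalize_eq_scale3[OF v0 a0]
  have nn: "normalize_triple (normalize_triple ?y) = normalize_triple ?y"
    using normalize_norm Suc Xn by blast
  have "acc N (normalize_triple ?y) = (Zext ^^ N (normalize_triple ?y)) (scale3 ?a ?b ?y)"
    unfolding acc_def[of N "normalize_triple ?y"] nn using e by simp
  also have "\<dots> = scale3 ?a ?b (acc N ?y)" unfolding acc_def[of N ?y] by (rule Zext_scale3[OF ab vy])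
  finally have "normalize_triple (acc N (normalize_triple ?y)) = normalize_triple (acc N ?y)"
    using normalize_scale3[OF ab] by simp
  then show ?case using N1[OF Suc] by simp
qed

lemma T_Suc: "T (Suc n) = T n + N (normalize_triple ((acc N ^^ n) x))" "T n < T (Suc n)"
proof -
  show "T (Suc n) = T n + N (normalize_triple ((acc N ^^ n) x))" by (simp add: acc_time_def)
  then show "T n < T (Suc n)" using N1[OF acc_in_X[of n]] by simp
qed

lemma T_strict: "strict_mono T" using T_Suc(2) by (rule strict_mono_Suc_iff[THEN iffD2, rule_format])

lemma T0: "T 0 = 0" by (simp add: acc_time_def)

lemma T_ge: "n \<le> T n" using strict_mono_imp_increasing[OF T_strict] .

lemma acc_Q_eq: "acc_Q N ((acc N ^^ n) x) = path_prod pth (R n) (R (Suc n) - R n)"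
proof -
  let ?y = "(acc N ^^ n) x"
  have "ext_matrix ((Zext ^^ i) ?y) = zorich_step_mat pth (T n + i)" for i
  proof -
    have "(Zext ^^ i) ?y = (Zext ^^ (T n + i)) x" unfolding acc_iter by (metis add.commute comp_apply funpow_add)
    then show ?thesis using ext_matrix_iter[OF vx] unfolding pth_def by simp
  qed
  then have "acc_Q N ?y = mat_prod (\<lambda>i. zorich_step_mat pth (T n + i)) (N (normalize_triple ?y))" unfolding acc_Q_def by simp
  also have "\<dots> = path_prod pth (R n) (R (Suc n) - R n)"
    using mat_prod_Bm[of pth "T n" "N (normalize_triple ?y)"] unfolding R_def T_Suc(1) by simp
  finally show ?thesis .
qed

lemma R_mono: "m \<le> n \<Longrightarrow> R m \<le> R n"
proof -
  assume "m \<le> n"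
  then have "T m \<le> T n" using T_strict by (simp add: strict_mono_less_eq)
  then show ?thesis unfolding R_def using mat_prod_Bm[of pth "T m" "T n - T m"] by simp
qed

lemma acc_prod_eq: "acc_prod N x m (m + k) = path_prod pth (R m) (R (m + k) - R m)"
proof -
  have "mat_prod (\<lambda>i. acc_Q N ((acc N ^^ (m + i)) x)) k = path_prod pth (R m) (R (m + k) - R m)"
  proof (induction k)
    case (Suc k)
    have le: "R m \<le> R (m + k)" "R (m + k) \<le> R (Suc (m + k))" using R_mono[of m "m + k"] R_mono[of "m + k" "Suc (m + k)"] by auto
    then have e: "R (m + Suc k) - R m = (R (m + k) - R m) + (R (Suc (m + k)) - R (m + k))" "R m + (R (m + k) - R m) = R (m + k)" by auto
    show ?case unfolding mat_prod.simps Suc e(1) path_prod_add e(2) by (simp only: acc_Q_eq)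
  qed simp
  then show ?thesis unfolding acc_prod_def by simp
qed

lemma acc_lambda_eq: "acc_lambda N x n = fst ((istep ^^ R n) (snd x))"
  unfolding acc_lambda_def acc_iter Zext_iter[OF vx] zstep_iter R_def pth_def ..

lemma R0: "R 0 = 0" unfolding R_def T0 by simp

end

section \<open>The forward half of a two-sided orbit\<close>

lemma two_sided_forward:
  assumes o: "two_sided_orbit x xs"
  shows "\<exists>c>0. snd (xs (int i)) = rescale c ((zstep ^^ i) (snd x))"
proof (induction i)
  case 0
  then show ?case using o unfolding two_sided_orbit_def by (intro exI[of _ 1]) (simp add: rescale_def)
next
  case (Suc i)
  have xn: "xs k \<in> norm_triples" for k using o unfolding two_sided_orbit_def by blast
  have st: "xs (int i + 1) = Zext_norm (xs (int i))" using o unfolding two_sided_orbit_def by blast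
  obtain c where c: "c > 0" "snd (xs (int i)) = rescale c ((zstep ^^ i) (snd x))" using Suc by blast
  let ?y = "xs (int i)"
  note vy = norm_triples_valid(1)[OF xn[of "int i"]]
  define d where "d = vsum (matrix_inv (ext_matrix ?y) *v fst (snd ?y))"
  have z: "snd (Zext_norm ?y) = rescale (1 / d) (zstep (snd ?y))"
    unfolding Zext_norm_def ext_valid(2)[OF vy] Let_def d_def by (cases ?y) (simp add: rescale_def split: prod.split)
  have pos: "0 < vsum (fst (zstep (snd ?y)))" using vsum_valid_pos[OF valid_zstep[OF vy, of 1]] by simp
  have "vsum (fst (snd (xs (int i + 1)))) = 1" using norm_triples_valid(2)[OF xn] .
  then have "(1 / d) * vsum (fst (zstep (snd ?y))) = 1" unfolding st z rescale_def by (simp add: vsum_scale)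
  \<comment> \<open>The factor \<open>d\<close> comes from a matrix inverse and has no evident sign.
    It is positive because the total length equals 1 along the orbit and \<open>zstep\<close> keeps
    lengths positive.\<close>
  then have d: "0 < 1 / d" using pos by (metis zero_less_mult_pos2 zero_less_one)
  have "snd (xs (int (Suc i))) = rescale (1 / d) (rescale c ((zstep ^^ Suc i) (snd x)))"
    using z st c rescale_iet_zstep[OF c(1), of "(zstep ^^ i) (snd x)"] by (simp add: add.commute)
  also have "\<dots> = rescale (1 / d * c) ((zstep ^^ Suc i) (snd x))" by (simp add: rescale_def)
  finally show ?case using d c(1) by (intro exI[of _ "1 / d * c"]) (simp add: zero_less_mult_iff)
qed

lemma two_sided_matrix:
  assumes o: "two_sided_orbit x xs"
  shows "ext_matrix (xs (int i)) = zorich_step_mat (ipath (snd x)) i"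
proof -
  have xn: "xs k \<in> norm_triples" for k using o unfolding two_sided_orbit_def by blast
  obtain c where c: "c > 0" "snd (xs (int i)) = rescale c ((zstep ^^ i) (snd x))" using two_sided_forward[OF o] by blast
  have "ipath (snd (xs (int i))) = (\<lambda>k. ipath (snd x) (zorich_time (ipath (snd x)) i + k))"
    unfolding c(2) rescale_iet_ipath[OF c(1)] zstep_iter ipath_istep ..
  then show ?thesis using ext_valid(1)[OF norm_triples_valid(1)[OF xn[of "int i"]]] by (simp add: rm_shift)
qed

lemma height_cocycle_pm:
  assumes o: "two_sided_orbit x xs"
  shows "height_cocycle xs (int j) m = transpose (path_prod (ipath (snd x)) (zorich_time (ipath (snd x)) j) (zorich_time (ipath (snd x)) (j + m) - zorich_time (ipath (snd x)) j))"
proof -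
  have "ext_matrix (xs (int j + int i)) = zorich_step_mat (ipath (snd x)) (j + i)" for i
    using two_sided_matrix[OF o, of "j + i"] by simp
  then show ?thesis unfolding height_cocycle_def using mat_prod_Bm[of "ipath (snd x)" j m] by simp
qed

section \<open>Growth in an Oseledets basis\<close>

text \<open>A crude form of Hadamard's inequality. The factorial is harmless, since it will be
  compared with exponential rates.\<close>

lemma det_norm_bound:
  fixes A :: "real^'n^'n"
  shows "\<bar>det A\<bar> \<le> fact CARD('n) * (\<Prod>j\<in>UNIV. norm (column j A))"
proof -
  let ?U = "UNIV :: 'n set"
  have "\<bar>det A\<bar> \<le> (\<Sum>p\<in>{p. p permutes ?U}. \<bar>of_int (sign p) * (\<Prod>i\<in>?U. A $ i $ p i)\<bar>)"
    unfolding det_def by (rule sum_abs)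
  also have "\<dots> \<le> (\<Sum>p\<in>{p. p permutes ?U}. (\<Prod>j\<in>?U. norm (column j A)))"
  proof (rule sum_mono)
    fix p assume "p \<in> {p. p permutes ?U}"
    then have p: "p permutes ?U" by simp
    have "\<bar>of_int (sign p) * (\<Prod>i\<in>?U. A $ i $ p i)\<bar> = (\<Prod>i\<in>?U. \<bar>A $ i $ p i\<bar>)"
      by (simp add: abs_mult abs_prod sign_def)
    also have "\<dots> \<le> (\<Prod>i\<in>?U. norm (column (p i) A))"
    proof (intro prod_mono conjI)
      fix i show "\<bar>A $ i $ p i\<bar> \<le> norm (column (p i) A)"
        using component_le_norm_cart[of "column (p i) A" i] by (simp add: column_def)
    qed simp
    also have "\<dots> = (\<Prod>j\<in>?U. norm (column j A))"
      using prod.permute[OF p, of "\<lambda>j. norm (column j A)"] by (simp add: o_def)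
    finally show "\<bar>of_int (sign p) * (\<Prod>i\<in>?U. A $ i $ p i)\<bar> \<le> (\<Prod>j\<in>?U. norm (column j A))" .
  qed
  also have "\<dots> = fact CARD('n) * (\<Prod>j\<in>?U. norm (column j A))"
    using card_permutations[of ?U "CARD('n)"] by simp
  finally show ?thesis .
qed

section \<open>Exponential growth rates\<close>

lemma eventually_bound:
  fixes f g :: "nat \<Rightarrow> real"
  assumes "eventually (\<lambda>m. f m \<le> g m) sequentially" "\<And>m. 0 < g m"
  shows "\<exists>C>0. \<forall>m. f m \<le> C * g m"
proof -
  obtain m0 where m0: "\<And>m. m \<ge> m0 \<Longrightarrow> f m \<le> g m" using assms(1) unfolding eventually_sequentially by blast
  let ?C = "1 + (\<Sum>m<m0. \<bar>f m\<bar> / g m)"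
  have nn: "0 \<le> (\<Sum>m<m0. \<bar>f m\<bar> / g m)" by (intro sum_nonneg) (simp add: assms(2) less_imp_le)
  have "f m \<le> ?C * g m" for m
  proof (cases "m < m0")
    case True
    then have "\<bar>f m\<bar> / g m \<le> (\<Sum>m<m0. \<bar>f m\<bar> / g m)" by (intro member_le_sum) (auto simp: assms(2) less_imp_le)
    then have "\<bar>f m\<bar> \<le> (\<Sum>m<m0. \<bar>f m\<bar> / g m) * g m" using assms(2)[of m] by (simp add: field_simps)
    then show ?thesis using assms(2)[of m] by (simp add: distrib_right)
  next
    case False
    then have "f m \<le> 1 * g m" using m0 by simp
    also have "\<dots> \<le> ?C * g m" using nn assms(2)[of m] by (intro mult_right_mono) auto
    finally show ?thesis .
  qed
  then show ?thesis using nn by (intro exI[of _ ?C]) auto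
qed

lemma ln_rate_bound:
  fixes f :: "nat \<Rightarrow> real"
  assumes lim: "(\<lambda>m. ln (f m) / real m) \<longlonglongrightarrow> \<theta>" and "0 < \<epsilon>" and nn: "\<And>m. 0 \<le> f m"
  shows "\<exists>C>0. \<forall>m. f m \<le> C * exp ((\<theta> + \<epsilon>) * real m)"
proof (rule eventually_bound)
  have "eventually (\<lambda>m. ln (f m) / real m < \<theta> + \<epsilon>) sequentially" using order_tendstoD(2)[OF lim] assms(2) by simp
  then show "eventually (\<lambda>m. f m \<le> exp ((\<theta> + \<epsilon>) * real m)) sequentially"
    using eventually_gt_at_top[of 0]
  proof eventually_elim
    case (elim m)
    show ?case
    proof (cases "f m = 0")
      case False
      then have "0 < f m" using nn[of m] by simp
      moreover have "ln (f m) \<le> (\<theta> + \<epsilon>) * real m" using elim by (simp add: field_simps)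
      ultimately show ?thesis by (metis exp_le_cancel_iff exp_ln)
    qed simp
  qed
qed simp

text \<open>Upper exponential growth rate at most \<open>\<theta>\<close>. The loss
  \<open>\<epsilon>\<close> is what a limit of \<open>ln (f m) / m\<close> provides, and it makes
  the notion stable under sums and linear combinations.\<close>

definition subexp :: "real \<Rightarrow> (nat \<Rightarrow> real) \<Rightarrow> bool" where
  "subexp \<theta> f \<longleftrightarrow> (\<forall>\<epsilon>>0. \<exists>C>0. \<forall>m. f m \<le> C * exp ((\<theta> + \<epsilon>) * real m))"

lemma subexp_lim: "(\<lambda>m. ln (f m) / real m) \<longlonglongrightarrow> \<theta> \<Longrightarrow> (\<And>m. 0 \<le> f m) \<Longrightarrow> subexp \<theta> f"
  unfolding subexp_def using ln_rate_bound by blast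

lemma subexp_add:
  assumes "subexp \<theta> f" "subexp \<theta> g" "\<And>m. h m \<le> f m + g m" shows "subexp \<theta> h"
  unfolding subexp_def
proof (intro allI impI)
  fix \<epsilon> :: real assume "\<epsilon> > 0"
  then obtain C D where C: "C > 0" "\<And>m. f m \<le> C * exp ((\<theta> + \<epsilon>) * real m)"
    "D > 0" "\<And>m. g m \<le> D * exp ((\<theta> + \<epsilon>) * real m)" using assms(1,2) unfolding subexp_def by meson
  have "h m \<le> (C + D) * exp ((\<theta> + \<epsilon>) * real m)" for m
    using assms(3)[of m] C(2)[of m] C(4)[of m] by (simp add: distrib_right)
  then show "\<exists>C>0. \<forall>m. h m \<le> C * exp ((\<theta> + \<epsilon>) * real m)" using C by (intro exI[of _ "C + D"]) auto
qed

lemma subexp_scale: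
  assumes "subexp \<theta> f" "0 \<le> a" "\<And>m. h m \<le> a * f m" shows "subexp \<theta> h"
  unfolding subexp_def
proof (intro allI impI)
  fix \<epsilon> :: real assume "\<epsilon> > 0"
  then obtain C where C: "C > 0" "\<And>m. f m \<le> C * exp ((\<theta> + \<epsilon>) * real m)" using assms(1) unfolding subexp_def by meson
  have "h m \<le> ((a + 1) * C) * exp ((\<theta> + \<epsilon>) * real m)" for m
  proof -
    have "h m \<le> a * (C * exp ((\<theta> + \<epsilon>) * real m))" using assms(2,3) C(2) by (meson mult_left_mono order_trans)
    also have "\<dots> \<le> (a + 1) * (C * exp ((\<theta> + \<epsilon>) * real m))" using C(1) by (intro mult_right_mono) auto
    finally show ?thesis by (simp add: mult.assoc)
  qed
  then show "\<exists>C>0. \<forall>m. h m \<le> C * exp ((\<theta> + \<epsilon>) * real m)" using C assms(2) by (intro exI[of _ "(a + 1) * C"]) auto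
qed

lemma subexp_shift:
  assumes "subexp \<theta> (\<lambda>m. f (j + m))" shows "subexp \<theta> f"
  unfolding subexp_def
proof (intro allI impI)
  fix \<epsilon> :: real assume "\<epsilon> > 0"
  then obtain C where C: "C > 0" "\<And>m. f (j + m) \<le> C * exp ((\<theta> + \<epsilon>) * real m)" using assms unfolding subexp_def by meson
  let ?K = "C * exp (- (\<theta> + \<epsilon>) * real j)"
  have "f m \<le> ?K * exp ((\<theta> + \<epsilon>) * real m)" if "m \<ge> j" for m
  proof -
    have "f m \<le> C * exp ((\<theta> + \<epsilon>) * real (m - j))" using C(2)[of "m - j"] that by simp
    also have "(\<theta> + \<epsilon>) * real (m - j) = - (\<theta> + \<epsilon>) * real j + (\<theta> + \<epsilon>) * real m" using that by (simp add: of_nat_diff algebra_simps)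
    finally show ?thesis by (simp only: exp_add mult.assoc)
  qed
  then have "eventually (\<lambda>m. f m \<le> ?K * exp ((\<theta> + \<epsilon>) * real m)) sequentially"
    unfolding eventually_sequentially by blast
  from eventually_bound[OF this] C(1) obtain C' where "C' > 0" "\<And>m. f m \<le> C' * (?K * exp ((\<theta> + \<epsilon>) * real m))" by auto
  then show "\<exists>C>0. \<forall>m. f m \<le> C * exp ((\<theta> + \<epsilon>) * real m)"
    using C(1) by (intro exI[of _ "C' * ?K"]) (auto simp: mult.assoc)
qed

lemma subexp_span:
  fixes P :: "nat \<Rightarrow> real^'a::finite^'a"
  assumes "v \<in> span S" "\<And>w. w \<in> S \<Longrightarrow> subexp \<theta> (\<lambda>m. norm (P m *v w))"
  shows "subexp \<theta> (\<lambda>m. norm (P m *v v))"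
  using assms(1)
proof (induction rule: span_induct_alt)
  case base
  show ?case unfolding subexp_def by (auto intro: exI[of _ 1])
next
  case (step c x y)
  have "subexp \<theta> (\<lambda>m. norm (P m *v (c *\<^sub>R x)))"
    by (rule subexp_scale[OF assms(2)[OF step(1)], of "\<bar>c\<bar>"]) (simp_all add: matrix_vector_mult_scaleR)
  then show ?case
    by (rule subexp_add[OF _ step(2)]) (simp add: matrix_vector_right_distrib norm_triangle_ineq)
qed

text \<open>The part of the Oseledets theorem that enters the estimates: a basis with upper bounds
  on its growth, set against unit determinants by the condition \<open>total\<close> on the sum of
  the rates.\<close>

locale exp_basis =
  fixes P :: "nat \<Rightarrow> real^'a::finite^'a" and b :: "'a \<Rightarrow> real^'a" and \<theta> :: "'a \<Rightarrow> real"
  assumes det1: "\<bar>det (P m)\<bar> = 1" and indep: "det (\<chi> i j. b j $ i) \<noteq> 0"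
    and rate: "subexp (\<theta> i) (\<lambda>m. norm (P m *v b i))" and total: "(\<Sum>i\<in>UNIV. \<theta> i) \<le> 0"
begin

definition "M = (\<chi> i j. b j $ i)"
definition "coef v = matrix_inv M *v v"

lemma M_inv: "M ** matrix_inv M = mat 1"
proof -
  have "invertible M" using indep invertible_det_nz unfolding M_def by blast
  then show ?thesis unfolding matrix_inv_def invertible_def by (rule someI2_ex) blast
qed

lemma coef: "M *v coef v = v" "v = (\<Sum>i\<in>UNIV. coef v $ i *\<^sub>R b i)"
proof -
  show 1: "M *v coef v = v" unfolding coef_def by (simp add: matrix_vector_mul_assoc M_inv)
  have "M *v coef v = (\<Sum>i\<in>UNIV. coef v $ i *\<^sub>R b i)"
    unfolding M_def matrix_vector_mult_def by (simp add: vec_eq_iff mult.commute)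
  then show "v = (\<Sum>i\<in>UNIV. coef v $ i *\<^sub>R b i)" using 1 by simp
qed

lemma coef_diff: "coef (v - w) = coef v - coef w"
  unfolding coef_def by (simp add: matrix_vector_mult_diff_distrib)

lemma column_PM: "column j (P m ** M) = P m *v b j"
  unfolding column_def matrix_matrix_mult_def matrix_vector_mult_def M_def by simp

text \<open>Upper bounds on growth become lower bounds by Cramer's rule. The coordinate is a
  determinant in which column \<open>i\<close> is replaced by the image of \<open>v\<close>; the
  other columns grow at rates whose sum is at most \<open>- \<theta> i\<close>, and the denominator
  has constant modulus.\<close>

lemma coef_bound:
  assumes "0 < \<epsilon>"
  shows "\<exists>K>0. \<forall>m v i. \<bar>coef v $ i\<bar> \<le> K * exp ((- \<theta> i + \<epsilon>) * real m) * norm (P m *v v)"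
proof -
  define d where "d = real CARD('a)"
  have d: "1 \<le> d" unfolding d_def by (simp add: Suc_leI)
  \<comment> \<open>Each of the fewer than \<open>d\<close> remaining columns may lose
    \<open>\<epsilon> / d\<close>, so the total loss stays below \<open>\<epsilon>\<close>.\<close>
  have ed: "0 < \<epsilon> / d" using d assms by simp
  have "\<exists>C>0. \<forall>m. norm (P m *v b i) \<le> C * exp ((\<theta> i + \<epsilon> / d) * real m)" for i
    using rate[of i] ed unfolding subexp_def by blast
  then obtain C where C: "\<And>i. C i > 0" "\<And>i m. norm (P m *v b i) \<le> C i * exp ((\<theta> i + \<epsilon> / d) * real m)" by metis
  define CC where "CC = (\<Sum>i\<in>UNIV. (\<Prod>j\<in>UNIV - {i}. C j))"
  have CC: "0 < CC" "(\<Prod>j\<in>UNIV - {i}. C j) \<le> CC" for i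
  proof -
    show "0 < CC" unfolding CC_def by (intro sum_pos prod_pos) (auto simp: C(1))
    show "(\<Prod>j\<in>UNIV - {i}. C j) \<le> CC" unfolding CC_def
      by (intro member_le_sum[of i UNIV "\<lambda>i. (\<Prod>j\<in>UNIV - {i}. C j)"]) (auto intro!: prod_nonneg simp: C(1) less_imp_le)
  qed
  define K where "K = fact CARD('a) * CC / \<bar>det M\<bar>"
  have dM: "det M \<noteq> 0" using indep unfolding M_def .
  have K: "0 < K" unfolding K_def using CC dM by simp
  have "\<bar>coef v $ i\<bar> \<le> K * exp ((- \<theta> i + \<epsilon>) * real m) * norm (P m *v v)" for m v i
  proof -
    let ?A = "P m ** M"
    have detA: "\<bar>det ?A\<bar> = \<bar>det M\<bar>" by (simp add: det_mul abs_mult det1)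
    then have "det ?A \<noteq> 0" using dM by auto
    moreover have "?A *v coef v = P m *v v" by (simp add: matrix_vector_mul_assoc[symmetric] coef(1))
    ultimately have cf: "coef v = (\<chi> k. det (\<chi> i j. if j = k then (P m *v v) $ i else ?A $ i $ j) / det ?A)"
      using cramer by blast
    then have "coef v $ i = det (\<chi> i' j. if j = i then (P m *v v) $ i' else ?A $ i' $ j) / det ?A"
      using arg_cong[OF cf, of "\<lambda>w. w $ i"] by simp
    then have ce: "\<bar>coef v $ i\<bar> = \<bar>det (\<chi> i' j. if j = i then (P m *v v) $ i' else ?A $ i' $ j)\<bar> / \<bar>det M\<bar>"
      using detA by (simp add: abs_divide)
    let ?B = "\<chi> i' j. if j = i then (P m *v v) $ i' else ?A $ i' $ j"
    have cols: "column j ?B = (if j = i then P m *v v else P m *v b j)" for j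
      using column_PM[of j m] unfolding column_def by (simp add: vec_eq_iff)
    have "(\<Prod>j\<in>UNIV. norm (column j ?B)) = norm (P m *v v) * (\<Prod>j\<in>UNIV - {i}. norm (P m *v b j))"
      unfolding cols by (subst prod.remove[of _ i]) (auto intro!: prod.cong)
    also have "\<dots> \<le> norm (P m *v v) * (\<Prod>j\<in>UNIV - {i}. C j * exp ((\<theta> j + \<epsilon> / d) * real m))"
      by (intro mult_left_mono prod_mono conjI C(2)) auto
    also have "(\<Prod>j\<in>UNIV - {i}. C j * exp ((\<theta> j + \<epsilon> / d) * real m)) =
       (\<Prod>j\<in>UNIV - {i}. C j) * exp (\<Sum>j\<in>UNIV - {i}. (\<theta> j + \<epsilon> / d) * real m)"
      by (simp add: prod.distrib exp_sum)
    also have "(\<Sum>j\<in>UNIV - {i}. (\<theta> j + \<epsilon> / d) * real m) = ((\<Sum>j\<in>UNIV - {i}. \<theta> j) + (d - 1) * (\<epsilon> / d)) * real m"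
      unfolding sum_distrib_right[symmetric] sum.distrib by (simp add: d_def of_nat_diff Suc_leI card_Diff_singleton)
    also have "(\<Sum>j\<in>UNIV - {i}. \<theta> j) = (\<Sum>j\<in>UNIV. \<theta> j) - \<theta> i" by (simp add: sum_diff1)
    also have "norm (P m *v v) * ((\<Prod>j\<in>UNIV - {i}. C j) * exp ((((\<Sum>j\<in>UNIV. \<theta> j) - \<theta> i) + (d - 1) * (\<epsilon> / d)) * real m))
       \<le> norm (P m *v v) * (CC * exp ((- \<theta> i + \<epsilon>) * real m))"
    proof (intro mult_left_mono mult_mono CC(2))
      have "(d - 1) * (\<epsilon> / d) \<le> \<epsilon>" using d assms by (simp add: field_simps)
      then show "exp ((((\<Sum>j\<in>UNIV. \<theta> j) - \<theta> i) + (d - 1) * (\<epsilon> / d)) * real m) \<le> exp ((- \<theta> i + \<epsilon>) * real m)"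
        using total by (auto intro!: mult_right_mono)
    qed (use CC(1) in \<open>auto intro: less_imp_le\<close>)
    finally have "\<bar>det ?B\<bar> \<le> fact CARD('a) * (norm (P m *v v) * (CC * exp ((- \<theta> i + \<epsilon>) * real m)))"
      using det_norm_bound[of ?B] by (meson fact_ge_zero mult_left_mono order_trans)
    then have "\<bar>det ?B\<bar> / \<bar>det M\<bar> \<le> fact CARD('a) * (norm (P m *v v) * (CC * exp ((- \<theta> i + \<epsilon>) * real m))) / \<bar>det M\<bar>"
      by (rule divide_right_mono) simp
    then show ?thesis unfolding ce K_def by (simp add: mult_ac)
  qed
  then show ?thesis using K by blast
qed

text \<open>A coordinate of positive exponent would force exponential growth of the whole
  vector.\<close>

lemma coef_zero:
  assumes "subexp 0 (\<lambda>m. norm (P m *v v))" "0 < \<theta> i"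
  shows "coef v $ i = 0"
proof -
  \<comment> \<open>One third of the exponent is lost in the bound for the coordinate and one third
    in the growth of the vector; the last third still decays.\<close>
  have e: "0 < \<theta> i / 3" using assms(2) by simp
  obtain K where K: "K > 0" "\<And>m v j. \<bar>coef v $ j\<bar> \<le> K * exp ((- \<theta> j + \<theta> i / 3) * real m) * norm (P m *v v)"
    using coef_bound[OF e] by blast
  obtain C where C: "C > 0" "\<And>m. norm (P m *v v) \<le> C * exp ((0 + \<theta> i / 3) * real m)"
    using assms(1) e unfolding subexp_def by meson
  have b: "\<bar>coef v $ i\<bar> \<le> K * C * exp (- (\<theta> i / 3)) ^ m" for m
  proof -
    have "\<bar>coef v $ i\<bar> \<le> K * exp ((- \<theta> i + \<theta> i / 3) * real m) * (C * exp ((0 + \<theta> i / 3) * real m))"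
      by (rule order_trans[OF K(2)[where m=m] mult_left_mono[OF C(2)]]) (use K(1) in simp)
    also have "\<dots> = K * C * exp ((- \<theta> i + \<theta> i / 3) * real m + (0 + \<theta> i / 3) * real m)" by (simp only: exp_add mult_ac)
    also have "(- \<theta> i + \<theta> i / 3) * real m + (0 + \<theta> i / 3) * real m = real m * (- (\<theta> i / 3))" by (simp add: field_simps)
    finally show ?thesis by (simp only: exp_of_nat_mult)
  qed
  have "(\<lambda>m. K * C * exp (- (\<theta> i / 3)) ^ m) \<longlonglongrightarrow> K * C * 0"
    using assms(2) by (intro tendsto_mult_left LIMSEQ_realpow_zero) auto
  then have "\<bar>coef v $ i\<bar> \<le> K * C * 0" using b by (intro LIMSEQ_le_const) auto
  then show ?thesis by simp
qed

lemma norm_coef: "norm (P m *v v) \<le> (\<Sum>i\<in>UNIV. \<bar>coef v $ i\<bar> * norm (P m *v b i))"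
proof -
  have "P m *v v = P m *v (\<Sum>i\<in>UNIV. coef v $ i *\<^sub>R b i)" by (rule arg_cong[OF coef(2)])
  also have "\<dots> = (\<Sum>i\<in>UNIV. coef v $ i *\<^sub>R (P m *v b i))"
    by (simp only: linear_sum[OF matrix_vector_mul_linear] matrix_vector_mult_scaleR)
  finally have e: "P m *v v = (\<Sum>i\<in>UNIV. coef v $ i *\<^sub>R (P m *v b i))" .
  show ?thesis by (subst e, rule order_trans[OF norm_sum]) simp
qed

text \<open>Along the orbit, the stable coefficients of \<open>\<eta>\<close> contract by themselves, the unstable ones vanish,
  and the central ones converge; their limits vanish because of the returns.\<close>

lemma central_decay:
  assumes eta: "\<And>j. subexp 0 (\<lambda>m. norm (P m *v \<eta> j))"
    and inc: "\<And>j. norm (P (Suc j) *v (\<eta> (Suc j) - \<eta> j)) \<le> C0 * c ^ j" and c: "0 < c" "c < 1"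
    and ret: "\<And>j0. \<exists>j\<ge>j0. norm (P j *v \<eta> j) \<le> C0 * c ^ j"
  shows "\<exists>C>0. \<exists>\<rho>. 0 < \<rho> \<and> \<rho> < 1 \<and> (\<forall>j. norm (P j *v \<eta> j) \<le> C * \<rho> ^ j)"
proof -
  have C0: "0 \<le> C0" using order_trans[OF norm_ge_zero inc[of 0]] by simp
  \<comment> \<open>With this choice \<open>c * exp \<epsilon>\<close> is the square root of
    \<open>c\<close>, so the loss in the bounds on coordinates leaves exponential decay.\<close>
  define \<epsilon> where "\<epsilon> = - ln c / 2"
  have e: "0 < \<epsilon>" using c unfolding \<epsilon>_def by simp
  define c1 where "c1 = c * exp \<epsilon>"
  have c1: "0 < c1" "c1 < 1"
  proof -
    show "0 < c1" unfolding c1_def using c by simp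
    have "ln c1 < 0" unfolding c1_def using c by (simp add: ln_mult \<epsilon>_def)
    then show "c1 < 1" using \<open>0 < c1\<close> by simp
  qed
  obtain K where K: "K > 0" "\<And>m v i. \<bar>coef v $ i\<bar> \<le> K * exp ((- \<theta> i + \<epsilon>) * real m) * norm (P m *v v)"
    using coef_bound[OF e] by blast
  have Kb: "\<bar>coef v $ i\<bar> * exp (\<theta> i * real m) \<le> K * C0 * c1 ^ m" if "norm (P m *v v) \<le> C0 * c ^ m" for v i m
  proof -
    have "\<bar>coef v $ i\<bar> \<le> K * exp ((- \<theta> i + \<epsilon>) * real m) * (C0 * c ^ m)"
      by (rule order_trans[OF K(2)[where m=m] mult_left_mono[OF that]]) (use K(1) in simp)
    then have "\<bar>coef v $ i\<bar> * exp (\<theta> i * real m) \<le> K * exp ((- \<theta> i + \<epsilon>) * real m) * (C0 * c ^ m) * exp (\<theta> i * real m)"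
      by (rule mult_right_mono) simp
    also have "\<dots> = K * C0 * (c ^ m * (exp ((- \<theta> i + \<epsilon>) * real m) * exp (\<theta> i * real m)))" by (simp only: mult_ac)
    also have "exp ((- \<theta> i + \<epsilon>) * real m) * exp (\<theta> i * real m) = exp (real m * \<epsilon>)"
      unfolding exp_add[symmetric] by (simp add: algebra_simps)
    also have "c ^ m * exp (real m * \<epsilon>) = c1 ^ m" unfolding c1_def by (simp add: exp_of_nat_mult power_mult_distrib)
    finally show ?thesis .
  qed
  define a where "a i j = coef (\<eta> j) $ i" for i j
  define K1 where "K1 = (\<Sum>i\<in>UNIV. K * C0 / c * exp (\<bar>\<theta> i\<bar>))"
  have step: "\<bar>a i (Suc j) - a i j\<bar> * exp (\<theta> i * real (Suc j)) \<le> K * C0 / c * c1 ^ Suc j" for i j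
  proof -
    have "norm (P (Suc j) *v (\<eta> (Suc j) - \<eta> j)) \<le> (C0 / c) * c ^ Suc j" using inc[of j] c by simp
    moreover have "0 \<le> C0 / c" using C0 c by simp
    ultimately have "\<bar>coef (\<eta> (Suc j) - \<eta> j) $ i\<bar> \<le> K * exp ((- \<theta> i + \<epsilon>) * real (Suc j)) * ((C0 / c) * c ^ Suc j)"
      by (intro order_trans[OF K(2)[where m="Suc j"] mult_left_mono]) (use K(1) in auto)
    then have "\<bar>coef (\<eta> (Suc j) - \<eta> j) $ i\<bar> * exp (\<theta> i * real (Suc j)) \<le> K * exp ((- \<theta> i + \<epsilon>) * real (Suc j)) * ((C0 / c) * c ^ Suc j) * exp (\<theta> i * real (Suc j))"
      by (rule mult_right_mono) simp
    also have "\<dots> = K * (C0 / c) * (c ^ Suc j * (exp ((- \<theta> i + \<epsilon>) * real (Suc j)) * exp (\<theta> i * real (Suc j))))" by (simp only: mult_ac)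
    also have "exp ((- \<theta> i + \<epsilon>) * real (Suc j)) * exp (\<theta> i * real (Suc j)) = exp (real (Suc j) * \<epsilon>)"
      unfolding exp_add[symmetric] by (simp add: algebra_simps)
    also have "c ^ Suc j * exp (real (Suc j) * \<epsilon>) = c1 ^ Suc j" unfolding c1_def exp_of_nat_mult power_mult_distrib ..
    finally show ?thesis unfolding a_def by (simp add: coef_diff)
  qed
  define L where "L = K * C0 / c"
  have L: "0 \<le> L" unfolding L_def using K(1) C0 c by simp
  have "\<exists>M\<ge>0. \<exists>\<rho>. 0 < \<rho> \<and> \<rho> < 1 \<and> (\<forall>j. \<bar>a i j\<bar> * exp (\<theta> i * real j) \<le> M * \<rho> ^ j)" for i
  proof -
    consider "\<theta> i > 0" | "\<theta> i = 0" | "\<theta> i < 0" by linarith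
    then show ?thesis
    proof cases
      case 1
      then have "a i j = 0" for j unfolding a_def using coef_zero[OF eta] by blast
      then show ?thesis by (intro exI[of _ 0] conjI exI[of _ "1/2"]) auto
    next
      case 2
      have st: "\<bar>a i (Suc j) - a i j\<bar> \<le> L * c1 ^ Suc j" for j using step[of i j] 2 by (simp add: L_def)
      have tele: "\<bar>a i (j + k) - a i j\<bar> \<le> L * c1 ^ j / (1 - c1)" for j k
      proof -
        have "\<bar>a i (j + k) - a i j\<bar> \<le> (\<Sum>t<k. L * c1 ^ (Suc (j + t)))"
        proof (induction k)
          case (Suc k)
          then show ?case using st[of "j + k"] by simp
        qed simp
        also have "\<dots> = L * c1 ^ Suc j * (\<Sum>t<k. c1 ^ t)" by (simp add: sum_distrib_left power_add mult_ac)
        also have "\<dots> \<le> L * c1 ^ j * (1 / (1 - c1))"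
        proof (intro mult_mono mult_left_mono)
          show "c1 ^ Suc j \<le> c1 ^ j" using c1 by (simp add: mult_left_le_one_le)
          show "(\<Sum>t<k. c1 ^ t) \<le> 1 / (1 - c1)" using sum_le_suminf[OF summable_geometric, of c1 "{..<k}"] suminf_geometric[of c1] c1 by simp
        qed (use L c1 in \<open>auto intro!: sum_nonneg\<close>)
        finally show ?thesis by simp
      qed
      \<comment> \<open>Comparison with a later return \<open>g\<close>, at which the coordinate is
        small, shows that the limit is zero; what remains is the geometric tail of the
        increments.\<close>
      have "\<bar>a i j\<bar> \<le> L * c1 ^ j / (1 - c1)" for j
      proof (rule field_le_epsilon)
        fix \<delta> :: real assume d: "0 < \<delta>"
        have "(\<lambda>g. K * C0 * c1 ^ g) \<longlonglongrightarrow> K * C0 * 0" using c1 by (intro tendsto_mult_left LIMSEQ_realpow_zero) auto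
        then have "eventually (\<lambda>g. K * C0 * c1 ^ g < \<delta>) sequentially" using d by (intro order_tendstoD(2)) auto
        then obtain g0 where g0: "\<And>g. g \<ge> g0 \<Longrightarrow> K * C0 * c1 ^ g < \<delta>" unfolding eventually_sequentially by blast
        obtain g where g: "g \<ge> max j g0" "norm (P g *v \<eta> g) \<le> C0 * c ^ g" using ret by blast
        have "\<bar>a i g\<bar> \<le> K * C0 * c1 ^ g" using Kb[OF g(2), of i] 2 unfolding a_def by simp
        moreover have "\<bar>a i (j + (g - j)) - a i j\<bar> \<le> L * c1 ^ j / (1 - c1)" by (rule tele)
        ultimately show "\<bar>a i j\<bar> \<le> L * c1 ^ j / (1 - c1) + \<delta>" using g(1) g0[of g] by simp
      qed
      then show ?thesis using c1 L 2 by (intro exI[of _ "L / (1 - c1)"] conjI exI[of _ c1]) auto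
    next
      case 3
      \<comment> \<open>The rate lies strictly between 1 and the larger of \<open>c1\<close> and
        \<open>exp (\<theta> i)\<close>, and \<open>M\<close> is taken large enough for the
        recursion to close: \<open>M * exp (\<theta> i) + L \<le> M * \<rho>\<close>.\<close>
      define \<rho> where "\<rho> = (1 + max c1 (exp (\<theta> i))) / 2"
      have r: "c1 < \<rho>" "exp (\<theta> i) < \<rho>" "\<rho> < 1" "0 < \<rho>" using c1 3 unfolding \<rho>_def by (auto simp: max_def)
      define M where "M = \<bar>a i 0\<bar> + L / (\<rho> - exp (\<theta> i))"
      have M: "0 \<le> M" "L \<le> M * (\<rho> - exp (\<theta> i))" "\<bar>a i 0\<bar> \<le> M" unfolding M_def using L r by (auto simp: distrib_right)
      have "\<bar>a i j\<bar> * exp (\<theta> i * real j) \<le> M * \<rho> ^ j" for j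
      proof (induction j)
        case 0
        then show ?case using M(3) by simp
      next
        case (Suc j)
        have "\<bar>a i (Suc j)\<bar> * exp (\<theta> i * real (Suc j)) \<le> (\<bar>a i j\<bar> + \<bar>a i (Suc j) - a i j\<bar>) * exp (\<theta> i * real (Suc j))"
          by (intro mult_right_mono) auto
        also have "\<dots> = \<bar>a i j\<bar> * exp (\<theta> i * real j) * exp (\<theta> i) + \<bar>a i (Suc j) - a i j\<bar> * exp (\<theta> i * real (Suc j))"
          by (simp add: distrib_right exp_add[symmetric] algebra_simps)
        also have "\<dots> \<le> M * \<rho> ^ j * exp (\<theta> i) + L * c1 ^ Suc j"
          using Suc step[of i j] unfolding L_def by (intro add_mono mult_right_mono) auto
        also have "\<dots> \<le> M * \<rho> ^ j * exp (\<theta> i) + L * \<rho> ^ j"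
        proof -
          have "c1 ^ Suc j \<le> c1 ^ j" using c1 by (simp add: mult_left_le_one_le)
          also have "\<dots> \<le> \<rho> ^ j" using c1 r by (intro power_mono) auto
          finally show ?thesis using L by (simp add: mult_left_mono)
        qed
        also have "\<dots> = (M * exp (\<theta> i) + L) * \<rho> ^ j" by (simp add: algebra_simps)
        also have "\<dots> \<le> (M * \<rho>) * \<rho> ^ j" using M(2) r by (intro mult_right_mono) (auto simp: algebra_simps)
        finally show ?case by simp
      qed
      then show ?thesis using M(1) r by blast
    qed
  qed
  then obtain M \<rho> where M: "\<And>i. 0 \<le> M i" "\<And>i. 0 < \<rho> i" "\<And>i. \<rho> i < 1" "\<And>i j. \<bar>a i j\<bar> * exp (\<theta> i * real j) \<le> M i * \<rho> i ^ j" by metis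
  define r where "r = Max (range \<rho>)"
  have r: "\<rho> i \<le> r" "0 < r" "r < 1" for i
  proof -
    show le: "\<rho> i \<le> r" for i unfolding r_def by simp
    show "0 < r" using M(2) le by (metis less_le_trans)
    show "r < 1" unfolding r_def using M(3) by simp
  qed
  \<comment> \<open>The basis vectors obey their rates up to an arbitrarily small loss; half of the
    decay rate of \<open>r\<close> is spent on it.\<close>
  define \<delta> where "\<delta> = - ln r / 2"
  have d: "0 < \<delta>" unfolding \<delta>_def using r by simp
  have "\<exists>C>0. \<forall>m. norm (P m *v b i) \<le> C * exp ((\<theta> i + \<delta>) * real m)" for i
    using rate[of i] d unfolding subexp_def by blast
  then obtain C where C: "\<And>i. C i > 0" "\<And>i m. norm (P m *v b i) \<le> C i * exp ((\<theta> i + \<delta>) * real m)" by metis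
  define r1 where "r1 = r * exp \<delta>"
  have r1: "0 < r1" "r1 < 1"
  proof -
    show "0 < r1" unfolding r1_def using r by simp
    have "ln r1 < 0" unfolding r1_def using r by (simp add: ln_mult \<delta>_def)
    then show "r1 < 1" using \<open>0 < r1\<close> by simp
  qed
  have trm: "\<bar>a i j\<bar> * norm (P j *v b i) \<le> M i * C i * r1 ^ j" for i j
  proof -
    have "\<bar>a i j\<bar> * norm (P j *v b i) \<le> \<bar>a i j\<bar> * (C i * exp ((\<theta> i + \<delta>) * real j))" by (intro mult_left_mono C(2)) auto
    also have "exp ((\<theta> i + \<delta>) * real j) = exp (\<theta> i * real j) * exp (real j * \<delta>)"
      unfolding exp_add[symmetric] by (simp add: algebra_simps)
    also have "\<bar>a i j\<bar> * (C i * (exp (\<theta> i * real j) * exp (real j * \<delta>))) = C i * exp (real j * \<delta>) * (\<bar>a i j\<bar> * exp (\<theta> i * real j))" by (simp only: mult_ac)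
    also have "\<dots> \<le> C i * exp (real j * \<delta>) * (M i * r ^ j)"
    proof (intro mult_left_mono order_trans[OF M(4)])
      show "\<rho> i ^ j \<le> r ^ j" using r(1)[of i] M(2)[of i] by (intro power_mono) auto
    qed (use C(1)[of i] M(1)[of i] in auto)
    also have "\<dots> = M i * C i * r1 ^ j" unfolding r1_def by (simp add: exp_of_nat_mult power_mult_distrib)
    finally show ?thesis .
  qed
  define CC where "CC = 1 + (\<Sum>i\<in>UNIV. M i * C i)"
  have "0 \<le> M i * C i" for i using M(1)[of i] C(1)[of i] by simp
  then have CC: "0 < CC" unfolding CC_def by (intro add_pos_nonneg sum_nonneg) simp_all
  have "norm (P j *v \<eta> j) \<le> CC * r1 ^ j" for j
  proof -
    have "norm (P j *v \<eta> j) \<le> (\<Sum>i\<in>UNIV. M i * C i * r1 ^ j)"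
      by (rule order_trans[OF norm_coef sum_mono]) (use trm in \<open>simp add: a_def\<close>)
    also have "\<dots> \<le> CC * r1 ^ j" unfolding CC_def sum_distrib_right[symmetric] using r1 by (intro mult_right_mono) auto
    finally show ?thesis .
  qed
  then show ?thesis using CC r1 by blast
qed

end

text \<open>With a positive sum the columns would shrink at a negative total rate, and a determinant
  of constant non-zero modulus would tend to zero. This will be applied to the cocycle in the
  past.\<close>

lemma exponent_sum_le:
  fixes Q :: "nat \<Rightarrow> real^'a::finite^'a"
  assumes det1: "\<And>m. \<bar>det (Q m)\<bar> = 1" and indep: "det (\<chi> i j. b j $ i) \<noteq> 0"
    and rate: "\<And>i. subexp (- \<theta> i) (\<lambda>m. norm (Q m *v b i))"
  shows "(\<Sum>i\<in>UNIV. \<theta> i) \<le> 0"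
proof (rule ccontr)
  assume "\<not> ?thesis"
  then have S: "0 < (\<Sum>i\<in>UNIV. \<theta> i)" by simp
  define d where "d = real CARD('a)"
  have d: "1 \<le> d" unfolding d_def by (simp add: Suc_leI)
  define \<epsilon> where "\<epsilon> = (\<Sum>i\<in>UNIV. \<theta> i) / (2 * d)"
  have e: "0 < \<epsilon>" unfolding \<epsilon>_def using S d by simp
  have "\<exists>C>0. \<forall>m. norm (Q m *v b i) \<le> C * exp ((- \<theta> i + \<epsilon>) * real m)" for i
    using rate[of i] e unfolding subexp_def by blast
  then obtain C where C: "\<And>i. C i > 0" "\<And>i m. norm (Q m *v b i) \<le> C i * exp ((- \<theta> i + \<epsilon>) * real m)" by metis
  let ?M = "\<chi> i j. b j $ i"
  let ?D = "fact CARD('a) * (\<Prod>i\<in>UNIV. C i)"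
  have bd: "\<bar>det ?M\<bar> \<le> ?D * exp (- (\<Sum>i\<in>UNIV. \<theta> i) / 2) ^ m" for m
  proof -
    have col: "column j (Q m ** ?M) = Q m *v b j" for j
      unfolding column_def matrix_matrix_mult_def matrix_vector_mult_def by simp
    have "\<bar>det ?M\<bar> = \<bar>det (Q m ** ?M)\<bar>" by (simp add: det_mul abs_mult det1)
    also have "\<dots> \<le> fact CARD('a) * (\<Prod>j\<in>UNIV. norm (Q m *v b j))" using det_norm_bound[of "Q m ** ?M"] unfolding col .
    also have "\<dots> \<le> fact CARD('a) * (\<Prod>j\<in>UNIV. C j * exp ((- \<theta> j + \<epsilon>) * real m))"
      by (intro mult_left_mono prod_mono conjI C(2)) auto
    also have "(\<Prod>j\<in>UNIV. C j * exp ((- \<theta> j + \<epsilon>) * real m)) = (\<Prod>j\<in>UNIV. C j) * exp (\<Sum>j\<in>UNIV. (- \<theta> j + \<epsilon>) * real m)"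
      by (simp add: prod.distrib exp_sum)
    also have "(\<Sum>j\<in>UNIV. (- \<theta> j + \<epsilon>) * real m) = (- (\<Sum>j\<in>UNIV. \<theta> j) + d * \<epsilon>) * real m"
      unfolding sum_distrib_right[symmetric] sum.distrib by (simp add: d_def sum_negf)
    also have "\<dots> = real m * (- (\<Sum>i\<in>UNIV. \<theta> i) / 2)" unfolding \<epsilon>_def using d by (simp add: field_simps)
    finally show ?thesis by (simp only: exp_of_nat_mult mult.assoc)
  qed
  have "(\<lambda>m. ?D * exp (- (\<Sum>i\<in>UNIV. \<theta> i) / 2) ^ m) \<longlonglongrightarrow> ?D * 0"
    using S by (intro tendsto_mult_left LIMSEQ_realpow_zero) auto
  then have "\<bar>det ?M\<bar> \<le> ?D * 0" using bd by (intro LIMSEQ_le_const) auto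
  then show False using indep by simp
qed

section \<open>Slopes, shapes and distances\<close>

lemma ln_one_plus_bound: "\<bar>x\<bar> \<le> 1/2 \<Longrightarrow> \<bar>ln (1 + x :: real)\<bar> \<le> 2 * \<bar>x\<bar>"
proof -
  assume x: "\<bar>x\<bar> \<le> 1/2"
  have "\<bar>ln (1 + x) - x\<bar> \<le> 2 * x\<^sup>2" by (rule abs_ln_one_plus_x_minus_x_bound[OF x])
  moreover have "2 * x\<^sup>2 \<le> \<bar>x\<bar>"
  proof -
    have "x\<^sup>2 = \<bar>x\<bar> * \<bar>x\<bar>" by (simp add: power2_eq_square)
    moreover have "\<bar>x\<bar> * \<bar>x\<bar> \<le> 1/2 * \<bar>x\<bar>" by (rule mult_right_mono[OF x]) simp
    ultimately show ?thesis by linarith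
  qed
  ultimately show ?thesis by linarith
qed

lemma affine_in: "u < v \<Longrightarrow> t \<in> {0..1} \<Longrightarrow> u + t * (v - u) \<in> {u..v::real}"
proof -
  assume a: "u < v" "t \<in> {0..1}"
  then have "t * (v - u) \<le> 1 * (v - u)" by (intro mult_right_mono) auto
  moreover have "0 \<le> t * (v - u)" using a by simp
  ultimately show ?thesis by simp
qed

text \<open>The supremum in \<open>Cr_norm\<close> is a true bound when the derivative is bounded,
  which continuity on the compact interval ensures.\<close>

lemma Cr_norm_1:
  assumes h: "\<And>t. t \<in> {0..1} \<Longrightarrow> (h has_real_derivative h' t) (at t within {0..1})" and c: "continuous_on {0..1} h'"
    and t: "t \<in> {0..1}"
  shows "\<bar>h' t\<bar> \<le> Cr_norm 1 h" "0 \<le> Cr_norm 1 h"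
proof -
  let ?V = "\<lambda>i. SUP t\<in>{0..1}. \<bar>((\<lambda>h s. vector_derivative h (at s within {0..1})) ^^ i) h t\<bar>"
  have vd: "vector_derivative h (at s within {0..1}) = h' s" if "s \<in> {0..1}" for s
    using h[OF that] within_Icc_nontrivial[of 0 1 s] that
    by (intro vector_derivative_within) (auto simp: has_real_derivative_iff_has_vector_derivative)
  have "bounded (h' ` {0..1})" using c by (intro compact_imp_bounded compact_continuous_image) auto
  then obtain B where B: "\<forall>y\<in>h' ` {0..1}. \<bar>y\<bar> \<le> B" unfolding bounded_iff real_norm_def by blast
  then have "bdd_above ((\<lambda>s. \<bar>vector_derivative h (at s within {0..1})\<bar>) ` {0..1})"
    using vd by (intro bdd_aboveI[of _ B]) auto
  then have "\<bar>vector_derivative h (at t within {0..1})\<bar> \<le> ?V 1" using cSUP_upper[OF t] by fastforce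
  then have "\<bar>h' t\<bar> \<le> ?V 1" using vd[OF t] by simp
  moreover have "?V 1 \<le> Cr_norm 1 h" unfolding Cr_norm_def by (rule Max_ge[OF _ imageI[of 1]]) auto
  ultimately show "\<bar>h' t\<bar> \<le> Cr_norm 1 h" "0 \<le> Cr_norm 1 h" by linarith+
qed

lemma shape_eq:
  assumes gi: "gint g a = {u..<v}" and G: "C1_ext (gmap g) u v p q G D" and t: "t \<in> {0..1}"
  shows "shape g a t = (G (u + t * (v - u)) - p) / (q - p)"
proof -
  have uv: "u < v" and FG: "\<And>x. x \<in> {u..<v} \<Longrightarrow> gmap g x = G x" and Gv: "G u = p" "G v = q"
    using G unfolding C1_ext_def by auto
  have br: "branch g a x = G x" if x: "x \<in> {u..v}" for x
  proof (cases "x = v")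
    case False
    then show ?thesis using x FG[of x] unfolding branch_def gi by auto
  next
    case True
    have "(G \<longlongrightarrow> G v) (at v within {u..v})"
      using C1_ext_cont[OF G] uv unfolding continuous_on_def by auto
    then have "(G \<longlongrightarrow> G v) (at v within {u..<v})" by (rule tendsto_within_subset) auto
    moreover have "eventually (\<lambda>x. gmap g x = G x) (at v within {u..<v})"
      using FG unfolding eventually_at_filter by (auto intro: always_eventually)
    ultimately have "(gmap g \<longlongrightarrow> G v) (at v within {u..<v})" using tendsto_cong by fastforce
    moreover have "at v within {u..<v} \<noteq> bot"
    proof -
      have "v islimpt {u..<v}" using uv by (simp add: islimpt_Ico)
      then show ?thesis using trivial_limit_within by blast
    qed
    ultimately show ?thesis unfolding branch_def gi using True tendsto_Lim by auto
  qed
  have cl: "closure {u..<v} = {u..v}" using uv by simp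
  have "branch g a ` {u..v} = {p..q}" using br C1_ext_bij(3)[OF G] by (metis (no_types, lifting) image_cong)
  moreover have "p < q" using C1_ext_bij(2)[OF G] .
  moreover have "u + t * (v - u) \<in> {u..v}" using affine_in[OF uv t] .
  ultimately show ?thesis unfolding shape_def Xi_def gi cl using uv br by simp
qed

lemma shape_deriv:
  assumes gi: "gint g a = {u..<v}" and G: "C1_ext (gmap g) u v p q G D"
  shows "\<And>t. t \<in> {0..1} \<Longrightarrow> (shape g a has_real_derivative D (u + t * (v - u)) * (v - u) / (q - p)) (at t within {0..1})"
    "continuous_on {0..1} (\<lambda>t. D (u + t * (v - u)) * (v - u) / (q - p))"
proof -
  have uv: "u < v" using G unfolding C1_ext_def by auto
  have img: "(\<lambda>t. u + t * (v - u)) ` {0..1} \<subseteq> {u..v}" using affine_in[OF uv] by blast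
  show "continuous_on {0..1} (\<lambda>t. D (u + t * (v - u)) * (v - u) / (q - p))"
  proof -
    have "continuous_on {0..1} (\<lambda>t. D (u + t * (v - u)))"
      by (rule continuous_on_compose2[where t="{u..v}" and g=D]) (use G img in \<open>auto simp: C1_ext_def intro!: continuous_intros\<close>)
    then show ?thesis unfolding divide_inverse by (intro continuous_on_mult continuous_on_const)
  qed
  fix t :: real assume t: "t \<in> {0..1}"
  have x: "u + t * (v - u) \<in> {u..v}" using img t by blast
  have "(G has_real_derivative D (u + t * (v - u))) (at (u + t * (v - u)) within {u..v})" using G x unfolding C1_ext_def by blast
  then have "(G has_real_derivative D (u + t * (v - u))) (at (u + t * (v - u)) within (\<lambda>t. u + t * (v - u)) ` {0..1})"
    using img by (rule DERIV_subset)
  moreover have "((\<lambda>t. u + t * (v - u)) has_real_derivative (v - u)) (at t within {0..1})"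
    by (auto intro!: derivative_eq_intros)
  ultimately have "(G \<circ> (\<lambda>t. u + t * (v - u)) has_real_derivative D (u + t * (v - u)) * (v - u)) (at t within {0..1})"
    by (rule DERIV_image_chain)
  then have "((\<lambda>t. (G (u + t * (v - u)) - p) / (q - p)) has_real_derivative (D (u + t * (v - u)) * (v - u) - 0) / (q - p)) (at t within {0..1})"
    unfolding o_def by (intro DERIV_cdivide DERIV_diff DERIV_const)
  then show "(shape g a has_real_derivative D (u + t * (v - u)) * (v - u) / (q - p)) (at t within {0..1})"
    using shape_eq[OF gi G] t by (auto intro: has_field_derivative_transform_within[where d=1])
qed

text \<open>The integrand is the two-sided derivative, whose values at the ends of the interval are
  not controlled. Two points do not affect the integral, which is then the length of the
  image.\<close>

lemma log_mean_slope_eq: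
  assumes gi: "gint g a = {u..<v}" and G: "C1_ext (gmap g) u v p q G D"
  shows "log_mean_slope g $ a = ln ((q - p) / (v - u))"
proof -
  have uv: "u < v" and Gv: "G u = p" "G v = q" using G unfolding C1_ext_def by auto
  have "(D has_integral (G v - G u)) {u..v}"
    using G uv unfolding C1_ext_def
    by (intro fundamental_theorem_of_calculus) (auto simp: has_real_derivative_iff_has_vector_derivative[symmetric])
  moreover have dx: "deriv (gmap g) x = D x" if x: "x \<in> {u..v} - {u, v}" for x
  proof -
    have x': "u < x" "x < v" using x by auto
    have "eventually (\<lambda>t. t \<in> {u<..<v}) (nhds x)" using x' by (intro eventually_nhds_in_open) auto
    then have "eventually (\<lambda>t. gmap g t = G t) (nhds x)"
      by eventually_elim (use G in \<open>auto simp: C1_ext_def\<close>)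
    then have "(gmap g has_real_derivative D x) (at x)"
      using C1_ext_DERIV(1)[OF G x'] DERIV_cong_ev[of x x "gmap g" G "D x" "D x"] by simp
    then show ?thesis by (rule DERIV_imp_deriv)
  qed
  ultimately have "(deriv (gmap g) has_integral (q - p)) {u..v}"
    unfolding Gv by (intro has_integral_spike_finite[of "{u, v}" "{u..v}" "deriv (gmap g)" D]) auto
  moreover have "negligible {x \<in> {u..v} - {u..<v}. deriv (gmap g) x \<noteq> 0}"
    by (rule negligible_subset[OF negligible_sing[of v]]) auto
  moreover have "negligible {x \<in> {u..<v} - {u..v}. deriv (gmap g) x \<noteq> 0}"
    by (rule negligible_subset[OF negligible_sing[of v]]) auto
  ultimately have "(deriv (gmap g) has_integral (q - p)) {u..<v}"
    using has_integral_spike_set_eq by blast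
  then have "integral (gint g a) (deriv (gmap g)) = q - p" unfolding gi by (rule integral_unique)
  moreover have "ilen (gint g a) = v - u" unfolding gi using uv by simp
  moreover have "log_mean_slope g $ a = ln (1 / ilen (gint g a) * integral (gint g a) (deriv (gmap g)))"
    unfolding log_mean_slope_def by simp
  ultimately show ?thesis by simp
qed

text \<open>The derivative of the shape is the derivative of the branch divided by its mean slope.
  Closeness of the shape to the identity in \<open>C^1\<close> thus bounds the logarithm of this
  quotient.\<close>

lemma slope_near_mean:
  assumes gi: "gint g a = {u..<v}" and B: "C1_branch (gmap g) u v p q"
    and n: "Cr_norm 1 (\<lambda>t. shape g a t - t) \<le> \<epsilon>" "\<epsilon> \<le> 1/2" and x: "x \<in> gint g a"
  shows "\<bar>ln (right_deriv (gmap g) x) - log_mean_slope g $ a\<bar> \<le> 2 * \<epsilon>"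
proof -
  obtain G D where G: "C1_ext (gmap g) u v p q G D" using B unfolding C1_branch_def by blast
  have uv: "u < v" and pq: "p < q" using C1_branch_image[OF B] by auto
  note s = shape_deriv[OF gi G]
  define t where "t = (x - u) / (v - u)"
  have t: "t \<in> {0..1}" "u + t * (v - u) = x" using x gi uv unfolding t_def by (auto simp: field_simps)
  have "\<bar>D (u + t * (v - u)) * (v - u) / (q - p) - 1\<bar> \<le> Cr_norm 1 (\<lambda>t. shape g a t - t)"
    by (rule Cr_norm_1(1)[where h'="\<lambda>t. D (u + t * (v - u)) * (v - u) / (q - p) - 1"])
      (use s t in \<open>auto intro!: DERIV_diff DERIV_ident continuous_on_diff continuous_on_const\<close>)
  then have e: "\<bar>D x * (v - u) / (q - p) - 1\<bar> \<le> \<epsilon>" using n t(2) by simp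
  have Dx: "0 < D x" using G x gi unfolding C1_ext_def by auto
  have "ln (D x) - ln ((q - p) / (v - u)) = ln (1 + (D x * (v - u) / (q - p) - 1))"
    using Dx uv pq by (simp add: ln_div ln_mult)
  then have "\<bar>ln (D x) - ln ((q - p) / (v - u))\<bar> \<le> 2 * \<bar>D x * (v - u) / (q - p) - 1\<bar>"
    using ln_one_plus_bound[of "D x * (v - u) / (q - p) - 1"] e n(2) by simp
  then show ?thesis using e C1_ext_rd[OF G, of x] x gi log_mean_slope_eq[OF gi G] by simp
qed

lemma ln_close:
  fixes x y :: real
  assumes "0 < k" "k \<le> y" "\<bar>x - y\<bar> \<le> \<epsilon>" "\<epsilon> \<le> k / 2"
  shows "\<bar>ln x - ln y\<bar> \<le> 2 * \<epsilon> / k"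
proof -
  have y: "0 < y" and x: "0 < x" using assms by auto
  have "\<bar>x / y - 1\<bar> = \<bar>x - y\<bar> / y" using y by (simp add: field_simps abs_divide[symmetric])
  also have "\<dots> \<le> \<epsilon> / k" using assms y by (intro frac_le) auto
  finally have b: "\<bar>x / y - 1\<bar> \<le> \<epsilon> / k" .
  moreover have "\<epsilon> / k \<le> 1/2" using assms by (simp add: field_simps)
  ultimately have "\<bar>x / y - 1\<bar> \<le> 1/2" by linarith
  then have "\<bar>ln (1 + (x / y - 1))\<bar> \<le> 2 * \<bar>x / y - 1\<bar>" by (rule ln_one_plus_bound)
  moreover have "ln (1 + (x / y - 1)) = ln x - ln y" using x y by (simp add: ln_div)
  ultimately show ?thesis using b by simp
qed

lemma rescale_branch:
  assumes gi: "gint g a = {u..<v}" and B: "C1_branch (gmap g) u v p q" and A: "0 < A" "Sup (gdom g) = A"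
  shows "gint (rescale_giet g) a = {u / A..<v / A}" "C1_branch (gmap (rescale_giet g)) (u / A) (v / A) (p / A) (q / A)"
proof -
  have im: "(\<lambda>x. x / A) ` {a..<b} = {a / A..<b / A}" for a b
  proof (intro equalityI subsetI)
    fix y assume "y \<in> {a / A..<b / A}"
    then have "y * A \<in> {a..<b}" using A by (auto simp: field_simps)
    moreover have "y = (y * A) / A" using A by simp
    ultimately show "y \<in> (\<lambda>x. x / A) ` {a..<b}" by blast
  qed (use A in \<open>auto simp: divide_right_mono divide_strict_right_mono\<close>)
  show "gint (rescale_giet g) a = {u / A..<v / A}" unfolding rescale_giet_def Let_def using gi im A by simp
  obtain G D where G: "C1_ext (gmap g) u v p q G D" using B unfolding C1_branch_def by blast
  have uv: "u < v" using G unfolding C1_ext_def by auto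
  have rescale: "x * A \<in> {u..v}" if "x \<in> {u / A..v / A}" for x using that A by (auto simp: field_simps)
  have "C1_ext (gmap (rescale_giet g)) (u / A) (v / A) (p / A) (q / A) (\<lambda>x. G (A * x) / A) (\<lambda>x. D (A * x))"
    unfolding C1_ext_def
  proof (intro conjI ballI)
    show "u / A < v / A" using uv A by (simp add: divide_strict_right_mono)
    show "gmap (rescale_giet g) x = G (A * x) / A" if "x \<in> {u / A..<v / A}" for x
    proof -
      have "A * x \<in> {u..<v}" using that A by (auto simp: field_simps)
      then show ?thesis unfolding rescale_giet_def Let_def using G A by (auto simp: C1_ext_def)
    qed
    show "G (A * (u / A)) / A = p / A" "G (A * (v / A)) / A = q / A" using G A unfolding C1_ext_def by auto
    fix x assume x: "x \<in> {u / A..v / A}"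
    then have xi: "A * x \<in> {u..v}" using rescale[OF x] by (simp add: mult.commute)
    then show "0 < D (A * x)" using G unfolding C1_ext_def by auto
    have "(G has_real_derivative D (A * x)) (at (A * x) within {u..v})" using G xi unfolding C1_ext_def by auto
    then have "(G has_real_derivative D (A * x)) (at (A * x) within (\<lambda>x. A * x) ` {u / A..v / A})"
      by (rule DERIV_subset) (use rescale in \<open>auto simp: mult.commute\<close>)
    moreover have "((\<lambda>x. A * x) has_real_derivative A) (at x within {u / A..v / A})"
      by (auto intro!: derivative_eq_intros)
    ultimately have "(G \<circ> (\<lambda>x. A * x) has_real_derivative D (A * x) * A) (at x within {u / A..v / A})"
      by (rule DERIV_image_chain)
    from DERIV_cdivide[OF this, of A] show "((\<lambda>x. G (A * x) / A) has_real_derivative D (A * x)) (at x within {u / A..v / A})"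
      using A by (simp add: o_def)
  next
    show "continuous_on {u / A..v / A} (\<lambda>x. D (A * x))"
      by (rule continuous_on_compose2[where t="{u..v}" and g=D]) (use G rescale in \<open>auto simp: C1_ext_def mult.commute intro!: continuous_intros\<close>)
  qed
  then show "C1_branch (gmap (rescale_giet g)) (u / A) (v / A) (p / A) (q / A)" unfolding C1_branch_def by blast
qed

text \<open>The three summands of the distance are non-negative, so each difference of lengths is
  bounded by the whole.\<close>

lemma giet_dist_lengths:
  fixes g g' :: "'a::finite giet"
  assumes "gint g a = {u..<v}" "C1_branch (gmap g) u v p q" and "\<And>b. \<exists>u v p q. gint g b = {u..<v} \<and> C1_branch (gmap g) u v p q"
    and "gint g' a = {u'..<v'}" "C1_branch (gmap g') u' v' p' q'"
    and "\<And>b. \<exists>u v p q. gint g' b = {u..<v} \<and> C1_branch (gmap g') u v p q"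
  shows "\<bar>(v - u) - (v' - u')\<bar> \<le> giet_dist 1 g g'" "\<bar>(q - p) - (q' - p')\<bar> \<le> giet_dist 1 g g'"
proof -
  have nn: "0 \<le> Cr_norm 1 (\<lambda>t. shape g a t - shape g' a t)"
  proof -
    obtain G D where G: "C1_ext (gmap g) u v p q G D" using assms(2) unfolding C1_branch_def by blast
    obtain G' D' where G': "C1_ext (gmap g') u' v' p' q' G' D'" using assms(5) unfolding C1_branch_def by blast
    show ?thesis
      by (rule Cr_norm_1(2)[where t=0, OF DERIV_diff[OF shape_deriv(1)[OF assms(1) G] shape_deriv(1)[OF assms(4) G']]
            continuous_on_diff[OF shape_deriv(2)[OF assms(1) G] shape_deriv(2)[OF assms(4) G']]]) auto
  qed
  have le: "Cr_norm 1 (\<lambda>t. shape g a t - shape g' a t) + \<bar>ilen (gint g a) - ilen (gint g' a)\<bar>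
     + \<bar>ilen (gmap g ` gint g a) - ilen (gmap g' ` gint g' a)\<bar> \<le> giet_dist 1 g g'"
    unfolding giet_dist_def by (rule Max_ge) auto
  have "ilen (gint g a) = v - u" "ilen (gint g' a) = v' - u'" "ilen (gmap g ` gint g a) = q - p" "ilen (gmap g' ` gint g' a) = q' - p'"
    using C1_branch_image[OF assms(2)] C1_branch_image[OF assms(5)] unfolding assms(1,4) by auto
  then show "\<bar>(v - u) - (v' - u')\<bar> \<le> giet_dist 1 g g'" "\<bar>(q - p) - (q' - p')\<bar> \<le> giet_dist 1 g g'"
    using nn le by linarith+
qed

section \<open>Frequency of positive products\<close>

abbreviation perm_space :: "((real^'a::finite) \<times> 'a iet_perm) measure" where
  "perm_space \<equiv> borel \<Otimes>\<^sub>M count_space UNIV"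

lemma countable_iet_perm: "countable (UNIV :: 'a::finite iet_perm set)"
  by (rule countableI_type)

text \<open>Permutations form a countable discrete set. Measurability is checked with the
  permutation frozen and the pieces are glued; the following lemmas repeat the pattern.\<close>

lemma measurable_itype: "(itype :: (real^'a) \<times> 'a::finite iet_perm \<Rightarrow> nat) \<in> measurable perm_space (count_space UNIV)"
proof -
  have [measurable]: "(\<lambda>q. fst q $ a) \<in> borel_measurable (perm_space :: ((real^'a) \<times> 'a iet_perm) measure)" for a
    by (rule measurable_compose[OF measurable_fst]) (auto intro!: borel_measurable_continuous_onI continuous_intros)
  have P: "(\<lambda>q. if fst q $ last_letter \<pi> 0 > fst q $ last_letter \<pi> 1 then 0 else 1 :: nat) \<in>
       measurable (perm_space :: ((real^'a) \<times> 'a iet_perm) measure) (count_space UNIV)" for \<pi> :: "'a iet_perm"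
    by measurable
  show ?thesis unfolding itype_def[abs_def]
    by (rule measurable_compose_countable'[where f="\<lambda>\<pi> q. if fst q $ last_letter \<pi> 0 > fst q $ last_letter \<pi> 1 then 0 else 1 :: nat"
          and g=snd and I=UNIV, OF P measurable_snd countable_iet_perm])
qed

lemma measurable_istate: "(istate :: (real^'a) \<times> 'a::finite iet_perm \<Rightarrow> _) \<in> measurable perm_space (count_space UNIV)"
proof -
  have P: "(\<lambda>q. (\<pi>, itype q)) \<in> measurable (perm_space :: ((real^'a) \<times> 'a iet_perm) measure) (count_space UNIV)" for \<pi> :: "'a iet_perm"
    by (rule measurable_compose[OF measurable_itype]) simp
  show ?thesis unfolding istate_def[abs_def]
    by (rule measurable_compose_countable'[where f="\<lambda>\<pi> q. (\<pi>, itype q)" and g=snd and I=UNIV, OF P measurable_snd countable_iet_perm])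
qed

lemma measurable_istep: "(istep :: (real^'a) \<times> 'a::finite iet_perm \<Rightarrow> _) \<in> measurable perm_space perm_space"
proof -
  let ?M = "perm_space :: ((real^'a) \<times> 'a iet_perm) measure"
  have P1: "(\<lambda>q. \<chi> a. if a = winner s then fst q $ a - fst q $ loser s else fst q $ a) \<in> borel_measurable ?M"
    for s :: "'a iet_perm \<times> nat"
  proof -
    have "continuous_on UNIV (\<lambda>l::real^'a. if a = winner s then l $ a - l $ loser s else l $ a)" for a
      by (cases "a = winner s") (auto intro!: continuous_intros)
    then have c: "continuous_on UNIV (\<lambda>l::real^'a. \<chi> a. if a = winner s then l $ a - l $ loser s else l $ a)"
      by (intro continuous_on_vec_lambda)
    show ?thesis by (rule measurable_compose[OF measurable_fst borel_measurable_continuous_onI[OF c]])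
  qed
  have P2: "(\<lambda>q. rauzy_move \<pi> (itype q)) \<in> measurable ?M (count_space UNIV)" for \<pi> :: "'a iet_perm"
    by (rule measurable_compose[OF measurable_itype]) simp
  show ?thesis unfolding istep_def[abs_def]
  proof (rule measurable_Pair)
    show "(\<lambda>q. \<chi> a. if a = winner (istate q) then fst q $ a - fst q $ loser (istate q) else fst q $ a) \<in> borel_measurable ?M"
      by (rule measurable_compose_countable'[where f="\<lambda>s q. \<chi> a. if a = winner s then fst q $ a - fst q $ loser s else fst q $ a"
            and g=istate and I=UNIV, OF P1 measurable_istate]) simp
    show "(\<lambda>q. rauzy_move (snd q) (itype q)) \<in> measurable ?M (count_space UNIV)"
      by (rule measurable_compose_countable'[where f="\<lambda>\<pi> q. rauzy_move \<pi> (itype q)" and g=snd and I=UNIV, OF P2 measurable_snd countable_iet_perm])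
  qed
qed

lemma measurable_istep_iter: "(\<lambda>q. (istep ^^ n) q) \<in> measurable perm_space perm_space"
  by (induction n) (auto intro: measurable_compose[OF _ measurable_istep])

lemma measurable_ipath: "(\<lambda>q. ipath q n) \<in> measurable perm_space (count_space UNIV)"
  unfolding ipath_def by (rule measurable_compose[OF measurable_istep_iter measurable_istate])

lemma measurable_zstep: "zstep \<in> measurable perm_space perm_space"
proof -
  have a: "(\<lambda>q. snd (ipath q n)) \<in> measurable perm_space (count_space UNIV)" for n
    by (rule measurable_compose[OF measurable_ipath]) simp
  have b: "(\<lambda>q. 1 \<le> n \<and> snd (ipath q n) \<noteq> v) \<in> measurable perm_space (count_space UNIV)" for n v
    by (rule measurable_compose[OF a[of n], where g="\<lambda>w. 1 \<le> n \<and> w \<noteq> v"]) simp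
  have "(\<lambda>q. LEAST n. 1 \<le> n \<and> snd (ipath q n) \<noteq> snd (ipath q 0)) \<in> measurable perm_space (count_space UNIV)"
  proof (rule measurable_Least)
    fix n
    show "(\<lambda>q. 1 \<le> n \<and> snd (ipath q n) \<noteq> snd (ipath q 0)) \<in> measurable perm_space (count_space UNIV)"
      by (rule measurable_compose_countable[where f="\<lambda>v q. 1 \<le> n \<and> snd (ipath q n) \<noteq> v" and g="\<lambda>q. snd (ipath q 0)", OF b a])
  qed
  then have "(\<lambda>q. ztime (ipath q)) \<in> measurable perm_space (count_space UNIV)"
    unfolding ztime_def .
  from measurable_compose_countable[OF measurable_istep_iter this] show ?thesis unfolding zstep_def[abs_def] .
qed

lemma measurable_zstep_iter: "(\<lambda>q. (zstep ^^ n) q) \<in> measurable perm_space perm_space"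
  by (induction n) (auto intro: measurable_compose[OF _ measurable_zstep])

lemma measurable_pm: "(\<lambda>q. path_prod (ipath q) 0 k $ a $ b) \<in> borel_measurable perm_space"
proof (induction k arbitrary: b)
  case (Suc k)
  have "(\<lambda>q. (\<lambda>s q. path_prod (ipath q) 0 k $ a $ b + (if b = loser s then path_prod (ipath q) 0 k $ a $ winner s else 0)) (ipath q (0 + k)) q) \<in> borel_measurable perm_space"
  proof (rule measurable_compose_countable'[OF _ measurable_ipath])
    fix s :: "'a::finite iet_perm \<times> nat"
    show "(\<lambda>q. path_prod (ipath q) 0 k $ a $ b + (if b = loser s then path_prod (ipath q) 0 k $ a $ winner s else 0)) \<in> borel_measurable perm_space"
      using Suc[of b] Suc[of "winner s"] by (cases "b = loser s") (simp_all add: borel_measurable_add)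
  qed simp
  then show ?case unfolding mat_prod.simps matrix_mult_rm .
qed (simp add: mat_def)

section \<open>Density of times with a short positive product\<close>

definition no_posblock :: "nat \<Rightarrow> (real^'a) \<times> 'a::finite iet_perm \<Rightarrow> bool" where
  "no_posblock K q \<longleftrightarrow> (\<forall>k\<le>K. \<not> posblock (ipath q) 0 k)"

text \<open>A bound on the lower density of bad Zorich times: it is asked for infinitely many
  \<open>m\<close>. In this form it follows from invariance of the measure and Chebyshev's
  inequality.\<close>

definition good_freq :: "(real^'a) \<times> 'a::finite iet_perm \<Rightarrow> bool" where
  "good_freq q \<longleftrightarrow> (\<forall>r::nat. \<exists>K. \<forall>m0. \<exists>m\<ge>m0. real (card {j. j < m \<and> no_posblock K ((zstep ^^ j) q)}) \<le> real m / real (Suc r))"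

lemma measurable_bad: "Measurable.pred perm_space (\<lambda>q. no_posblock K ((zstep ^^ j) q))"
proof -
  have [measurable]: "(\<lambda>q. path_prod (ipath q) 0 k $ a $ b) \<in> borel_measurable perm_space" for k a b by (rule measurable_pm)
  have "Measurable.pred perm_space (no_posblock K)"
    unfolding no_posblock_def[abs_def] posblock_def by measurable
  from measurable_compose[OF measurable_zstep_iter this] show ?thesis .
qed

lemma card_bad_sum:
  fixes m :: nat
  shows "real (card {j. j < m \<and> Q j}) = (\<Sum>j<m. if Q j then 1 else 0)"
proof -
  have "{j. j < m \<and> Q j} = {j\<in>{..<m}. Q j}" by auto
  then have "real (card {j. j < m \<and> Q j}) = (\<Sum>j\<in>{j\<in>{..<m}. Q j}. 1)" by simp
  also have "\<dots> = (\<Sum>j<m. if Q j then 1 else 0)" by (rule sum.inter_filter) simp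
  finally show ?thesis .
qed

lemma measurable_good_freq: "Measurable.pred perm_space good_freq"
proof -
  have [measurable]: "Measurable.pred perm_space (\<lambda>q. no_posblock K ((zstep ^^ j) q))" for K j by (rule measurable_bad)
  show ?thesis unfolding good_freq_def[abs_def] card_bad_sum by measurable
qed

lemma bad_sc: "c > 0 \<Longrightarrow> no_posblock K (rescale c q) = no_posblock K q"
  unfolding no_posblock_def rescale_iet_ipath by simp

lemma rescale_iet_zstep_iter: assumes "c > 0" shows "(zstep ^^ n) (rescale c q) = rescale c ((zstep ^^ n) q)"
  by (induction n) (simp_all add: rescale_iet_zstep[OF assms])

lemma Zext_norm_snd:
  assumes "x \<in> norm_triples" "Zext_norm x \<in> norm_triples"
  shows "\<exists>c>0. snd (Zext_norm x) = rescale c (zstep (snd x))"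
proof -
  note vy = norm_triples_valid(1)[OF assms(1)]
  define d where "d = vsum (matrix_inv (ext_matrix x) *v fst (snd x))"
  have z: "snd (Zext_norm x) = rescale (1 / d) (zstep (snd x))"
    unfolding Zext_norm_def ext_valid(2)[OF vy] Let_def d_def by (cases x) (simp add: rescale_def split: prod.split)
  have pos: "0 < vsum (fst (zstep (snd x)))" using vsum_valid_pos[OF valid_zstep[OF vy, of 1]] by simp
  have "(1 / d) * vsum (fst (zstep (snd x))) = 1" using norm_triples_valid(2)[OF assms(2)] unfolding z rescale_def by (simp add: vsum_scale)
  then have "0 < 1 / d" using pos by (metis zero_less_mult_pos2 zero_less_one)
  then show ?thesis using z by blast
qed

text \<open>By invariance the bad set \<open>E K j\<close> has the same measure for all
  \<open>j\<close>, and this measure tends to zero as \<open>K\<close> grows. Chebyshev's inequality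
  for the average of the indicators bounds the measure of the set on which the bad frequency exceeds
  \<open>1 / Suc r\<close> for all late \<open>m\<close>, by \<open>Suc r\<close> times the measure
  of \<open>E K 0\<close>. The exceptional set is null for the projected measure, hence for Lebesgue
  measure.\<close>

lemma AE_good_freq:
  fixes \<mu> :: "'a::finite triple measure"
  assumes mu: "is_mu_ext \<mu>" and ev: "AE x in \<mu>. \<exists>K. \<not> no_posblock K (snd x)"
  shows "AE q in (iet_lebesgue :: ((real^'a) \<times> 'a iet_perm) measure). good_freq q"
proof -
  interpret prob_space \<mu> using mu unfolding is_mu_ext_def by (rule conjunct1)
  let ?B = "borel :: (real^'a) measure" and ?I = "count_space (irred_perms :: 'a iet_perm set)"
  have sets: "sets \<mu> = sets (?B \<Otimes>\<^sub>M (?B \<Otimes>\<^sub>M ?I))" using mu unfolding is_mu_ext_def by blast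
  have nt: "AE x in \<mu>. x \<in> norm_triples" using mu unfolding is_mu_ext_def by blast
  have inv: "Zext_norm -` E \<inter> norm_triples \<in> sets \<mu>" "emeasure \<mu> (Zext_norm -` E \<inter> norm_triples) = emeasure \<mu> E" if "E \<in> sets \<mu>" for E
    using mu that unfolding is_mu_ext_def by blast+
  obtain Y where Y: "Y \<subseteq> norm_triples" "AE x in \<mu>. x \<in> Y" "bij_betw Zext_norm Y Y" using mu unfolding is_mu_ext_def by blast
  have Ysub: "Zext_norm x \<in> Y" if "x \<in> Y" for x using Y(3) that bij_betwE by blast
  have null: "null_sets (distr \<mu> (?B \<Otimes>\<^sub>M ?I) snd) = null_sets iet_lebesgue" using mu unfolding is_mu_ext_def by blast
  have snd1: "snd \<in> measurable \<mu> (?B \<Otimes>\<^sub>M ?I)" using measurable_cong_sets[OF sets refl] measurable_snd by blast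
  \<comment> \<open>The measurability lemmas are stated over all permutations, the measure lives on
    the irreducible ones; the inclusion is measurable.\<close>
  have id2: "(\<lambda>q. q) \<in> measurable (?B \<Otimes>\<^sub>M ?I) perm_space"
  proof -
    have "(\<lambda>q. (fst q, snd q)) \<in> measurable (?B \<Otimes>\<^sub>M ?I) perm_space"
    proof (rule measurable_Pair)
      have "(\<lambda>x. x) \<in> measurable ?I (count_space UNIV)" by simp
      have "(\<lambda>q. (\<lambda>x. x) (snd q)) \<in> measurable (?B \<Otimes>\<^sub>M ?I) (count_space UNIV)"
        by (rule measurable_compose[OF measurable_snd]) simp
      then show "snd \<in> measurable (?B \<Otimes>\<^sub>M ?I) (count_space UNIV)" by simp
    qed (rule measurable_fst)
    then show ?thesis by simp
  qed
  have pb: "Measurable.pred \<mu> (\<lambda>x. no_posblock K ((zstep ^^ j) (snd x)))" for K j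
    using measurable_compose[OF measurable_compose[OF snd1 id2] measurable_bad] .
  define E where "E K j = {x \<in> space \<mu>. no_posblock K ((zstep ^^ j) (snd x))}" for K j
  have Es: "E K j \<in> sets \<mu>" for K j unfolding E_def using pb[of K j] by (simp add: pred_def)
  have Eeq: "emeasure \<mu> (E K j) = emeasure \<mu> (E K 0)" for K j
  proof (induction j)
    case (Suc j)
    have "emeasure \<mu> (E K (Suc j)) = emeasure \<mu> (Zext_norm -` E K j \<inter> norm_triples)"
    proof (rule emeasure_eq_AE)
      \<comment> \<open>On (\<lambda>, \<pi>) the map \<open>Zext_norm\<close> is a Zorich step
        followed by a rescaling, and the absence of a short positive product is insensitive to
        scale.\<close>
      show "AE x in \<mu>. (x \<in> E K (Suc j)) = (x \<in> Zext_norm -` E K j \<inter> norm_triples)"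
        using Y(2) AE_space
      proof eventually_elim
        case (elim x)
        have n: "x \<in> norm_triples" "Zext_norm x \<in> norm_triples" using elim(1) Y(1) Ysub[OF elim(1)] by blast+
        obtain c where c: "c > 0" "snd (Zext_norm x) = rescale c (zstep (snd x))" using Zext_norm_snd[OF n] by blast
        have "Zext_norm x \<in> space \<mu>"
        proof -
          have "space \<mu> = UNIV \<times> UNIV \<times> irred_perms" using sets_eq_imp_space_eq[OF sets] by (simp add: space_pair_measure)
          moreover have "snd (snd (Zext_norm x)) \<in> irred_perms" using n(2) unfolding norm_triples_def ext_triples_def by auto
          ultimately show ?thesis by (metis UNIV_I mem_Times_iff)
        qed
        moreover have "no_posblock K ((zstep ^^ j) (snd (Zext_norm x))) = no_posblock K ((zstep ^^ Suc j) (snd x))"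
          unfolding c(2) rescale_iet_zstep_iter[OF c(1)] bad_sc[OF c(1)] by (simp add: funpow_swap1)
        ultimately show ?case using elim n(1) unfolding E_def by simp
      qed
    qed (rule Es, rule inv(1)[OF Es])
    then show ?case using inv(2)[OF Es] Suc by simp
  qed simp
  have E0: "(\<lambda>K. emeasure \<mu> (E K 0)) \<longlonglongrightarrow> 0"
  proof -
    have "decseq (\<lambda>K. E K 0)" unfolding decseq_def E_def no_posblock_def by auto
    then have "(\<lambda>K. emeasure \<mu> (E K 0)) \<longlonglongrightarrow> emeasure \<mu> (\<Inter>K. E K 0)"
      by (intro Lim_emeasure_decseq) (auto simp: Es)
    moreover have "emeasure \<mu> (\<Inter>K. E K 0) = 0"
    proof -
      have ae: "AE x in \<mu>. x \<notin> (\<Inter>K. E K 0)" using ev by eventually_elim (auto simp: E_def)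
      have eq: "{x \<in> space \<mu>. \<not> (x \<notin> (\<Inter>K. E K 0))} = (\<Inter>K. E K 0)"
        using sets.sets_into_space[OF Es[of undefined 0]] by blast
      have "(\<Inter>K. E K 0) \<in> sets \<mu>" using Es by blast
      from AE_iff_measurable[OF this eq] show ?thesis using ae by simp
    qed
    ultimately show ?thesis by simp
  qed
  define F where "F r K m0 = {x \<in> space \<mu>. \<forall>m\<ge>m0. real m / real (Suc r) < real (card {j. j < m \<and> no_posblock K ((zstep ^^ j) (snd x))})}" for r K m0
  have Fs: "F r K m0 \<in> sets \<mu>" for r K m0
  proof -
    have [measurable]: "Measurable.pred \<mu> (\<lambda>x. no_posblock K ((zstep ^^ j) (snd x)))" for K j by (rule pb)
    show ?thesis unfolding F_def card_bad_sum by measurable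
  qed
  have Fb: "emeasure \<mu> (F r K m0) \<le> ennreal (real (Suc r)) * emeasure \<mu> (E K 0)" for r K m0
  proof -
    \<comment> \<open>Any positive \<open>m \<ge> m0\<close> would do, because \<open>m\<close>
      cancels from the estimate.\<close>
    define m where "m = Suc m0"
    have "ennreal (real m / real (Suc r)) * emeasure \<mu> (F r K m0) = (\<integral>\<^sup>+x. ennreal (real m / real (Suc r)) * indicator (F r K m0) x \<partial>\<mu>)"
      using Fs by (simp add: nn_integral_cmult_indicator)
    also have "\<dots> \<le> (\<integral>\<^sup>+x. (\<Sum>j<m. indicator (E K j) x) \<partial>\<mu>)"
    proof (rule nn_integral_mono)
      fix x assume x: "x \<in> space \<mu>"
      show "ennreal (real m / real (Suc r)) * indicator (F r K m0) x \<le> (\<Sum>j<m. indicator (E K j) x)"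
      proof (cases "x \<in> F r K m0")
        case True
        have "m0 \<le> m" unfolding m_def by simp
        with True have "real m / real (Suc r) < real (card {j. j < m \<and> no_posblock K ((zstep ^^ j) (snd x))})"
          unfolding F_def by blast
        then have "real m / real (Suc r) \<le> real (card {j. j < m \<and> no_posblock K ((zstep ^^ j) (snd x))})" by (rule less_imp_le)
        also have "\<dots> = (\<Sum>j<m. indicator (E K j) x)" unfolding card_bad_sum using x by (intro sum.cong) (auto simp: E_def indicator_def)
        finally have "ennreal (real m / real (Suc r)) \<le> ennreal (\<Sum>j<m. indicator (E K j) x)" by (rule ennreal_leI)
        also have "\<dots> = (\<Sum>j<m. indicator (E K j) x)" by (simp add: sum_ennreal[symmetric] ennreal_indicator)
        finally show ?thesis using True by simp
      qed simp
    qed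
    also have "\<dots> = (\<Sum>j<m. emeasure \<mu> (E K j))" using Es by (simp add: nn_integral_sum)
    also have "\<dots> = (\<Sum>j<m. emeasure \<mu> (E K 0))" by (rule sum.cong[OF refl Eeq])
    also have "\<dots> = ennreal (real m) * emeasure \<mu> (E K 0)" by (simp add: ennreal_of_nat_eq_real_of_nat)
    finally have *: "ennreal (real m / real (Suc r)) * emeasure \<mu> (F r K m0) \<le> ennreal (real m) * emeasure \<mu> (E K 0)" .
    have m: "real m \<noteq> 0" unfolding m_def by simp
    have e1: "ennreal (real (Suc r) / real m) * ennreal (real m / real (Suc r)) = 1"
    proof -
      have "ennreal (real (Suc r) / real m) * ennreal (real m / real (Suc r)) = ennreal (real (Suc r) / real m * (real m / real (Suc r)))"
        by (rule ennreal_mult[symmetric]) simp_all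
      also have "real (Suc r) / real m * (real m / real (Suc r)) = 1" using m by (simp del: of_nat_Suc)
      finally show ?thesis by simp
    qed
    have e2: "ennreal (real (Suc r) / real m) * ennreal (real m) = ennreal (real (Suc r))"
    proof -
      have "ennreal (real (Suc r) / real m) * ennreal (real m) = ennreal (real (Suc r) / real m * real m)"
        by (rule ennreal_mult[symmetric]) simp_all
      also have "real (Suc r) / real m * real m = real (Suc r)" using m by (simp del: of_nat_Suc)
      finally show ?thesis .
    qed
    have "ennreal (real (Suc r) / real m) * (ennreal (real m / real (Suc r)) * emeasure \<mu> (F r K m0)) \<le> ennreal (real (Suc r) / real m) * (ennreal (real m) * emeasure \<mu> (E K 0))"
      by (rule mult_left_mono[OF *]) simp
    then show ?thesis unfolding mult.assoc[symmetric] e1 e2 by simp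
  qed
  have Fnull: "(\<Inter>K. \<Union>m0. F r K m0) \<in> null_sets \<mu>" for r
  proof -
    have S: "(\<Union>m0. F r K m0) \<in> sets \<mu>" for K using Fs by blast
    have b: "emeasure \<mu> (\<Union>m0. F r K m0) \<le> ennreal (real (Suc r)) * emeasure \<mu> (E K 0)" for K
    proof -
      have "incseq (\<lambda>m0. F r K m0)" unfolding incseq_def F_def by auto
      then have "(SUP m0. emeasure \<mu> (F r K m0)) = emeasure \<mu> (\<Union>m0. F r K m0)" by (intro SUP_emeasure_incseq) (use Fs in auto)
      moreover have "(SUP m0. emeasure \<mu> (F r K m0)) \<le> ennreal (real (Suc r)) * emeasure \<mu> (E K 0)" by (intro SUP_least Fb)
      ultimately show ?thesis by simp
    qed
    have "emeasure \<mu> (\<Inter>K. \<Union>m0. F r K m0) \<le> ennreal (real (Suc r)) * emeasure \<mu> (E K 0)" for K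
      by (rule order_trans[OF emeasure_mono b]) (use S in auto)
    moreover have "(\<lambda>K. ennreal (real (Suc r)) * emeasure \<mu> (E K 0)) \<longlonglongrightarrow> ennreal (real (Suc r)) * 0"
      by (intro ennreal_tendsto_cmult E0) simp
    ultimately have "emeasure \<mu> (\<Inter>K. \<Union>m0. F r K m0) \<le> ennreal (real (Suc r)) * 0" by (intro LIMSEQ_le_const) auto
    moreover have "(\<Inter>K. \<Union>m0. F r K m0) \<in> sets \<mu>" using S by blast
    ultimately show ?thesis by (simp add: null_sets_def)
  qed
  define Nb where "Nb = {q \<in> space (?B \<Otimes>\<^sub>M ?I). \<not> good_freq q}"
  have gp: "Measurable.pred (?B \<Otimes>\<^sub>M ?I) good_freq" using measurable_compose[OF id2 measurable_good_freq] .
  have Nbs: "Nb \<in> sets (?B \<Otimes>\<^sub>M ?I)" unfolding Nb_def using gp by measurable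
  have "snd -` Nb \<inter> space \<mu> \<subseteq> (\<Union>r. \<Inter>K. \<Union>m0. F r K m0)"
  proof
    fix x assume x: "x \<in> snd -` Nb \<inter> space \<mu>"
    then have "\<not> good_freq (snd x)" unfolding Nb_def by auto
    then obtain r where "\<And>K. \<exists>m0. \<forall>m\<ge>m0. \<not> real (card {j. j < m \<and> no_posblock K ((zstep ^^ j) (snd x))}) \<le> real m / real (Suc r)"
      unfolding good_freq_def by blast
    then have "\<And>K. \<exists>m0. x \<in> F r K m0" unfolding F_def using x by (simp add: not_le)
    then have "x \<in> (\<Inter>K. \<Union>m0. F r K m0)" by simp
    then show "x \<in> (\<Union>r. \<Inter>K. \<Union>m0. F r K m0)" by (rule UN_I[OF UNIV_I])
  qed
  moreover have "(\<Union>r. \<Inter>K. \<Union>m0. F r K m0) \<in> null_sets \<mu>" by (intro null_sets_UN Fnull)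
  moreover have "snd -` Nb \<inter> space \<mu> \<in> sets \<mu>" using measurable_sets[OF snd1 Nbs] .
  ultimately have "snd -` Nb \<inter> space \<mu> \<in> null_sets \<mu>" by (rule null_sets_subset[rotated 2])
  then have "Nb \<in> null_sets (distr \<mu> (?B \<Otimes>\<^sub>M ?I) snd)" using null_sets_distr_iff[OF snd1, of Nb] Nbs by simp
  then have "Nb \<in> null_sets iet_lebesgue" using null by blast
  moreover have "space iet_lebesgue = space (?B \<Otimes>\<^sub>M ?I)"
    unfolding iet_lebesgue_def simplex_lebesgue_def Let_def by (simp add: space_pair_measure)
  ultimately show ?thesis using AE_I'[of Nb iet_lebesgue good_freq] unfolding Nb_def by simp
qed

section \<open>The height cocycle\<close>

lemma det_rm:
  assumes "winner (p n) \<noteq> loser (p n)" shows "det (path_step p n) = 1"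
proof -
  have "path_step p n = (\<chi> k. if k = winner (p n) then row (winner (p n)) (mat 1) + 1 *s row (loser (p n)) (mat 1) else row k (mat 1))"
    by (auto simp: path_step_def vec_eq_iff rauzy_matrix_entry row_def mat_def)
  then show ?thesis using det_row_operation[OF assms, of "mat 1" 1] by simp
qed

lemma det_mat_prod: "(\<And>i. i < k \<Longrightarrow> det (M i) = 1) \<Longrightarrow> det (mat_prod M k) = 1"
  by (induction k) (simp_all add: det_mul)

lemma matrix_inv_mult:
  fixes A :: "real^'n^'n"
  assumes "det A \<noteq> 0" shows "A ** matrix_inv A = mat 1" "matrix_inv A ** A = mat 1"
proof -
  have "invertible A" using assms by (simp add: invertible_det_nz)
  then have "A ** matrix_inv A = mat 1 \<and> matrix_inv A ** A = mat 1"
    unfolding invertible_def matrix_inv_def by (rule someI_ex)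
  then show "A ** matrix_inv A = mat 1" "matrix_inv A ** A = mat 1" by blast+
qed

lemma (in rv_orbit) rv_path_rot: "rv_path (rot_number f)"
proof
  fix n
  show "fst (rot_number f (Suc n)) = rauzy_move (fst (rot_number f n)) (snd (rot_number f n))"
    using step.rv_giet(2)[of n] unfolding rot_number_def by simp
  show "snd (rot_number f n) \<in> {0, 1}" unfolding rot_number_def rv_type_def by simp
  show "winner (rot_number f n) \<noteq> loser (rot_number f n)" unfolding rot by (rule step.wl_ne)
qed

lemma rv_path_ipath: "valid q \<Longrightarrow> rv_path (ipath q)"
  using rv_orbit.rv_path_rot[OF valid_iet(4)[of q]] valid_iet(5)[of q] by simp

lemma (in rv_path) det_pm: "det (path_prod p n k) = 1"
  by (rule det_mat_prod) (rule det_rm[OF ne])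

lemma ext_matrix_det:
  assumes "x \<in> norm_triples" shows "det (ext_matrix x) = 1"
proof -
  note v = norm_triples_valid(1)[OF assms]
  show ?thesis unfolding ext_valid(1)[OF v] by (rule rv_path.det_pm[OF rv_path_ipath[OF v]])
qed

abbreviation zorich_cocycle :: "(nat \<Rightarrow> 'a::finite iet_perm \<times> nat) \<Rightarrow> nat \<Rightarrow> real^'a^'a" where
  "zorich_cocycle p m \<equiv> transpose (path_prod p 0 (zorich_time p m))"

lemma cocyc_add: "zorich_cocycle p (j + m) = transpose (path_prod p (zorich_time p j) (zorich_time p (j + m) - zorich_time p j)) ** zorich_cocycle p j"
proof -
  have "zorich_time p (j + m) = zorich_time p j + (zorich_time p (j + m) - zorich_time p j)" using mat_prod_Bm[of p j m] by simp
  then have "path_prod p 0 (zorich_time p (j + m)) = path_prod p 0 (zorich_time p j) ** path_prod p (0 + zorich_time p j) (zorich_time p (j + m) - zorich_time p j)"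
    using path_prod_add[of p 0 "zorich_time p j" "zorich_time p (j + m) - zorich_time p j"] by simp
  then show ?thesis by (simp add: matrix_transpose_mul)
qed

lemma normalize_snd:
  assumes "y \<in> ext_triples"
  shows "ipath (snd (normalize_triple y)) = ipath (snd y)" "valid (snd y)"
proof -
  obtain \<tau> l \<pi> where y: "y = (\<tau>, l, \<pi>)" by (cases y) auto
  have pos: "0 < l $ a" for a using assms unfolding y ext_triples_def by simp
  show "valid (snd y)" using assms unfolding y ext_triples_def by (auto intro!: inf_renorm_valid irred_valid_perm)
  have "0 < 1 / vsum l" using vsum_pos[of l] pos by simp
  then show "ipath (snd (normalize_triple y)) = ipath (snd y)"
    unfolding y normalize_triple_def using rescale_iet_ipath[of "1 / vsum l" "(l, \<pi>)"] by (simp add: rescale_def)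
qed

section \<open>Oseledets spaces along the Rauzy-Veech path\<close>

lemma generic_orbit:
  assumes "oseledets_generic y"
  shows "two_sided_orbit (normalize_triple y) (ext_orbit y)" "y \<in> ext_triples"
proof -
  have "y \<in> ext_triples \<and> (\<exists>xs. two_sided_orbit (normalize_triple y) xs \<and> oseledets_orbit xs)"
    using assms unfolding oseledets_generic_def .
  then obtain xs where "y \<in> ext_triples" "two_sided_orbit (normalize_triple y) xs" by (elim conjE exE)
  then show "two_sided_orbit (normalize_triple y) (ext_orbit y)" "y \<in> ext_triples"
    unfolding ext_orbit_def using someI[of "two_sided_orbit (normalize_triple y)" xs] by simp_all
qed

lemma oseledets_forward:
  assumes y: "y \<in> ext_triples" and xs: "two_sided_orbit (normalize_triple y) xs" and v: "v \<in> oseledets_space xs (int n) \<theta>"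
  defines "p \<equiv> ipath (snd y)"
  shows "subexp \<theta> (\<lambda>m. norm (transpose (path_prod p (zorich_time p n) (zorich_time p (n + m) - zorich_time p n)) *v v))"
proof (cases "v = 0")
  case True
  then show ?thesis unfolding subexp_def by (auto intro!: exI[of _ 1])
next
  case False
  have "(\<lambda>m. ln (norm (height_cocycle xs (int n) m *v v)) / real m) \<longlonglongrightarrow> \<theta>" using v False unfolding oseledets_space_def by blast
  then show ?thesis unfolding height_cocycle_pm[OF xs] normalize_snd(1)[OF y] p_def by (rule subexp_lim) simp
qed

text \<open>The basis is extracted from the union of the Oseledets spaces, which spans. The limits
  of its vectors in the future give the rates; their limits in the past, together with unit
  determinants, bound the sum of the exponents.\<close>

lemma generic_basis:
  assumes gen: "oseledets_generic y"
  shows "\<exists>b \<theta>. exp_basis (zorich_cocycle (ipath (snd y))) b \<theta>"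
proof -
  define p where "p = ipath (snd y)"
  have y: "y \<in> ext_triples" using gen generic_orbit by blast
  obtain xs where xs: "two_sided_orbit (normalize_triple y) xs" and os: "oseledets_orbit xs"
    using gen unfolding oseledets_generic_def by blast
  interpret rv_path p unfolding p_def by (rule rv_path_ipath[OF normalize_snd(2)[OF y]])
  have dec: "\<exists>w. (\<forall>\<theta>. w \<theta> \<in> oseledets_space xs 0 \<theta>) \<and> v = (\<Sum>\<theta>\<in>exponents xs 0. w \<theta>)" for v
    using os unfolding oseledets_orbit_def by blast
  define S where "S = (\<Union>\<theta>. oseledets_space xs 0 \<theta>)"
  have "v \<in> span S" for v
  proof -
    obtain w where w: "\<And>\<theta>. w \<theta> \<in> oseledets_space xs 0 \<theta>" "v = (\<Sum>\<theta>\<in>exponents xs 0. w \<theta>)" using dec by blast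
    show ?thesis unfolding w(2) by (rule span_sum, rule span_base) (use w(1) in \<open>auto simp: S_def\<close>)
  qed
  then have spS: "span S = UNIV" by blast
  obtain B where B: "B \<subseteq> S" "independent B" "S \<subseteq> span B" using maximal_independent_subset by blast
  have spB: "span B = UNIV" using B(3) spS by (metis span_mono span_span top.extremum_uniqueI)
  have fin: "finite B" using independent_imp_finite[OF B(2)] .
  have "card B = CARD('a)" using dim_span_eq_card_independent[OF B(2)] spB by simp
  then obtain b where b: "bij_betw b (UNIV::'a set) B" using finite_same_card_bij[of "UNIV :: 'a set" B] fin by auto
  have bS: "b i \<in> S" for i using b B(1) bij_betwE by blast
  have b0: "b i \<noteq> 0" for i
  proof
    assume "b i = 0"
    then have "0 \<in> B" using b unfolding bij_betw_def by (metis rangeI)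
    then show False using B(2) dependent_zero by blast
  qed
  have "\<forall>i. \<exists>\<theta>. b i \<in> oseledets_space xs 0 \<theta>" using bS unfolding S_def by blast
  then obtain \<theta> where th: "\<And>i. b i \<in> oseledets_space xs 0 (\<theta> i)" by metis
  have indep: "det (\<chi> i j. b j $ i) \<noteq> 0"
  proof -
    have "columns (\<chi> i j. b j $ i) = B"
      using bij_betw_imp_surj_on[OF b] unfolding columns_def column_def by (simp add: full_SetCompr_eq)
    then have "\<exists>B'. (\<chi> i j. b j $ i) ** B' = mat 1" using matrix_right_invertible_span_columns[of "\<chi> i j. b j $ i"] spB by (simp add: span_vec_eq)
    then have "invertible (\<chi> i j. b j $ i)" unfolding invertible_right_inverse .
    then show ?thesis by (simp add: invertible_det_nz)
  qed
  have "exp_basis (zorich_cocycle p) b \<theta>"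
  proof
    show "\<bar>det (zorich_cocycle p m)\<bar> = 1" for m unfolding det_transpose det_pm by simp
    show "det (\<chi> i j. b j $ i) \<noteq> 0" by (rule indep)
    show "subexp (\<theta> i) (\<lambda>m. norm (zorich_cocycle p m *v b i))" for i
      using oseledets_forward[OF y xs, of "b i" 0 "\<theta> i"] th[of i] by (simp add: p_def)
    have d1: "det (height_cocycle xs k m) = 1" for k m
    proof -
      have "\<And>k. xs k \<in> norm_triples" using xs unfolding two_sided_orbit_def by blast
      then show ?thesis unfolding height_cocycle_def det_transpose by (intro det_mat_prod ext_matrix_det)
    qed
    \<comment> \<open>The cocycle run into the past, under which the same vectors have the rates
      \<open>- \<theta> i\<close>.\<close>
    let ?Q = "\<lambda>m. matrix_inv (height_cocycle xs (0 - int m) m)"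
    show "(\<Sum>i\<in>UNIV. \<theta> i) \<le> 0"
    proof (rule exponent_sum_le[of ?Q b])
      fix m
      have "det (height_cocycle xs (0 - int m) m) * det (?Q m) = 1"
        unfolding det_mul[symmetric] using matrix_inv_mult(1)[of "height_cocycle xs (0 - int m) m"] d1 by simp
      then show "\<bar>det (?Q m)\<bar> = 1" unfolding d1 by simp
    next
      fix i
      have "(\<lambda>m. ln (norm (?Q m *v b i)) / (- real m)) \<longlonglongrightarrow> \<theta> i"
        using th[of i] b0[of i] unfolding oseledets_space_def by blast
      then have "(\<lambda>m. ln (norm (?Q m *v b i)) / real m) \<longlonglongrightarrow> - \<theta> i"
        using tendsto_minus by fastforce
      then show "subexp (- \<theta> i) (\<lambda>m. norm (?Q m *v b i))" by (rule subexp_lim) simp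
    qed (rule indep)
  qed
  then show ?thesis unfolding p_def by blast
qed

lemma E_c_growth:
  assumes gen: "oseledets_generic y" and v: "v \<in> E_c y n"
  defines "p \<equiv> ipath (snd y)"
  shows "subexp 0 (\<lambda>m. norm (transpose (path_prod p (zorich_time p n) (zorich_time p (n + m) - zorich_time p n)) *v v))"
proof (rule subexp_span)
  show "v \<in> span (oseledets_space (ext_orbit y) (int n) 0)" using v unfolding E_c_def oseledets_sum_def by simp
  show "subexp 0 (\<lambda>m. norm (transpose (path_prod p (zorich_time p n) (zorich_time p (n + m) - zorich_time p n)) *v w))"
    if "w \<in> oseledets_space (ext_orbit y) (int n) 0" for w
    unfolding p_def by (rule oseledets_forward[OF generic_orbit(2)[OF gen] generic_orbit(1)[OF gen] that])
qed

lemma E_s_bounded: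
  assumes gen: "oseledets_generic y" and v: "v \<in> E_s y 0"
  shows "\<exists>C>0. \<forall>m. norm (zorich_cocycle (ipath (snd y)) m *v v) \<le> C"
proof -
  let ?P = "zorich_cocycle (ipath (snd y))"
  have "v \<in> span (\<Union>\<theta>\<in>{..<0}. oseledets_space (ext_orbit y) 0 \<theta>)" using v unfolding E_s_def oseledets_sum_def by simp
  then show ?thesis
  proof (induction rule: span_induct_alt)
    case base
    show ?case by (intro exI[of _ 1]) simp
  next
    case (step c w v)
    obtain \<theta> where th: "\<theta> < 0" "w \<in> oseledets_space (ext_orbit y) (int 0) \<theta>" using step(1) by auto
    have "subexp \<theta> (\<lambda>m. norm (?P m *v w))" using oseledets_forward[OF generic_orbit(2)[OF gen] generic_orbit(1)[OF gen] th(2)] by simp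
    \<comment> \<open>The choice \<open>\<epsilon> = - \<theta>\<close>, possible since the exponent
      is negative, turns the exponential bound into a constant.\<close>
    then obtain C where C: "C > 0" "\<And>m. norm (?P m *v w) \<le> C * exp ((\<theta> + (- \<theta>)) * real m)"
      unfolding subexp_def using th(1) neg_0_less_iff_less by metis
    obtain C' where C': "C' > 0" "\<And>m. norm (?P m *v v) \<le> C'" using step(2) by blast
    have "norm (?P m *v (c *\<^sub>R w + v)) \<le> \<bar>c\<bar> * C + C'" for m
    proof -
      have "norm (?P m *v (c *\<^sub>R w + v)) \<le> \<bar>c\<bar> * norm (?P m *v w) + norm (?P m *v v)"
        unfolding matrix_vector_right_distrib matrix_vector_mult_scaleR using norm_triangle_ineq by (metis norm_scaleR)
      moreover have "\<bar>c\<bar> * norm (?P m *v w) \<le> \<bar>c\<bar> * C" using C(2)[of m] by (intro mult_left_mono) auto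
      ultimately show ?thesis using C'(2)[of m] by linarith
    qed
    moreover have "0 < \<bar>c\<bar> * C + C'" using C(1) C'(1) by (simp add: add_nonneg_pos)
    ultimately show ?case by blast
  qed
qed

lemma bounded_subexp: "(\<And>m. f m \<le> C) \<Longrightarrow> 0 < C \<Longrightarrow> subexp 0 f"
  unfolding subexp_def
proof (intro allI impI)
  fix \<epsilon> :: real assume "\<And>m. f m \<le> C" "0 < C" "0 < \<epsilon>"
  then have "f m \<le> C * exp ((0 + \<epsilon>) * real m)" for m
    using mult_left_mono[of 1 "exp (\<epsilon> * real m)" C] order_trans[of "f m" C] by fastforce
  then show "\<exists>C>0. \<forall>m. f m \<le> C * exp ((0 + \<epsilon>) * real m)" using \<open>0 < C\<close> by blast
qed

lemma subexp_forward:
  assumes "subexp \<theta> f" shows "subexp \<theta> (\<lambda>m. f (j + m))"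
  unfolding subexp_def
proof (intro allI impI)
  fix \<epsilon> :: real assume "0 < \<epsilon>"
  then obtain C where C: "C > 0" "\<And>m. f m \<le> C * exp ((\<theta> + \<epsilon>) * real m)" using assms unfolding subexp_def by blast
  have "f (j + m) \<le> (C * exp ((\<theta> + \<epsilon>) * real j)) * exp ((\<theta> + \<epsilon>) * real m)" for m
    using C(2)[of "j + m"] by (simp only: of_nat_add distrib_left exp_add mult.assoc)
  then show "\<exists>C>0. \<forall>m. f (j + m) \<le> C * exp ((\<theta> + \<epsilon>) * real m)" using C(1)
    by (intro exI[of _ "C * exp ((\<theta> + \<epsilon>) * real j)"]) auto
qed

lemma E_cs_growth:
  assumes gen: "oseledets_generic y" and v: "v \<in> E_cs y"
  shows "subexp 0 (\<lambda>m. norm (zorich_cocycle (ipath (snd y)) m *v v))"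
proof -
  obtain v1 v2 where v12: "v = v1 + v2" "v1 \<in> E_s y 0" "v2 \<in> E_c y 0" using v unfolding E_cs_def by blast
  obtain C where "C > 0" "\<And>m. norm (zorich_cocycle (ipath (snd y)) m *v v1) \<le> C" using E_s_bounded[OF gen v12(2)] by blast
  then have 1: "subexp 0 (\<lambda>m. norm (zorich_cocycle (ipath (snd y)) m *v v1))" by (rule bounded_subexp[rotated])
  have 2: "subexp 0 (\<lambda>m. norm (zorich_cocycle (ipath (snd y)) m *v v2))" using E_c_growth[OF gen v12(3)] by simp
  show ?thesis by (rule subexp_add[OF 1 2]) (simp add: v12(1) matrix_vector_right_distrib norm_triangle_ineq)
qed

section \<open>The accelerated orbit\<close>

text \<open>For non-negative matrices this is the l1 norm of the entries. It is visibly monotone in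
  them and comparable to the operator norm.\<close>

definition entry_sum :: "real^'a^'a \<Rightarrow> real" where
  "entry_sum M = (\<Sum>a\<in>UNIV. \<Sum>b\<in>UNIV. M $ a $ b)"

lemma entry_sum_mono: "(\<And>a b. M $ a $ b \<le> M' $ a $ b) \<Longrightarrow> entry_sum M \<le> entry_sum M'"
  unfolding entry_sum_def by (intro sum_mono) auto

lemma entry_sum_opnorm: "entry_sum M \<le> (real CARD('a))\<^sup>2 * opnorm M" for M :: "real^'a::finite^'a"
proof -
  have "M $ a $ b \<le> opnorm M" for a b
  proof -
    have "M $ a $ b = (M *v axis b 1) $ a" by (simp add: matrix_vector_mult_basis column_def)
    also have "\<dots> \<le> norm (M *v axis b 1)" using component_le_norm_cart[of "M *v axis b 1" a] by simp
    also have "\<dots> \<le> opnorm M * norm (axis b (1::real))" unfolding opnorm_def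
      by (rule onorm[OF matrix_vector_mul_bounded_linear])
    finally show ?thesis by simp
  qed
  then have "entry_sum M \<le> (\<Sum>a\<in>(UNIV::'a set). \<Sum>b\<in>(UNIV::'a set). opnorm M)" unfolding entry_sum_def by (intro sum_mono)
  then show ?thesis by (simp add: power2_eq_square mult.assoc)
qed

lemma norm_transpose_ent:
  fixes M :: "real^'a::finite^'a"
  assumes "\<And>a b. 0 \<le> M $ a $ b" shows "norm (transpose M *v v) \<le> entry_sum M * norm v"
proof -
  have "norm (transpose M *v v) \<le> (\<Sum>a\<in>UNIV. \<bar>(transpose M *v v) $ a\<bar>)" by (rule norm_le_l1_cart)
  also have "\<dots> \<le> (\<Sum>a\<in>UNIV. \<Sum>b\<in>UNIV. M $ b $ a * norm v)"
  proof (rule sum_mono)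
    fix a
    have "\<bar>(transpose M *v v) $ a\<bar> \<le> (\<Sum>b\<in>UNIV. \<bar>M $ b $ a * v $ b\<bar>)"
      unfolding matrix_vector_mult_def transpose_def by (simp add: sum_abs)
    also have "\<dots> \<le> (\<Sum>b\<in>UNIV. M $ b $ a * norm v)"
      using assms component_le_norm_cart[of v] by (intro sum_mono) (simp add: abs_mult mult_left_mono)
    finally show "\<bar>(transpose M *v v) $ a\<bar> \<le> (\<Sum>b\<in>UNIV. M $ b $ a * norm v)" .
  qed
  also have "\<dots> = entry_sum M * norm v" unfolding entry_sum_def by (subst sum.swap) (simp add: sum_distrib_right)
  finally show ?thesis .
qed

context rv_path
begin

lemma path_prod_diag: "1 \<le> path_prod p n k $ a $ a"
  using path_prod_mono[of 0 k n a a] by (simp add: mat_def)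

text \<open>Each step adds the winner's column to the loser's, and the diagonal entry of the former
  is at least 1. The number of Rauzy-Veech steps in a Zorich step is thus controlled by its
  matrix.\<close>

lemma entry_sum_steps: "real k \<le> entry_sum (path_prod p n k)"
proof (induction k)
  case 0
  show ?case unfolding entry_sum_def of_nat_0 by (intro sum_nonneg path_prod_bounds(1))
next
  case (Suc k)
  let ?M = "path_prod p n k" and ?s = "p (n + k)"
  have "entry_sum (path_prod p n (Suc k)) = (\<Sum>a\<in>UNIV. \<Sum>b\<in>UNIV. ?M $ a $ b + (if b = loser ?s then ?M $ a $ winner ?s else 0))"
    unfolding entry_sum_def mat_prod.simps matrix_mult_rm ..
  also have "\<dots> = entry_sum ?M + (\<Sum>a\<in>UNIV. ?M $ a $ winner ?s)" by (simp add: entry_sum_def sum.distrib)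
  also have "(\<Sum>a\<in>UNIV. ?M $ a $ winner ?s) \<ge> ?M $ winner ?s $ winner ?s"
    by (rule member_le_sum) (use path_prod_bounds(1) in auto)
  then have "entry_sum ?M + (\<Sum>a\<in>UNIV. ?M $ a $ winner ?s) \<ge> entry_sum ?M + 1" using path_prod_diag[of n k "winner ?s"] by linarith
  finally show ?case using Suc by simp
qed

text \<open>Diagonal entries stay at least 1, so a prefix can be put before a product without
  decreasing any entry.\<close>

lemma entry_sum_pm_sub: "entry_sum (path_prod p (n + k) k') \<le> entry_sum (path_prod p n (k + k'))"
proof (rule entry_sum_mono)
  fix a b
  have "path_prod p (n + k) k' $ a $ b \<le> path_prod p n k $ a $ a * path_prod p (n + k) k' $ a $ b"
    using mult_right_mono[OF path_prod_diag[of n k a] path_prod_bounds(1)[of p "n + k" k' a b]] by simp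
  also have "\<dots> \<le> (\<Sum>c\<in>UNIV. path_prod p n k $ a $ c * path_prod p (n + k) k' $ c $ b)"
    by (rule member_le_sum) (auto intro!: mult_nonneg_nonneg path_prod_bounds(1))
  also have "\<dots> = path_prod p n (k + k') $ a $ b" unfolding path_prod_add by (simp add: matrix_matrix_mult_def)
  finally show "path_prod p (n + k) k' $ a $ b \<le> path_prod p n (k + k') $ a $ b" .
qed

lemma entry_sum_pm_mono: "k \<le> k' \<Longrightarrow> entry_sum (path_prod p n k) \<le> entry_sum (path_prod p n k')"
  by (intro entry_sum_mono path_prod_mono)

lemma entry_sum_pm_ge_1: "1 \<le> entry_sum (path_prod p n k)"
proof -
  have "path_prod p n k $ a $ a \<le> (\<Sum>b\<in>UNIV. path_prod p n k $ a $ b)" for a by (rule member_le_sum) (use path_prod_bounds(1) in auto)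
  moreover have "(\<Sum>b\<in>UNIV. path_prod p n k $ a $ b) \<le> entry_sum (path_prod p n k)" for a
    unfolding entry_sum_def by (rule member_le_sum[of a UNIV "\<lambda>a. \<Sum>b\<in>UNIV. path_prod p n k $ a $ b"]) (auto intro!: sum_nonneg path_prod_bounds(1))
  ultimately show ?thesis using path_prod_diag order_trans by meson
qed

end

section \<open>Lengths along an infinitely renormalizable path\<close>

lemma istep_fst: "fst ((istep ^^ Suc i) q) $ a = fst ((istep ^^ i) q) $ a - (if a = winner (ipath q i) then fst ((istep ^^ i) q) $ loser (ipath q i) else 0)"
  unfolding ipath_def by (simp add: istep_def)

lemma valid_pos: "valid q \<Longrightarrow> 0 < fst ((istep ^^ i) q) $ a"
  using valid_istep[of q i] unfolding valid_def[of "(istep ^^ i) q"] by simp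

text \<open>Under a constant type the winner never changes, and each step shortens it by the length
  of another letter. These other lengths are constant, so the winner would be exhausted.\<close>

lemma valid_type_changes:
  assumes v: "valid q" shows "\<exists>k\<ge>1. snd (ipath q (n + k)) \<noteq> snd (ipath q n)"
proof (rule ccontr)
  assume "\<not> ?thesis"
  then have same: "snd (ipath q (n + k)) = snd (ipath q n)" for k by (cases k) auto
  interpret rv_path "ipath q" by (rule rv_path_ipath[OF v])
  let ?w = "winner (ipath q n)" and ?l = "\<lambda>i. fst ((istep ^^ i) q)"
  have w: "winner (ipath q (n + k)) = ?w" for k
  proof (induction k)
    case (Suc k)
    have "snd (ipath q (Suc (n + k))) = snd (ipath q (n + k))" using same[of "Suc k"] same[of k] by simp
    from winner_next(2)[OF this] Suc show ?case by simp
  qed simp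
  define \<delta> where "\<delta> = Min (range (\<lambda>a. ?l n $ a))"
  have d: "0 < \<delta>" unfolding \<delta>_def using valid_pos[OF v] by (subst Min_gr_iff) auto
  have dl: "\<delta> \<le> ?l n $ a" for a unfolding \<delta>_def by (rule Min_le) auto
  have main: "(\<forall>b. b \<noteq> ?w \<longrightarrow> ?l (n + k) $ b = ?l n $ b) \<and> ?l (n + k) $ ?w \<le> ?l n $ ?w - real k * \<delta>" for k
  proof (induction k)
    case (Suc k)
    have l: "loser (ipath q (n + k)) \<noteq> ?w" using ne[of "n + k"] unfolding w by simp
    then have "?l (n + k) $ loser (ipath q (n + k)) \<ge> \<delta>" using Suc dl by simp
    moreover have "?l (n + Suc k) $ ?w = ?l (n + k) $ ?w - ?l (n + k) $ loser (ipath q (n + k))"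
      using istep_fst[of "n + k" q ?w] unfolding w by (simp del: funpow.simps)
    ultimately have "?l (n + Suc k) $ ?w \<le> ?l n $ ?w - real (Suc k) * \<delta>" using conjunct2[OF Suc] by (simp add: distrib_right del: funpow.simps)
    moreover have "?l (n + Suc k) $ b = ?l n $ b" if "b \<noteq> ?w" for b
      using istep_fst[of "n + k" q b] that Suc unfolding w by (simp del: funpow.simps)
    ultimately show ?case by blast
  qed simp
  obtain k :: nat where "?l n $ ?w < real k * \<delta>" using reals_Archimedean3[OF d] by blast
  then have "?l (n + k) $ ?w < 0" using main[of k] by linarith
  then show False using valid_pos[OF v, of "n + k" ?w] by linarith
qed

lemma valid_zt:
  assumes v: "valid q" shows "zorich_time (ipath q) j < zorich_time (ipath q) (Suc j)"
proof -
  let ?Q = "\<lambda>k. 1 \<le> k \<and> snd (ipath q (zorich_time (ipath q) j + k)) \<noteq> snd (ipath q (zorich_time (ipath q) j + 0))"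
  have "\<exists>k. ?Q k" using valid_type_changes[OF v, of "zorich_time (ipath q) j"] by simp
  from LeastI_ex[OF this] show ?thesis unfolding zorich_time.simps ztime_def by simp
qed

locale acc_generic = accel +
  assumes bal: "\<exists>c>0. \<forall>n\<ge>1. \<forall>a b. acc_lambda N x n $ a / acc_lambda N x n $ b > c"
    and lin: "acc_linear_time N x" and cen: "acc_central N x" and gro: "acc_exp_growth N x"
    and roth: "acc_roth N x" and gen: "oseledets_generic x"
begin

sublocale path: rv_path pth unfolding pth_def by (rule rv_path_ipath[OF vx])

lemma zorich_time_strict: "strict_mono (zorich_time pth)"
  unfolding strict_mono_Suc_iff pth_def using valid_zt[OF vx] by blast

lemma R_strict: "R n < R (Suc n)"
  unfolding R_def using zorich_time_strict T_Suc(2)[of n] by (simp add: strict_mono_less)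

abbreviation "lam i \<equiv> fst ((istep ^^ i) (snd x))"

lemma lam_pos: "0 < lam i $ a" by (rule valid_pos[OF vx])

lemma vsum_step: "vsum (lam (Suc i)) = vsum (lam i) - lam i $ loser (pth i)"
proof -
  have "vsum (lam (Suc i)) = (\<Sum>a\<in>UNIV. lam i $ a - (if a = winner (pth i) then lam i $ loser (pth i) else 0))"
    unfolding vsum_def istep_fst pth_def ..
  then show ?thesis unfolding vsum_def by (simp add: sum_subtractf)
qed

lemma vsum_mono: "i \<le> j \<Longrightarrow> vsum (lam j) \<le> vsum (lam i)"
proof (induction j rule: dec_induct)
  case (step j)
  then show ?case using vsum_step[of j] lam_pos[of j "loser (pth j)"] by linarith
qed simp

text \<open>At a balanced time the loser has at least the share \<open>c / d\<close> of the total
  length, and the step removes that share. This happens at least once in every step of the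
  acceleration.\<close>

lemma vsum_zero:
  assumes "0 < \<epsilon>" shows "\<exists>i. vsum (lam i) < \<epsilon>"
proof -
  obtain c where c: "c > 0" "\<And>n a b. 1 \<le> n \<Longrightarrow> lam (R n) $ a / lam (R n) $ b > c"
    using bal unfolding acc_lambda_eq by blast
  define d where "d = real CARD('a)"
  have d: "0 < d" unfolding d_def by simp
  define \<theta> where "\<theta> = 1 - c / d"
  have st: "vsum (lam (R (Suc n))) \<le> \<theta> * vsum (lam (R n))" if "1 \<le> n" for n
  proof -
    let ?l = "lam (R n) $ loser (pth (R n))"
    have "c * lam (R n) $ b \<le> ?l" for b
      using c(2)[OF that, of "loser (pth (R n))" b] lam_pos[of "R n" b] by (simp add: field_simps)
    then have "(\<Sum>b\<in>(UNIV::'a set). c * lam (R n) $ b) \<le> (\<Sum>b\<in>(UNIV::'a set). ?l)" by (intro sum_mono)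
    then have "c * vsum (lam (R n)) \<le> d * ?l" unfolding vsum_def d_def by (simp add: sum_distrib_left)
    then have "vsum (lam (R n)) - ?l \<le> \<theta> * vsum (lam (R n))" unfolding \<theta>_def using d by (simp add: field_simps)
    moreover have "vsum (lam (R (Suc n))) \<le> vsum (lam (Suc (R n)))" using R_strict[of n] by (intro vsum_mono) simp
    ultimately show ?thesis using vsum_step[of "R n"] by linarith
  qed
  have vp: "0 < vsum (lam i)" for i using lam_pos by (rule vsum_pos)
  have t0: "0 \<le> \<theta>" using st[of 1] vp[of "R 1"] vp[of "R 2"]
    by (smt (verit) One_nat_def Suc_1 mult_nonneg_nonpos order_refl mult.commute)
  have t1: "\<theta> < 1" unfolding \<theta>_def using c d by simp
  have pw: "vsum (lam (R (Suc n))) \<le> \<theta> ^ n * vsum (lam (R 1))" for n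
  proof (induction n)
    case (Suc n)
    have "vsum (lam (R (Suc (Suc n)))) \<le> \<theta> * vsum (lam (R (Suc n)))" by (rule st) simp
    also have "\<dots> \<le> \<theta> * (\<theta> ^ n * vsum (lam (R 1)))" using Suc t0 by (rule mult_left_mono)
    finally show ?case by (simp add: mult.assoc)
  qed simp
  have "(\<lambda>n. \<theta> ^ n * vsum (lam (R 1))) \<longlonglongrightarrow> 0 * vsum (lam (R 1))"
    using t0 t1 by (intro tendsto_mult_right LIMSEQ_realpow_zero)
  then have "(\<lambda>n. \<theta> ^ n * vsum (lam (R 1))) \<longlonglongrightarrow> 0" by simp
  then have "eventually (\<lambda>n. \<theta> ^ n * vsum (lam (R 1)) < \<epsilon>) sequentially" using order_tendstoD(2) assms by blast
  then obtain n where "\<theta> ^ n * vsum (lam (R 1)) < \<epsilon>" using eventually_happens'[OF sequentially_bot] by blast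
  then show ?thesis using pw[of n] by (intro exI[of _ "R (Suc n)"]) linarith
qed

text \<open>A letter that no longer wins would keep its length for ever, while the total length
  tends to zero.\<close>

lemma wins: "\<exists>n'\<ge>n. winner (pth n') = a"
proof (rule ccontr)
  assume no: "\<not> ?thesis"
  have const: "lam (n + k) $ a = lam n $ a" for k
  proof (induction k)
    case (Suc k)
    have "winner (pth (n + k)) \<noteq> a" using no by auto
    then show ?case using istep_fst[of "n + k" "snd x" a] Suc unfolding pth_def by (auto simp del: funpow.simps)
  qed simp
  obtain i where i: "vsum (lam i) < lam n $ a" using vsum_zero[OF lam_pos] by blast
  have "lam (n + i) $ a \<le> vsum (lam (n + i))"
    unfolding vsum_def by (rule member_le_sum) (use lam_pos less_imp_le in auto)
  also have "\<dots> \<le> vsum (lam i)" by (rule vsum_mono) simp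
  finally show False using const[of i] i by linarith
qed

lemma not_bad: "\<exists>K. \<not> no_posblock K (snd x)"
proof -
  obtain k where "posblock pth 0 k" using path.posblock_exists[OF wins] by blast
  then show ?thesis unfolding no_posblock_def pth_def by blast
qed

lemma T_linear: "\<exists>a\<ge>1. \<forall>n. T n \<le> a * n"
proof -
  obtain a0 where a0: "\<And>n. 1 \<le> n \<Longrightarrow> real (T n) / real n \<le> a0"
    using lin unfolding acc_linear_time_def bdd_above_def by auto
  obtain a :: nat where a: "1 \<le> a" "a0 \<le> real a"
  proof -
    obtain b :: nat where "a0 \<le> real b" using real_arch_simple by blast
    then show ?thesis using that[of "Suc b"] by simp
  qed
  have Ta: "T n \<le> a * n" for n
  proof (cases "n = 0")
    case False
    then have "real (T n) \<le> real a * real n" using a0[of n] a(2) by (simp add: field_simps) (smt (verit) mult_left_mono mult.commute of_nat_0_le_iff)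
    then show ?thesis by (metis of_nat_le_iff of_nat_mult)
  qed (simp add: T0)
  then show ?thesis using a(1) by blast
qed

text \<open>The bound \<open>T n \<le> a * n\<close> places at least \<open>m div a\<close>
  acceleration times below \<open>m\<close>. For some large \<open>m\<close> the bad Zorich times
  fill at most the fraction \<open>1 / (2 * a)\<close>, so they cannot include all late acceleration
  times.\<close>

lemma good_times:
  assumes gf: "good_freq (snd x)"
  shows "\<exists>K. \<forall>n0. \<exists>n\<ge>n0. \<exists>k\<le>K. posblock pth (R n) k"
proof -
  obtain a where a: "1 \<le> a" and Ta: "\<And>n. T n \<le> a * n" using T_linear by blast
  \<comment> \<open>Since \<open>good_freq\<close> divides by \<open>Suc r\<close>, the index
    \<open>r = 2 * a - 1\<close> produces the fraction \<open>1 / (2 * a)\<close>.\<close>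
  have "Suc (2 * a - 1) = 2 * a" using a by simp
  then have "\<exists>K. \<forall>m0. \<exists>m\<ge>m0. real (card {j. j < m \<and> no_posblock K ((zstep ^^ j) (snd x))}) \<le> real m / real (2 * a)"
    using spec[OF gf[unfolded good_freq_def], of "2 * a - 1"] by (simp only:)
  then obtain K where K: "\<forall>m0. \<exists>m\<ge>m0. real (card {j. j < m \<and> no_posblock K ((zstep ^^ j) (snd x))}) \<le> real m / real (2 * a)" ..
  have "\<exists>n\<ge>n0. \<not> no_posblock K ((zstep ^^ T n) (snd x))" for n0
  proof (rule ccontr)
    assume no: "\<not> ?thesis"
    obtain m where m: "2 * a * (1 + n0) + 1 \<le> m" "real (card {j. j < m \<and> no_posblock K ((zstep ^^ j) (snd x))}) \<le> real m / real (2 * a)"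
      using spec[OF K, of "2 * a * (1 + n0) + 1"] by (elim exE conjE)
    have sub: "T ` {n0..<m div a} \<subseteq> {j. j < m \<and> no_posblock K ((zstep ^^ j) (snd x))}"
    proof
      fix j assume "j \<in> T ` {n0..<m div a}"
      then obtain n where n: "j = T n" "n0 \<le> n" "n < m div a" by auto
      have "a * n < m" proof -
        have "a * Suc n \<le> a * (m div a)" using n(3) by (intro mult_le_mono2) simp
        also have "\<dots> \<le> m" by simp
        finally show ?thesis using a by simp
      qed
      then have "T n < m" using Ta[of n] by linarith
      then show "j \<in> {j. j < m \<and> no_posblock K ((zstep ^^ j) (snd x))}" using n no by auto
    qed
    have "card (T ` {n0..<m div a}) = m div a - n0"
      using T_strict by (subst card_image) (auto simp: strict_mono_eq inj_on_def)
    then have "m div a - n0 \<le> card {j. j < m \<and> no_posblock K ((zstep ^^ j) (snd x))}"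
      using card_mono[OF _ sub] by simp
    then have "real (m div a) - real n0 \<le> real m / real (2 * a)" using m(2) by linarith
    moreover have "real m < real a * (real (m div a) + 1)"
    proof -
      have "m < a * (m div a + 1)" using a by (simp add: dividend_less_times_div)
      then show ?thesis by (metis of_nat_1 of_nat_add of_nat_less_iff of_nat_mult)
    qed
    ultimately have "real m < real a * (real n0 + real m / real (2 * a) + 1)"
      using a by (smt (verit) mult_left_mono of_nat_0_le_iff)
    also have "\<dots> = real a * (real n0 + 1) + real m / 2" using a by (simp add: field_simps)
    finally have "real m < 2 * real a * (real n0 + 1)" by simp
    moreover have "real (2 * a * (1 + n0) + 1) \<le> real m" using m(1) by (simp only: of_nat_le_iff)
    ultimately show False by (simp add: algebra_simps)
  qed
  then have "\<forall>n0. \<exists>n\<ge>n0. \<exists>k\<le>K. posblock (\<lambda>i. pth (R n + i)) 0 k"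
    unfolding no_posblock_def zstep_iter ipath_istep R_def pth_def by blast
  then show ?thesis unfolding posblock_def rm_shift by (intro exI[of _ K]) simp
qed

text \<open>The \<open>j\<close>-th Zorich step is a factor of a single acceleration step, of index
  \<open>n \<le> j\<close>. The Roth type bound with exponent \<open>\<epsilon> / \<Lambda>\<close>
  turns the growth \<open>exp (\<Lambda> * n)\<close> of the long products into
  \<open>exp (\<epsilon> * n)\<close> for that step.\<close>

lemma subexp_B: "subexp 0 (\<lambda>j. entry_sum (zorich_step_mat pth j))"
  unfolding subexp_def
proof (intro allI impI)
  fix \<epsilon> :: real assume e: "0 < \<epsilon>"
  obtain \<Lambda>0 where L0: "\<And>n. 1 \<le> n \<Longrightarrow> 1 / real n * ln (opnorm (acc_prod N x 0 n)) \<le> \<Lambda>0"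
    using gro unfolding acc_exp_growth_def bdd_above_def by auto
  define \<Lambda> where "\<Lambda> = max \<Lambda>0 1"
  have L: "0 < \<Lambda>" "\<Lambda>0 \<le> \<Lambda>" unfolding \<Lambda>_def by auto
  have op: "0 \<le> opnorm M" for M :: "real^'a^'a" unfolding opnorm_def by (rule onorm_pos_le[OF matrix_vector_mul_bounded_linear])
  have gr: "opnorm (acc_prod N x 0 n) \<le> exp (\<Lambda> * real n)" if "1 \<le> n" for n
  proof (cases "opnorm (acc_prod N x 0 n) = 0")
    case False
    then have pos: "0 < opnorm (acc_prod N x 0 n)" using op[of "acc_prod N x 0 n"] by linarith
    have "ln (opnorm (acc_prod N x 0 n)) \<le> \<Lambda>0 * real n" using L0[OF that] that by (simp add: field_simps)
    also have "\<dots> \<le> \<Lambda> * real n" using L by (intro mult_right_mono) auto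
    finally show ?thesis using pos by (metis exp_le_cancel_iff exp_ln)
  qed simp
  have "0 < \<epsilon> / \<Lambda>" using e L by simp
  then obtain C where C: "C > 0" "\<And>n. 1 \<le> n \<Longrightarrow> opnorm (acc_prod N x (n - 1) n) \<le> C * opnorm (acc_prod N x 0 n) powr (\<epsilon> / \<Lambda>)"
    using roth unfolding acc_roth_def by blast
  define d where "d = (real CARD('a))\<^sup>2"
  have d: "0 < d" unfolding d_def by simp
  have "entry_sum (zorich_step_mat pth j) \<le> d * C * exp \<epsilon> * exp (\<epsilon> * real j)" for j
  proof -
    obtain n where n: "T n \<le> j" "j < T (Suc n)"
    proof -
      have ex: "\<exists>n. j < T (Suc n)" using T_ge[of "Suc j"] by (intro exI[of _ j]) simp
      define n where "n = (LEAST n. j < T (Suc n))"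
      have 1: "j < T (Suc n)" unfolding n_def by (rule LeastI_ex[OF ex])
      have 2: "T n \<le> j"
      proof (cases n)
        case (Suc k)
        then have "\<not> j < T (Suc k)" using not_less_Least[of k "\<lambda>n. j < T (Suc n)"] unfolding n_def by auto
        then show ?thesis using Suc by simp
      qed (simp add: T0)
      show ?thesis using that 1 2 by blast
    qed
    have z: "R n \<le> zorich_time pth j" "zorich_time pth (Suc j) \<le> R (Suc n)"
      unfolding R_def using zorich_time_strict n by (simp_all add: strict_mono_less_eq del: zorich_time.simps)
    let ?t = "ztime (\<lambda>i. pth (zorich_time pth j + i))"
    have "entry_sum (zorich_step_mat pth j) = entry_sum (path_prod pth (R n + (zorich_time pth j - R n)) ?t)" using z(1) by simp
    also have "\<dots> \<le> entry_sum (path_prod pth (R n) ((zorich_time pth j - R n) + ?t))" by (rule path.entry_sum_pm_sub)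
    also have "\<dots> \<le> entry_sum (path_prod pth (R n) (R (Suc n) - R n))" using z by (intro path.entry_sum_pm_mono) simp
    also have "\<dots> = entry_sum (acc_prod N x (Suc n - 1) (Suc n))" using acc_prod_eq[of n 1] by simp
    also have "\<dots> \<le> d * opnorm (acc_prod N x (Suc n - 1) (Suc n))" unfolding d_def by (rule entry_sum_opnorm)
    also have "\<dots> \<le> d * (C * opnorm (acc_prod N x 0 (Suc n)) powr (\<epsilon> / \<Lambda>))" using d by (intro mult_left_mono C(2)) auto
    also have "\<dots> \<le> d * (C * exp (\<Lambda> * real (Suc n)) powr (\<epsilon> / \<Lambda>))"
      using d C(1) e L op by (intro mult_left_mono powr_mono2 gr) auto
    also have "exp (\<Lambda> * real (Suc n)) powr (\<epsilon> / \<Lambda>) = exp (\<epsilon> * real (Suc n))" using L by (simp add: powr_def)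
    also have "d * (C * exp (\<epsilon> * real (Suc n))) \<le> d * (C * exp (\<epsilon> * real (Suc j)))"
      using d C(1) e T_ge[of n] n(1) by (intro mult_left_mono) auto
    also have "\<dots> = d * C * exp \<epsilon> * exp (\<epsilon> * real j)" by (simp add: exp_add[symmetric] distrib_left)
    finally show ?thesis .
  qed
  moreover have "0 < d * C * exp \<epsilon>" using d C(1) by simp
  ultimately show "\<exists>C>0. \<forall>j. entry_sum (zorich_step_mat pth j) \<le> C * exp ((0 + \<epsilon>) * real j)" by (intro exI[of _ "d * C * exp \<epsilon>"]) simp
qed

lemma central_bounded:
  assumes v: "v \<in> E_c x 0" shows "\<exists>C>0. \<forall>n\<ge>1. norm (zorich_cocycle pth (T n) *v v) \<le> C"
proof (cases "v = 0")
  case True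
  then show ?thesis by (intro exI[of _ 1]) simp
next
  case False
  then have "E_c x 0 \<noteq> {0}" using v by blast
  then obtain C where C: "C > 0" "\<And>n. 1 \<le> n \<Longrightarrow> opnorm_on (E_c x 0) (transpose (acc_prod N x 0 n)) < C"
    using cen unfolding acc_central_def by blast
  let ?u = "(1 / norm v) *\<^sub>R v"
  have u: "?u \<in> E_c x 0" "norm ?u = 1" using v False unfolding E_c_def oseledets_sum_def by (auto intro: span_scale)
  have "norm (zorich_cocycle pth (T n) *v v) \<le> C * norm v" if n: "1 \<le> n" for n
  proof -
    let ?M = "transpose (acc_prod N x 0 n)"
    have M: "?M = zorich_cocycle pth (T n)" using acc_prod_eq[of 0 n] unfolding R0 by (simp add: R_def)
    have "norm (?M *v ?u) \<le> opnorm_on (E_c x 0) ?M" unfolding opnorm_on_def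
    proof (rule cSUP_upper)
      show "?u \<in> {v \<in> E_c x 0. norm v = 1}" using u by simp
      show "bdd_above ((\<lambda>v. norm (?M *v v)) ` {v \<in> E_c x 0. norm v = 1})"
      proof (rule bdd_aboveI2[of _ _ "onorm ((*v) ?M)"])
        fix u assume "u \<in> {v \<in> E_c x 0. norm v = 1}"
        then show "norm (?M *v u) \<le> onorm ((*v) ?M)" using onorm[OF matrix_vector_mul_bounded_linear[of ?M], of u] by simp
      qed
    qed
    then have "norm (?M *v ?u) \<le> C" using C(2)[OF n] by linarith
    then show ?thesis using False unfolding M matrix_vector_mult_scaleR by (simp add: field_simps)
  qed
  moreover have "0 < C * norm v" using C(1) False by simp
  ultimately show ?thesis by blast
qed

text \<open>The stable component is bounded at all Zorich times; for the central one the bound comes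
  from the acceleration and holds at its times. This is why good times are sought among the
  \<open>R n\<close>.\<close>

lemma log_slope_bounded:
  assumes w: "\<omega> \<in> E_cs x" shows "\<exists>m>0. \<forall>n\<ge>1. \<forall>a. \<bar>log_slope pth \<omega> (R n) $ a\<bar> \<le> m"
proof -
  obtain v1 v2 where v12: "\<omega> = v1 + v2" "v1 \<in> E_s x 0" "v2 \<in> E_c x 0" using w unfolding E_cs_def by blast
  obtain C1 where C1: "C1 > 0" "\<And>m. norm (zorich_cocycle pth m *v v1) \<le> C1" using E_s_bounded[OF gen v12(2)] unfolding pth_def by blast
  obtain C2 where C2: "C2 > 0" "\<And>n. 1 \<le> n \<Longrightarrow> norm (zorich_cocycle pth (T n) *v v2) \<le> C2" using central_bounded[OF v12(3)] by blast
  have "\<bar>log_slope pth \<omega> (R n) $ a\<bar> \<le> C1 + C2" if "1 \<le> n" for n a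
  proof -
    have "log_slope pth \<omega> (R n) = zorich_cocycle pth (T n) *v v1 + zorich_cocycle pth (T n) *v v2"
      unfolding transpose_pm_om[symmetric] R_def v12(1) matrix_vector_right_distrib ..
    then have "norm (log_slope pth \<omega> (R n)) \<le> C1 + C2"
      using norm_triangle_ineq[of "zorich_cocycle pth (T n) *v v1" "zorich_cocycle pth (T n) *v v2"] C1(2)[of "T n"] C2(2)[OF that] by simp
    then show ?thesis using component_le_norm_cart[of "log_slope pth \<omega> (R n)" a] by linarith
  qed
  then show ?thesis using C1(1) C2(1) by (intro exI[of _ "C1 + C2"]) simp
qed

end

section \<open>Propagation of slope defects\<close>

text \<open>The intervals and their images both tile the domain, each in the order of its own row;
  one notion serves both.\<close>

definition tiling :: "('a::finite \<Rightarrow> nat) \<Rightarrow> real \<Rightarrow> ('a \<Rightarrow> real) \<Rightarrow> ('a \<Rightarrow> real) \<Rightarrow> bool" where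
  "tiling r A u v \<longleftrightarrow> bij_betw r UNIV {1..CARD('a)} \<and> (\<Union>a. {u a..<v a}) = {0..<A} \<and>
     (\<forall>a. u a < v a) \<and> (\<forall>a b. r a < r b \<longrightarrow> v a \<le> u b)"

lemma giet_tiling:
  assumes "giet_data g A u v p q"
  shows "tiling (fst (gperm g)) A u v" "tiling (snd (gperm g)) A p q"
proof -
  have B: "C1_branch (gmap g) (u a) (v a) (p a) (q a)" for a by (rule giet_dataD(2)[OF assms])
  have "(\<Union>a. {u a..<v a}) = {0..<A}" using giet_dataD(1,3)[OF assms] unfolding gdom_def by simp
  then show "tiling (fst (gperm g)) A u v" using assms C1_branch_image(3)[OF B] unfolding tiling_def giet_data_def by blast
  show "tiling (snd (gperm g)) A p q" using assms C1_branch_image(2)[OF B] unfolding tiling_def giet_data_def by blast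
qed

lemma tiling_ends:
  fixes r :: "'a::finite \<Rightarrow> nat"
  assumes D: "tiling r A u v"
  shows "r a = 1 \<Longrightarrow> u a = 0" "r a = CARD('a) \<Longrightarrow> v a = A" "r b = Suc (r a) \<Longrightarrow> v a = u b"
proof -
  have r: "bij_betw r UNIV {1..CARD('a)}" and dom: "(\<Union>a. {u a..<v a}) = {0..<A}"
    and ord: "\<And>a b. r a < r b \<Longrightarrow> v a \<le> u b" and uv: "\<And>a. u a < v a"
    using D unfolding tiling_def by blast+
  have sub: "0 \<le> u a" "v a \<le> A" for a
  proof -
    have "{u a..<v a} \<subseteq> {0..<A}" using dom by blast
    then show "0 \<le> u a" "v a \<le> A" unfolding ivl_subset using uv[of a] by auto
  qed
  have cover: "\<exists>a. u a \<le> x \<and> x < v a" if "0 \<le> x" "x < A" for x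
  proof -
    have "x \<in> (\<Union>a. {u a..<v a})" unfolding dom using that by simp
    then show ?thesis by auto
  qed
  have rng: "1 \<le> r c" "r c \<le> CARD('a)" for c using r bij_betwE by fastforce+
  have eqr: "b = c" if "r b = r c" for b c using r that unfolding bij_betw_def by (metis injD)
  show "u a = 0" if "r a = 1"
  proof (rule ccontr)
    assume "u a \<noteq> 0"
    then have "0 < u a" using sub(1)[of a] by simp
    then obtain c where c: "u c \<le> 0" "0 < v c" using cover[of 0] uv[of a] sub(2)[of a] by auto
    have "a \<noteq> c" using c \<open>0 < u a\<close> by auto
    then have "r a < r c" using that rng(1)[of c] eqr[of a c] by linarith
    then show False using ord[of a c] uv[of a] c \<open>0 < u a\<close> by linarith
  qed
  show "v a = A" if "r a = CARD('a)"
  proof (rule ccontr)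
    assume "v a \<noteq> A"
    then have "v a < A" using sub(2)[of a] by simp
    then obtain c where c: "u c \<le> v a" "v a < v c" using cover[of "v a"] uv[of a] sub(1)[of a] by auto
    have "a \<noteq> c" using c by auto
    then have "r c < r a" using that rng(2)[of c] eqr[of a c] by linarith
    then show False using ord[of c a] uv[of a] c by linarith
  qed
  show "v a = u b" if s: "r b = Suc (r a)"
  proof (rule ccontr)
    assume "v a \<noteq> u b"
    then have lt: "v a < u b" using ord[of a b] s by simp
    then obtain c where c: "u c \<le> v a" "v a < v c" using cover[of "v a"] uv[of a] uv[of b] sub(1)[of a] sub(2)[of b] by auto
    show False
    proof (cases "r c \<le> r a")
      case True
      then have "c = a \<or> r c < r a" using eqr[of c a] by linarith
      then show False using ord[of c a] uv[of a] c by auto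
    next
      case False
      then have "c = b \<or> r b < r c" using eqr[of c b] s by linarith
      then show False using ord[of b c] uv[of b] c lt by auto
    qed
  qed
qed

text \<open>Neighbouring tiles share an endpoint, so positions are recovered from lengths. It is
  used with \<open>H\<close> for \<open>f\<close> and with the identity for \<open>S\<close>, which
  makes the endpoints of the two maps comparable.\<close>

lemma tiling_telescope:
  fixes H :: "real \<Rightarrow> real" and r :: "'a::finite \<Rightarrow> nat"
  assumes D: "tiling r A u v"
  shows "H (u a) = H 0 + (\<Sum>b | r b < r a. H (v b) - H (u b))"
    "H A = H 0 + (\<Sum>b\<in>UNIV. H (v b) - H (u b))"
proof -
  have r: "bij_betw r UNIV {1..CARD('a)}" using D unfolding tiling_def by blast
  have rng: "1 \<le> r c" "r c \<le> CARD('a)" for c using r bij_betwE by fastforce+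
  have eqr: "b = c" if "r b = r c" for b c using r that unfolding bij_betw_def by (metis injD)
  have ex: "\<exists>b. r b = k" if "1 \<le> k" "k \<le> CARD('a)" for k
    using r that unfolding bij_betw_def by (metis atLeastAtMost_iff imageE)
  let ?S = "\<lambda>k. H 0 + (\<Sum>b | r b < k. H (v b) - H (u b))"
  have main: "\<forall>a. r a = Suc k \<longrightarrow> H (u a) = ?S (Suc k)" for k
  proof (induction k)
    case 0
    have "{b. r b < Suc 0} = {}" using rng(1) by (auto simp: Suc_le_eq)
    then show ?case using tiling_ends(1)[OF D] by (simp del: less_Suc_eq_0_disj less_Suc0)
  next
    case (Suc k)
    show ?case
    proof (intro allI impI)
      fix a assume a: "r a = Suc (Suc k)"
      obtain c where c: "r c = Suc k" using ex[of "Suc k"] a rng(2)[of a] by auto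
      have "{b. r b < Suc (Suc k)} = insert c {b. r b < Suc k}" using c eqr by (auto simp: less_Suc_eq)
      then have "?S (Suc (Suc k)) = ?S (Suc k) + (H (v c) - H (u c))" using c by simp
      also have "v c = u a" using tiling_ends(3)[OF D, of a c] a c by simp
      finally show "H (u a) = ?S (Suc (Suc k))" using Suc c by simp
    qed
  qed
  show 1: "H (u a) = H 0 + (\<Sum>b | r b < r a. H (v b) - H (u b))" for a
    using main[of "r a - 1"] rng(1)[of a] by simp
  obtain c where c: "r c = CARD('a)" using ex[of "CARD('a)"] by (auto simp: Suc_le_eq)
  have "(UNIV::'a set) = insert c {b. r b < r c}"
  proof -
    have "b = c \<or> r b < r c" for b using eqr[of b c] rng(2)[of b] c by linarith
    then show ?thesis by blast
  qed
  then have "(\<Sum>b\<in>UNIV. H (v b) - H (u b)) = (H (v c) - H (u c)) + (\<Sum>b | r b < r c. H (v b) - H (u b))"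
    by (metis (no_types, lifting) finite finite_insert less_irrefl mem_Collect_eq sum.insert)
  then show "H A = H 0 + (\<Sum>b\<in>UNIV. H (v b) - H (u b))" using 1[of c] tiling_ends(2)[OF D c] by simp
qed

lemma slope_defect_bounded:
  assumes "C1_giet (g :: 'a::finite giet)" shows "\<exists>e. \<forall>x\<in>gdom g. \<bar>slope_defect \<omega> g x\<bar> \<le> e"
proof -
  obtain A u v p q where D: "giet_data g A u v p q" using assms unfolding C1_giet_def by blast
  have "\<exists>e. \<forall>x\<in>gint g a. \<bar>slope_defect \<omega> g x\<bar> \<le> e" for a
  proof -
    obtain G E where E: "C1_ext (gmap g) (u a) (v a) (p a) (q a) G E" using giet_dataD(2)[OF D] unfolding C1_branch_def by blast
    have "continuous_on {u a..v a} (\<lambda>x. ln (E x) - \<omega> $ a)"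
      using E unfolding C1_ext_def by (intro continuous_intros) (auto simp: less_imp_neq[symmetric])
    then have "bounded ((\<lambda>x. ln (E x) - \<omega> $ a) ` {u a..v a})" by (intro compact_imp_bounded compact_continuous_image) auto
    then obtain e where "\<forall>y\<in>(\<lambda>x. ln (E x) - \<omega> $ a) ` {u a..v a}. norm y \<le> e" unfolding bounded_iff by blast
    then have e: "\<bar>ln (E x) - \<omega> $ a\<bar> \<le> e" if "x \<in> {u a..v a}" for x using that by simp
    have "\<bar>slope_defect \<omega> g x\<bar> \<le> e" if "x \<in> gint g a" for x
    proof -
      have x: "u a \<le> x" "x < v a" using that unfolding giet_dataD(1)[OF D] by auto
      show ?thesis unfolding slope_defect_def C1_ext_rd[OF E x] letter_of_eq[OF assms that] using e[of x] x by simp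
    qed
    then show ?thesis by blast
  qed
  then obtain e where e: "\<And>a x. x \<in> gint g a \<Longrightarrow> \<bar>slope_defect \<omega> g x\<bar> \<le> e a" by metis
  have "\<bar>slope_defect \<omega> g x\<bar> \<le> Max (range e)" if "x \<in> gdom g" for x
    by (rule order_trans[OF e[OF letter_of_in[OF assms that]]]) (rule Max_ge, auto)
  then show ?thesis by blast
qed

context rv_orbit
begin

lemma shift: "rv_orbit ((rv ^^ m) f)"
proof
  have e: "(rv ^^ n) ((rv ^^ m) f) = (rv ^^ (n + m)) f" for n by (simp add: funpow_add)
  show "C1_giet ((rv ^^ m) f)" by (rule g)
  show "rv_defined ((rv ^^ n) ((rv ^^ m) f))" for n unfolding e by (rule def)
  show "gtop ((rv ^^ n) ((rv ^^ m) f)) \<noteq> gbot ((rv ^^ n) ((rv ^^ m) f))" for n unfolding e by (rule ne)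
qed

text \<open>The column sum of a letter is its return time to the domain of \<open>g k\<close>, and
  the defect of the return map is the sum of the defects met on the way.\<close>

lemma slope_defect_columns:
  assumes e: "\<And>x. x \<in> gdom f \<Longrightarrow> \<bar>slope_defect w f x\<bar> \<le> e"
  shows "x \<in> gdom (g k) \<Longrightarrow> \<bar>slope_defect (log_slope (rot_number f) w k) (g k) x\<bar> \<le> e * (\<Sum>c\<in>UNIV. path_prod (rot_number f) 0 k $ c $ letter_of (g k) x)"
proof (induction k arbitrary: x)
  case 0
  then show ?case using e[of x] by (simp add: mat_def)
next
  case (Suc k)
  let ?p = "rot_number f"
  let ?c = "\<lambda>k a. \<Sum>c\<in>UNIV. path_prod ?p 0 k $ c $ a"
  have col: "?c (Suc k) a = ?c k a + (if a = L k then ?c k (W k) else 0)" for a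
    unfolding mat_prod.simps matrix_mult_rm by (simp add: sum.distrib rot)
  show ?case
  proof (cases "x \<in> gint (g (Suc k)) (L k)")
    case True
    note two = slope_defect_two[OF True]
    have "letter_of (g (Suc k)) x = L k" using letter_of_eq[OF g True] .
    then have c: "?c (Suc k) (letter_of (g (Suc k)) x) = ?c k (L k) + ?c k (W k)" unfolding col by simp
    let ?y = "gmap (g k) x"
    have "\<bar>slope_defect (log_slope ?p w (Suc k)) (g (Suc k)) x\<bar> \<le> e * ?c k (letter_of (g k) x) + e * ?c k (letter_of (g k) ?y)"
      unfolding two(2) using Suc.IH[OF two(4)] Suc.IH[OF two(5)] by linarith
    also have "\<dots> = e * (?c k (L k) + ?c k (W k))"
      using two(3) unfolding doubleton_eq_iff by (auto simp: distrib_left add.commute)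
    finally show ?thesis unfolding c .
  next
    case False
    note one = slope_defect_one[OF Suc.prems False]
    have "letter_of (g (Suc k)) x \<noteq> L k" using letter_of_in[OF g Suc.prems] False by auto
    then have c: "?c (Suc k) (letter_of (g (Suc k)) x) = ?c k (letter_of (g k) x)" unfolding col one(3) by simp
    have xk: "x \<in> gdom (g k)" using Suc.prems step.rv_giet(4)[of k] unfolding gdom_g by simp
    show ?thesis unfolding one(2) c by (rule Suc.IH[OF xk])
  qed
qed

lemma slope_defect_propagate:
  assumes e: "\<And>x. x \<in> gdom (g m) \<Longrightarrow> \<bar>slope_defect w (g m) x\<bar> \<le> e" and x: "x \<in> gdom (g (m + k))"
  shows "\<bar>slope_defect (transpose (path_prod (rot_number f) m k) *v w) (g (m + k)) x\<bar> \<le> e * entry_sum (path_prod (rot_number f) m k)"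
proof -
  interpret s: rv_orbit "(rv ^^ m) f" by (rule shift)
  have gk: "(rv ^^ k) ((rv ^^ m) f) = g (m + k)" by (simp add: funpow_add add.commute)
  have pp: "path_prod (rot_number ((rv ^^ m) f)) 0 k = path_prod (rot_number f) m k" unfolding rot_number_rv rm_shift by simp
  have e0: "0 \<le> e" using e[of 0] step.A_pos[of m] unfolding gdom_g by fastforce
  have "\<bar>slope_defect (transpose (path_prod (rot_number f) m k) *v w) (g (m + k)) x\<bar> \<le> e * (\<Sum>c\<in>UNIV. path_prod (rot_number f) m k $ c $ letter_of (g (m + k)) x)"
    using s.slope_defect_columns[of w e x k, OF e] x unfolding transpose_pm_om[symmetric] gk pp by simp
  also have "\<dots> \<le> e * entry_sum (path_prod (rot_number f) m k)"
  proof (intro mult_left_mono e0)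
    show "(\<Sum>c\<in>UNIV. path_prod (rot_number f) m k $ c $ b) \<le> entry_sum (path_prod (rot_number f) m k)" for b
      unfolding entry_sum_def by (intro sum_mono member_le_sum) (auto intro: path_prod_bounds(1))
  qed
  finally show ?thesis .
qed

end

lemma slope_defect_change: "slope_defect w g x = slope_defect w' g x + (w' - w) $ letter_of g x"
  unfolding slope_defect_def by simp

section \<open>Exponential bounds and summation over blocks\<close>

lemma bigo_pow:
  fixes F :: "nat \<Rightarrow> real"
  assumes "F \<in> O(\<lambda>n. c ^ n)" "0 < c" shows "\<exists>K>0. \<forall>n. \<bar>F n\<bar> \<le> K * c ^ n"
proof -
  obtain C where C: "C > 0" "eventually (\<lambda>n. norm (F n) \<le> C * norm (c ^ n)) sequentially"
    using landau_o.bigE[OF assms(1)] by blast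
  have "eventually (\<lambda>n. \<bar>F n\<bar> \<le> C * c ^ n) sequentially" using C(2) assms(2) by simp
  from eventually_bound[OF this] obtain K where "K > 0" "\<And>n. \<bar>F n\<bar> \<le> K * (C * c ^ n)" using C(1) assms(2) by auto
  then show ?thesis using C(1) by (intro exI[of _ "K * C"]) (simp add: mult.assoc)
qed

text \<open>A bound that is constant on the blocks between consecutive Zorich times contributes, per
  block, its value times the length of the block.\<close>

lemma summable_blocks:
  fixes z :: "nat \<Rightarrow> nat" and b h :: "nat \<Rightarrow> real"
  assumes z: "strict_mono z" "z 0 = 0" and b: "\<And>j. 0 \<le> b j" "\<And>j. real (z (Suc j) - z j) * b j \<le> h j" and h: "summable h"
  shows "\<exists>e. summable e \<and> (\<forall>i. \<exists>j. z j \<le> i \<and> i < z (Suc j) \<and> e i = b j)"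
proof -
  have zs: "z j < z (Suc j)" for j using z(1) by (simp add: strict_mono_less)
  have zge: "j \<le> z j" for j by (rule strict_mono_imp_increasing[OF z(1)])
  define ix where "ix i = (LEAST j. i < z (Suc j))" for i
  have ix: "z (ix i) \<le> i" "i < z (Suc (ix i))" for i
  proof -
    have "\<exists>j. i < z (Suc j)" using zge[of "Suc i"] by (intro exI[of _ i]) simp
    then show "i < z (Suc (ix i))" unfolding ix_def by (rule LeastI_ex)
    show "z (ix i) \<le> i"
    proof (cases "ix i")
      case (Suc k)
      then have "\<not> i < z (Suc k)" using not_less_Least[of k "\<lambda>j. i < z (Suc j)"] unfolding ix_def by auto
      then show ?thesis using Suc by simp
    qed (simp add: z(2))
  qed
  have ixe: "ix i = j" if "z j \<le> i" "i < z (Suc j)" for i j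
  proof -
    have "z (ix i) < z (Suc j)" "z j < z (Suc (ix i))" using ix[of i] that by linarith+
    then show ?thesis using strict_mono_less[OF z(1)] by (metis less_Suc_eq_le le_antisym)
  qed
  define e where "e i = b (ix i)" for i
  have blk: "(\<Sum>i<z J. e i) \<le> (\<Sum>j<J. h j)" for J
  proof (induction J)
    case (Suc J)
    have "(\<Sum>i<z (Suc J). e i) = (\<Sum>i<z J. e i) + (\<Sum>i=z J..<z (Suc J). e i)"
      using zs[of J] by (simp add: sum.atLeastLessThan_concat lessThan_atLeast0)
    also have "(\<Sum>i=z J..<z (Suc J). e i) = (\<Sum>i=z J..<z (Suc J). b J)" by (intro sum.cong) (auto simp: e_def ixe)
    also have "\<dots> = real (z (Suc J) - z J) * b J" by simp
    finally show ?case using Suc b(2)[of J] by simp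
  qed (simp add: z(2))
  have h0: "0 \<le> h j" for j using b(2)[of j] b(1)[of j] mult_nonneg_nonneg[of "real (z (Suc j) - z j)" "b j"] by linarith
  have "summable e"
  proof (rule summableI_nonneg_bounded)
    show "0 \<le> e n" for n unfolding e_def by (rule b(1))
    fix n
    have "(\<Sum>i<n. e i) \<le> (\<Sum>i<z n. e i)" using zge[of n] b(1) by (intro sum_mono2) (auto simp: e_def)
    also have "\<dots> \<le> (\<Sum>j<n. h j)" by (rule blk)
    also have "\<dots> \<le> suminf h" by (rule sum_le_suminf[OF h]) (auto intro: h0)
    finally show "(\<Sum>i<n. e i) \<le> suminf h" .
  qed
  then show ?thesis using ix unfolding e_def by blast
qed

section \<open>Decay of slope defects\<close>

lemma norm_le_card:
  fixes v :: "real^'a::finite"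
  assumes "\<And>a. \<bar>v $ a\<bar> \<le> e" shows "norm v \<le> real CARD('a) * e"
proof -
  have "norm v \<le> (\<Sum>a\<in>UNIV. \<bar>v $ a\<bar>)" by (rule norm_le_l1_cart)
  also have "\<dots> \<le> (\<Sum>a\<in>(UNIV::'a set). e)" by (intro sum_mono assms)
  finally show ?thesis by simp
qed

context acc_generic
begin

text \<open>The distance compares lengths additively, whereas slopes are ratios. The two fit
  together where no length is small: at a good time the intervals of the rescaled \<open>S\<close>
  and their images exceed a fixed constant, so nearby lengths have nearby logarithms.\<close>

lemma return_close:
  assumes f: "rv_orbit f" "rot_number f = pth" and S: "rv_orbit S" "rot_number S = pth" and rescale: "scales (\<lambda>x. x) \<omega> S"
    and gf: "good_freq (snd x)" and w: "\<omega> \<in> E_cs x"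
    and dist: "(\<lambda>n. giet_dist 1 (acc_giet N x n f) (acc_giet N x n S)) \<in> O(\<lambda>n. c ^ n)" and c: "0 < c" "c < 1"
  shows "\<exists>C0>0. \<exists>c1. 0 < c1 \<and> c1 < 1 \<and> (\<forall>j0. \<exists>j\<ge>j0. norm (log_mean_slope ((zor ^^ j) f) - log_slope pth \<omega> (zorich_time pth j)) \<le> C0 * c1 ^ j)"
proof -
  interpret f: rv_orbit f by (rule f)
  interpret S: rv_orbit S by (rule S)
  obtain m where m: "m > 0" "\<And>n a. 1 \<le> n \<Longrightarrow> \<bar>log_slope pth \<omega> (R n) $ a\<bar> \<le> m" using log_slope_bounded[OF w] by blast
  obtain K where K: "\<And>n0. \<exists>n\<ge>n0. \<exists>k\<le>K. posblock pth (R n) k" using good_times[OF gf] by blast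
  obtain C where C: "C > 0" "\<And>n. \<bar>giet_dist 1 (acc_giet N x n f) (acc_giet N x n S)\<bar> \<le> C * c ^ n" using bigo_pow[OF dist c(1)] by blast
  obtain a where a: "1 \<le> a" "\<And>n. T n \<le> a * n" using T_linear by blast
  \<comment> \<open>\<open>T n \<le> a * n\<close> converts decay in the acceleration index
    \<open>n\<close> into decay in the Zorich time \<open>T n\<close>, at the cost of an
    \<open>a\<close>-th root.\<close>
  define c1 where "c1 = c powr (1 / real a)"
  have c1: "0 < c1" "c1 < 1"
  proof -
    show "0 < c1" unfolding c1_def using c by simp
    have "(1 / real a) * ln c < 0" using a(1) c by (simp add: divide_neg_pos)
    then show "c1 < 1" unfolding c1_def powr_def using c(1) by (simp only: if_False less_imp_neq[symmetric]) (simp add: exp_less_one_iff)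
  qed
  have cT: "c ^ n \<le> c1 ^ T n" for n
  proof -
    have "c ^ n = c powr real n" using c by (simp add: powr_realpow)
    also have "\<dots> \<le> c powr (real (T n) / real a)"
    proof (rule powr_mono')
      have "real (T n) \<le> real a * real n" using a(2)[of n] by (metis of_nat_le_iff of_nat_mult)
      then show "real (T n) / real a \<le> real n" using a(1) by (simp add: field_simps)
    qed (use c in auto)
    also have "\<dots> = c1 powr real (T n)" unfolding c1_def using c by (simp add: powr_powr)
    also have "\<dots> = c1 ^ T n" using c1 by (simp add: powr_realpow)
    finally show ?thesis .
  qed
  define d where "d = real CARD('a)"
  have d: "0 < d" unfolding d_def by simp
  define \<kappa> where "\<kappa> = exp (- (2 ^ K * m))"
  define \<Lambda> where "\<Lambda> = exp (2 ^ K * m) * 2 ^ K"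
  \<comment> \<open>A lower bound for intervals and images alike:
    \<open>\<kappa> / (d * \<Lambda>)\<close> is the share of an interval at a good time, and
    \<open>exp (- m)\<close> bounds the slopes from below.\<close>
  define k0 where "k0 = exp (- m) * (\<kappa> / (d * \<Lambda>))"
  have kp: "0 < \<kappa>" "0 < \<Lambda>" unfolding \<kappa>_def \<Lambda>_def by auto
  have k0: "0 < k0" unfolding k0_def using kp d by simp
  obtain n1 where n1: "\<And>n. n1 \<le> n \<Longrightarrow> C * c ^ n \<le> k0 / 2"
  proof -
    have "(\<lambda>n. C * c ^ n) \<longlonglongrightarrow> C * 0" using c by (intro tendsto_mult_left LIMSEQ_realpow_zero) auto
    then have "eventually (\<lambda>n. C * c ^ n < k0 / 2) sequentially" by (rule order_tendstoD(2)) (use k0 in simp)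
    then show ?thesis using that unfolding eventually_sequentially by (meson less_imp_le)
  qed
  define s where "s n = (\<chi> a. Hlen (\<lambda>x. x) (S.g n) a)" for n
  have ws: "length_rec pth \<omega> s" unfolding s_def S(2)[symmetric] by (rule S.scales_wrec[OF rescale]) (rule continuous_on_id)
  have sp: "0 < s n $ a" for n a unfolding s_def using glen_Hlen[OF S.g] by simp
  have key: "norm (log_mean_slope ((zor ^^ T n) f) - log_slope pth \<omega> (R n)) \<le> d * (4 * C / k0) * c ^ n"
    if n: "1 \<le> n" "n1 \<le> n" and k: "k \<le> K" "posblock pth (R n) k" for n k
  proof -
    have F: "(zor ^^ T n) f = f.g (R n)" unfolding zor_iter f(2) R_def ..
    have G: "(zor ^^ T n) S = S.g (R n)" unfolding zor_iter S(2) R_def ..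
    obtain A u v p q where D: "giet_data (f.g (R n)) A u v p q" using f.data by blast
    obtain A' u' v' p' q' where D': "giet_data (S.g (R n)) A' u' v' p' q'" using S.data by blast
    note A = giet_data_lft(3,4)[OF D] and A' = giet_data_lft(3,4)[OF D']
    have rA: "Sup (gdom (f.g (R n))) = A" "Sup (gdom (S.g (R n))) = A'" using A(1) A'(1) unfolding gend_def by auto
    note rf = rescale_branch[OF giet_dataD(1)[OF D] giet_dataD(2)[OF D] A(2) rA(1)]
    note rS = rescale_branch[OF giet_dataD(1)[OF D'] giet_dataD(2)[OF D'] A'(2) rA(2)]
    have br: "\<exists>u v p q. gint (rescale_giet (f.g (R n))) b = {u..<v} \<and> C1_branch (gmap (rescale_giet (f.g (R n)))) u v p q"
      "\<exists>u v p q. gint (rescale_giet (S.g (R n))) b = {u..<v} \<and> C1_branch (gmap (rescale_giet (S.g (R n)))) u v p q" for b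
      using rf[of b] rS[of b] by blast+
    have gd: "giet_dist 1 (rescale_giet (f.g (R n))) (rescale_giet (S.g (R n))) \<le> C * c ^ n"
      using C(2)[of n] unfolding acc_giet_def F G by linarith
    have len': "v' a - u' a = s (R n) $ a" for a unfolding s_def Hlen_def giet_data_lft(1,2)[OF D'] by simp
    have tot: "A' = (\<Sum>b\<in>UNIV. s (R n) $ b)" using tiling_telescope(2)[OF giet_tiling(1)[OF D'], of "\<lambda>x. x"] unfolding len' by simp
    note pb = posblock_bounds[OF ws path.ne m(2)[OF n(1)] k(2,1) less_imp_le[OF sp]]
    have vs: "0 < vsum (s (R n + k))" using sp by (rule vsum_pos)
    have "A' \<le> (\<Sum>b\<in>(UNIV::'a set). \<Lambda> * vsum (s (R n + k)))" unfolding tot \<Lambda>_def by (intro sum_mono pb(2))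
    then have A'le: "A' \<le> d * \<Lambda> * vsum (s (R n + k))" by (simp add: d_def mult.assoc)
    have lb: "\<kappa> / (d * \<Lambda>) \<le> (v' a - u' a) / A'" for a
    proof -
      have "\<kappa> / (d * \<Lambda>) * A' \<le> \<kappa> / (d * \<Lambda>) * (d * \<Lambda> * vsum (s (R n + k)))" using kp d by (intro mult_left_mono A'le) auto
      also have "\<dots> = \<kappa> * vsum (s (R n + k))" using kp d by simp
      also have "\<dots> \<le> v' a - u' a" unfolding len' \<kappa>_def by (rule pb(1))
      finally show ?thesis using A'(2) by (simp add: pos_le_divide_eq)
    qed
    have lb1: "k0 \<le> (v' a - u' a) / A'" for a
    proof -
      have "k0 \<le> 1 * (\<kappa> / (d * \<Lambda>))" unfolding k0_def using m(1) kp d by (intro mult_right_mono) auto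
      then show ?thesis using lb[of a] by simp
    qed
    have slope: "q' a - p' a = exp (log_slope pth \<omega> (R n) $ a) * (v' a - u' a)" for a
    proof -
      have sc': "scales (\<lambda>x. x) (log_slope pth \<omega> (R n)) (S.g (R n))" using S.scales_all[OF rescale] unfolding S(2) .
      have gd: "gint (S.g (R n)) a \<subseteq> gdom (S.g (R n))" unfolding gdom_def by blast
      have B: "C1_branch (gmap (S.g (R n))) (u' a) (v' a) (p' a) (q' a)" by (rule giet_dataD(2)[OF D'])
      show ?thesis
      proof (rule scales_limit[OF B, of "max (v' a) (q' a) + \<bar>u' a\<bar> + \<bar>p' a\<bar>" "\<lambda>x. x"])
        show "0 \<le> u' a" using gd C1_branch_image(3)[OF B] unfolding giet_dataD(1)[OF D'] giet_dataD(3)[OF D'] ivl_subset by auto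
        have "{p' a..<q' a} \<subseteq> {0..<A'}" using D' unfolding giet_data_def by blast
        then show "0 \<le> p' a" using C1_branch_image(2)[OF B] unfolding ivl_subset by auto
        show "gmap (S.g (R n)) y - gmap (S.g (R n)) x = exp (log_slope pth \<omega> (R n) $ a) * (y - x)" if "x \<in> {u' a..<v' a}" "y \<in> {u' a..<v' a}" for x y
          using scalesD[OF sc', of x a y] that unfolding giet_dataD(1)[OF D'] by simp
      qed auto
    qed
    have lb2: "k0 \<le> (q' a - p' a) / A'" for a
    proof -
      have "k0 \<le> exp (log_slope pth \<omega> (R n) $ a) * ((v' a - u' a) / A')" unfolding k0_def
        using m(2)[OF n(1), of a] lb[of a] kp d by (intro mult_mono) auto
      then show ?thesis unfolding slope by simp
    qed
    have comp: "\<bar>(log_mean_slope ((zor ^^ T n) f) - log_slope pth \<omega> (R n)) $ a\<bar> \<le> 4 * C / k0 * c ^ n" for a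
    proof -
      have uv: "u a < v a" "p a < q a" "u' a < v' a" using C1_branch_image(2,3)[OF giet_dataD(2)[OF D, of a]] C1_branch_image(3)[OF giet_dataD(2)[OF D', of a]] by auto
      obtain G E where "C1_ext (gmap (f.g (R n))) (u a) (v a) (p a) (q a) G E" using giet_dataD(2)[OF D] unfolding C1_branch_def by blast
      from log_mean_slope_eq[OF giet_dataD(1)[OF D] this] have L: "log_mean_slope ((zor ^^ T n) f) $ a = ln ((q a - p a) / (v a - u a))" unfolding F .
      have x1: "0 < (q a - p a) / A" "0 < (v a - u a) / A" using uv A(2) by auto
      have L1: "ln ((q a - p a) / (v a - u a)) = ln ((q a - p a) / A) - ln ((v a - u a) / A)"
      proof -
        have e: "(q a - p a) / (v a - u a) = ((q a - p a) / A) / ((v a - u a) / A)" using A(2) by simp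
        show ?thesis unfolding e by (rule trans[OF ln_div if_P]) (use x1 in \<open>metis less_irrefl\<close>)
      qed
      have y1: "0 < (q' a - p' a) / A'" "0 < (v' a - u' a) / A'" using lb1[of a] lb2[of a] k0 by auto
      have L2: "log_slope pth \<omega> (R n) $ a = ln ((q' a - p' a) / A') - ln ((v' a - u' a) / A')"
      proof -
        have "ln ((q' a - p' a) / A') = log_slope pth \<omega> (R n) $ a + ln ((v' a - u' a) / A')"
          unfolding slope using y1(2) uv(3) A'(2) ln_mult[of "exp (log_slope pth \<omega> (R n) $ a)" "(v' a - u' a) / A'"] by simp
        then show ?thesis by simp
      qed
      note gl = giet_dist_lengths[OF rf[of a] br(1) rS[of a] br(2)]
      have g1: "\<bar>(v a - u a) / A - (v' a - u' a) / A'\<bar> \<le> C * c ^ n" "\<bar>(q a - p a) / A - (q' a - p' a) / A'\<bar> \<le> C * c ^ n"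
        using order_trans[OF gl(1) gd] order_trans[OF gl(2) gd] by (simp_all only: diff_divide_distrib)
      have "\<bar>ln ((v a - u a) / A) - ln ((v' a - u' a) / A')\<bar> \<le> 2 * (C * c ^ n) / k0" by (rule ln_close[OF k0 lb1 g1(1) n1[OF n(2)]])
      moreover have "\<bar>ln ((q a - p a) / A) - ln ((q' a - p' a) / A')\<bar> \<le> 2 * (C * c ^ n) / k0" by (rule ln_close[OF k0 lb2 g1(2) n1[OF n(2)]])
      moreover have "4 * C / k0 * c ^ n = 2 * (C * c ^ n) / k0 + 2 * (C * c ^ n) / k0" using k0 by (simp add: field_simps)
      ultimately show ?thesis unfolding vector_minus_component L L1 L2 by linarith
    qed
    from norm_le_card[OF this] show ?thesis unfolding d_def by (simp add: mult.assoc)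
  qed
  have C0: "0 < d * (4 * C / k0)" using d C(1) k0 by simp
  have "\<exists>j\<ge>j0. norm (log_mean_slope ((zor ^^ j) f) - log_slope pth \<omega> (zorich_time pth j)) \<le> d * (4 * C / k0) * c1 ^ j" for j0
  proof -
    obtain n k where n: "max j0 (Suc n1) \<le> n" "k \<le> K" "posblock pth (R n) k" using K by blast
    have "norm (log_mean_slope ((zor ^^ T n) f) - log_slope pth \<omega> (R n)) \<le> d * (4 * C / k0) * c ^ n" by (rule key[OF _ _ n(2,3)]) (use n(1) in auto)
    also have "\<dots> \<le> d * (4 * C / k0) * c1 ^ T n" using C0 by (intro mult_left_mono cT) auto
    finally show ?thesis using T_ge[of n] n(1) unfolding R_def by (intro exI[of _ "T n"]) auto
  qed
  then show ?thesis using C0 c1 by blast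
qed

text \<open>The EC Condition yields a decomposition separately at each time, over a triple
  \<open>y\<close> of its own, with no stated relation between the \<open>Lc n\<close>. Such a
  relation comes from slope defects: at consecutive Zorich times the mean slopes follow the cocycle
  up to a multiple of \<open>E j * c ^ j\<close>, which is still exponentially small because
  \<open>E\<close> is subexponential.\<close>

lemma slope_summable:
  assumes f: "rv_orbit f" "rot_number f = pth" and y: "oseledets_generic y" "snd y = snd x"
    and shape: "(\<lambda>n. MAX a\<in>UNIV. Cr_norm 1 (\<lambda>t. shape ((zor ^^ n) f) a t - t)) \<in> O(\<lambda>n. c ^ n)" and c: "0 < c" "c < 1"
    and dec: "\<And>n. Lc n \<in> E_c y n" "\<And>n. log_mean_slope ((zor ^^ n) f) = Ls n + Lc n + Lu n"
    and small: "(\<lambda>n. norm (Lu n)) \<in> O(\<lambda>n. c ^ n)" "(\<lambda>n. norm (Ls n)) \<in> O(\<lambda>n. c ^ n)"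
    and w: "\<omega> \<in> E_cs x"
    and ret: "\<And>j0. \<exists>j\<ge>j0. norm (log_mean_slope ((zor ^^ j) f) - log_slope pth \<omega> (zorich_time pth j)) \<le> C0 * c1 ^ j" and c1: "0 < c1" "c1 < 1" "0 < C0"
  shows "\<exists>e. summable e \<and> (\<forall>n. \<forall>z\<in>gdom ((rv ^^ n) f). \<bar>slope_defect (log_slope pth \<omega> n) ((rv ^^ n) f) z\<bar> \<le> e n)"
proof -
  interpret f: rv_orbit f by (rule f)
  define L where "L j = log_mean_slope ((zor ^^ j) f)" for j
  have G: "(zor ^^ j) f = f.g (zorich_time pth j)" for j unfolding zor_iter f(2) ..
  define d where "d = real CARD('a)"
  have d: "1 \<le> d" unfolding d_def by (simp add: Suc_le_eq)
  define E where "E j = entry_sum (zorich_step_mat pth j)" for j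
  have E1: "1 \<le> E j" for j unfolding E_def by (rule path.entry_sum_pm_ge_1)
  have zS: "zorich_time pth (Suc j) = zorich_time pth j + ztime (\<lambda>i. pth (zorich_time pth j + i))" for j by simp
  have PS: "zorich_cocycle pth (Suc j) = transpose (zorich_step_mat pth j) ** zorich_cocycle pth j" for j using cocyc_add[of pth j 1] by simp
  obtain Ks where Ks: "Ks > 0" "\<And>n. \<bar>MAX a\<in>UNIV. Cr_norm 1 (\<lambda>t. shape ((zor ^^ n) f) a t - t)\<bar> \<le> Ks * c ^ n" using bigo_pow[OF shape c(1)] by blast
  obtain K1 where K1: "K1 > 0" "\<And>n. \<bar>norm (Lu n)\<bar> \<le> K1 * c ^ n" using bigo_pow[OF small(1) c(1)] by blast
  obtain K2 where K2: "K2 > 0" "\<And>n. \<bar>norm (Ls n)\<bar> \<le> K2 * c ^ n" using bigo_pow[OF small(2) c(1)] by blast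
  define r where "r n = Ls n + Lu n" for n
  have r: "norm (r n) \<le> (K1 + K2) * c ^ n" for n
    using norm_triangle_ineq[of "Ls n" "Lu n"] K1(2)[of n] K2(2)[of n] unfolding r_def by (simp add: distrib_right)
  have Lr: "L n = Lc n + r n" for n unfolding L_def dec(2) r_def by simp
  \<comment> \<open>The estimate through shapes holds from some time on. The suprema are finite at
    every time, so they extend it to all times at the cost of the constant.\<close>
  define Mx where "Mx j = (SUP z\<in>gdom (f.g (zorich_time pth j)). \<bar>slope_defect (L j) (f.g (zorich_time pth j)) z\<bar>)" for j
  have ne: "gdom (f.g n) \<noteq> {}" for n unfolding f.gdom_g using f.step.A_pos[of n] by auto
  have Mx: "\<bar>slope_defect (L j) (f.g (zorich_time pth j)) z\<bar> \<le> Mx j" if "z \<in> gdom (f.g (zorich_time pth j))" for j z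
  proof -
    obtain e where "\<And>z. z \<in> gdom (f.g (zorich_time pth j)) \<Longrightarrow> \<bar>slope_defect (L j) (f.g (zorich_time pth j)) z\<bar> \<le> e" using slope_defect_bounded[OF f.g] by blast
    then show ?thesis unfolding Mx_def using that by (intro cSUP_upper bdd_aboveI2)
  qed
  have "eventually (\<lambda>j. Mx j \<le> 2 * (Ks * c ^ j)) sequentially"
  proof -
    have "(\<lambda>n. Ks * c ^ n) \<longlonglongrightarrow> Ks * 0" using c by (intro tendsto_mult_left LIMSEQ_realpow_zero) auto
    then have "eventually (\<lambda>n. Ks * c ^ n < 1 / 2) sequentially" by (rule order_tendstoD(2)) simp
    then show ?thesis
    proof eventually_elim
      case (elim j)
      obtain A u v p q where D: "giet_data (f.g (zorich_time pth j)) A u v p q" using f.data by blast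
      show ?case unfolding Mx_def
      proof (rule cSUP_least[OF ne])
        fix z assume z: "z \<in> gdom (f.g (zorich_time pth j))"
        define a where "a = letter_of (f.g (zorich_time pth j)) z"
        have za: "z \<in> gint (f.g (zorich_time pth j)) a" unfolding a_def by (rule letter_of_in[OF f.g z])
        have "Cr_norm 1 (\<lambda>t. shape (f.g (zorich_time pth j)) a t - t) \<le> (MAX a\<in>UNIV. Cr_norm 1 (\<lambda>t. shape ((zor ^^ j) f) a t - t))"
          unfolding G by (rule Max_ge) auto
        also have "\<dots> \<le> Ks * c ^ j" using Ks(2)[of j] by linarith
        finally have "Cr_norm 1 (\<lambda>t. shape (f.g (zorich_time pth j)) a t - t) \<le> Ks * c ^ j" .
        from slope_near_mean[OF giet_dataD(1)[OF D] giet_dataD(2)[OF D] this _ za] elim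
        show "\<bar>slope_defect (L j) (f.g (zorich_time pth j)) z\<bar> \<le> 2 * (Ks * c ^ j)"
          unfolding slope_defect_def L_def G a_def[symmetric] by simp
      qed
    qed
  qed
  from eventually_bound[OF this] obtain K3' where K3': "K3' > 0" "\<And>j. Mx j \<le> K3' * (2 * (Ks * c ^ j))" using Ks(1) c by auto
  define K3 where "K3 = 2 * K3' * Ks"
  have K3: "0 < K3" "\<And>j. Mx j \<le> K3 * c ^ j" unfolding K3_def using K3' Ks(1) by (auto simp: mult_ac)
  have lbd: "\<bar>slope_defect (L j) (f.g (zorich_time pth j)) z\<bar> \<le> K3 * c ^ j" if "z \<in> gdom (f.g (zorich_time pth j))" for j z
    using Mx[OF that] K3(2)[of j] by linarith
  have cS: "c ^ Suc j \<le> c ^ j" for j using c by (simp add: mult_left_le_one_le)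
  have Linc: "norm (L (Suc j) - transpose (zorich_step_mat pth j) *v L j) \<le> d * (2 * K3 * (E j * c ^ j))" for j
  proof -
    have "\<bar>(L (Suc j) - transpose (zorich_step_mat pth j) *v L j) $ a\<bar> \<le> 2 * K3 * (E j * c ^ j)" for a
    proof -
      let ?g = "f.g (zorich_time pth (Suc j))"
      obtain A u v p q where D: "giet_data ?g A u v p q" using f.data by blast
      have z: "u a \<in> gint ?g a" using C1_branch_image(3)[OF giet_dataD(2)[OF D, of a]] unfolding giet_dataD(1)[OF D] by simp
      then have zd: "u a \<in> gdom ?g" unfolding gdom_def by blast
      have la: "letter_of ?g (u a) = a" by (rule letter_of_eq[OF f.g z])
      have 1: "\<bar>slope_defect (transpose (zorich_step_mat pth j) *v L j) ?g (u a)\<bar> \<le> K3 * c ^ j * E j"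
        using f.slope_defect_propagate[OF lbd, where k="ztime (\<lambda>i. pth (zorich_time pth j + i))" and x="u a"] zd unfolding f(2) E_def zS by blast
      have 2: "\<bar>slope_defect (L (Suc j)) ?g (u a)\<bar> \<le> K3 * c ^ Suc j" by (rule lbd[OF zd])
      have "K3 * c ^ Suc j \<le> K3 * (E j * c ^ j)"
        using order_trans[OF cS[of j]] E1[of j] K3(1) c mult_right_mono[of 1 "E j" "c ^ j"] by (intro mult_left_mono) auto
      moreover have "(L (Suc j) - transpose (zorich_step_mat pth j) *v L j) $ a = slope_defect (transpose (zorich_step_mat pth j) *v L j) ?g (u a) - slope_defect (L (Suc j)) ?g (u a)"
        using slope_defect_change[of "transpose (zorich_step_mat pth j) *v L j" ?g "u a" "L (Suc j)"] unfolding la by simp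
      moreover have "K3 * c ^ j * E j = K3 * (E j * c ^ j)" by (simp only: mult_ac)
      ultimately show ?thesis using 1 2 by linarith
    qed
    from norm_le_card[OF this] show ?thesis unfolding d_def .
  qed
  \<comment> \<open>Half of the decay rate of \<open>c\<close> absorbs the growth of
    \<open>E\<close>, hence \<open>c'\<close>, the square root of \<open>c\<close>.\<close>
  obtain Ce where Ce: "Ce > 0" "\<And>j. E j \<le> Ce * exp ((0 + (- ln c / 2)) * real j)"
    using subexp_B c unfolding subexp_def E_def by (metis divide_pos_pos ln_less_zero neg_0_less_iff_less zero_less_numeral)
  define c' where "c' = exp (ln c / 2)"
  have c': "0 < c'" "c' < 1" "c \<le> c'" "c'^2 = c"
  proof -
    show "0 < c'" unfolding c'_def by simp
    show "c' < 1" unfolding c'_def using c by simp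
    have "ln c \<le> ln c / 2" using c by simp
    then show "c \<le> c'" unfolding c'_def using c(1) by (metis exp_le_cancel_iff exp_ln)
    show "c'^2 = c" unfolding c'_def using c(1) by (simp add: exp_double[symmetric])
  qed
  have Ec: "E j * c ^ j \<le> Ce * c' ^ j" for j
  proof -
    have "exp ((0 + (- ln c / 2)) * real j) * c ^ j = c' ^ j"
    proof -
      have "c ^ j = exp (ln c * real j)" using c(1) by (metis exp_ln exp_of_nat2_mult)
      then have "exp ((0 + (- ln c / 2)) * real j) * c ^ j = exp (ln c / 2 * real j)" by (simp add: exp_add[symmetric] field_simps)
      then show ?thesis unfolding c'_def by (simp only: exp_of_nat2_mult)
    qed
    then show ?thesis using mult_right_mono[OF Ce(2)[of j], of "c ^ j"] c by (simp add: mult.assoc)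
  qed
  have dP: "det (zorich_cocycle pth j) \<noteq> 0" for j unfolding det_transpose path.det_pm by simp
  \<comment> \<open>Pulling the central parts back to time 0 allows vectors from different times to
    be subtracted, and there \<open>\<omega>\<close> is subtracted once and for all.\<close>
  define \<eta> where "\<eta> j = matrix_inv (zorich_cocycle pth j) *v Lc j - \<omega>" for j
  have Pe: "zorich_cocycle pth j *v \<eta> j = Lc j - log_slope pth \<omega> (zorich_time pth j)" for j
    unfolding \<eta>_def matrix_vector_mult_diff_distrib matrix_vector_mul_assoc matrix_inv_mult(1)[OF dP] by (simp only: matrix_vector_mul_lid transpose_pm_om)
  obtain b \<theta> where "exp_basis (zorich_cocycle pth) b \<theta>" using generic_basis[OF y(1)] unfolding y(2) pth_def by blast
  then interpret B: exp_basis "zorich_cocycle pth" b \<theta> .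
  define cc where "cc = max c' c1"
  have cc: "0 < cc" "cc < 1" "c' \<le> cc" "c1 \<le> cc" "c \<le> cc" unfolding cc_def using c' c1 by auto
  \<comment> \<open>The term \<open>2 * d * K3\<close> comes from the increments of
    \<open>L\<close>, and \<open>K1 + K2\<close> appears twice for the stable and unstable
    remainders at the two ends of a step.\<close>
  define K4 where "K4 = 2 * d * K3 + 2 * (K1 + K2)"
  have K4: "0 < K4" unfolding K4_def using d K3(1) K1(1) K2(1) by (simp add: add_pos_pos)
  define C5 where "C5 = max (K4 * Ce) (C0 + (K1 + K2))"
  have C5: "0 < C5" unfolding C5_def using K4 Ce(1) by (simp add: less_max_iff_disj)
  have decay: "\<exists>C>0. \<exists>\<rho>. 0 < \<rho> \<and> \<rho> < 1 \<and> (\<forall>j. norm (zorich_cocycle pth j *v \<eta> j) \<le> C * \<rho> ^ j)"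
  proof (rule B.central_decay[OF _ _ cc(1,2), where ?C0.0=C5])
    fix j
    \<comment> \<open>Growth rates concern the tail alone, and from time \<open>j\<close> on the
      cocycle carries the central vector \<open>Lc j\<close>.\<close>
    show "subexp 0 (\<lambda>m. norm (zorich_cocycle pth m *v \<eta> j))"
    proof (rule subexp_shift[where j=j])
      have 1: "subexp 0 (\<lambda>m. norm (transpose (path_prod pth (zorich_time pth j) (zorich_time pth (j + m) - zorich_time pth j)) *v Lc j))"
        using E_c_growth[OF y(1) dec(1)[of j]] unfolding y(2) pth_def .
      have 2: "subexp 0 (\<lambda>m. norm (zorich_cocycle pth (j + m) *v \<omega>))"
        by (rule subexp_forward) (use E_cs_growth[OF gen w] in \<open>simp add: pth_def\<close>)
      show "subexp 0 (\<lambda>m. norm (zorich_cocycle pth (j + m) *v \<eta> j))"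
      proof (rule subexp_add[OF 1 2])
        fix m
        let ?Q = "transpose (path_prod pth (zorich_time pth j) (zorich_time pth (j + m) - zorich_time pth j))"
        have "zorich_cocycle pth (j + m) *v \<eta> j = ?Q *v (zorich_cocycle pth j *v (matrix_inv (zorich_cocycle pth j) *v Lc j)) - zorich_cocycle pth (j + m) *v \<omega>"
          unfolding \<eta>_def matrix_vector_mult_diff_distrib cocyc_add[of pth j m] matrix_vector_mul_assoc by (simp add: matrix_mul_assoc)
        also have "zorich_cocycle pth j *v (matrix_inv (zorich_cocycle pth j) *v Lc j) = Lc j"
          unfolding matrix_vector_mul_assoc matrix_inv_mult(1)[OF dP] by simp
        finally show "norm (zorich_cocycle pth (j + m) *v \<eta> j) \<le> norm (?Q *v Lc j) + norm (zorich_cocycle pth (j + m) *v \<omega>)"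
          using norm_triangle_ineq4[of "?Q *v Lc j" "zorich_cocycle pth (j + m) *v \<omega>"] by simp
      qed
    qed
    show "norm (zorich_cocycle pth (Suc j) *v (\<eta> (Suc j) - \<eta> j)) \<le> C5 * cc ^ j"
    proof -
      let ?B = "transpose (zorich_step_mat pth j)"
      have "zorich_cocycle pth (Suc j) *v (\<eta> (Suc j) - \<eta> j) = zorich_cocycle pth (Suc j) *v \<eta> (Suc j) - ?B *v (zorich_cocycle pth j *v \<eta> j)"
        unfolding matrix_vector_mult_diff_distrib by (simp only: PS matrix_vector_mul_assoc)
      also have "\<dots> = Lc (Suc j) - ?B *v Lc j - (log_slope pth \<omega> (zorich_time pth (Suc j)) - ?B *v log_slope pth \<omega> (zorich_time pth j))"
        unfolding Pe matrix_vector_mult_diff_distrib by (simp add: algebra_simps del: zorich_time.simps)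
      also have "?B *v log_slope pth \<omega> (zorich_time pth j) = log_slope pth \<omega> (zorich_time pth (Suc j))"
        unfolding transpose_pm_om[symmetric] matrix_vector_mul_assoc PS ..
      also have "Lc (Suc j) - ?B *v Lc j - (log_slope pth \<omega> (zorich_time pth (Suc j)) - log_slope pth \<omega> (zorich_time pth (Suc j))) = (L (Suc j) - ?B *v L j) - (r (Suc j) - ?B *v r j)"
        unfolding Lr matrix_vector_right_distrib by (simp add: algebra_simps)
      finally have tri: "norm (zorich_cocycle pth (Suc j) *v (\<eta> (Suc j) - \<eta> j)) \<le> norm (L (Suc j) - ?B *v L j) + (norm (r (Suc j)) + norm (?B *v r j))"
        using norm_triangle_ineq4[of "L (Suc j) - ?B *v L j" "r (Suc j) - ?B *v r j"] norm_triangle_ineq4[of "r (Suc j)" "?B *v r j"] by simp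
      have n1: "norm (?B *v r j) \<le> E j * ((K1 + K2) * c ^ j)"
      proof -
        have "norm (?B *v r j) \<le> E j * norm (r j)" unfolding E_def by (rule norm_transpose_ent) (rule path_prod_bounds(1))
        also have "\<dots> \<le> E j * ((K1 + K2) * c ^ j)" using E1[of j] r[of j] by (intro mult_left_mono) auto
        finally show ?thesis .
      qed
      have n2: "norm (r (Suc j)) \<le> (K1 + K2) * (E j * c ^ j)"
      proof -
        have "c ^ Suc j \<le> E j * c ^ j" using cS[of j] mult_right_mono[OF E1[of j], of "c ^ j"] c by simp
        then have "(K1 + K2) * c ^ Suc j \<le> (K1 + K2) * (E j * c ^ j)" using K1(1) K2(1) by (intro mult_left_mono) auto
        then show ?thesis using r[of "Suc j"] by linarith
      qed
      have "norm (zorich_cocycle pth (Suc j) *v (\<eta> (Suc j) - \<eta> j)) \<le>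
          d * (2 * K3 * (E j * c ^ j)) + ((K1 + K2) * (E j * c ^ j) + E j * ((K1 + K2) * c ^ j))"
        using tri n1 n2 Linc[of j] by linarith
      also have "d * (2 * K3 * (E j * c ^ j)) + ((K1 + K2) * (E j * c ^ j) + E j * ((K1 + K2) * c ^ j)) = K4 * (E j * c ^ j)"
        unfolding K4_def by (simp add: algebra_simps)
      also have "\<dots> \<le> K4 * (Ce * c' ^ j)" using K4 Ec[of j] by (intro mult_left_mono) auto
      also have "\<dots> \<le> K4 * Ce * cc ^ j" using K4 Ce(1) power_mono[OF cc(3), of j] c' by (simp add: mult.assoc)
      also have "\<dots> \<le> C5 * cc ^ j" unfolding C5_def using cc(1) by (intro mult_right_mono) auto
      finally show ?thesis .
    qed
    show "\<exists>i\<ge>j. norm (zorich_cocycle pth i *v \<eta> i) \<le> C5 * cc ^ i"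
    proof -
      obtain i where i: "j \<le> i" "norm (L i - log_slope pth \<omega> (zorich_time pth i)) \<le> C0 * c1 ^ i" using ret[of j] unfolding L_def by blast
      have "zorich_cocycle pth i *v \<eta> i = (L i - log_slope pth \<omega> (zorich_time pth i)) - r i" unfolding Pe Lr by simp
      then have "norm (zorich_cocycle pth i *v \<eta> i) \<le> norm (L i - log_slope pth \<omega> (zorich_time pth i)) + norm (r i)" using norm_triangle_ineq4[of "L i - log_slope pth \<omega> (zorich_time pth i)" "r i"] by simp
      also have "\<dots> \<le> C0 * c1 ^ i + (K1 + K2) * c ^ i" using i(2) r[of i] by linarith
      also have "\<dots> \<le> C0 * cc ^ i + (K1 + K2) * cc ^ i"
        using c1 c cc K1(1) K2(1) by (intro add_mono mult_left_mono power_mono) auto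
      also have "\<dots> = (C0 + (K1 + K2)) * cc ^ i" by (simp add: distrib_right)
      also have "\<dots> \<le> C5 * cc ^ i" unfolding C5_def using cc(1) by (intro mult_right_mono) auto
      finally show ?thesis using i(1) by blast
    qed
  qed
  from decay obtain C6 \<rho> where C6: "C6 > 0" "0 < \<rho>" "\<rho> < 1" "\<And>j. norm (zorich_cocycle pth j *v \<eta> j) \<le> C6 * \<rho> ^ j" by blast
  define \<sigma> where "\<sigma> = max \<rho> c"
  have sg: "0 < \<sigma>" "\<sigma> < 1" "\<rho> \<le> \<sigma>" "c \<le> \<sigma>" unfolding \<sigma>_def using C6 c by auto
  define K7 where "K7 = K3 + C6 + (K1 + K2)"
  have K7: "0 < K7" unfolding K7_def using K3(1) C6(1) K1(1) K2(1) by linarith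
  have top: "\<bar>slope_defect (log_slope pth \<omega> (zorich_time pth j)) (f.g (zorich_time pth j)) z\<bar> \<le> K7 * \<sigma> ^ j" if z: "z \<in> gdom (f.g (zorich_time pth j))" for j z
  proof -
    let ?a = "letter_of (f.g (zorich_time pth j)) z"
    have "L j - log_slope pth \<omega> (zorich_time pth j) = zorich_cocycle pth j *v \<eta> j + r j" unfolding Pe Lr by simp
    then have "norm (L j - log_slope pth \<omega> (zorich_time pth j)) \<le> C6 * \<rho> ^ j + (K1 + K2) * c ^ j"
      using norm_triangle_ineq[of "zorich_cocycle pth j *v \<eta> j" "r j"] C6(4)[of j] r[of j] by simp
    then have "\<bar>(L j - log_slope pth \<omega> (zorich_time pth j)) $ ?a\<bar> \<le> C6 * \<rho> ^ j + (K1 + K2) * c ^ j"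
      using component_le_norm_cart[of "L j - log_slope pth \<omega> (zorich_time pth j)" ?a] by linarith
    then have "\<bar>slope_defect (log_slope pth \<omega> (zorich_time pth j)) (f.g (zorich_time pth j)) z\<bar> \<le> K3 * c ^ j + (C6 * \<rho> ^ j + (K1 + K2) * c ^ j)"
      using lbd[OF z] slope_defect_change[of "log_slope pth \<omega> (zorich_time pth j)" "f.g (zorich_time pth j)" z "L j"] by linarith
    also have "\<dots> \<le> K3 * \<sigma> ^ j + (C6 * \<sigma> ^ j + (K1 + K2) * \<sigma> ^ j)"
      using sg c C6(1,2) K3(1) K1(1) K2(1) by (intro add_mono mult_left_mono power_mono) auto
    also have "\<dots> = K7 * \<sigma> ^ j" unfolding K7_def by (simp add: distrib_right)
    finally show ?thesis .
  qed
  \<comment> \<open>The factor \<open>E j\<close> enters twice, through the number of Rauzy-Veech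
    steps in the block and through the growth of the defect inside it. A quarter of the decay rate
    is spent on each, and half of it remains.\<close>
  obtain Cf where Cf: "Cf > 0" "\<And>j. E j \<le> Cf * exp ((0 + (- ln \<sigma> / 4)) * real j)"
    using subexp_B sg unfolding subexp_def E_def by (metis divide_pos_pos ln_less_zero neg_0_less_iff_less zero_less_numeral)
  define h where "h j = Cf^2 * K7 * exp (ln \<sigma> / 2) ^ j" for j
  have h: "summable h" unfolding h_def using sg by (intro summable_mult summable_geometric) simp
  define b where "b j = E j * (K7 * \<sigma> ^ j)" for j
  have b0: "0 \<le> b j" for j unfolding b_def using E1[of j] K7 sg(1) by simp
  have bh: "real (zorich_time pth (Suc j) - zorich_time pth j) * b j \<le> h j" for j
  proof -
    have "real (zorich_time pth (Suc j) - zorich_time pth j) \<le> E j" unfolding zS E_def using path.entry_sum_steps by simp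
    then have "real (zorich_time pth (Suc j) - zorich_time pth j) * b j \<le> E j * b j" using b0 by (rule mult_right_mono)
    also have "\<dots> = (E j)^2 * (K7 * \<sigma> ^ j)" unfolding b_def by (simp add: power2_eq_square)
    also have "\<dots> \<le> (Cf * exp ((0 + (- ln \<sigma> / 4)) * real j))^2 * (K7 * \<sigma> ^ j)"
      using E1[of j] Cf(2)[of j] K7 sg(1) by (intro mult_right_mono power_mono) auto
    also have "\<dots> = Cf^2 * K7 * (exp ((- ln \<sigma> / 2) * real j) * exp (ln \<sigma> * real j))"
    proof -
      have s: "\<sigma> ^ j = exp (ln \<sigma> * real j)" using sg(1) by (metis exp_ln exp_of_nat2_mult)
      have e: "(exp ((0 + (- ln \<sigma> / 4)) * real j))^2 = exp ((- ln \<sigma> / 2) * real j)"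
        by (simp add: exp_double[symmetric] power2_eq_square exp_add[symmetric])
      show ?thesis unfolding power_mult_distrib e s by (simp only: mult_ac)
    qed
    also have "exp ((- ln \<sigma> / 2) * real j) * exp (ln \<sigma> * real j) = exp (ln \<sigma> / 2 * real j)"
      unfolding exp_add[symmetric] by (simp add: field_simps)
    also have "exp (ln \<sigma> / 2 * real j) = exp (ln \<sigma> / 2) ^ j" by (simp only: exp_of_nat2_mult)
    finally show ?thesis unfolding h_def .
  qed
  obtain e where e: "summable e" "\<And>i. \<exists>j. zorich_time pth j \<le> i \<and> i < zorich_time pth (Suc j) \<and> e i = b j"
    using summable_blocks[OF zorich_time_strict _ b0 bh h] by auto
  have "\<bar>slope_defect (log_slope pth \<omega> i) (f.g i) z\<bar> \<le> e i" if z: "z \<in> gdom (f.g i)" for i z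
  proof -
    obtain j where j: "zorich_time pth j \<le> i" "i < zorich_time pth (Suc j)" "e i = b j" using e(2) by blast
    obtain k where k: "i = zorich_time pth j + k" using j(1) le_Suc_ex by blast
    have log_slope: "transpose (path_prod pth (zorich_time pth j) k) *v log_slope pth \<omega> (zorich_time pth j) = log_slope pth \<omega> i"
      unfolding k transpose_pm_om[symmetric] matrix_vector_mul_assoc matrix_transpose_mul[symmetric]
      using path_prod_add[of pth 0 "zorich_time pth j" k] by simp
    have "\<bar>slope_defect (transpose (path_prod pth (zorich_time pth j) k) *v log_slope pth \<omega> (zorich_time pth j)) (f.g (zorich_time pth j + k)) z\<bar> \<le> K7 * \<sigma> ^ j * entry_sum (path_prod pth (zorich_time pth j) k)"
      using f.slope_defect_propagate[OF top, where k=k and x=z] z unfolding f(2) k by blast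
    also have "\<dots> \<le> K7 * \<sigma> ^ j * E j"
      unfolding E_def using j(2) K7 sg(1) unfolding k zS by (intro mult_left_mono path.entry_sum_pm_mono) auto
    also have "\<dots> = e i" unfolding j(3) b_def by (simp only: mult_ac)
    finally show ?thesis unfolding log_slope k[symmetric] .
  qed
  then show ?thesis using e(1) by blast
qed

end

section \<open>The conjugacy\<close>

text \<open>The derivative of the inverse is needed within the closed interval, ends included, so it
  is obtained from the difference quotient along the continuous inverse.\<close>

lemma Cr_diffeo_1:
  fixes H :: "real \<Rightarrow> real"
  assumes E: "C1_ext H a b p q G D"  and HG: "\<And>x. x \<in> {a..b} \<Longrightarrow> H x = G x"
  shows "Cr_diffeo 1 H {a..b} {p..q}"
proof -
  have der: "(G has_real_derivative D x) (at x within {a..b})" "0 < D x" if "x \<in> {a..b}" for x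
    using E that unfolding C1_ext_def by blast+
  have contD: "continuous_on {a..b} D" using E unfolding C1_ext_def by blast
  have Hder: "(H has_real_derivative D x) (at x within {a..b})" if "x \<in> {a..b}" for x
    using has_field_derivative_transform_within[OF der(1)[OF that] zero_less_one that] HG by simp
  have img: "H ` {a..b} = {p..q}" using C1_ext_bij(3)[OF E] HG by (simp cong: image_cong_simp)
  have inj: "inj_on H {a..b}"
  proof (rule linorder_inj_onI)
    fix x y assume xy: "x < y" "x \<in> {a..b}" "y \<in> {a..b}"
    have "G x < G y" using C1_ext_strict[OF E, of x y] xy by simp
    then show "H x \<noteq> H y" using HG xy by simp
  qed (use linorder_linear in blast)
  have contH: "continuous_on {a..b} H" using Hder by (meson DERIV_continuous continuous_on_eq_continuous_within)
  define J where "J = inv_into {a..b} H"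
  have J: "J y \<in> {a..b}" "H (J y) = y" if "y \<in> {p..q}" for y
    unfolding J_def using inv_into_into[of y H "{a..b}"] f_inv_into_f[of y H "{a..b}"] that unfolding img by auto
  have contJ: "continuous_on {p..q} J" unfolding J_def img[symmetric]
    by (rule continuous_on_inv[OF contH compact_Icc]) (simp add: inv_into_f_f[OF inj])
  have Jder: "(J has_real_derivative inverse (D (J y))) (at y within {p..q})" if y: "y \<in> {p..q}" for y
  proof -
    have fl: "filterlim J (at (J y) within {a..b}) (at y within {p..q})"
      unfolding filterlim_at
    proof (intro conjI)
      show "(J \<longlongrightarrow> J y) (at y within {p..q})" using contJ y unfolding continuous_on_def by (rule bspec)
      have "J z \<in> {a..b} \<and> J z \<noteq> J y" if z: "z \<in> {p..q}" "z \<noteq> y" for z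
        using J(1)[OF z(1)] J(2)[OF z(1)] J(2)[OF y] z(2) by auto
      then show "eventually (\<lambda>z. J z \<in> {a..b} \<and> J z \<noteq> J y) (at y within {p..q})"
        unfolding eventually_at by (intro exI[of _ 1] conjI ballI impI) simp_all
    qed
    have "((\<lambda>x. (H x - H (J y)) / (x - J y)) \<longlongrightarrow> D (J y)) (at (J y) within {a..b})"
      using Hder[OF J(1)[OF y]] unfolding has_field_derivative_iff .
    from tendsto_inverse[OF filterlim_compose[OF this fl]] der(2)[OF J(1)[OF y]]
    have lim: "((\<lambda>z. inverse ((H (J z) - H (J y)) / (J z - J y))) \<longlongrightarrow> inverse (D (J y))) (at y within {p..q})" by simp
    have ev: "eventually (\<lambda>z. inverse ((H (J z) - H (J y)) / (J z - J y)) = (J z - J y) / (z - y)) (at y within {p..q})"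
      unfolding eventually_at
    proof (intro exI[of _ 1] conjI ballI impI)
      fix z assume "z \<in> {p..q}"
      then show "inverse ((H (J z) - H (J y)) / (J z - J y)) = (J z - J y) / (z - y)"
        using J(2)[of z] J(2)[OF y] by simp
    qed simp
    show ?thesis unfolding has_field_derivative_iff by (rule tendsto_cong[OF ev, THEN iffD1, OF lim])
  qed
  have c1: "Cr_on 1 H {a..b}" unfolding Cr_on_def
    using Hder contD by (intro exI[of _ "\<lambda>i. if i = 0 then H else D"]) auto
  have "continuous_on {p..q} (\<lambda>y. D (J y))"
    by (rule continuous_on_compose2[OF contD contJ]) (use J in auto)
  then have "continuous_on {p..q} (\<lambda>y. inverse (D (J y)))"
    by (rule continuous_on_inverse) (use der(2)[OF J(1)] in \<open>metis less_irrefl\<close>)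
  then have c2: "Cr_on 1 J {p..q}" unfolding Cr_on_def
    using Jder by (intro exI[of _ "\<lambda>i. if i = 0 then J else (\<lambda>y. inverse (D (J y)))"]) auto
  show ?thesis unfolding Cr_diffeo_def bij_betw_def J_def[symmetric] using c1 c2 inj img by simp
qed

lemma tiling_bounds:
  assumes "tiling r A u v" shows "0 \<le> u a" "v a \<le> A" "u a < v a"
proof -
  have "(\<Union>a. {u a..<v a}) = {0..<A}" "\<forall>a. u a < v a" using assms unfolding tiling_def by simp_all
  moreover have "{u a..<v a} \<subseteq> (\<Union>a. {u a..<v a})" by (rule UN_upper[OF UNIV_I])
  ultimately have "{u a..<v a} \<subseteq> {0..<A}" "u a < v a" by simp_all
  then show "0 \<le> u a" "v a \<le> A" "u a < v a" unfolding ivl_subset by auto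
qed

text \<open>Equal lengths and equal slopes give equal image lengths, and lengths determine positions
  in either row. A branch is then fixed by the image of its left end and its slope.\<close>

lemma conj_of_scales:
  fixes f S :: "'a::finite giet"
  assumes f: "C1_giet f" and S: "C1_giet S" and perm: "gperm f = gperm S"
    and dom: "gdom f = {0..<1}" "gdom S = {0..<1}"
    and E: "C1_ext H 0 1 0 1 H D" and sf: "scales H \<omega> f" and sS: "scales (\<lambda>x. x) \<omega> S"
    and len: "\<And>a. Hlen H f a = Hlen (\<lambda>x. x) S a"
  shows "giet_C1_conj f S"
proof -
  obtain A u v p q where D: "giet_data f A u v p q" using f unfolding C1_giet_def by blast
  obtain A' u' v' p' q' where D': "giet_data S A' u' v' p' q'" using S unfolding C1_giet_def by blast
  have A: "A = 1" "A' = 1" using giet_data_lft(3)[OF D] giet_data_lft(3)[OF D'] dom unfolding gend_def by simp_all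
  have H01: "H 0 = 0" "H 1 = 1" using E unfolding C1_ext_def by simp_all
  have contH: "continuous_on {0..1} H" by (rule C1_ext_cont[OF E])
  note B = giet_dataD(2)[OF D] and B' = giet_dataD(2)[OF D']
  have len1: "H (v a) - H (u a) = v' a - u' a" for a
    using len[of a] unfolding Hlen_def giet_data_lft(1,2)[OF D] giet_data_lft(1,2)[OF D'] .
  note t1 = giet_tiling(1)[OF D, unfolded A] and t2 = giet_tiling(2)[OF D, unfolded A]
    and t1' = giet_tiling(1)[OF D', unfolded A] and t2' = giet_tiling(2)[OF D', unfolded A]
  have inu: "0 \<le> u a" "v a \<le> 1" "0 \<le> p a" "q a \<le> 1" "u a < v a" for a
    using tiling_bounds[OF t1, of a] tiling_bounds[OF t2, of a] by auto
  have inu': "0 \<le> u' a" "v' a \<le> 1" "0 \<le> p' a" "q' a \<le> 1" for a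
    using tiling_bounds[OF t1', of a] tiling_bounds[OF t2', of a] by auto
  have scf: "H (gmap f y) - H (gmap f x) = exp (\<omega> $ a) * (H y - H x)" if "x \<in> {u a..<v a}" "y \<in> {u a..<v a}" for x y a
    using scalesD[OF sf, of x a y] that unfolding giet_dataD(1)[OF D] by simp
  have scS: "gmap S y - gmap S x = exp (\<omega> $ a) * (y - x)" if "x \<in> {u' a..<v' a}" "y \<in> {u' a..<v' a}" for x y a
    using scalesD[OF sS, of x a y] that unfolding giet_dataD(1)[OF D'] by simp
  have im1: "H (q a) - H (p a) = exp (\<omega> $ a) * (H (v a) - H (u a))" for a
    by (rule scales_limit[OF B contH inu(1,2,3,4)]) (rule scf)
  have im2: "q' a - p' a = exp (\<omega> $ a) * (v' a - u' a)" for a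
    using scales_limit[OF B'[of a] continuous_on_id inu'(1,2,3,4)] scS by blast
  have len2: "H (q a) - H (p a) = q' a - p' a" for a unfolding im1 im2 len1 ..
  have Hu: "H (u a) = u' a" for a
    unfolding tiling_telescope(1)[OF giet_tiling(1)[OF D], of H a] H01 len1 perm
    using tiling_telescope(1)[OF giet_tiling(1)[OF D'], of "\<lambda>x. x" a] by simp
  have Hp: "H (p a) = p' a" for a
    unfolding tiling_telescope(1)[OF giet_tiling(2)[OF D], of H a] H01 len2 perm
    using tiling_telescope(1)[OF giet_tiling(2)[OF D'], of "\<lambda>x. x" a] by simp
  have Hv: "H (v a) = v' a" for a using len1[of a] Hu[of a] by simp
  have img: "H ` gint f a = gint S a" for a
  proof -
    have "C1_ext H (u a) (v a) (H (u a)) (H (v a)) H D"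
    proof (rule C1_extI_self)
      have sub: "{u a..v a} \<subseteq> {0..1}" using inu[of a] by auto
      show "(H has_real_derivative D x) (at x within {u a..v a})" "0 < D x" if "x \<in> {u a..v a}" for x
        using E that sub has_field_derivative_subset[OF _ sub] unfolding C1_ext_def by blast+
      show "continuous_on {u a..v a} D" using E sub continuous_on_subset unfolding C1_ext_def by blast
    qed (rule inu(5))
    from C1_ext_bij(1)[OF this] show ?thesis unfolding giet_dataD(1)[OF D] giet_dataD(1)[OF D'] Hu Hv .
  qed
  have conj: "H (gmap f x) = gmap S (H x)" if x: "x \<in> gdom f" for x
  proof -
    obtain a where a: "x \<in> gint f a" using x unfolding gdom_def by blast
    have xa: "x \<in> {u a..<v a}" "u a \<in> {u a..<v a}" using a inu(5)[of a] unfolding giet_dataD(1)[OF D] by auto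
    have "H x \<in> gint S a" using a img by blast
    then have ya: "H x \<in> {u' a..<v' a}" "u' a \<in> {u' a..<v' a}" unfolding giet_dataD(1)[OF D'] by auto
    have "H (gmap f x) - H (p a) = exp (\<omega> $ a) * (H x - H (u a))" using scf[OF xa(2,1)] unfolding C1_branch_left[OF B] .
    moreover have "gmap S (H x) - p' a = exp (\<omega> $ a) * (H x - u' a)" using scS[OF ya(2,1)] unfolding C1_branch_left[OF B'] .
    ultimately show ?thesis unfolding Hu Hp by simp
  qed
  have "mono_on {0..<1} H"
  proof (rule mono_onI)
    fix r s :: real assume "r \<in> {0..<1}" "s \<in> {0..<1}" "r \<le> s"
    then show "H r \<le> H s" using C1_ext_strict[OF E, of r s] by (cases "r = s") auto
  qed
  moreover have "continuous_on {0..<1} H" by (rule continuous_on_subset[OF contH]) auto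
  moreover have "H ` gdom f = gdom S" unfolding gdom_def image_UN img ..
  ultimately have "giet_semiconj_by H f S" unfolding giet_semiconj_by_def using conj img dom by simp
  moreover have "Cr_diffeo 1 H (closure (gdom f)) (closure (gdom S))"
    using Cr_diffeo_1[OF E refl] unfolding dom by simp
  ultimately show ?thesis unfolding giet_C1_conj_def by blast
qed

text \<open>That the two last letters differ is a property of the path, so it passes from
  \<open>T\<close> to every map with the same rotation number.\<close>

lemma rv_orbit_same:
  assumes "rv_path p" "C1_giet f" "inf_renorm f" "rot_number f = p" shows "rv_orbit f"
proof
  show "rv_defined ((rv ^^ n) f)" for n using assms(3) unfolding inf_renorm_def by blast
  show "gtop ((rv ^^ n) f) \<noteq> gbot ((rv ^^ n) f)" for n
  proof -
    interpret rv_path p by (rule assms(1))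
    have pn: "p n = (gperm ((rv ^^ n) f), rv_type ((rv ^^ n) f))" using assms(4) unfolding rot_number_def by auto
    show ?thesis using ne[of n] ty[of n] unfolding pn winner_def loser_def by auto
  qed
qed (rule assms(2))

lemma Aff_scales:
  assumes "S \<in> Aff T \<omega>" shows "scales (\<lambda>x. x) \<omega> S"
  unfolding scales_def
proof (intro allI ballI)
  fix a x y assume xy: "x \<in> gint S a" "y \<in> gint S a"
  obtain b where b: "\<And>x. x \<in> gint S a \<Longrightarrow> gmap S x = exp (\<omega> $ a) * x + b" using assms unfolding Aff_def by blast
  show "gmap S y - gmap S x = exp (\<omega> $ a) * (y - x)" unfolding b[OF xy(1)] b[OF xy(2)] by (simp add: right_diff_distrib)
qed

context acc_generic
begin

text \<open>The two length vectors are proportional by the contraction at good times, and both sum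
  to 1, since \<open>H\<close> fixes the two ends of the unit interval.\<close>

lemma lengths_equal:
  assumes f: "rv_orbit f" "rot_number f = pth" and S: "rv_orbit S" "rot_number S = pth"
    and g1: "gend f = 1" "gend S = 1"
    and E: "C1_ext H 0 1 0 1 H D" and sf: "scales H \<omega> f" and sS: "scales (\<lambda>x. x) \<omega> S"
    and gf: "good_freq (snd x)" and w: "\<omega> \<in> E_cs x"
  shows "Hlen H f a = Hlen (\<lambda>x. x) S a"
proof -
  interpret f: rv_orbit f by (rule f)
  interpret S: rv_orbit S by (rule S)
  define s where "s n = (\<chi> a. Hlen (\<lambda>x. x) (S.g n) a)" for n
  define s' where "s' n = (\<chi> a. Hlen H (f.g n) a)" for n
  obtain m where m: "\<And>n a. 1 \<le> n \<Longrightarrow> \<bar>log_slope pth \<omega> (R n) $ a\<bar> \<le> m" using log_slope_bounded[OF w] by blast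
  obtain K where K: "\<And>n0. \<exists>n\<ge>n0. \<exists>k\<le>K. posblock pth (R n) k" using good_times[OF gf] by blast
  interpret W: length_rec_pair pth \<omega> s s' m K
  proof
    show "length_rec pth \<omega> s" unfolding s_def S(2)[symmetric] by (rule S.scales_wrec[OF sS]) (rule continuous_on_id)
    show "length_rec pth \<omega> s'" unfolding s'_def f(2)[symmetric] using f.scales_wrec[OF sf] C1_ext_cont[OF E] g1(1) by simp
    show "winner (pth n) \<noteq> loser (pth n)" for n by (rule path.ne)
    show "0 < s n $ a" for n a unfolding s_def using glen_Hlen[OF S.g] by simp
    show "0 < s' n $ a" for n a unfolding s'_def using f.Hlen_pos[of H 0 1 D] E g1(1) by simp
  qed
  obtain c where c: "\<And>a. s' 0 $ a = c * s 0 $ a"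
  proof -
    have "\<exists>n\<ge>n0. W.good n" for n0
    proof -
      obtain n k where n: "Suc n0 \<le> n" "k \<le> K" "posblock pth (R n) k" using K by blast
      have "n \<le> R n" using order_trans[OF T_ge strict_mono_imp_increasing[OF zorich_time_strict, of "T n"]] unfolding R_def .
      then show ?thesis unfolding W.good_def using n m[of n] by (intro exI[of _ "R n"]) auto
    qed
    from W.proportional[OF this] show ?thesis using that by blast
  qed
  obtain A u v p q where D: "giet_data f A u v p q" using f.f unfolding C1_giet_def by blast
  obtain A' u' v' p' q' where D': "giet_data S A' u' v' p' q'" using S.f unfolding C1_giet_def by blast
  have A: "A = 1" "A' = 1" using giet_data_lft(3)[OF D] giet_data_lft(3)[OF D'] g1 by simp_all
  have "(\<Sum>a\<in>UNIV. s' 0 $ a) = H 1 - H 0"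
    using tiling_telescope(2)[OF giet_tiling(1)[OF D], of H] unfolding s'_def Hlen_def A by (simp add: giet_data_lft(1,2)[OF D])
  then have t': "(\<Sum>a\<in>UNIV. s' 0 $ a) = 1" using E unfolding C1_ext_def by simp
  have t: "(\<Sum>a\<in>UNIV. s 0 $ a) = 1"
    using tiling_telescope(2)[OF giet_tiling(1)[OF D'], of "\<lambda>x. x"] unfolding s_def Hlen_def A by (simp add: giet_data_lft(1,2)[OF D'])
  have "c = 1" using t' t unfolding c sum_distrib_left[symmetric] by simp
  then show ?thesis using c[of a] unfolding s_def s'_def by simp
qed

lemma conjugate:
  assumes gf: "good_freq (snd x)" and f: "is_giet 3 f" "gdom f = {0..<1}" and rot: "same_rot_number f (iet (fst (snd x)) (snd (snd x)))"
    and EC: "EC_condition f (fst (snd x)) (snd (snd x))" and sh: "affine_shadow N x f \<omega>\<^sub>f"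
    and w: "\<omega> \<in> E_cs x" "proj_Ker (snd (snd x)) \<omega> = \<omega>\<^sub>f"
    and S: "S \<in> Aff (iet (fst (snd x)) (snd (snd x))) \<omega>" "gdom S = {0..<1}"
  shows "giet_C1_conj f S"
proof -
  let ?T = "iet (fst (snd x)) (snd (snd x))"
  have rT: "rot_number ?T = pth" using valid_iet(5)[OF vx] unfolding pth_def by simp
  have rf: "inf_renorm f" "rot_number f = pth" using rot rT unfolding same_rot_number_def by auto
  have rS: "inf_renorm S" "rot_number S = pth" "is_giet 1 S" using S(1) rT unfolding Aff_def same_rot_number_def by auto
  have C: "C1_giet f" "C1_giet S" using is_giet_data[OF f(1)] is_giet_data[OF rS(3)] by auto
  have of: "rv_orbit f" by (rule rv_orbit_same[OF path.rv_path_axioms C(1) rf])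
  have oS: "rv_orbit S" by (rule rv_orbit_same[OF path.rv_path_axioms C(2) rS(1,2)])
  have sS: "scales (\<lambda>x. x) \<omega> S" by (rule Aff_scales[OF S(1)])
  have g1: "gend f = 1" "gend S = 1" unfolding gend_def f(2) S(2) by simp_all
  have perm: "gperm f = gperm S"
    using fun_cong[OF trans[OF rf(2) rS(2)[symmetric]], of 0] unfolding rot_number_def by simp
  have "\<exists>c. 0 < c \<and> c < 1 \<and> (\<lambda>n. giet_dist 1 (acc_giet N x n f) (acc_giet N x n S)) \<in> O(\<lambda>n. c ^ n)"
    using sh w S(1) unfolding affine_shadow_def by (cases x) auto
  then obtain c where c: "0 < c" "c < 1" and d: "(\<lambda>n. giet_dist 1 (acc_giet N x n f) (acc_giet N x n S)) \<in> O(\<lambda>n. c ^ n)" by blast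
  obtain C0 c1 where c1: "C0 > 0" "0 < c1" "c1 < 1"
    and ret: "\<And>j0. \<exists>j\<ge>j0. norm (log_mean_slope ((zor ^^ j) f) - log_slope pth \<omega> (zorich_time pth j)) \<le> C0 * c1 ^ j"
    using return_close[OF of rf(2) oS rS(2) sS gf w(1) d c] by blast
  obtain \<tau> c2 Ls Lc Lu where gen2: "oseledets_generic (\<tau>, fst (snd x), snd (snd x))" and c2: "0 < c2" "c2 < 1"
    and shp: "(\<lambda>n. MAX a\<in>UNIV. Cr_norm 1 (\<lambda>t. shape ((zor ^^ n) f) a t - t)) \<in> O(\<lambda>n. c2 ^ n)"
    and dec: "\<forall>n. Ls n \<in> E_s (\<tau>, fst (snd x), snd (snd x)) n \<and> Lc n \<in> E_c (\<tau>, fst (snd x), snd (snd x)) n \<and>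
       Lu n \<in> E_u (\<tau>, fst (snd x), snd (snd x)) n \<and> log_mean_slope ((zor ^^ n) f) = Ls n + Lc n + Lu n"
    and sm: "(\<lambda>n. norm (Lu n)) \<in> O(\<lambda>n. c2 ^ n)" "(\<lambda>n. norm (Ls n)) \<in> O(\<lambda>n. c2 ^ n)"
    using EC unfolding EC_condition_def by (elim conjE exE)
  have "\<exists>e. summable e \<and> (\<forall>n. \<forall>z\<in>gdom ((rv ^^ n) f). \<bar>slope_defect (log_slope pth \<omega> n) ((rv ^^ n) f) z\<bar> \<le> e n)"
    by (rule slope_summable[OF of rf(2) gen2 _ shp c2 _ _ sm w(1) ret c1(2,3,1)]) (use dec in auto)
  then obtain e where e: "summable e" "\<And>n z. z \<in> gdom ((rv ^^ n) f) \<Longrightarrow> \<bar>slope_defect (log_slope pth \<omega> n) ((rv ^^ n) f) z\<bar> \<le> e n" by blast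
  interpret f: rv_orbit f by (rule of)
  obtain H D where H: "C1_ext H 0 1 0 1 H D" "scales H \<omega> f"
    using f.scale_function[of \<omega> e] e unfolding rf(2) g1(1) by blast
  show ?thesis
    by (rule conj_of_scales[OF C perm f(2) S(2) H sS])
      (rule lengths_equal[OF of rf(2) oS rS(2) g1 H sS gf w(1)])
qed

end

lemma acceleration_generic:
  assumes ac: "is_acceleration \<mu> X N" and x: "x \<in> X" shows "acc_generic X N x"
proof -
  have sub: "X \<subseteq> norm_triples" and N: "\<forall>x\<in>X. 1 \<le> N x \<and> normalize_triple (acc N x) \<in> X"
    and gen: "\<forall>x\<in>X. oseledets_generic x \<and> acc_linear_time N x \<and> acc_central N x \<and> acc_exp_growth N x \<and> acc_roth N x"
    and bal: "acc_balanced N X"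
    using ac unfolding is_acceleration_def by simp_all
  obtain c where c: "c > 0" "\<forall>x\<in>X. \<forall>n\<ge>1. \<forall>a b. acc_lambda N x n $ a / acc_lambda N x n $ b > c"
    using conjunct1[OF bal[unfolded acc_balanced_def]] by (elim exE conjE)
  show ?thesis
  proof
    show "\<exists>c>0. \<forall>n\<ge>1. \<forall>a b. acc_lambda N x n $ a / acc_lambda N x n $ b > c"
      using c(1) bspec[OF c(2) x] by (intro exI[of _ c]) simp
    show "1 \<le> N y \<and> normalize_triple (acc N y) \<in> X" if "y \<in> X" for y by (rule bspec[OF N that])
  qed (use bspec[OF gen x] sub x in simp_all)
qed

theorem theorem3p3:
  fixes \<mu> :: "'a::finite triple measure"
    and X :: "'a triple set"
    and N :: "'a triple \<Rightarrow> nat"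
  assumes "2 \<le> CARD('a)"
    and "is_mu_ext \<mu>"
    and "is_acceleration \<mu> X N"
  shows "AE (l, \<pi>) in iet_lebesgue. \<forall>\<tau>. (\<tau>, l, \<pi>) \<in> X \<longrightarrow>
    (\<forall>f \<omega>\<^sub>f \<omega> S.
       is_giet 3 f \<and> gdom f = {0..<1} \<and> mean_nonlinearity f = 0 \<and>
       same_rot_number f (iet l \<pi>) \<and> EC_condition f l \<pi> \<and>
       \<omega>\<^sub>f \<in> Ker_Omega \<pi> \<and> affine_shadow N (\<tau>, l, \<pi>) f \<omega>\<^sub>f \<and>
       \<omega> \<in> E_cs (\<tau>, l, \<pi>) \<and> proj_Ker \<pi> \<omega> = \<omega>\<^sub>f \<and>
       S \<in> Aff (iet l \<pi>) \<omega> \<and> gdom S = {0..<1}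
       \<longrightarrow> giet_C1_conj f S)"
proof -
  have "AE x in \<mu>. x \<in> X" using assms(3) unfolding is_acceleration_def by (elim conjE)
  \<comment> \<open>At every point of \<open>X\<close> all letters win infinitely often, so some
    positive product starts there.\<close>
  then have "AE x in \<mu>. \<exists>K. \<not> no_posblock K (snd x)"
    by eventually_elim (rule acc_generic.not_bad[OF acceleration_generic[OF assms(3)]])
  from AE_good_freq[OF assms(2) this] show ?thesis
  proof eventually_elim
    case (elim z)
    obtain l \<pi> where z: "z = (l, \<pi>)" by (cases z)
    show ?case unfolding z split_conv
    proof (intro allI impI, elim conjE)
      fix \<tau> f \<omega>\<^sub>f \<omega> S
      assume "(\<tau>, l, \<pi>) \<in> X"
      then interpret acc_generic X N "(\<tau>, l, \<pi>)" by (rule acceleration_generic[OF assms(3)])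
      assume "is_giet 3 f" "gdom f = {0..<1}" "same_rot_number f (iet l \<pi>)" "EC_condition f l \<pi>"
        "affine_shadow N (\<tau>, l, \<pi>) f \<omega>\<^sub>f" "\<omega> \<in> E_cs (\<tau>, l, \<pi>)" "proj_Ker \<pi> \<omega> = \<omega>\<^sub>f"
        "S \<in> Aff (iet l \<pi>) \<omega>" "gdom S = {0..<1}"
      then show "giet_C1_conj f S" using conjugate[of f \<omega>\<^sub>f \<omega> S] elim unfolding z by simp
    qed
  qed
qed

end
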